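(* Let $m,n\in\mathbb N$ be positive integers and $T>0$. Let $A$ be the set of all $n$-multiindices $\alpha$ with $|\alpha|\le 2m$, let $\ell$ be the cardinality of $A$, and let $R\colon[0,T]\to\mathbb R^\ell$, $R(t)=(\rho_\alpha(t))_{\alpha\in A}$, be a continuous mapping. For $(t,\xi)\in[0,T]\times(\mathbb R^n\setminus\{0\})$ and $k=0,\dots,2m$ set $$\rho_k(t,\xi):=(-1)^k\,\frac{\sum_{|\alpha|=k}\rho_\alpha(t)\xi^\alpha}{|\xi|^k},$$ and assume that there exists $\Lambda>0$ such that, for all $(t,\xi)\in[0,T]\times(\mathbb R^n\setminus\{0\})$, $$|\rho_k(t,\xi)|\le\Lambda\quad (k=0,\dots,2m-1),\qquad \frac1\Lambda\le\rho_{2m}(t,\xi)\le\Lambda .$$ Assume that the modulus of continuity $\mu(R,\cdot)$ of $R$ satisfies the Osgood condition. Let $u\in\mathcal H_1^m:=H^1([0,T],L^2(\mathbb R^n))\cap L^2([0,T],H^{2m}(\mathbb R^n))$ satisfy, for some constant $\tilde C$, the inequality $$\Big\|\partial_t u(t,\cdot)-\sum_{0\le|\alpha|\le 2m}\mathrm i^{|\alpha|}\rho_\alpha(t)\,\partial_x^\alpha u(t,\cdot)\Big\|_{L^2(\mathbb R^n)}\le\tilde C\,\|u(t,\cdot)\|_{H^m(\mathbb R^n)}\quad\text{for a.e. } t\in[0,T],$$ and $u(0,\cdot)\equiv0$ in $\mathbb R^n$. Then $u\equiv0$ in $[0,T]\times\mathbb R^n$.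
   Context: For a continuous function $f\colon I\to\mathcal B$ from a closed bounded interval $I\subset\mathbb R$ to a Banach space $\mathcal B$, the modulus of continuity of $f$ is the function $\mu(f,\cdot)\colon[0,1]\to\mathbb R$, $$\mu(f,\tau):=\sup_{t,s\in I,\ 0\le|t-s|\le\tau}\|f(t)-f(s)\|_{\mathcal B}.$$ A nondecreasing function $\omega\colon[0,1]\to\mathbb R$ with $\omega(0)=0$ satisfies the Osgood condition iff $\int_0^1\frac{1}{\omega(s)}\,ds=+\infty$. The convention $1/0=+\infty$ is used, so that constant $R$ (for which $\mu(R,\cdot)\equiv0$) is included. Here $\mathrm i$ is the imaginary unit, and $u(0,\cdot)$ is understood via the continuous representative of $u$ in $C([0,T],L^2(\mathbb R^n))$. *)

theory Defs
  imports "HOL-Analysis.Analysis"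
begin

section \<open>The Hilbert space of complex-valued square-integrable functions\<close>


definition sq_integrable :: "('a::euclidean_space \<Rightarrow> complex) \<Rightarrow> bool" where
  "sq_integrable f \<longleftrightarrow> f \<in> borel_measurable lebesgue \<and> integrable lebesgue (\<lambda>x. (norm (f x))\<^sup>2)"

text \<open>
  The space is the quotient modulo equality almost everywhere. With the instances below it is
  a separable real Hilbert space, so the library's Bochner integral and Borel measurability
  apply to functions with values in it.
\<close>

definition L2rel :: "('a::euclidean_space \<Rightarrow> complex) \<Rightarrow> ('a \<Rightarrow> complex) \<Rightarrow> bool" where
  "L2rel f g \<longleftrightarrow> sq_integrable f \<and> sq_integrable g \<and> (AE x in lebesgue. f x = g x)"

lemma sq_integrable_measurable: "sq_integrable f \<Longrightarrow> f \<in> borel_measurable lebesgue"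
  by (simp add: sq_integrable_def)

lemma sq_integrable_zero: "sq_integrable (\<lambda>_. 0)"
  by (simp add: sq_integrable_def)

lemma sq_integrable_cmult:
  assumes "sq_integrable f" shows "sq_integrable (\<lambda>x. c * f x)"
  using assms by (auto simp: sq_integrable_def norm_mult power_mult_distrib)

lemma sq_integrable_scaleR: "sq_integrable f \<Longrightarrow> sq_integrable (\<lambda>x. r *\<^sub>R f x)"
  using sq_integrable_cmult[of f "of_real r"] by (simp add: scaleR_conv_of_real)

lemma sq_integrable_uminus: "sq_integrable f \<Longrightarrow> sq_integrable (\<lambda>x. - f x)"
  using sq_integrable_cmult[of f "-1"] by simp

lemma norm_add_sq_le: "(norm (a + b))\<^sup>2 \<le> 2 * (norm a)\<^sup>2 + 2 * (norm (b::'b::real_normed_vector))\<^sup>2"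
proof -
  have "(norm (a + b))\<^sup>2 \<le> (norm a + norm b)\<^sup>2"
    by (intro power_mono norm_triangle_ineq) auto
  also have "\<dots> \<le> 2 * (norm a)\<^sup>2 + 2 * (norm b)\<^sup>2"
    using sum_squares_bound[of "norm a" "norm b"] by (simp add: power2_sum)
  finally show ?thesis .
qed

lemma sq_integrable_add:
  assumes "sq_integrable f" "sq_integrable g" shows "sq_integrable (\<lambda>x. f x + g x)"
proof -
  have [measurable]: "f \<in> borel_measurable lebesgue" "g \<in> borel_measurable lebesgue"
    using assms by (auto simp: sq_integrable_def)
  have "integrable lebesgue (\<lambda>x. 2 * (norm (f x))\<^sup>2 + 2 * (norm (g x))\<^sup>2)"
    using assms by (auto simp: sq_integrable_def)
  then have "integrable lebesgue (\<lambda>x. (norm (f x + g x))\<^sup>2)"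
    by (rule Bochner_Integration.integrable_bound) (auto simp: norm_add_sq_le)
  then show ?thesis
    by (simp add: sq_integrable_def)
qed

lemma sq_integrable_diff:
  "sq_integrable f \<Longrightarrow> sq_integrable g \<Longrightarrow> sq_integrable (\<lambda>x. f x - g x)"
  using sq_integrable_add[OF _ sq_integrable_uminus, of f g] by simp

lemma sq_integrable_inner:
  assumes "sq_integrable f" "sq_integrable g" shows "integrable lebesgue (\<lambda>x. f x \<bullet> g x)"
proof -
  have [measurable]: "f \<in> borel_measurable lebesgue" "g \<in> borel_measurable lebesgue"
    using assms by (auto simp: sq_integrable_def)
  have "integrable lebesgue (\<lambda>x. (norm (f x))\<^sup>2 + (norm (g x))\<^sup>2)"
    using assms by (auto simp: sq_integrable_def)
  then show ?thesis
  proof (rule Bochner_Integration.integrable_bound)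
    have "\<bar>f x \<bullet> g x\<bar> \<le> (norm (f x))\<^sup>2 + (norm (g x))\<^sup>2" for x
    proof -
      have "\<bar>f x \<bullet> g x\<bar> \<le> norm (f x) * norm (g x)" by (rule Cauchy_Schwarz_ineq2)
      moreover have "norm (f x) * norm (g x) \<ge> 0" by simp
      moreover have "2 * norm (f x) * norm (g x) \<le> (norm (f x))\<^sup>2 + (norm (g x))\<^sup>2"
        by (rule sum_squares_bound)
      ultimately show ?thesis by linarith
    qed
    then show "AE x in lebesgue. norm (f x \<bullet> g x) \<le> norm ((norm (f x))\<^sup>2 + (norm (g x))\<^sup>2)"
      by auto
  qed simp
qed

quotient_type (overloaded) 'a L2 = "'a::euclidean_space \<Rightarrow> complex" / partial: L2rel
proof (rule part_equivpI)
  show "\<exists>f. L2rel f f"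
    using sq_integrable_zero by (intro exI[of _ "\<lambda>_. 0"]) (simp add: L2rel_def)
  show "symp L2rel"
    by (auto intro!: sympI simp: L2rel_def)
  show "transp L2rel"
    by (rule transpI) (auto simp: L2rel_def)
qed

instantiation L2 :: (euclidean_space) real_inner
begin

lift_definition zero_L2 :: "'a L2" is "\<lambda>_. 0"
  by (simp add: L2rel_def sq_integrable_zero)

lift_definition plus_L2 :: "'a L2 \<Rightarrow> 'a L2 \<Rightarrow> 'a L2" is "\<lambda>f g x. f x + g x"
  by (auto simp: L2rel_def sq_integrable_add)

lift_definition uminus_L2 :: "'a L2 \<Rightarrow> 'a L2" is "\<lambda>f x. - f x"
  by (auto simp: L2rel_def sq_integrable_uminus)

lift_definition minus_L2 :: "'a L2 \<Rightarrow> 'a L2 \<Rightarrow> 'a L2" is "\<lambda>f g x. f x - g x"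
  by (auto simp: L2rel_def sq_integrable_diff)

lift_definition scaleR_L2 :: "real \<Rightarrow> 'a L2 \<Rightarrow> 'a L2" is "\<lambda>r f x. r *\<^sub>R f x"
  by (auto simp: L2rel_def sq_integrable_scaleR)

lift_definition inner_L2 :: "'a L2 \<Rightarrow> 'a L2 \<Rightarrow> real" is "\<lambda>f g. \<integral>x. f x \<bullet> g x \<partial>lebesgue"
  by (rule integral_cong_AE)
     (auto simp: L2rel_def sq_integrable_def)

definition norm_L2 :: "'a L2 \<Rightarrow> real" where
  "norm_L2 f = sqrt (f \<bullet> f)"

definition sgn_L2 :: "'a L2 \<Rightarrow> 'a L2" where
  "sgn_L2 f = scaleR (inverse (norm f)) f"

definition dist_L2 :: "'a L2 \<Rightarrow> 'a L2 \<Rightarrow> real" where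
  "dist_L2 f g = norm (f - g)"

definition uniformity_L2 :: "('a L2 \<times> 'a L2) filter" where
  "uniformity_L2 = (INF e\<in>{0<..}. principal {(x, y). dist x y < e})"

definition open_L2 :: "'a L2 set \<Rightarrow> bool" where
  "open_L2 U \<longleftrightarrow> (\<forall>x\<in>U. \<forall>\<^sub>F (x', y) in uniformity. x' = x \<longrightarrow> y \<in> U)"

instance
proof
  fix f g h :: "'a L2" and r s :: real
  show "f + g + h = f + (g + h)"
    by transfer (auto simp: L2rel_def algebra_simps intro!: sq_integrable_add)
  show "f + g = g + f"
    by transfer (auto simp: L2rel_def algebra_simps intro!: sq_integrable_add)
  show "0 + f = f"
    by transfer (auto simp: L2rel_def)
  show "- f + f = 0"
    by transfer (auto simp: L2rel_def sq_integrable_zero)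
  show "f - g = f + - g"
    by transfer (auto simp: L2rel_def sq_integrable_diff)
  show "r *\<^sub>R (f + g) = r *\<^sub>R f + r *\<^sub>R g"
    by transfer (auto simp: L2rel_def scaleR_add_right intro!: sq_integrable_add sq_integrable_scaleR)
  show "(r + s) *\<^sub>R f = r *\<^sub>R f + s *\<^sub>R f"
    by transfer (auto simp: L2rel_def scaleR_add_left intro!: sq_integrable_add sq_integrable_scaleR)
  show "r *\<^sub>R s *\<^sub>R f = (r * s) *\<^sub>R f"
    by transfer (auto simp: L2rel_def intro!: sq_integrable_scaleR)
  show "1 *\<^sub>R f = f"
    by transfer (auto simp: L2rel_def)
  show "f \<bullet> g = g \<bullet> f"
    by transfer (simp add: inner_commute)
  show "(f + g) \<bullet> h = f \<bullet> h + g \<bullet> h"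
    by transfer (auto simp: L2rel_def inner_add_left sq_integrable_inner)
  show "(r *\<^sub>R f) \<bullet> g = r * (f \<bullet> g)"
    by transfer simp
  show "0 \<le> f \<bullet> f"
    by transfer simp
  show "f \<bullet> f = 0 \<longleftrightarrow> f = 0"
  proof (transfer, goal_cases)
    case (1 f)
    then have "(\<integral>x. f x \<bullet> f x \<partial>lebesgue) = 0 \<longleftrightarrow> (AE x in lebesgue. f x \<bullet> f x = 0)"
      by (intro integral_nonneg_eq_0_iff_AE sq_integrable_inner) (auto simp: L2rel_def)
    with 1 show ?case
      by (auto simp: L2rel_def sq_integrable_zero)
  qed
qed (rule norm_L2_def sgn_L2_def dist_L2_def uniformity_L2_def open_L2_def)+

end

text \<open>The class instance only provides real scalars.\<close>

lift_definition scaleC :: "complex \<Rightarrow> 'a::euclidean_space L2 \<Rightarrow> 'a L2" is "\<lambda>c f x. c * f x"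
  by (auto simp: L2rel_def sq_integrable_cmult)

lemma L2_eq_abs:
  obtains g where "sq_integrable g" "f = abs_L2 g"
  by (metis Quotient3_L2 Quotient3_abs_rep Quotient3_rep_reflp L2rel_def)

lemma norm_abs_L2:
  assumes "sq_integrable f"
  shows "ennreal ((norm (abs_L2 f))\<^sup>2) = (\<integral>\<^sup>+x. ennreal ((norm (f x))\<^sup>2) \<partial>lebesgue)"
proof -
  have "(norm (abs_L2 f))\<^sup>2 = (\<integral>x. (norm (f x))\<^sup>2 \<partial>lebesgue)"
    using assms by (simp add: power2_norm_eq_inner inner_L2.abs_eq L2rel_def)
  moreover have "(\<integral>\<^sup>+x. ennreal ((norm (f x))\<^sup>2) \<partial>lebesgue) = ennreal (\<integral>x. (norm (f x))\<^sup>2 \<partial>lebesgue)"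
    using assms by (intro nn_integral_eq_integral) (auto simp: sq_integrable_def)
  ultimately show ?thesis by simp
qed

lemma abs_L2_diff:
  assumes "sq_integrable f" "sq_integrable g"
  shows "abs_L2 f - abs_L2 g = abs_L2 (\<lambda>x. f x - g x)"
  using assms by (simp add: minus_L2.abs_eq L2rel_def)

lemma sq_integrableI:
  assumes "f \<in> borel_measurable lebesgue" "(\<integral>\<^sup>+x. ennreal ((norm (f x))\<^sup>2) \<partial>lebesgue) < \<infinity>"
  shows "sq_integrable f"
  using assms unfolding sq_integrable_def
  by (intro conjI integrableI_bounded) auto

lemma half_power_sq: "((1/2)^k)\<^sup>2 = (1/4::real)^k"
  unfolding power2_eq_square power_mult_distrib[symmetric] by simp

instance L2 :: (euclidean_space) banach
proof
  fix X :: "nat \<Rightarrow> 'a L2"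
  assume "Cauchy X"
  have "\<exists>g. sq_integrable g \<and> X n = abs_L2 g" for n
    by (rule L2_eq_abs[of "X n"]) blast
  then have "\<exists>F. \<forall>n. sq_integrable (F n) \<and> X n = abs_L2 (F n)"
    by (intro choice allI)
  then obtain F where F: "\<And>n. sq_integrable (F n)" "\<And>n. X n = abs_L2 (F n)"
    by blast
  have [measurable]: "F n \<in> borel_measurable lebesgue" for n
    using F(1) by (rule sq_integrable_measurable)
  have dist_F: "(\<integral>\<^sup>+x. ennreal ((norm (F m x - F n x))\<^sup>2) \<partial>lebesgue) = ennreal ((dist (X m) (X n))\<^sup>2)" for m n
    using F by (simp add: dist_norm abs_L2_diff norm_abs_L2 sq_integrable_diff)
  have "\<forall>k. \<exists>N. \<forall>m\<ge>N. \<forall>n\<ge>N. dist (X m) (X n) < (1/2)^k"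
    using \<open>Cauchy X\<close> unfolding Cauchy_def by auto
  then obtain N where N: "\<And>k m n. m \<ge> N k \<Longrightarrow> n \<ge> N k \<Longrightarrow> dist (X m) (X n) < (1/2)^k"
    by metis
  define r where "r k = Max (N ` {..k})" for k
  have r_ge: "N k \<le> r j" if "k \<le> j" for j k
    unfolding r_def using that by (intro Max_ge) auto
  have sq_le: "(\<integral>\<^sup>+x. ennreal ((norm (F m x - F n x))\<^sup>2) \<partial>lebesgue) \<le> ennreal ((1/4)^k)"
    if "m \<ge> N k" "n \<ge> N k" for m n k
  proof -
    have "(dist (X m) (X n))\<^sup>2 \<le> ((1/2)^k)\<^sup>2"
      using N[OF that] by (intro power_mono) auto
    also have "\<dots> = (1/4)^k"
      by (rule half_power_sq)
    finally show ?thesis unfolding dist_F by (rule ennreal_leI)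
  qed
  define G where "G k = F (r k)" for k
  have [measurable]: "G n \<in> borel_measurable lebesgue" for n
    by (simp add: G_def)
  have "(\<integral>\<^sup>+x. (\<Sum>k. ennreal (2^k * (norm (G (Suc k) x - G k x))\<^sup>2)) \<partial>lebesgue)
      = (\<Sum>k. \<integral>\<^sup>+x. ennreal (2^k * (norm (G (Suc k) x - G k x))\<^sup>2) \<partial>lebesgue)"
    by (rule nn_integral_suminf) simp
  also have "\<dots> \<le> (\<Sum>k. ennreal ((1/2)^k))"
  proof (rule suminf_le)
    fix k
    have "(\<integral>\<^sup>+x. ennreal (2^k * (norm (G (Suc k) x - G k x))\<^sup>2) \<partial>lebesgue)
        = ennreal (2^k) * (\<integral>\<^sup>+x. ennreal ((norm (G (Suc k) x - G k x))\<^sup>2) \<partial>lebesgue)"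
      by (subst nn_integral_cmult[symmetric]) (auto simp: ennreal_mult)
    also have "\<dots> \<le> ennreal (2^k) * ennreal ((1/4)^k)"
      unfolding G_def by (intro mult_left_mono sq_le r_ge) auto
    also have "\<dots> = ennreal ((1/2)^k)"
    proof -
      have "(2::real)^k * (1/4)^k = (1/2)^k"
        unfolding power_mult_distrib[symmetric] by simp
      then show ?thesis
        by (subst ennreal_mult[symmetric]) auto
    qed
    finally show "(\<integral>\<^sup>+x. ennreal (2^k * (norm (G (Suc k) x - G k x))\<^sup>2) \<partial>lebesgue) \<le> ennreal ((1/2)^k)" .
  qed auto
  also have "\<dots> = ennreal (\<Sum>k. (1/2)^k)"
    by (rule suminf_ennreal2) (auto intro: summable_geometric)
  finally have "AE x in lebesgue. (\<Sum>k. ennreal (2^k * (norm (G (Suc k) x - G k x))\<^sup>2)) \<noteq> \<infinity>"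
    by (intro nn_integral_PInf_AE) (auto simp: top_unique)
  then have conv: "AE x in lebesgue. convergent (\<lambda>k. G k x)"
  proof eventually_elim
    case (elim x)
    then have "summable (\<lambda>k. 2^k * (norm (G (Suc k) x - G k x))\<^sup>2)"
      by (intro summable_suminf_not_top) auto
    then have "Bseq (\<lambda>k. 2^k * (norm (G (Suc k) x - G k x))\<^sup>2)"
      by (intro convergent_imp_Bseq) (auto simp: convergent_def dest: summable_LIMSEQ_zero)
    then obtain K where K: "K > 0" "\<And>k. 2^k * (norm (G (Suc k) x - G k x))\<^sup>2 \<le> K"
      unfolding Bseq_def by auto
    have "summable (\<lambda>k. sqrt K * (sqrt (1/2))^k)"
      by (intro summable_mult summable_geometric) (auto simp: real_sqrt_lt_1_iff)
    then have "summable (\<lambda>k. G (Suc k) x - G k x)"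
    proof (rule summable_comparison_test[rotated], intro exI allI impI)
      fix k
      have "(norm (G (Suc k) x - G k x))\<^sup>2 \<le> K * (1/2)^k"
        using K(2)[of k] by (simp add: field_simps)
      then have "sqrt ((norm (G (Suc k) x - G k x))\<^sup>2) \<le> sqrt (K * (1/2)^k)"
        by (rule real_sqrt_le_mono)
      then show "norm (G (Suc k) x - G k x) \<le> sqrt K * (sqrt (1/2))^k"
        unfolding real_sqrt_mult real_sqrt_power by simp
    qed
    then have "convergent (\<lambda>n. (\<Sum>k<n. G (Suc k) x - G k x) + G 0 x)"
      unfolding summable_iff_convergent by (intro convergent_add convergent_const)
    then show "convergent (\<lambda>k. G k x)"
      by (simp add: sum_lessThan_telescope[of "\<lambda>k. G k x"])
  qed
  define f where "f x = lim (\<lambda>k. G k x)" for x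
  have [measurable]: "f \<in> borel_measurable lebesgue"
    unfolding f_def by measurable
  have fatou: "(\<integral>\<^sup>+x. ennreal ((norm (F n x - f x))\<^sup>2) \<partial>lebesgue) \<le> ennreal ((1/4)^k)"
    if "n \<ge> N k" for n k
  proof -
    have "(\<integral>\<^sup>+x. ennreal ((norm (F n x - f x))\<^sup>2) \<partial>lebesgue)
        = (\<integral>\<^sup>+x. liminf (\<lambda>j. ennreal ((norm (F n x - G j x))\<^sup>2)) \<partial>lebesgue)"
    proof (rule nn_integral_cong_AE, use conv in eventually_elim)
      case (elim x)
      then have "(\<lambda>j. G j x) \<longlonglongrightarrow> f x"
        unfolding f_def by (simp add: convergent_LIMSEQ_iff)
      then have "(\<lambda>j. ennreal ((norm (F n x - G j x))\<^sup>2)) \<longlonglongrightarrow> ennreal ((norm (F n x - f x))\<^sup>2)"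
        by (intro tendsto_intros)
      then show ?case
        by (intro lim_imp_Liminf[symmetric]) auto
    qed
    also have "\<dots> \<le> liminf (\<lambda>j. \<integral>\<^sup>+x. ennreal ((norm (F n x - G j x))\<^sup>2) \<partial>lebesgue)"
      by (rule nn_integral_liminf) simp
    also have "\<dots> \<le> ennreal ((1/4)^k)"
    proof (rule Liminf_le)
      show "\<forall>\<^sub>F j in sequentially. (\<integral>\<^sup>+x. ennreal ((norm (F n x - G j x))\<^sup>2) \<partial>lebesgue) \<le> ennreal ((1/4)^k)"
        using eventually_ge_at_top[of k]
        by eventually_elim (use that r_ge in \<open>auto simp: G_def intro!: sq_le\<close>)
    qed simp
    finally show ?thesis .
  qed
  have "sq_integrable (\<lambda>x. F (N 0) x - f x)"
    using fatou[of 0 "N 0"] by (intro sq_integrableI) (auto intro: order_le_less_trans)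
  then have f: "sq_integrable f"
    using sq_integrable_diff[OF F(1)[of "N 0"]] by fastforce
  have le: "dist (X n) (abs_L2 f) \<le> (1/2)^k" if "n \<ge> N k" for n k
  proof -
    have "ennreal ((norm (X n - abs_L2 f))\<^sup>2) \<le> ennreal ((1/4)^k)"
      using fatou[OF that] F f by (simp add: abs_L2_diff norm_abs_L2 sq_integrable_diff)
    then have "(norm (X n - abs_L2 f))\<^sup>2 \<le> ((1/2)^k)\<^sup>2"
      unfolding half_power_sq by (subst (asm) ennreal_le_iff) auto
    then show ?thesis
      unfolding dist_norm by (rule power2_le_imp_le) simp
  qed
  have "X \<longlonglongrightarrow> abs_L2 f"
  proof (rule metric_LIMSEQ_I)
    fix e :: real assume "e > 0"
    then obtain k where "(1/2)^k < e"
      using real_arch_pow_inv[of e "1/2"] by auto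
    with le[of k] show "\<exists>n0. \<forall>n\<ge>n0. dist (X n) (abs_L2 f) < e"
      by (meson order_le_less_trans)
  qed
  then show "convergent X"
    by (auto simp: convergent_def)
qed

definition L2_ind :: "complex \<Rightarrow> 'a::euclidean_space set \<Rightarrow> 'a L2" where
  "L2_ind c A = abs_L2 (\<lambda>x. indicator A x *\<^sub>R c)"

lemma sq_integrable_ind:
  assumes "A \<in> lmeasurable" shows "sq_integrable (\<lambda>x. indicator A x *\<^sub>R c)"
proof -
  have "(\<lambda>x. (norm (indicat_real A x *\<^sub>R c))\<^sup>2) = (\<lambda>x. indicat_real A x * (norm c)\<^sup>2)"
    by (auto simp: indicator_def)
  with assms show ?thesis
    by (auto simp: sq_integrable_def fmeasurable_def)
qed

lemma dist_ind:
  fixes A B :: "'a::euclidean_space set"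
  assumes "A \<in> lmeasurable" "B \<in> lmeasurable" "A \<subseteq> B"
  shows "(dist (L2_ind c A) (L2_ind c B))\<^sup>2 = (norm c)\<^sup>2 * measure lebesgue (B - A)"
proof -
  have [measurable]: "A \<in> sets lebesgue" "B \<in> sets lebesgue"
    using assms by (auto simp: fmeasurable_def)
  have "ennreal ((dist (L2_ind c A) (L2_ind c B))\<^sup>2) =
      (\<integral>\<^sup>+x. ennreal ((norm (indicator A x *\<^sub>R c - indicator B x *\<^sub>R c))\<^sup>2) \<partial>lebesgue)"
    using assms
    by (simp add: L2_ind_def dist_norm abs_L2_diff norm_abs_L2 sq_integrable_diff sq_integrable_ind)
  also have "\<dots> = (\<integral>\<^sup>+x. ennreal ((norm c)\<^sup>2) * indicator (B - A) x \<partial>lebesgue)"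
    using assms(3) by (intro nn_integral_cong) (auto simp: indicator_def)
  also have "\<dots> = ennreal ((norm c)\<^sup>2) * emeasure lebesgue (B - A)"
    by (rule nn_integral_cmult_indicator) simp
  also have "\<dots> = ennreal ((norm c)\<^sup>2 * measure lebesgue (B - A))"
    using assms by (subst emeasure_eq_measure2) (auto simp: ennreal_mult)
  finally show ?thesis
    by simp
qed

lemma ind_eq: 
  assumes "A \<in> lmeasurable"
  shows "L2_ind c A = Re c *\<^sub>R L2_ind 1 A + Im c *\<^sub>R L2_ind \<i> A"
proof -
  have eq: "r *\<^sub>R L2_ind d A = abs_L2 (\<lambda>x. r *\<^sub>R indicator A x *\<^sub>R d)" for r d
    using assms sq_integrable_ind[OF assms] by (simp add: L2_ind_def scaleR_L2.abs_eq L2rel_def)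
  have "abs_L2 (\<lambda>x. Re c *\<^sub>R indicator A x *\<^sub>R 1) + abs_L2 (\<lambda>x. Im c *\<^sub>R indicator A x *\<^sub>R \<i>)
      = abs_L2 (\<lambda>x. Re c *\<^sub>R indicator A x *\<^sub>R 1 + Im c *\<^sub>R indicator A x *\<^sub>R \<i>)"
    using assms sq_integrable_ind[OF assms]
    by (intro plus_L2.abs_eq) (simp_all only: L2rel_def sq_integrable_scaleR simp_thms AE_I2)
  also have "(\<lambda>x. Re c *\<^sub>R indicator A x *\<^sub>R 1 + Im c *\<^sub>R indicator A x *\<^sub>R \<i>) = (\<lambda>x. indicator A x *\<^sub>R c)"
    by (auto simp: fun_eq_iff complex_eq_iff)
  finally show ?thesis
    unfolding eq by (simp add: L2_ind_def)
qed

lemma sq_integrable_sum_ind: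
  assumes "finite S" "\<And>y. y \<in> S \<Longrightarrow> A y \<in> lmeasurable"
  shows "sq_integrable (\<lambda>x. \<Sum>y\<in>S. indicator (A y) x *\<^sub>R y) \<and>
         abs_L2 (\<lambda>x. \<Sum>y\<in>S. indicator (A y) x *\<^sub>R y) = (\<Sum>y\<in>S. L2_ind y (A y))"
  using assms
proof (induction S rule: finite_induct)
  case empty
  then show ?case by (simp add: sq_integrable_zero zero_L2_def)
next
  case (insert z S)
  have "L2_ind z (A z) + abs_L2 (\<lambda>x. \<Sum>y\<in>S. indicator (A y) x *\<^sub>R y)
     = abs_L2 (\<lambda>x. indicator (A z) x *\<^sub>R z + (\<Sum>y\<in>S. indicator (A y) x *\<^sub>R y))"
    using insert unfolding L2_ind_def
    by (intro plus_L2.abs_eq) (auto simp: L2rel_def sq_integrable_ind)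
  moreover have "sq_integrable (\<lambda>x. indicator (A z) x *\<^sub>R z + (\<Sum>y\<in>S. indicator (A y) x *\<^sub>R y))"
    using insert by (intro sq_integrable_add sq_integrable_ind) auto
  moreover have "(\<lambda>x. \<Sum>y\<in>insert z S. indicator (A y) x *\<^sub>R y)
      = (\<lambda>x. indicator (A z) x *\<^sub>R z + (\<Sum>y\<in>S. indicator (A y) x *\<^sub>R y))"
    using insert(1,2) by (intro ext) (rule sum.insert)
  ultimately show ?case
    using insert by (simp only: sum.insert insert_iff simp_thms)
qed

lemma closure_span_add:
  fixes x y :: "'b::real_normed_vector"
  assumes "x \<in> closure (span G)" "y \<in> closure (span G)"
  shows "x + y \<in> closure (span G)"
proof -
  obtain a b where "\<And>n. a n \<in> span G" "a \<longlonglongrightarrow> x" "\<And>n. b n \<in> span G" "b \<longlonglongrightarrow> y"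
    using assms by (auto simp: closure_sequential)
  then show ?thesis
    unfolding closure_sequential
    by (intro exI[of _ "\<lambda>n. a n + b n"]) (auto intro: span_add tendsto_add)
qed

lemma closure_span_scaleR:
  fixes x :: "'b::real_normed_vector"
  assumes "x \<in> closure (span G)"
  shows "r *\<^sub>R x \<in> closure (span G)"
proof -
  obtain a where "\<And>n. a n \<in> span G" "a \<longlonglongrightarrow> x"
    using assms by (auto simp: closure_sequential)
  then show ?thesis
    unfolding closure_sequential
    by (intro exI[of _ "\<lambda>n. r *\<^sub>R a n"]) (auto intro: span_scale tendsto_intros)
qed

lemma closure_span_zero: "0 \<in> closure (span G)"
  using closure_subset span_zero by blast

lemma dense_imp_countable_basis:
  fixes D :: "'b::metric_space set"
  assumes "countable D" "closure D = UNIV"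
  shows "\<exists>B::'b set set. countable B \<and> open = generate_topology B"
proof (intro exI conjI)
  let ?B = "(\<lambda>(d, n). ball d (inverse (real (Suc n)))) ` (D \<times> UNIV)"
  show "countable ?B"
    using assms by auto
  have "topological_basis ?B"
  proof (rule topological_basisI)
    fix U and x :: 'b assume "open U" "x \<in> U"
    then obtain e where e: "e > 0" "ball x e \<subseteq> U"
      by (auto simp: open_contains_ball)
    obtain n where n: "inverse (real (Suc n)) < e / 2"
      using reals_Archimedean[of "e/2"] e by auto
    have "x \<in> closure D" using assms by simp
    then obtain d where d: "d \<in> D" "dist d x < inverse (real (Suc n))"
      unfolding closure_approachable by (meson inverse_positive_iff_positive of_nat_0_less_iff zero_less_Suc)
    have "ball d (inverse (real (Suc n))) \<subseteq> U"
    proof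
      fix y assume "y \<in> ball d (inverse (real (Suc n)))"
      then have "dist x y < e"
        using d n dist_triangle[of x y d] by (simp add: dist_commute)
      with e show "y \<in> U" by auto
    qed
    with d show "\<exists>B'\<in>?B. x \<in> B' \<and> B' \<subseteq> U"
      by (intro bexI[of _ "ball d (inverse (real (Suc n)))"]) auto
  qed auto
  then show "open = generate_topology ?B"
    by (rule topological_basis_imp_subbasis)
qed

lemma countable_dense_span:
  fixes G :: "'b::real_normed_vector set"
  assumes "countable G"
  shows "\<exists>D. countable D \<and> closure (span G) \<subseteq> closure D"
proof -
  define K where "K = (\<lambda>(q, g). q *\<^sub>R g) ` (\<rat> \<times> G)"
  define D where "D = sum_list ` lists K"
  have "countable K"
    unfolding K_def using assms countable_rat by (intro countable_image countable_SIGMA)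
  then have "countable D"
    unfolding D_def by (intro countable_image countable_lists)
  have add: "x + y \<in> closure D" if "x \<in> closure D" "y \<in> closure D" for x y
  proof -
    from \<open>x \<in> closure D\<close> obtain a where a: "\<forall>n. a n \<in> D" "a \<longlonglongrightarrow> x"
      unfolding closure_sequential by blast
    from \<open>y \<in> closure D\<close> obtain b where b: "\<forall>n. b n \<in> D" "b \<longlonglongrightarrow> y"
      unfolding closure_sequential by blast
    have "a n + b n \<in> D" for n
    proof -
      obtain u v where "a n = sum_list u" "u \<in> lists K" "b n = sum_list v" "v \<in> lists K"
        using a(1) b(1) unfolding D_def by (meson imageE)
      then have "a n + b n = sum_list (u @ v)" "u @ v \<in> lists K"
        by (simp_all only: sum_list.append append_in_lists_conv simp_thms)
      then show ?thesis unfolding D_def by (rule image_eqI)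
    qed
    then show ?thesis
      using a(2) b(2) unfolding closure_sequential
      by (intro exI[of _ "\<lambda>n. a n + b n"] conjI allI tendsto_add)
  qed
  have scale: "r *\<^sub>R g \<in> closure D" if "g \<in> G" for r g
  proof -
    have "r \<in> closure \<rat>"
      unfolding closure_approachable
    proof (intro allI impI)
      fix e :: real assume "e > 0"
      then obtain p where "p \<in> \<rat>" "r < p" "p < r + e"
        using Rats_dense_in_real[of r "r + e"] by auto
      then show "\<exists>p\<in>\<rat>. dist p r < e"
        by (intro bexI[of _ p]) (auto simp: dist_real_def)
    qed
    then obtain q where q: "\<forall>n. q n \<in> \<rat>" "q \<longlonglongrightarrow> r"
      unfolding closure_sequential by blast
    have "q n *\<^sub>R g \<in> D" for n
    proof -
      have "q n *\<^sub>R g \<in> K"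
        unfolding K_def using q(1) that by (intro image_eqI[of _ _ "(q n, g)"]) auto
      then show ?thesis
        unfolding D_def by (intro image_eqI[of _ _ "[q n *\<^sub>R g]"]) auto
    qed
    then show ?thesis
      using q(2) unfolding closure_sequential
      by (intro exI[of _ "\<lambda>n. q n *\<^sub>R g"] conjI allI tendsto_intros)
  qed
  have zero: "0 \<in> closure D"
    using closure_subset[of D] unfolding D_def by (force intro: image_eqI[of _ _ "[]"])
  have "span G \<subseteq> closure D"
  proof
    fix x assume "x \<in> span G"
    then show "x \<in> closure D"
      by (induction rule: span_induct_alt) (auto intro: zero add scale)
  qed
  then have "closure (span G) \<subseteq> closure D"
    by (rule closure_minimal) simp
  with \<open>countable D\<close> show ?thesis by blast
qed

lemma L2_separable: "\<exists>D :: 'a::euclidean_space L2 set. countable D \<and> closure D = UNIV"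
proof -
  obtain B :: "'a set set" where B: "countable B" "topological_basis B"
    using ex_countable_basis by blast
  define E where "E = {b \<in> B. bounded b}"
  define U where "U = Union ` {\<F>. finite \<F> \<and> \<F> \<subseteq> E}"
  have "countable E"
    unfolding E_def using B(1) by (rule countable_subset[rotated]) blast
  then have "countable U"
    unfolding U_def by (intro countable_image countable_Collect_finite_subset)
  have U_open: "open u \<and> bounded u" if u: "u \<in> U" for u
  proof -
    obtain \<F> where \<F>: "finite \<F>" "\<F> \<subseteq> E" "u = \<Union>\<F>"
      using u unfolding U_def by blast
    show ?thesis
      unfolding \<F>(3) using \<F>(1,2) topological_basis_open[OF B(2)]
      by (intro conjI open_Union bounded_Union) (auto simp: E_def)
  qed
  define G where "G = L2_ind 1 ` U \<union> L2_ind \<i> ` U"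
  let ?S = "closure (span G)"
  have "countable G"
    unfolding G_def using \<open>countable U\<close> by (intro countable_Un countable_image)
  have lmU: "u \<in> lmeasurable" if "u \<in> U" for u
    using U_open[OF that] by (blast intro: lmeasurable_open)
  have ind_U: "L2_ind c u \<in> ?S" if "u \<in> U" for c u
  proof -
    have "L2_ind 1 u \<in> span G" "L2_ind \<i> u \<in> span G"
      using that unfolding G_def by (blast intro: span_base)+
    then have "Re c *\<^sub>R L2_ind 1 u + Im c *\<^sub>R L2_ind \<i> u \<in> span G"
      by (intro span_add span_scale)
    then have "L2_ind c u \<in> span G"
      using ind_eq[OF lmU[OF that], of c] by (rule ssubst[rotated])
    then show ?thesis using closure_subset[of "span G"] by (rule rev_subsetD)
  qed
  have approx: "L2_ind c V \<in> ?S"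
    if "\<And>e. e > 0 \<Longrightarrow> \<exists>W. W \<in> lmeasurable \<and> L2_ind c W \<in> ?S \<and> (W \<subseteq> V \<and> measure lebesgue (V - W) < e \<or> V \<subseteq> W \<and> measure lebesgue (W - V) < e)"
      "V \<in> lmeasurable" for c V
  proof -
    have "L2_ind c V \<in> closure ?S"
      unfolding closure_approachable
    proof (intro allI impI)
      fix e :: real assume "e > 0"
      define d where "d = e\<^sup>2 / ((norm c)\<^sup>2 + 1)"
      have pos: "(norm c)\<^sup>2 + 1 > 0" by (simp add: add_nonneg_pos)
      have "d > 0" unfolding d_def using \<open>e > 0\<close> pos by simp
      from that(1)[OF this] obtain W where W: "W \<in> lmeasurable" "L2_ind c W \<in> ?S"
        "W \<subseteq> V \<and> measure lebesgue (V - W) < d \<or> V \<subseteq> W \<and> measure lebesgue (W - V) < d"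
        by blast
      have "\<exists>m. (dist (L2_ind c W) (L2_ind c V))\<^sup>2 = (norm c)\<^sup>2 * m \<and> 0 \<le> m \<and> m < d"
        using W that(2) dist_ind[of W V c] dist_ind[of V W c] by (auto simp: dist_commute)
      then obtain m where m: "(dist (L2_ind c W) (L2_ind c V))\<^sup>2 = (norm c)\<^sup>2 * m" "0 \<le> m" "m < d"
        by blast
      have "(norm c)\<^sup>2 * m \<le> ((norm c)\<^sup>2 + 1) * m"
        using m by (intro mult_right_mono) auto
      also have "\<dots> < ((norm c)\<^sup>2 + 1) * d"
        using m pos by (intro mult_strict_left_mono) auto
      also have "\<dots> = e\<^sup>2"
        using pos by (simp add: d_def)
      finally have "(dist (L2_ind c W) (L2_ind c V))\<^sup>2 < e\<^sup>2"
        using m by simp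
      then have "dist (L2_ind c W) (L2_ind c V) < e"
        using \<open>e > 0\<close> by (simp add: power2_less_imp_less)
      with W show "\<exists>y\<in>?S. dist y (L2_ind c V) < e" by blast
    qed
    then show ?thesis by simp
  qed
  have ind_open: "L2_ind c V \<in> ?S" if V: "open V" "V \<in> lmeasurable" for c V
  proof (rule approx[OF _ V(2)])
    fix e :: real assume "e > 0"
    let ?C = "{b \<in> E. b \<subseteq> V}"
    have "countable ?C" using \<open>countable E\<close> by (auto intro: countable_subset)
    have UC: "\<Union>?C = V"
    proof (intro equalityI subsetI)
      fix x assume "x \<in> V"
      then obtain b where "b \<in> B" "x \<in> b" "b \<subseteq> V \<inter> ball x 1"
        using topological_basisE[OF B(2), of "V \<inter> ball x 1" x] V(1) by auto
      then show "x \<in> \<Union>?C"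
        using bounded_subset[OF bounded_ball] by (auto simp: E_def)
    qed auto
    define W where "W n = \<Union>(from_nat_into (insert {} ?C) ` {..n})" for n :: nat
    have ran: "range (from_nat_into (insert {} ?C)) = insert {} ?C"
      by (rule range_from_nat_into) (use \<open>countable ?C\<close> in auto)
    have W_sub: "W n \<subseteq> V" for n
      using ran by (auto simp: W_def)
    have W_U: "W n \<in> U" for n
    proof -
      have "W n = \<Union>(from_nat_into (insert {} ?C) ` {..n} - {{}})"
        by (auto simp: W_def)
      moreover have "from_nat_into (insert {} ?C) ` {..n} - {{}} \<subseteq> E"
        using ran by auto
      ultimately show ?thesis
        unfolding U_def by (intro image_eqI[where x = "from_nat_into (insert {} ?C) ` {..n} - {{}}"]) auto
    qed
    have UW: "(\<Union>n. W n) = V"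
    proof -
      have "(\<Union>n. W n) = \<Union>(range (from_nat_into (insert {} ?C)))"
        by (auto simp: W_def)
      then show ?thesis unfolding ran using UC by auto
    qed
    have "incseq W"
      unfolding incseq_def W_def by (intro allI impI Union_mono image_mono) simp
    then have "(\<lambda>n. measure lebesgue (W n)) \<longlonglongrightarrow> measure lebesgue (\<Union>n. W n)"
      using lmU[OF W_U] V UW by (intro Lim_measure_incseq) (auto simp: fmeasurable_def)
    then have "\<forall>\<^sub>F n in sequentially. measure lebesgue V - e < measure lebesgue (W n)"
      unfolding UW by (rule order_tendstoD) (use \<open>e > 0\<close> in auto)
    then obtain n where n: "measure lebesgue V - e < measure lebesgue (W n)"
      by (auto simp: eventually_sequentially)
    have "measure lebesgue (V - W n) = measure lebesgue V - measure lebesgue (W n)"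
      using lmU[OF W_U] V(2) W_sub by (intro measurable_measure_Diff) (auto simp: fmeasurable_def)
    with n show "\<exists>W. W \<in> lmeasurable \<and> L2_ind c W \<in> ?S \<and> (W \<subseteq> V \<and> measure lebesgue (V - W) < e \<or> V \<subseteq> W \<and> measure lebesgue (W - V) < e)"
      using W_sub W_U lmU ind_U by (intro exI[of _ "W n"]) auto
  qed
  have ind_lm: "L2_ind c V \<in> ?S" if V: "V \<in> lmeasurable" for c V
  proof (rule approx[OF _ V])
    fix e :: real assume "e > 0"
    then obtain T where T: "open T" "V \<subseteq> T" "T - V \<in> lmeasurable" "emeasure lebesgue (T - V) < ennreal e"
      using sets_lebesgue_outer_open[of V e] V by (auto simp: fmeasurable_def)
    have "T = V \<union> (T - V)" using T by auto
    then have "T \<in> lmeasurable"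
      using fmeasurable.Un[OF V T(3)] by simp
    moreover have "measure lebesgue (T - V) < e"
      using T \<open>e > 0\<close> by (simp add: emeasure_eq_measure2 ennreal_less_iff)
    ultimately show "\<exists>W. W \<in> lmeasurable \<and> L2_ind c W \<in> ?S \<and> (W \<subseteq> V \<and> measure lebesgue (V - W) < e \<or> V \<subseteq> W \<and> measure lebesgue (W - V) < e)"
      using T ind_open by (intro exI[of _ T]) auto
  qed
  have simple: "sq_integrable s \<and> abs_L2 s \<in> ?S"
    if s: "simple_function lebesgue s" and f: "sq_integrable f" and le: "\<And>x. norm (s x) \<le> 2 * norm (f x)"
    for s f
  proof -
    have meas: "s -` {y} \<in> lmeasurable" if "y \<noteq> 0" for y
    proof -
      have [measurable]: "s -` {y} \<in> sets lebesgue"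
        using simple_functionD(2)[OF s, of "{y}"] by simp
      have "integrable lebesgue (\<lambda>x. 4 * (norm (f x))\<^sup>2)"
        using f by (simp add: sq_integrable_def)
      then have "integrable lebesgue (\<lambda>x. indicat_real (s -` {y}) x * (norm y)\<^sup>2)"
      proof (rule Bochner_Integration.integrable_bound)
        have "(norm (s x))\<^sup>2 \<le> (2 * norm (f x))\<^sup>2" for x
          by (intro power_mono le) auto
        then show "AE x in lebesgue. norm (indicat_real (s -` {y}) x * (norm y)\<^sup>2) \<le> norm (4 * (norm (f x))\<^sup>2)"
          by (auto simp: indicator_def power_mult_distrib)
      qed simp
      then show ?thesis
        using that by (auto simp: fmeasurable_def integrable_indicator_iff)
    qed
    let ?Y = "range s - {0}"
    have fin: "finite ?Y"
      using simple_functionD(1)[OF s] by simp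
    have "s x = (\<Sum>y\<in>?Y. indicator (s -` {y}) x *\<^sub>R y)" for x
    proof -
      have "s x = (\<Sum>y\<in>range s. indicator (s -` {y}) x *\<^sub>R y)"
        by (rule simple_function_indicator_representation_banach
              [OF s, of x, unfolded space_completion space_lborel space_borel Int_UNIV_right])
           (rule UNIV_I)
      also have "\<dots> = (\<Sum>y\<in>?Y. indicator (s -` {y}) x *\<^sub>R y)"
        using simple_functionD(1)[OF s] by (intro sum.mono_neutral_right) auto
      finally show ?thesis .
    qed
    then have s_eq: "(\<lambda>x. \<Sum>y\<in>?Y. indicator (s -` {y}) x *\<^sub>R y) = s"
      by (metis (no_types, lifting) ext)
    have "sq_integrable (\<lambda>x. \<Sum>y\<in>?Y. indicator (s -` {y}) x *\<^sub>R y) \<and>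
        abs_L2 (\<lambda>x. \<Sum>y\<in>?Y. indicator (s -` {y}) x *\<^sub>R y) = (\<Sum>y\<in>?Y. L2_ind y (s -` {y}))"
      using meas by (intro sq_integrable_sum_ind[OF fin]) blast
    then have *: "sq_integrable s \<and> abs_L2 s = (\<Sum>y\<in>?Y. L2_ind y (s -` {y}))"
      unfolding s_eq .
    have "(\<Sum>y\<in>T. L2_ind y (s -` {y})) \<in> ?S" if "finite T" "T \<subseteq> ?Y" for T
      using that
      by (induction rule: finite_induct) (auto intro!: closure_span_add closure_span_zero ind_lm meas)
    with * fin show ?thesis by simp
  qed
  have "f \<in> ?S" for f
  proof -
    obtain g where g: "sq_integrable g" "f = abs_L2 g"
      using L2_eq_abs by blast
    have [measurable]: "g \<in> borel_measurable lebesgue"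
      using g by (simp add: sq_integrable_def)
    obtain s where s: "\<And>i. simple_function lebesgue (s i)" "\<And>x. (\<lambda>i. s i x) \<longlonglongrightarrow> g x"
      "\<And>i x. norm (s i x) \<le> 2 * norm (g x)"
      using borel_measurable_implies_sequence_metric[of g lebesgue 0]
      by (auto simp: norm_conv_dist[symmetric])
    have [measurable]: "s i \<in> borel_measurable lebesgue" for i
      using s(1) by (rule borel_measurable_simple_function)
    have S: "sq_integrable (s i)" "abs_L2 (s i) \<in> ?S" for i
      using simple[OF s(1) g(1) s(3)] by auto
    have "(\<lambda>i. \<integral>x. (norm (s i x - g x))\<^sup>2 \<partial>lebesgue) \<longlonglongrightarrow> integral\<^sup>L (lebesgue :: 'a measure) (\<lambda>_. 0)"
    proof (rule integral_dominated_convergence)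
      show "integrable lebesgue (\<lambda>x. 9 * (norm (g x))\<^sup>2)"
        using g by (simp add: sq_integrable_def)
      show "AE x in lebesgue. (\<lambda>i. (norm (s i x - g x))\<^sup>2) \<longlonglongrightarrow> 0"
      proof (rule AE_I2)
        fix x
        have "(\<lambda>i. (norm (s i x - g x))\<^sup>2) \<longlonglongrightarrow> (norm (g x - g x))\<^sup>2"
          by (intro tendsto_intros s)
        then show "(\<lambda>i. (norm (s i x - g x))\<^sup>2) \<longlonglongrightarrow> 0" by simp
      qed
      show "AE x in lebesgue. norm ((norm (s i x - g x))\<^sup>2) \<le> 9 * (norm (g x))\<^sup>2" for i
      proof (rule AE_I2)
        fix x
        have "norm (s i x - g x) \<le> 3 * norm (g x)"
          using norm_triangle_ineq4[of "s i x" "g x"] s(3)[of i x] by simp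
        then have "(norm (s i x - g x))\<^sup>2 \<le> (3 * norm (g x))\<^sup>2"
          by (intro power_mono) auto
        then show "norm ((norm (s i x - g x))\<^sup>2) \<le> 9 * (norm (g x))\<^sup>2"
          by (simp add: power_mult_distrib)
      qed
    qed auto
    moreover have "(\<integral>x. (norm (s i x - g x))\<^sup>2 \<partial>lebesgue) = (norm (abs_L2 (s i) - f))\<^sup>2" for i
    proof -
      have d: "sq_integrable (\<lambda>x. s i x - g x)"
        using S(1) g(1) by (rule sq_integrable_diff)
      have "(norm (abs_L2 (s i) - f))\<^sup>2 = abs_L2 (\<lambda>x. s i x - g x) \<bullet> abs_L2 (\<lambda>x. s i x - g x)"
        using S(1) g by (simp add: abs_L2_diff power2_norm_eq_inner)
      also have "\<dots> = (\<integral>x. (norm (s i x - g x))\<^sup>2 \<partial>lebesgue)"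
        using d by (simp add: inner_L2.abs_eq L2rel_def power2_norm_eq_inner)
      finally show ?thesis by simp
    qed
    ultimately have "(\<lambda>i. (norm (abs_L2 (s i) - f))\<^sup>2) \<longlonglongrightarrow> 0"
      by simp
    then have "(\<lambda>i. sqrt ((norm (abs_L2 (s i) - f))\<^sup>2)) \<longlonglongrightarrow> sqrt 0"
      by (rule tendsto_real_sqrt)
    then have "(\<lambda>i. abs_L2 (s i)) \<longlonglongrightarrow> f"
      by (simp add: tendsto_norm_zero_iff LIM_zero_iff)
    with S(2) have "f \<in> closure ?S"
      unfolding closure_sequential[of f] by (intro exI[of _ "\<lambda>i. abs_L2 (s i)"]) auto
    then show "f \<in> ?S" by simp
  qed
  then have "?S = UNIV" by auto
  with countable_dense_span[OF \<open>countable G\<close>] show ?thesis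
    by (metis top.extremum_uniqueI)
qed

instance L2 :: (euclidean_space) second_countable_topology
  by standard (use L2_separable dense_imp_countable_basis in blast)


section \<open>Multi-indices and weak derivatives\<close>

definition multiindices_le :: "nat \<Rightarrow> ('n::finite \<Rightarrow> nat) set" where
  "multiindices_le k = {\<alpha>. sum \<alpha> UNIV \<le> k}"

lemma finite_multiindices_le: "finite (multiindices_le k :: ('n::finite \<Rightarrow> nat) set)"
proof (rule finite_subset)
  show "multiindices_le k \<subseteq> (PiE UNIV (\<lambda>_. {..k}) :: ('n \<Rightarrow> nat) set)"
  proof
    fix \<alpha> :: "'n \<Rightarrow> nat" assume "\<alpha> \<in> multiindices_le k"
    then have "\<alpha> i \<le> k" for i
      using member_le_sum[of i UNIV \<alpha>] by (simp add: multiindices_le_def)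
    then show "\<alpha> \<in> PiE UNIV (\<lambda>_. {..k})"
      by auto
  qed
qed (simp add: finite_PiE)

definition multi_power :: "real^'n \<Rightarrow> ('n::finite \<Rightarrow> nat) \<Rightarrow> real" where
  "multi_power \<xi> \<alpha> = (\<Prod>i\<in>UNIV. (\<xi> $ i) ^ \<alpha> i)"

definition partial_deriv :: "'n::finite \<Rightarrow> (real^'n \<Rightarrow> complex) \<Rightarrow> real^'n \<Rightarrow> complex" where
  "partial_deriv i \<phi> x = frechet_derivative \<phi> (at x) (axis i 1)"

definition partial_derivs :: "'n::finite list \<Rightarrow> (real^'n \<Rightarrow> complex) \<Rightarrow> real^'n \<Rightarrow> complex" where
  "partial_derivs is \<phi> = foldr partial_deriv is \<phi>"

text \<open>
  A function all of whose iterated partial derivatives are differentiable everywhere is smooth,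
  and conversely.
\<close>

definition test_functions :: "(real^'n::finite \<Rightarrow> complex) set" where
  "test_functions = {\<phi>. (\<forall>is. partial_derivs is \<phi> differentiable_on UNIV) \<and>
     (\<exists>K. compact K \<and> (\<forall>x. x \<notin> K \<longrightarrow> \<phi> x = 0))}"

text \<open>
  Only used for test functions, whose partial derivatives commute, so the order in which
  the list arranges the variables is irrelevant.
\<close>

definition multi_deriv :: "('n::finite \<Rightarrow> nat) \<Rightarrow> (real^'n \<Rightarrow> complex) \<Rightarrow> real^'n \<Rightarrow> complex" where
  "multi_deriv \<alpha> \<phi> = partial_derivs (SOME is. \<forall>i. count_list is i = \<alpha> i) \<phi>"

text \<open>
  \<^term>\<open>rep_L2 f\<close> is some representative of the class; the integrals do not depend on which.
\<close>

definition is_weak_deriv :: "('n::finite \<Rightarrow> nat) \<Rightarrow> (real^'n) L2 \<Rightarrow> (real^'n) L2 \<Rightarrow> bool" where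
  "is_weak_deriv \<alpha> f g \<longleftrightarrow> (\<forall>\<phi>\<in>test_functions.
     (\<integral>x. rep_L2 f x * multi_deriv \<alpha> \<phi> x \<partial>lebesgue) =
     (-1) ^ sum \<alpha> UNIV * (\<integral>x. rep_L2 g x * \<phi> x \<partial>lebesgue))"

text \<open>Weak derivatives are unique as elements of the quotient type.\<close>

definition weak_deriv :: "('n::finite \<Rightarrow> nat) \<Rightarrow> (real^'n) L2 \<Rightarrow> (real^'n) L2" where
  "weak_deriv \<alpha> f = (SOME g. is_weak_deriv \<alpha> f g)"

definition sobolev :: "nat \<Rightarrow> (real^'n::finite) L2 set" where
  "sobolev k = {f. \<forall>\<alpha>\<in>multiindices_le k. \<exists>g. is_weak_deriv \<alpha> f g}"

definition sobolev_norm :: "nat \<Rightarrow> (real^'n::finite) L2 \<Rightarrow> real" where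
  "sobolev_norm k f = sqrt (\<Sum>\<alpha>\<in>multiindices_le k. (norm (weak_deriv \<alpha> f))\<^sup>2)"


section \<open>Spaces of functions of time\<close>

text \<open>
  \<^typ>\<open>(real^'n) L2\<close> is separable, so Borel measurability is strong (Bochner) measurability.
\<close>

definition time_L2 :: "real \<Rightarrow> (real \<Rightarrow> (real^'n::finite) L2) set" where
  "time_L2 T = {u. u \<in> borel_measurable (lebesgue_on {0..T}) \<and>
     integrable (lebesgue_on {0..T}) (\<lambda>t. (norm (u t))\<^sup>2)}"

text \<open>
  Strong measurability with respect to the Sobolev norm: almost everywhere a limit, in
  that norm, of simple functions with values in the Sobolev space.
\<close>

definition sobolev_measurable :: "real \<Rightarrow> nat \<Rightarrow> (real \<Rightarrow> (real^'n::finite) L2) \<Rightarrow> bool" where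
  "sobolev_measurable T k u \<longleftrightarrow>
     (\<exists>s. (\<forall>i. simple_function (lebesgue_on {0..T}) (s i) \<and> (\<forall>t. s i t \<in> sobolev k)) \<and>
       (AE t in lebesgue_on {0..T}. u t \<in> sobolev k \<and>
         (\<lambda>i. sobolev_norm k (s i t - u t)) \<longlonglongrightarrow> 0))"

definition time_L2_sobolev :: "real \<Rightarrow> nat \<Rightarrow> (real \<Rightarrow> (real^'n::finite) L2) set" where
  "time_L2_sobolev T k = {u. sobolev_measurable T k u \<and>
     integrable (lebesgue_on {0..T}) (\<lambda>t. (sobolev_norm k (u t))\<^sup>2)}"

definition time_test_functions :: "real \<Rightarrow> (real \<Rightarrow> real) set" where
  "time_test_functions T = {\<phi>. (\<forall>k. (deriv ^^ k) \<phi> differentiable_on UNIV) \<and>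
     (\<exists>K. compact K \<and> K \<subseteq> {0<..<T} \<and> (\<forall>t. t \<notin> K \<longrightarrow> \<phi> t = 0))}"

definition is_time_deriv ::
    "real \<Rightarrow> (real \<Rightarrow> (real^'n::finite) L2) \<Rightarrow> (real \<Rightarrow> (real^'n) L2) \<Rightarrow> bool" where
  "is_time_deriv T u v \<longleftrightarrow> v \<in> time_L2 T \<and> (\<forall>\<phi>\<in>time_test_functions T.
     (\<integral>t. deriv \<phi> t *\<^sub>R u t \<partial>lebesgue_on {0..T}) = - (\<integral>t. \<phi> t *\<^sub>R v t \<partial>lebesgue_on {0..T}))"

text \<open>Unique up to equality for almost every time.\<close>

definition time_deriv :: "real \<Rightarrow> (real \<Rightarrow> (real^'n::finite) L2) \<Rightarrow> real \<Rightarrow> (real^'n) L2" where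
  "time_deriv T u = (SOME v. is_time_deriv T u v)"

definition time_H1 :: "real \<Rightarrow> (real \<Rightarrow> (real^'n::finite) L2) set" where
  "time_H1 T = {u \<in> time_L2 T. \<exists>v. is_time_deriv T u v}"

text \<open>
  For \<^term>\<open>T > 0\<close> a continuous representative is unique on \<^term>\<open>{0..T}\<close>; it exists for
  every element of \<^term>\<open>time_H1 T\<close>.
\<close>

definition continuous_rep :: "real \<Rightarrow> (real \<Rightarrow> (real^'n::finite) L2) \<Rightarrow> real \<Rightarrow> (real^'n) L2" where
  "continuous_rep T u = (SOME U. continuous_on {0..T} U \<and> (AE t in lebesgue_on {0..T}. U t = u t))"


section \<open>Coefficients\<close>

text \<open>
  The norm is a parameter because the coefficient space, of dimension the number of
  multi-indices of order at most \<^term>\<open>2 * m\<close>, is represented by functions on multi-indices,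
  with the Euclidean norm \<^term>\<open>\<lambda>v. L2_set v (multiindices_le (2 * m))\<close>.
\<close>

definition modulus_of_continuity ::
    "('b::minus \<Rightarrow> real) \<Rightarrow> real set \<Rightarrow> (real \<Rightarrow> 'b) \<Rightarrow> real \<Rightarrow> real" where
  "modulus_of_continuity N I f \<tau> =
     (SUP (t, s) \<in> {(t, s). t \<in> I \<and> s \<in> I \<and> \<bar>t - s\<bar> \<le> \<tau>}. N (f t - f s))"

text \<open>In \<^typ>\<open>ennreal\<close> the inverse of 0 is \<^term>\<open>\<infinity> :: ennreal\<close>.\<close>

definition osgood :: "(real \<Rightarrow> real) \<Rightarrow> bool" where
  "osgood \<omega> \<longleftrightarrow> mono_on {0..1} \<omega> \<and> \<omega> 0 = 0 \<and>
     (\<integral>\<^sup>+s. inverse (ennreal (\<omega> s)) \<partial>lebesgue_on {0..1}) = \<infinity>"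

definition symbol_part ::
    "(real \<Rightarrow> ('n::finite \<Rightarrow> nat) \<Rightarrow> real) \<Rightarrow> nat \<Rightarrow> real \<Rightarrow> real^'n \<Rightarrow> real" where
  "symbol_part R k t \<xi> =
     (-1) ^ k * ((\<Sum>\<alpha> | sum \<alpha> UNIV = k. R t \<alpha> * multi_power \<xi> \<alpha>) / norm \<xi> ^ k)"

end

theory Submission imports Defs "HOL-Probability.Characteristic_Functions"
begin

text \<open>
  On the Fourier side the equation for \<open>u\<close> becomes \<open>V' = P(t, \<xi>) V + f\<close>: each \<open>\<i> ^ |\<alpha>|\<close> of the
  operator meets a second \<open>\<i> ^ |\<alpha>|\<close> from the derivative, so
  \<open>P(t, \<xi>) = (\<Sum>\<alpha>. (- 1) ^ |\<alpha>| \<rho>\<^sub>\<alpha>(t) \<xi>\<^sup>\<alpha>)\<close> is real. With the weight \<open>Y(\<xi>) = max 1 |\<xi>| ^ (2 m)\<close> of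
  the norm of \<open>H\<^sup>m\<close>, ellipticity says \<open>P \<ge> Y / (2 \<Lambda>) - D\<close> (\<open>full_symbol_lower_bound\<close>), and \<open>|f|\<close> is
  bounded by that norm. The equation is thus backward parabolic: no growth bound for \<open>V\<close> is
  available, and uniqueness from \<open>V(0) = 0\<close> is obtained from a Carleman estimate.

  Multiply by a positive weight \<open>e(t)\<close> with \<open>e' = - \<gamma> e\<close>. Then \<open>w = e V\<close> satisfies
  \<open>w' = (P - \<gamma>) w + e f\<close>, and for differentiable coefficients the energy \<open>\<langle>(P - \<gamma>) w, w\<rangle>\<close> has a
  derivative of at least \<open>\<integral> ((P - \<gamma>)\<^sup>2 + P' - \<gamma>') |w|\<^sup>2 - |e f|\<^sup>2\<close>. The coefficients are only continuous, so
  the energy is formed with \<open>P\<^sub>\<sigma>\<close>, in which each coefficient is averaged over \<open>[t, t + \<sigma>(t)]\<close>. If \<open>\<omega>\<close>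
  bounds the modulus of continuity, then the averaging error is \<open>\<omega>(\<sigma>)\<close> and the derivative of the
  average is \<open>2 \<omega>(\<sigma>) / \<sigma>\<close> (\<open>averaged_coefficient\<close>). The choice \<open>\<gamma> = 1 / \<sigma>\<close>, \<open>\<sigma>' = K \<omega>(\<sigma>)\<close>, that is
  \<open>- \<gamma>' = K \<omega>(\<sigma>) \<gamma>\<^sup>2\<close>, makes the pointwise inequality

    \<open>A Y \<le> (P\<^sub>\<sigma> - \<gamma>)\<^sup>2 + P\<^sub>\<sigma>' - \<gamma>' - 2 (P\<^sub>\<sigma> - P)\<^sup>2\<close>

  true for any prescribed \<open>A\<close> (\<open>carleman_symbol_inequality\<close>): where \<open>Y\<close> is at most a multiple of \<open>\<gamma>\<close>, all
  error terms are multiples of \<open>\<omega>(\<sigma>) \<gamma>\<^sup>2\<close>; where \<open>Y\<close> is larger, \<open>P\<^sub>\<sigma> - \<gamma>\<close> is comparable to \<open>Y\<close> and its square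
  wins. The Osgood condition is what makes this choice possible: a solution of \<open>\<sigma>' = K \<omega>(\<sigma>)\<close> needs
  the time \<open>\<integral> ds / (K \<omega>(s))\<close> over \<open>[a, b]\<close> to move from \<open>a\<close> to \<open>b\<close>, and since this diverges as \<open>a \<longrightarrow> 0\<close> there are
  solutions on all of \<open>[0, T]\<close> below any given positive bound (\<open>slow_growth_solution\<close>).

  Integrating from 0, where \<open>V\<close> vanishes, to \<open>b\<close> and taking \<open>A\<close> so large that \<open>f\<close> is absorbed gives
  \<open>\<integral>\<^sub>0\<^sup>b e\<^sup>2 S \<le> c e(b)\<^sup>2 S(b)\<close> for \<open>S(t) = \<integral> Y |V(t)|\<^sup>2\<close> (\<open>carleman_integrated\<close>). If \<open>\<sigma> \<le> s\<^sub>1\<close>, then \<open>e\<close> decreases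
  at least at the rate \<open>1 / s\<^sub>1\<close>, so for \<open>a < b\<close> the integral of \<open>S\<close> over \<open>[0, a]\<close> is at most
  \<open>c exp (- 2 (b - a) / s\<^sub>1) S(b)\<close>, and \<open>s\<^sub>1 \<longrightarrow> 0\<close> yields \<open>S = 0\<close>.

  The multipliers \<open>P\<close> and \<open>Y\<close> are unbounded. All energies are therefore cut off to \<open>|\<xi>| \<le> N\<close>, where
  every operator is bounded, with estimates uniform in \<open>N\<close>; the limit \<open>N \<longrightarrow> \<infinity>\<close> is taken only
  in the integrated inequality. The analytic background is proved here: the Fourier transform is
  an isometry (\<open>norm_four\<close>) that turns weak derivatives into multiplication
  (\<open>four_weak_deriv\<close>), a function with a weak time derivative has a continuous
  representative that is its primitive (\<open>time_representation\<close>), and primitives obey the product rule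
  (\<open>primitive_on_bilinear\<close>), which differentiates the energy (\<open>energy_primitive\<close>).
\<close>

section \<open>Fourier transforms of Gaussians\<close>

text \<open>
  Lebesgue measure is the image of a product of one-dimensional Lebesgue measures under the map
  from coordinates to vectors, so integrals of tensor products factor.
\<close>

lemma lborel_tensor:
  fixes f :: "'a::euclidean_space \<Rightarrow> real \<Rightarrow> complex"
  assumes "\<And>b. b \<in> Basis \<Longrightarrow> integrable lborel (f b)"
  shows "integrable lborel (\<lambda>x. \<Prod>b\<in>Basis. f b (x \<bullet> b))" (is ?A)
    and "(\<integral>x. (\<Prod>b\<in>Basis. f b (x \<bullet> b)) \<partial>lborel) = (\<Prod>b\<in>Basis. integral\<^sup>L lborel (f b))" (is ?B)
proof -
  interpret product_sigma_finite "\<lambda>_::'a. lborel :: real measure" ..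
  have [measurable]: "f b \<in> borel_measurable borel" if "b \<in> Basis" for b
    using assms[OF that] by (auto dest: borel_measurable_integrable)
  have *: "(\<lambda>x. \<Prod>b\<in>Basis. f b ((\<Sum>i\<in>Basis. x i *\<^sub>R i) \<bullet> b)) = (\<lambda>x. \<Prod>b\<in>Basis. f b (x b))" for f :: "'a \<Rightarrow> real \<Rightarrow> complex"
    by (intro ext prod.cong) simp_all
  show ?A
    unfolding lborel_eq[where 'a='a]
    by (subst integrable_distr_eq) (auto simp: * intro!: product_integrable_prod assms)
  show ?B
    unfolding lborel_eq[where 'a='a]
    by (subst integral_distr) (auto simp: * intro!: product_integral_prod assms)
qed

text \<open>
  The characteristic function of the standard normal distribution, rescaled by \<open>x \<mapsto> s x\<close>.
\<close>

lemma char_gauss_1d: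
  assumes "s > 0"
  shows "integrable lborel (\<lambda>x::real. cis (- (z * x)) * of_real (exp (- (s * x)\<^sup>2 / 2)))" (is ?A)
    and "(\<integral>x. cis (- (z * x)) * of_real (exp (- (s * x)\<^sup>2 / 2)) \<partial>lborel)
      = of_real (sqrt (2 * pi) / s * exp (- (z / s)\<^sup>2 / 2))" (is ?B)
proof -
  have i: "has_bochner_integral lborel (\<lambda>x. std_normal_density x *\<^sub>R iexp (- z / s * x)) (of_real (exp (- (z/s)\<^sup>2 / 2)))"
  proof -
    have "has_bochner_integral (density lborel std_normal_density) (\<lambda>x. iexp (- z / s * x)) (of_real (exp (- (z/s)\<^sup>2 / 2)))"
    proof -
      interpret real_distribution "density lborel std_normal_density" by (rule real_dist_normal_dist)
      have "integrable (density lborel std_normal_density) (\<lambda>x. iexp (- z / s * x))"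
        by (rule integrable_iexp) auto
      moreover have "(\<integral>x. iexp (- z / s * x) \<partial>density lborel std_normal_density) = of_real (exp (- (z/s)\<^sup>2 / 2))"
        using fun_cong[OF char_std_normal_distribution, of "- z / s"] by (simp add: char_def)
      ultimately show ?thesis by (metis has_bochner_integral_integrable)
    qed
    then show ?thesis
      unfolding has_bochner_integral_iff
      by (subst (asm) integrable_density, simp, simp, simp, subst (asm) integral_density, simp_all del: mult_minus_left of_real_divide)
  qed
  then have "has_bochner_integral lborel (\<lambda>x. sqrt (2 * pi) *\<^sub>R (std_normal_density x *\<^sub>R iexp (- z / s * x))) (sqrt (2 * pi) *\<^sub>R of_real (exp (- (z/s)\<^sup>2 / 2)))"
    by (intro has_bochner_integral_scaleR_right) auto
  moreover have "sqrt (2 * pi) *\<^sub>R (std_normal_density x *\<^sub>R iexp (- z / s * x)) = cis (- (z * (x / s))) * of_real (exp (- x\<^sup>2 / 2))" for x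
    by (simp add: std_normal_density_def cis_conv_exp scaleR_conv_of_real real_sqrt_mult)
  ultimately have h: "has_bochner_integral lborel (\<lambda>x. cis (- (z * (x / s))) * of_real (exp (- x\<^sup>2 / 2))) (of_real (sqrt (2 * pi) * exp (- (z/s)\<^sup>2 / 2)))"
    by (simp add: scaleR_conv_of_real)
  have "has_bochner_integral lborel (\<lambda>x. cis (- (z * ((0 + s * x) / s))) * of_real (exp (- (0 + s * x)\<^sup>2 / 2))) (of_real (sqrt (2 * pi) * exp (- (z/s)\<^sup>2 / 2)) /\<^sub>R \<bar>s\<bar>)"
    by (rule lborel_has_bochner_integral_real_affine_iff[THEN iffD1, OF _ h]) (use assms in simp)
  then have "has_bochner_integral lborel (\<lambda>x. cis (- (z * x)) * of_real (exp (- (s * x)\<^sup>2 / 2))) (of_real (sqrt (2 * pi) / s * exp (- (z/s)\<^sup>2 / 2)))"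
    using assms by (simp add: scaleR_conv_of_real field_simps)
  then show ?A ?B by (auto simp: has_bochner_integral_iff)
qed

lemma char_gauss:
  fixes z :: "'a::euclidean_space"
  assumes "s > 0"
  shows "integrable lborel (\<lambda>x. cis (- (z \<bullet> x)) * of_real (exp (- (s * norm x)\<^sup>2 / 2)))" (is ?A)
    and "(\<integral>x. cis (- (z \<bullet> x)) * of_real (exp (- (s * norm x)\<^sup>2 / 2)) \<partial>lborel)
      = of_real ((sqrt (2 * pi) / s) ^ DIM('a) * exp (- (norm z / s)\<^sup>2 / 2))" (is ?B)
proof -
  have n: "(norm x)\<^sup>2 = (\<Sum>b\<in>Basis. (x \<bullet> b)\<^sup>2)" for x :: 'a
    unfolding power2_norm_eq_inner by (subst euclidean_inner) (simp add: power2_eq_square)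
  have e: "exp (- (c * norm x)\<^sup>2 / 2) = (\<Prod>b\<in>Basis. exp (- (c * (x \<bullet> b))\<^sup>2 / 2))" for x :: 'a and c :: real
    by (simp add: power_mult_distrib n sum_distrib_left sum_negf[symmetric] sum_divide_distrib exp_sum[symmetric])
  have c: "cis (- (z \<bullet> x)) = (\<Prod>b\<in>Basis. cis (- ((z \<bullet> b) * (x \<bullet> b))))" for x
    by (subst euclidean_inner) (simp add: cis_conv_exp sum_distrib_left sum_negf[symmetric] exp_sum[symmetric])
  have *: "cis (- (z \<bullet> x)) * of_real (exp (- (s * norm x)\<^sup>2 / 2)) =
      (\<Prod>b\<in>Basis. cis (- ((z \<bullet> b) * (x \<bullet> b))) * of_real (exp (- (s * (x \<bullet> b))\<^sup>2 / 2)))" for x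
    by (simp only: e c prod.distrib of_real_prod)
  show ?A
    unfolding * by (rule lborel_tensor) (rule char_gauss_1d[OF assms])
  have "(\<integral>x. cis (- (z \<bullet> x)) * of_real (exp (- (s * norm x)\<^sup>2 / 2)) \<partial>lborel)
     = (\<Prod>b\<in>Basis. of_real (sqrt (2 * pi) / s * exp (- ((z\<bullet>b) / s)\<^sup>2 / 2)))"
    unfolding * by (subst lborel_tensor(2)[OF char_gauss_1d(1)[OF assms]]) (simp_all only: char_gauss_1d(2)[OF assms])
  also have "\<dots> = of_real ((sqrt (2 * pi) / s) ^ DIM('a) * exp (- (norm z / s)\<^sup>2 / 2))"
    using e[of "1/s" z] by (simp only: of_real_prod[symmetric] prod.distrib prod_constant) simp
  finally show ?B .
qed

definition heat_kernel :: "real \<Rightarrow> 'a::euclidean_space \<Rightarrow> real" where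
  "heat_kernel s z = exp (- (norm z / s)\<^sup>2 / 2) / (sqrt (2 * pi) * s) ^ DIM('a)"

lemma heat_kernel_measurable [measurable]: "heat_kernel s \<in> borel_measurable borel"
  unfolding heat_kernel_def by measurable

lemma heat_kernel_nonneg: "s > 0 \<Longrightarrow> heat_kernel s z \<ge> 0"
  by (simp add: heat_kernel_def)

lemma heat_kernel_minus: "heat_kernel s (x - y) = heat_kernel s (y - x)"
  by (simp add: heat_kernel_def norm_minus_commute)

lemma heat_kernel_integral:
  assumes "s > 0"
  shows "has_bochner_integral lborel (heat_kernel s :: 'a::euclidean_space \<Rightarrow> real) 1"
proof -
  have "integrable lborel (\<lambda>x::'a. complex_of_real (exp (- (inverse s * norm x)\<^sup>2 / 2)))"
    using char_gauss(1)[of "inverse s" "0::'a"] assms by simp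
  then have 1: "integrable lborel (\<lambda>x::'a. exp (- (inverse s * norm x)\<^sup>2 / 2))"
    by (rule complex_of_real_integrable_eq[THEN iffD1])
  have "(\<integral>x. complex_of_real (exp (- (inverse s * norm (x::'a))\<^sup>2 / 2)) \<partial>lborel) = of_real ((sqrt (2 * pi) / inverse s) ^ DIM('a) * exp (- (norm (0::'a) / inverse s)\<^sup>2 / 2))"
    using char_gauss(2)[of "inverse s" "0::'a"] assms by (simp only: inner_zero_left minus_zero cis_zero mult_1 inverse_positive_iff_positive)
  then have "integral\<^sup>L lborel (\<lambda>x::'a. exp (- (inverse s * norm x)\<^sup>2 / 2)) = (sqrt (2 * pi) * s) ^ DIM('a)"
    unfolding integral_complex_of_real of_real_eq_iff divide_inverse[of _ "inverse s"] inverse_inverse_eq by simp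
  moreover have eq: "(heat_kernel s :: 'a \<Rightarrow> real) = (\<lambda>x. exp (- (inverse s * norm x)\<^sup>2 / 2) / (sqrt (2 * pi) * s) ^ DIM('a))"
    unfolding heat_kernel_def divide_inverse[of _ s] mult.commute[of _ "inverse s"] ..
  moreover have "(sqrt (2 * pi) * s) ^ DIM('a) \<noteq> 0" using assms by simp
  ultimately show ?thesis
    using 1 unfolding has_bochner_integral_iff eq integral_divide_zero by (intro conjI integrable_divide) simp_all
qed

lemma nn_integral_heat_kernel:
  fixes x :: "'a::euclidean_space"
  assumes "s > 0"
  shows "(\<integral>\<^sup>+y. ennreal (heat_kernel s (x - y)) \<partial>lborel) = 1"
proof -
  have "(\<integral>\<^sup>+y. ennreal (heat_kernel s (x - y)) \<partial>lborel) = (\<integral>\<^sup>+y. ennreal (heat_kernel s (y - x)) \<partial>lborel)"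
    by (simp add: heat_kernel_minus)
  also have "\<dots> = (\<integral>\<^sup>+y. ennreal (heat_kernel s y) \<partial>distr lborel borel ((+) (- x)))"
    by (subst nn_integral_distr) auto
  also have "\<dots> = (\<integral>\<^sup>+y. ennreal (heat_kernel s (y::'a)) \<partial>lborel)"
    by (simp only: lborel_distr_plus)
  also have "\<dots> = 1"
    using heat_kernel_integral[OF assms] heat_kernel_nonneg[OF assms]
    by (subst nn_integral_eq_integral) (auto simp: has_bochner_integral_iff)
  finally show ?thesis .
qed

section \<open>Plancherel identity for continuous functions of compact support\<close>

definition ft :: "('a::euclidean_space \<Rightarrow> complex) \<Rightarrow> 'a \<Rightarrow> complex" where
  "ft f \<xi> = of_real (1 / sqrt (2 * pi) ^ DIM('a)) * (\<integral>x. cis (- (x \<bullet> \<xi>)) * f x \<partial>lebesgue)"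

lemma cis_measurable [measurable]: "cis \<in> borel_measurable borel"
  by (intro borel_measurable_continuous_onI continuous_intros)

lemma ft_borel:
  fixes f :: "'a::euclidean_space \<Rightarrow> complex"
  assumes [measurable]: "f \<in> borel_measurable borel"
  shows "ft f \<xi> = of_real (1 / sqrt (2 * pi) ^ DIM('a)) * (\<integral>x. cis (- (x \<bullet> \<xi>)) * f x \<partial>lborel)"
  unfolding ft_def by (subst integral_completion) auto

lemma ft_measurable:
  fixes f :: "'a::euclidean_space \<Rightarrow> complex"
  assumes [measurable]: "f \<in> borel_measurable borel"
  shows "ft f \<in> borel_measurable borel"
  unfolding ft_borel[OF assms, abs_def] by measurable

lemma integrable_pair_mult:
  fixes f g :: "'a::euclidean_space \<Rightarrow> complex"
  assumes f: "integrable lborel f" and g: "integrable lborel g"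
  shows "integrable (lborel \<Otimes>\<^sub>M lborel) (\<lambda>p. f (fst p) * g (snd p))"
    and "(\<integral>p. f (fst p) * g (snd p) \<partial>(lborel \<Otimes>\<^sub>M lborel)) = integral\<^sup>L lborel f * integral\<^sup>L lborel g"
proof -
  have [measurable]: "f \<in> borel_measurable borel" "g \<in> borel_measurable borel"
    using f g by (auto dest: borel_measurable_integrable)
  show i: "integrable (lborel \<Otimes>\<^sub>M lborel) (\<lambda>p. f (fst p) * g (snd p))"
  proof (rule lborel_pair.Fubini_integrable)
    show "integrable lborel (\<lambda>x. \<integral>y. norm (f (fst (x, y)) * g (snd (x, y))) \<partial>lborel)"
      using f by (simp add: norm_mult integrable_norm)
    show "AE x in lborel. integrable lborel (\<lambda>y. f (fst (x, y)) * g (snd (x, y)))"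
      using g by simp
  qed simp
  show "(\<integral>p. f (fst p) * g (snd p) \<partial>(lborel \<Otimes>\<^sub>M lborel)) = integral\<^sup>L lborel f * integral\<^sup>L lborel g"
    by (subst lborel_pair.integral_fst'[OF i, symmetric]) simp
qed

text \<open>
  The square of an integral as a double integral: the frequency then occurs only in one character,
  which a Gaussian in \<open>\<xi>\<close> makes integrable.
\<close>

lemma norm_ft_sq:
  fixes f :: "'a::euclidean_space \<Rightarrow> complex"
  assumes f: "integrable lborel f"
  shows "complex_of_real ((norm (ft f \<xi>))\<^sup>2) = (of_real (1 / sqrt (2 * pi) ^ DIM('a)))\<^sup>2 *
    (\<integral>p. cis (- ((fst p - snd p) \<bullet> \<xi>)) * (f (fst p) * cnj (f (snd p))) \<partial>(lborel \<Otimes>\<^sub>M lborel))"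
proof -
  have [measurable]: "f \<in> borel_measurable borel"
    using f by (auto dest: borel_measurable_integrable)
  have fi: "integrable lborel (\<lambda>x. cis (- (x \<bullet> \<xi>)) * f x)"
    by (rule Bochner_Integration.integrable_bound[OF f]) (auto simp: norm_mult)
  have gi: "integrable lborel (\<lambda>x. cnj (cis (- (x \<bullet> \<xi>)) * f x))"
    using fi by (rule integrable_cnj)
  have "(\<integral>p. cis (- ((fst p - snd p) \<bullet> \<xi>)) * (f (fst p) * cnj (f (snd p))) \<partial>(lborel \<Otimes>\<^sub>M lborel))
    = (\<integral>p. (cis (- (fst p \<bullet> \<xi>)) * f (fst p)) * cnj (cis (- (snd p \<bullet> \<xi>)) * f (snd p)) \<partial>(lborel \<Otimes>\<^sub>M lborel))"
  proof (rule Bochner_Integration.integral_cong[OF refl])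
    fix p :: "'a \<times> 'a"
    have "cis (- ((fst p - snd p) \<bullet> \<xi>)) = cis (- (fst p \<bullet> \<xi>)) * cnj (cis (- (snd p \<bullet> \<xi>)))"
      by (simp add: cis_cnj cis_mult inner_diff_left)
    then show "cis (- ((fst p - snd p) \<bullet> \<xi>)) * (f (fst p) * cnj (f (snd p))) = (cis (- (fst p \<bullet> \<xi>)) * f (fst p)) * cnj (cis (- (snd p \<bullet> \<xi>)) * f (snd p))"
      by (simp only: complex_cnj_mult mult_ac)
  qed
  also have "\<dots> = (\<integral>x. cis (- (x \<bullet> \<xi>)) * f x \<partial>lborel) * cnj (\<integral>x. cis (- (x \<bullet> \<xi>)) * f x \<partial>lborel)"
    using integrable_pair_mult(2)[OF fi gi] by (simp only: Bochner_Integration.integral_cnj)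
  finally show ?thesis
    unfolding complex_norm_square by (simp add: ft_borel power2_eq_square)
qed

lemma norm_ft_le:
  fixes f :: "'a::euclidean_space \<Rightarrow> complex"
  assumes f: "integrable lborel f"
  shows "norm (ft f \<xi>) \<le> (\<integral>x. norm (f x) \<partial>lborel)"
proof -
  have [measurable]: "f \<in> borel_measurable borel"
    using f by (auto dest: borel_measurable_integrable)
  have "1 \<le> sqrt (2 * pi)" using pi_gt3 by simp
  then have "1 \<le> sqrt (2 * pi) ^ DIM('a)" by (rule one_le_power)
  then have c: "1 / sqrt (2 * pi) ^ DIM('a) \<le> 1" by simp
  have "norm (\<integral>x. cis (- (x \<bullet> \<xi>)) * f x \<partial>lborel) \<le> (\<integral>x. norm (cis (- (x \<bullet> \<xi>)) * f x) \<partial>lborel)"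
    by (rule integral_norm_bound)
  then have "norm (\<integral>x. cis (- (x \<bullet> \<xi>)) * f x \<partial>lborel) \<le> (\<integral>x. norm (f x) \<partial>lborel)"
    by (simp add: norm_mult)
  then have "(1 / sqrt (2 * pi) ^ DIM('a)) * norm (\<integral>x. cis (- (x \<bullet> \<xi>)) * f x \<partial>lborel) \<le> 1 * (\<integral>x. norm (f x) \<partial>lborel)"
    using c by (intro mult_mono) auto
  then show ?thesis
    by (simp add: ft_borel norm_mult norm_divide norm_power)
qed

lemma gauss_integrable:
  assumes "s > 0" shows "integrable lborel (\<lambda>x::'a::euclidean_space. exp (- (s * norm x)\<^sup>2 / 2))"
proof -
  have "integrable lborel (\<lambda>x::'a. complex_of_real (exp (- (s * norm x)\<^sup>2 / 2)))"
    using char_gauss(1)[OF assms, of "0::'a"] by simp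
  then show ?thesis by (rule complex_of_real_integrable_eq[THEN iffD1])
qed

text \<open>
  Against a Gaussian the integral over the frequencies converges absolutely, so it can be carried
  out first, and the Fourier transform of the Gaussian is the heat kernel. As \<open>s\<close> tends to 0 the left
  side tends to the integral of \<open>|ft f|\<^sup>2\<close> and the heat kernel to a point mass on the diagonal.
\<close>

lemma gaussian_plancherel:
  fixes f :: "'a::euclidean_space \<Rightarrow> complex"
  assumes f: "integrable lborel f" and s: "s > 0"
  shows "complex_of_real (\<integral>\<xi>. (norm (ft f \<xi>))\<^sup>2 * exp (- (s * norm \<xi>)\<^sup>2 / 2) \<partial>lborel)
    = (\<integral>p. f (fst p) * cnj (f (snd p)) * of_real (heat_kernel s (fst p - snd p)) \<partial>(lborel \<Otimes>\<^sub>M lborel))"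
proof -
  let ?M = "lborel \<Otimes>\<^sub>M lborel :: ('a \<times> 'a) measure"
  interpret Q: pair_sigma_finite "lborel :: 'a measure" ?M
    by (intro pair_sigma_finite.intro sigma_finite_lborel lborel_pair.sigma_finite_measure_axioms)
  have [measurable]: "f \<in> borel_measurable borel"
    using f by (auto dest: borel_measurable_integrable)
  let ?c = "complex_of_real (1 / sqrt (2 * pi) ^ DIM('a))"
  define W where "W p = f (fst p) * cnj (f (snd p))" for p
  define H where "H = (\<lambda>(\<xi>, p). of_real (exp (- (s * norm \<xi>)\<^sup>2 / 2)) * (cis (- ((fst p - snd p) \<bullet> \<xi>)) * W p))"
  have W: "integrable ?M W"
    unfolding W_def by (rule integrable_pair_mult[OF f integrable_cnj[OF f]])
  have [measurable]: "W \<in> borel_measurable ?M"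
    using W by (rule borel_measurable_integrable)
  have Hi: "integrable (lborel \<Otimes>\<^sub>M ?M) H"
  proof (rule Q.Fubini_integrable)
    show "H \<in> borel_measurable (lborel \<Otimes>\<^sub>M ?M)"
      unfolding H_def by measurable
    have "(\<integral>p. norm (H (\<xi>, p)) \<partial>?M) = exp (- (s * norm \<xi>)\<^sup>2 / 2) * (\<integral>p. norm (W p) \<partial>?M)" for \<xi>
      by (simp add: H_def norm_mult)
    then show "integrable lborel (\<lambda>\<xi>. \<integral>p. norm (H (\<xi>, p)) \<partial>?M)"
      using gauss_integrable[OF s, where 'a='a] by simp
    have "integrable ?M (\<lambda>p. H (\<xi>, p))" for \<xi>
      unfolding H_def split by (intro integrable_mult_right Bochner_Integration.integrable_bound[OF W]) (auto simp: norm_mult)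
    then show "AE \<xi> in lborel. integrable ?M (\<lambda>p. H (\<xi>, p))" by simp
  qed
  have "complex_of_real (\<integral>\<xi>. (norm (ft f \<xi>))\<^sup>2 * exp (- (s * norm \<xi>)\<^sup>2 / 2) \<partial>lborel)
     = (\<integral>\<xi>. ?c\<^sup>2 * (\<integral>p. H (\<xi>, p) \<partial>?M) \<partial>lborel)"
    unfolding integral_complex_of_real[symmetric] of_real_mult norm_ft_sq[OF f]
    by (intro Bochner_Integration.integral_cong) (auto simp: H_def W_def)
  also have "\<dots> = ?c\<^sup>2 * (\<integral>\<xi>. (\<integral>p. H (\<xi>, p) \<partial>?M) \<partial>lborel)"
    by simp
  also have "(\<integral>\<xi>. (\<integral>p. H (\<xi>, p) \<partial>?M) \<partial>lborel) = (\<integral>p. (\<integral>\<xi>. H (\<xi>, p) \<partial>lborel) \<partial>?M)"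
    using Q.Fubini_integral[of "\<lambda>\<xi> p. H (\<xi>, p)"] Hi by simp
  also have "?c\<^sup>2 * \<dots> = (\<integral>p. ?c\<^sup>2 * (\<integral>\<xi>. H (\<xi>, p) \<partial>lborel) \<partial>?M)"
    by simp
  also have "\<dots> = (\<integral>p. W p * of_real (heat_kernel s (fst p - snd p)) \<partial>?M)"
  proof (rule Bochner_Integration.integral_cong[OF refl])
    fix p :: "'a \<times> 'a"
    have "(\<integral>\<xi>. H (\<xi>, p) \<partial>lborel) = W p * (\<integral>\<xi>. cis (- ((fst p - snd p) \<bullet> \<xi>)) * of_real (exp (- (s * norm \<xi>)\<^sup>2 / 2)) \<partial>lborel)"
      unfolding H_def split by (subst integral_mult_right_zero[symmetric]) (simp add: mult_ac)
    also have "?c\<^sup>2 * \<dots> = W p * of_real ((1 / sqrt (2 * pi) ^ DIM('a))\<^sup>2 * ((sqrt (2 * pi) / s) ^ DIM('a) * exp (- (norm (fst p - snd p) / s)\<^sup>2 / 2)))"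
      unfolding char_gauss(2)[OF s] by (simp only: of_real_mult of_real_power mult_ac)
    also have "(1 / sqrt (2 * pi) ^ DIM('a))\<^sup>2 * ((sqrt (2 * pi) / s) ^ DIM('a) * exp (- (norm (fst p - snd p) / s)\<^sup>2 / 2)) = heat_kernel s (fst p - snd p)"
    proof -
      have "sqrt (2 * pi) ^ DIM('a) > 0" "s ^ DIM('a) > 0" using s by auto
      then show ?thesis
        unfolding heat_kernel_def power2_eq_square power_mult_distrib power_divide by (simp add: field_simps)
    qed
    finally show "?c\<^sup>2 * (\<integral>\<xi>. H (\<xi>, p) \<partial>lborel) = W p * of_real (heat_kernel s (fst p - snd p))" .
  qed
  finally show ?thesis unfolding W_def .
qed

lemma ft_gauss_integrable:
  fixes f :: "'a::euclidean_space \<Rightarrow> complex"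
  assumes f: "integrable lborel f" and s: "s > 0"
  shows "integrable lborel (\<lambda>\<xi>. (norm (ft f \<xi>))\<^sup>2 * exp (- (s * norm \<xi>)\<^sup>2 / 2))"
proof (rule Bochner_Integration.integrable_bound)
  show "integrable lborel (\<lambda>\<xi>::'a. (\<integral>x. norm (f x) \<partial>lborel)\<^sup>2 * exp (- (s * norm \<xi>)\<^sup>2 / 2))"
    using gauss_integrable[OF s, where 'a='a] by simp
  have [measurable]: "ft f \<in> borel_measurable borel"
    using f by (auto intro: ft_measurable dest: borel_measurable_integrable)
  show "(\<lambda>\<xi>. (norm (ft f \<xi>))\<^sup>2 * exp (- (s * norm \<xi>)\<^sup>2 / 2)) \<in> borel_measurable lborel"
    by measurable
  show "AE \<xi> in lborel. norm ((norm (ft f \<xi>))\<^sup>2 * exp (- (s * norm \<xi>)\<^sup>2 / 2)) \<le>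
     norm ((\<integral>x. norm (f x) \<partial>lborel)\<^sup>2 * exp (- (s * norm \<xi>)\<^sup>2 / 2))"
    by (auto simp: norm_mult intro!: mult_right_mono power_mono norm_ft_le f)
qed

lemma gauss_to_1: "(\<lambda>k. exp (- (inverse (real (Suc k)) * norm (\<xi>::'a::real_normed_vector))\<^sup>2 / 2)) \<longlonglongrightarrow> 1"
proof -
  have "(\<lambda>k. exp (- (inverse (real (Suc k)) * norm \<xi>)\<^sup>2 / 2)) \<longlonglongrightarrow> exp (- (0 * norm \<xi>)\<^sup>2 / 2)"
    by (intro tendsto_intros LIMSEQ_inverse_real_of_nat) simp
  then show ?thesis by simp
qed

text \<open>
  The Schur test: \<open>|f x| |f y| \<le> (|f x|\<^sup>2 + |f y|\<^sup>2) / 2\<close>, and the heat kernel has total mass 1 in each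
  variable. This inequality already extends the transform to all square-integrable functions, so that
  equality is needed only on a dense set.
\<close>

lemma ft_contraction:
  fixes f :: "'a::euclidean_space \<Rightarrow> complex"
  assumes f: "integrable lborel f"
  shows "(\<integral>\<^sup>+\<xi>. ennreal ((norm (ft f \<xi>))\<^sup>2) \<partial>lborel) \<le> (\<integral>\<^sup>+x. ennreal ((norm (f x))\<^sup>2) \<partial>lborel)"
proof -
  let ?M = "lborel \<Otimes>\<^sub>M lborel :: ('a \<times> 'a) measure"
  have [measurable]: "f \<in> borel_measurable borel"
    using f by (auto dest: borel_measurable_integrable)
  have [measurable]: "ft f \<in> borel_measurable borel" by (rule ft_measurable) simp
  let ?E = "\<lambda>s \<xi>. ennreal ((norm (ft f \<xi>))\<^sup>2 * exp (- (s * norm \<xi>)\<^sup>2 / 2))"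
  have bound: "(\<integral>\<^sup>+\<xi>. ?E s \<xi> \<partial>lborel) \<le> (\<integral>\<^sup>+x. ennreal ((norm (f x))\<^sup>2) \<partial>lborel)" if s: "s > 0" for s
  proof -
    let ?K = "\<lambda>p. f (fst p) * cnj (f (snd p)) * of_real (heat_kernel s (fst p - snd p))"
    let ?h = "\<lambda>x y. ennreal (heat_kernel s (x - y))"
    have "(\<integral>\<^sup>+\<xi>. ?E s \<xi> \<partial>lborel) = ennreal (\<integral>\<xi>. (norm (ft f \<xi>))\<^sup>2 * exp (- (s * norm \<xi>)\<^sup>2 / 2) \<partial>lborel)"
      by (rule nn_integral_eq_integral[OF ft_gauss_integrable[OF f s]]) auto
    also have "\<dots> \<le> ennreal (norm (\<integral>p. ?K p \<partial>?M))"
      unfolding gaussian_plancherel[OF f s, symmetric] by (intro ennreal_leI) simp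
    also have "\<dots> \<le> (\<integral>\<^sup>+p. ennreal (norm (?K p)) \<partial>?M)"
    proof (cases "integrable ?M ?K")
      case True then show ?thesis by (rule integral_norm_bound_ennreal)
    qed (simp add: not_integrable_integral_eq)
    \<comment> \<open>the arguments of the second kernel are exchanged so that its total mass in the first variable is 1\<close>
    also have "\<dots> \<le> (\<integral>\<^sup>+p. (ennreal ((norm (f (fst p)))\<^sup>2 / 2) * ?h (fst p) (snd p) + ennreal ((norm (f (snd p)))\<^sup>2 / 2) * ?h (snd p) (fst p)) \<partial>?M)"
    proof (rule nn_integral_mono)
      fix p :: "'a \<times> 'a"
      have "norm (f (fst p)) * norm (f (snd p)) \<le> (norm (f (fst p)))\<^sup>2 / 2 + (norm (f (snd p)))\<^sup>2 / 2"
        using sum_squares_bound[of "norm (f (fst p))" "norm (f (snd p))"] by simp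
      then have "norm (f (fst p)) * norm (f (snd p)) * heat_kernel s (fst p - snd p) \<le> ((norm (f (fst p)))\<^sup>2 / 2 + (norm (f (snd p)))\<^sup>2 / 2) * heat_kernel s (fst p - snd p)"
        by (rule mult_right_mono) (rule heat_kernel_nonneg[OF s])
      then have "norm (?K p) \<le> (norm (f (fst p)))\<^sup>2 / 2 * heat_kernel s (fst p - snd p) + (norm (f (snd p)))\<^sup>2 / 2 * heat_kernel s (snd p - fst p)"
        using abs_of_nonneg[OF heat_kernel_nonneg[OF s, of "fst p - snd p"]] by (simp add: norm_mult heat_kernel_minus[of s "snd p"] distrib_right)
      then show "ennreal (norm (?K p)) \<le> ennreal ((norm (f (fst p)))\<^sup>2 / 2) * ?h (fst p) (snd p) + ennreal ((norm (f (snd p)))\<^sup>2 / 2) * ?h (snd p) (fst p)"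
        using heat_kernel_nonneg[OF s] by (subst (1 2) ennreal_mult[symmetric]) (auto simp flip: ennreal_plus intro!: ennreal_leI)
    qed
    also have "\<dots> = (\<integral>\<^sup>+p. ennreal ((norm (f (fst p)))\<^sup>2 / 2) * ?h (fst p) (snd p) \<partial>?M) + (\<integral>\<^sup>+p. ennreal ((norm (f (snd p)))\<^sup>2 / 2) * ?h (snd p) (fst p) \<partial>?M)"
      by (rule nn_integral_add) auto
    also have "(\<integral>\<^sup>+p. ennreal ((norm (f (fst p)))\<^sup>2 / 2) * ?h (fst p) (snd p) \<partial>?M) = (\<integral>\<^sup>+x. ennreal ((norm (f x))\<^sup>2 / 2) \<partial>lborel)"
      by (subst lborel.nn_integral_fst[symmetric]) (auto simp: nn_integral_cmult nn_integral_heat_kernel[OF s])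
    also have "(\<integral>\<^sup>+p. ennreal ((norm (f (snd p)))\<^sup>2 / 2) * ?h (snd p) (fst p) \<partial>?M) = (\<integral>\<^sup>+x. ennreal ((norm (f x))\<^sup>2 / 2) \<partial>lborel)"
      by (subst lborel_pair.nn_integral_snd[symmetric]) (auto simp: nn_integral_cmult nn_integral_heat_kernel[OF s])
    also have "(\<integral>\<^sup>+x. ennreal ((norm (f x))\<^sup>2 / 2) \<partial>lborel) + (\<integral>\<^sup>+x. ennreal ((norm (f x))\<^sup>2 / 2) \<partial>lborel) = (\<integral>\<^sup>+x. ennreal ((norm (f x))\<^sup>2) \<partial>lborel)"
      by (subst nn_integral_add[symmetric]) (auto simp flip: ennreal_plus)
    finally show ?thesis .
  qed
  have "(\<integral>\<^sup>+\<xi>. ennreal ((norm (ft f \<xi>))\<^sup>2) \<partial>lborel) = (\<integral>\<^sup>+\<xi>. liminf (\<lambda>k. ?E (inverse (real (Suc k))) \<xi>) \<partial>lborel)"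
  proof (intro nn_integral_cong)
    fix \<xi> :: 'a
    have "(\<lambda>k. ?E (inverse (real (Suc k))) \<xi>) \<longlonglongrightarrow> ennreal ((norm (ft f \<xi>))\<^sup>2 * 1)"
      by (intro tendsto_ennrealI tendsto_mult tendsto_const gauss_to_1)
    then have "liminf (\<lambda>k. ?E (inverse (real (Suc k))) \<xi>) = ennreal ((norm (ft f \<xi>))\<^sup>2 * 1)"
      by (intro lim_imp_Liminf) simp
    then show "ennreal ((norm (ft f \<xi>))\<^sup>2) = liminf (\<lambda>k. ?E (inverse (real (Suc k))) \<xi>)"
      by (simp only: mult_1_right)
  qed
  \<comment> \<open>Fatou\<close>
  also have "\<dots> \<le> liminf (\<lambda>k. \<integral>\<^sup>+\<xi>. ?E (inverse (real (Suc k))) \<xi> \<partial>lborel)"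
    by (rule nn_integral_liminf) measurable
  also have "\<dots> \<le> liminf (\<lambda>k. (\<integral>\<^sup>+x. ennreal ((norm (f x))\<^sup>2) \<partial>lborel))"
    by (intro Liminf_mono always_eventually allI bound) simp
  also have "\<dots> = (\<integral>\<^sup>+x. ennreal ((norm (f x))\<^sup>2) \<partial>lborel)"
    by (simp add: Liminf_const)
  finally show ?thesis .
qed

text \<open>
  The substitution \<open>y = x - s z\<close> moves the dependence on \<open>s\<close> from the kernel into \<open>f\<close>, where
  continuity gives the limit \<open>s \<longrightarrow> 0\<close>.
\<close>

lemma heat_kernel_average:
  fixes f :: "'a::euclidean_space \<Rightarrow> complex"
  assumes [measurable]: "f \<in> borel_measurable borel" and s: "s > 0"
  shows "(\<integral>y. f y * of_real (heat_kernel s (x - y)) \<partial>lborel) = (\<integral>z. f (x - s *\<^sub>R z) * of_real (heat_kernel 1 z) \<partial>lborel)"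
proof -
  have "(\<integral>y. f y * of_real (heat_kernel s (x - y)) \<partial>lborel)
     = (\<integral>y. f y * of_real (heat_kernel s (x - y)) \<partial>density (distr lborel borel (\<lambda>z. x + (- s) *\<^sub>R z)) (\<lambda>_. \<bar>- s\<bar> ^ DIM('a)))"
    using lborel_affine[of "- s" x] s by (intro arg_cong[where f = "\<lambda>M. integral\<^sup>L M _"]) auto
  also have "\<dots> = (\<integral>z. (s ^ DIM('a)) *\<^sub>R (f (x - s *\<^sub>R z) * of_real (heat_kernel s (s *\<^sub>R z))) \<partial>lborel)"
    using s by (subst integral_density) (auto simp: integral_distr simp flip: ennreal_power)
  also have "\<dots> = (\<integral>z. f (x - s *\<^sub>R z) * of_real (heat_kernel 1 z) \<partial>lborel)"
    using s by (intro Bochner_Integration.integral_cong) (auto simp: heat_kernel_def scaleR_conv_of_real power_mult_distrib)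
  finally show ?thesis .
qed

text \<open>
  The limit \<open>s \<longrightarrow> 0\<close> in the identity with a Gaussian. On the frequency side \<open>|ft f|\<^sup>2\<close> itself is the
  dominating function, which is integrable because the transform is a contraction.
\<close>

lemma plancherel_Cc:
  fixes f :: "'a::euclidean_space \<Rightarrow> complex"
  assumes cont: "continuous_on UNIV f" and K: "compact K" "\<And>x. x \<notin> K \<Longrightarrow> f x = 0"
  shows "(\<integral>\<xi>. (norm (ft f \<xi>))\<^sup>2 \<partial>lborel) = (\<integral>x. (norm (f x))\<^sup>2 \<partial>lborel)"
    and "integrable lborel f" and "integrable lborel (\<lambda>x. (norm (f x))\<^sup>2)"
proof -
  have [measurable]: "f \<in> borel_measurable borel"
    using cont by (rule borel_measurable_continuous_onI)
  have "bounded (f ` K)"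
    by (intro compact_imp_bounded compact_continuous_image continuous_on_subset[OF cont] K) simp
  then obtain B where "\<And>x. x \<in> K \<Longrightarrow> norm (f x) \<le> B" "B > 0"
    by (auto simp: bounded_pos)
  then have B: "norm (f x) \<le> B" for x
    using K(2)[of x] by (cases "x \<in> K") auto
  have iK: "integrable lborel (indicator K :: 'a \<Rightarrow> real)"
    using K(1) by (intro integrable_real_indicator) (auto simp: borel_compact emeasure_compact_finite less_top[symmetric] dest: emeasure_compact_finite)
  show fi: "integrable lborel f"
    by (rule Bochner_Integration.integrable_bound[OF integrable_mult_right[OF iK, of B]])
       (use B K \<open>B > 0\<close> in \<open>auto simp: indicator_def\<close>)
  have "(norm (f x))\<^sup>2 \<le> B * norm (f x)" for x
    using B[of x] by (simp add: power2_eq_square mult_right_mono)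
  then show f2i: "integrable lborel (\<lambda>x. (norm (f x))\<^sup>2)"
    by (intro Bochner_Integration.integrable_bound[OF integrable_mult_right[OF integrable_norm[OF fi], of B]]) (use \<open>B > 0\<close> in auto)
  have [measurable]: "ft f \<in> borel_measurable borel" by (rule ft_measurable) simp
  define s where "s k = inverse (real (Suc k))" for k
  have s: "s k > 0" for k by (simp add: s_def)
  have s0: "s \<longlonglongrightarrow> 0" unfolding s_def by (rule LIMSEQ_inverse_real_of_nat)
  have "(\<integral>\<^sup>+\<xi>. ennreal ((norm (ft f \<xi>))\<^sup>2) \<partial>lborel) \<le> (\<integral>\<^sup>+x. ennreal ((norm (f x))\<^sup>2) \<partial>lborel)"
    by (rule ft_contraction[OF fi])
  also have "\<dots> < \<infinity>"
    using f2i by (subst nn_integral_eq_integral) auto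
  finally have ft2: "integrable lborel (\<lambda>\<xi>. (norm (ft f \<xi>))\<^sup>2)"
    by (intro integrableI_bounded) auto
  have A: "(\<lambda>k. \<integral>\<xi>. (norm (ft f \<xi>))\<^sup>2 * exp (- (s k * norm \<xi>)\<^sup>2 / 2) \<partial>lborel) \<longlonglongrightarrow> (\<integral>\<xi>. (norm (ft f \<xi>))\<^sup>2 \<partial>lborel)"
  proof (rule integral_dominated_convergence[OF _ _ ft2])
    show "AE \<xi> in lborel. (\<lambda>k. (norm (ft f \<xi>))\<^sup>2 * exp (- (s k * norm \<xi>)\<^sup>2 / 2)) \<longlonglongrightarrow> (norm (ft f \<xi>))\<^sup>2"
    proof (rule AE_I2)
      fix \<xi> :: 'a
      show "(\<lambda>k. (norm (ft f \<xi>))\<^sup>2 * exp (- (s k * norm \<xi>)\<^sup>2 / 2)) \<longlonglongrightarrow> (norm (ft f \<xi>))\<^sup>2"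
        using tendsto_mult[OF tendsto_const gauss_to_1, of "(norm (ft f \<xi>))\<^sup>2" \<xi>] by (simp add: s_def)
    qed
    show "AE \<xi> in lborel. norm ((norm (ft f \<xi>))\<^sup>2 * exp (- (s k * norm \<xi>)\<^sup>2 / 2)) \<le> (norm (ft f \<xi>))\<^sup>2" for k
      by (auto intro!: AE_I2 mult_left_le)
  qed measurable
  have [measurable]: "cnj \<in> borel_measurable borel"
    by (intro borel_measurable_continuous_onI continuous_intros)
  have [measurable]: "(heat_kernel 1 :: 'a \<Rightarrow> real) \<in> borel_measurable lborel" by simp
  define J where "J k x = (\<integral>z. cnj (f (x - s k *\<^sub>R z)) * of_real (heat_kernel 1 z) \<partial>lborel)" for k x
  have [measurable]: "J k \<in> borel_measurable borel" for k
    unfolding J_def by measurable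
  have h1: "integrable lborel (heat_kernel 1 :: 'a \<Rightarrow> real)" "integral\<^sup>L lborel (heat_kernel 1 :: 'a \<Rightarrow> real) = 1"
    using heat_kernel_integral[of 1] by (auto simp: has_bochner_integral_iff)
  have J_lim: "(\<lambda>k. J k x) \<longlonglongrightarrow> cnj (f x)" for x
  proof -
    have "(\<lambda>k. J k x) \<longlonglongrightarrow> (\<integral>z. cnj (f x) * of_real (heat_kernel 1 (z::'a)) \<partial>lborel)"
      unfolding J_def
    proof (rule integral_dominated_convergence[OF _ _ integrable_mult_right[OF h1(1), of B]])
      have "(\<lambda>k. cnj (f (x - s k *\<^sub>R z)) * of_real (heat_kernel 1 z)) \<longlonglongrightarrow> cnj (f (x - 0 *\<^sub>R z)) * of_real (heat_kernel 1 z)" for z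
        by (intro tendsto_intros continuous_on_tendsto_compose[OF cont] s0) auto
      then show "AE z in lborel. (\<lambda>k. cnj (f (x - s k *\<^sub>R z)) * of_real (heat_kernel 1 z)) \<longlonglongrightarrow> cnj (f x) * of_real (heat_kernel 1 z)"
        by simp
      show "AE z in lborel. norm (cnj (f (x - s k *\<^sub>R z)) * complex_of_real (heat_kernel 1 z)) \<le> B * heat_kernel 1 z" for k
        using B heat_kernel_nonneg[of 1, where 'a='a] by (auto simp: norm_mult intro!: AE_I2 mult_right_mono)
    qed measurable
    also have "(\<integral>z. cnj (f x) * of_real (heat_kernel 1 (z::'a)) \<partial>lborel) = cnj (f x)"
      using h1 by (simp add: integral_complex_of_real)
    finally show ?thesis .
  qed
  have J_le: "norm (J k x) \<le> B" for k x
  proof -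
    have le: "norm (cnj (f (x - s k *\<^sub>R z)) * of_real (heat_kernel 1 z)) \<le> B * heat_kernel 1 z" for z
      using B heat_kernel_nonneg[of 1 z] by (auto simp: norm_mult intro!: mult_right_mono)
    have "norm (J k x) \<le> (\<integral>z. norm (cnj (f (x - s k *\<^sub>R z)) * of_real (heat_kernel 1 z)) \<partial>lborel)"
      unfolding J_def by (rule integral_norm_bound)
    also have "\<dots> \<le> (\<integral>z. B * heat_kernel 1 (z::'a) \<partial>lborel)"
      using h1 le by (intro integral_mono integrable_norm Bochner_Integration.integrable_bound[OF integrable_mult_right[OF h1(1), of B]] AE_I2)
        (auto intro: order_trans[OF _ abs_ge_self])
    finally have "norm (J k x) \<le> (\<integral>z. B * heat_kernel 1 (z::'a) \<partial>lborel)" .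
    then show ?thesis using h1 by simp
  qed
  have "(\<lambda>k. \<integral>x. f x * J k x \<partial>lborel) \<longlonglongrightarrow> (\<integral>x. f x * cnj (f x) \<partial>lborel)"
  proof (rule integral_dominated_convergence[OF _ _ integrable_mult_right[OF integrable_norm[OF fi], of B]])
    show "AE x in lborel. (\<lambda>k. f x * J k x) \<longlonglongrightarrow> f x * cnj (f x)"
      by (intro AE_I2 tendsto_mult tendsto_const J_lim)
    show "AE x in lborel. norm (f x * J k x) \<le> B * norm (f x)" for k
      using J_le by (auto simp: norm_mult mult.commute[of B] intro!: mult_left_mono)
  qed measurable
  moreover have "(\<integral>x. f x * J k x \<partial>lborel) = complex_of_real (\<integral>\<xi>. (norm (ft f \<xi>))\<^sup>2 * exp (- (s k * norm \<xi>)\<^sup>2 / 2) \<partial>lborel)" for k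
  proof -
    have i: "integrable (lborel \<Otimes>\<^sub>M lborel) (\<lambda>p. f (fst p) * cnj (f (snd p)) * of_real (heat_kernel (s k) (fst p - snd p)))"
    proof (rule Bochner_Integration.integrable_bound)
      show "integrable (lborel \<Otimes>\<^sub>M lborel) (\<lambda>p. heat_kernel (s k) (0::'a) *\<^sub>R (f (fst p) * cnj (f (snd p))))"
        by (intro integrable_scaleR_right integrable_pair_mult fi integrable_cnj)
      have "\<bar>heat_kernel (s k) z\<bar> \<le> \<bar>heat_kernel (s k) (0::'a)\<bar>" for z :: 'a
        using s[of k] by (auto simp: heat_kernel_def abs_divide intro!: divide_right_mono)
      then show "AE p in lborel \<Otimes>\<^sub>M lborel. norm (f (fst p) * cnj (f (snd p)) * of_real (heat_kernel (s k) (fst p - snd p)))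
         \<le> norm (heat_kernel (s k) (0::'a) *\<^sub>R (f (fst p) * cnj (f (snd p))))"
        by (intro AE_I2) (simp add: norm_mult mult.commute mult_right_mono)
    qed measurable
    show ?thesis
      unfolding gaussian_plancherel[OF fi s[of k]] lborel_pair.integral_fst'[OF i, symmetric] J_def
      by (intro Bochner_Integration.integral_cong refl)
         (simp add: mult.assoc heat_kernel_average[OF _ s] )
  qed
  ultimately have "(\<lambda>k. complex_of_real (\<integral>\<xi>. (norm (ft f \<xi>))\<^sup>2 * exp (- (s k * norm \<xi>)\<^sup>2 / 2) \<partial>lborel)) \<longlonglongrightarrow> (\<integral>x. f x * cnj (f x) \<partial>lborel)"
    by simp
  moreover have "(\<integral>x. f x * cnj (f x) \<partial>lborel) = of_real (\<integral>x. (norm (f x))\<^sup>2 \<partial>lborel)"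
    unfolding complex_norm_square[symmetric] by (rule integral_complex_of_real)
  ultimately have "(\<lambda>k. (\<integral>\<xi>. (norm (ft f \<xi>))\<^sup>2 * exp (- (s k * norm \<xi>)\<^sup>2 / 2) \<partial>lborel)) \<longlonglongrightarrow> (\<integral>x. (norm (f x))\<^sup>2 \<partial>lborel)"
    by (simp only: tendsto_of_real_iff)
  with A show "(\<integral>\<xi>. (norm (ft f \<xi>))\<^sup>2 \<partial>lborel) = (\<integral>x. (norm (f x))\<^sup>2 \<partial>lborel)"
    by (rule LIMSEQ_unique)
qed

section \<open>The Fourier transform on square-integrable functions\<close>

lemma abs_L2_eq_iff:
  assumes "sq_integrable f" "sq_integrable g"
  shows "abs_L2 f = abs_L2 g \<longleftrightarrow> (AE x in lebesgue. f x = g x)"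
  using Quotient3_rel[OF Quotient3_L2, of f g] assms by (auto simp: L2rel_def)

lemma sq_integrable_rep [simp]: "sq_integrable (rep_L2 f)"
  using Quotient3_rep_reflp[OF Quotient3_L2, of f] by (simp add: L2rel_def)

lemma abs_rep_L2 [simp]: "abs_L2 (rep_L2 f) = f"
  by (rule Quotient3_abs_rep[OF Quotient3_L2])

lemma rep_L2_measurable [measurable]: "rep_L2 f \<in> borel_measurable lebesgue"
  using sq_integrable_rep by (rule sq_integrable_measurable)

lemma rep_abs_L2: "sq_integrable f \<Longrightarrow> AE x in lebesgue. rep_L2 (abs_L2 f) x = f x"
  using abs_L2_eq_iff[of "rep_L2 (abs_L2 f)" f] by simp

lemma abs_L2_add: "sq_integrable f \<Longrightarrow> sq_integrable g \<Longrightarrow> abs_L2 f + abs_L2 g = abs_L2 (\<lambda>x. f x + g x)"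
  by (simp add: plus_L2.abs_eq L2rel_def)

lemma abs_L2_scaleC: "sq_integrable f \<Longrightarrow> scaleC c (abs_L2 f) = abs_L2 (\<lambda>x. c * f x)"
  by (simp add: scaleC.abs_eq L2rel_def)

lemma abs_L2_scaleR: "sq_integrable f \<Longrightarrow> r *\<^sub>R (abs_L2 f) = abs_L2 (\<lambda>x. r *\<^sub>R f x)"
  by (simp add: scaleR_L2.abs_eq L2rel_def)

lemma scaleC_of_real: "scaleC (of_real r) f = r *\<^sub>R f"
  using abs_L2_scaleC[of "rep_L2 f" "of_real r"] abs_L2_scaleR[of "rep_L2 f" r]
  by (simp add: scaleR_conv_of_real)

lemma scaleC_scaleC: "scaleC c (scaleC d f) = scaleC (c * d) f"
  using abs_L2_scaleC[of "rep_L2 f"] abs_L2_scaleC[of "\<lambda>x. d * rep_L2 f x" c]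
  by (simp add: mult.assoc sq_integrable_cmult)

lemma scaleC_add: "scaleC c (f + g) = scaleC c f + scaleC c g"
  by transfer (auto simp: L2rel_def algebra_simps intro!: sq_integrable_add sq_integrable_cmult)

lemma inner_abs_L2:
  "sq_integrable f \<Longrightarrow> sq_integrable g \<Longrightarrow> abs_L2 f \<bullet> abs_L2 g = (\<integral>x. f x \<bullet> g x \<partial>lebesgue)"
  by (simp add: inner_L2.abs_eq L2rel_def)

lemma norm_abs_L2_sq: "sq_integrable f \<Longrightarrow> (norm (abs_L2 f))\<^sup>2 = (\<integral>x. (norm (f x))\<^sup>2 \<partial>lebesgue)"
  by (simp add: power2_norm_eq_inner inner_abs_L2)

lemma sq_integrable_bounded_mult:
  assumes "sq_integrable f" "b \<in> borel_measurable lebesgue" "\<And>x. norm (b x) \<le> K"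
  shows "sq_integrable (\<lambda>x. b x * f x)"
  unfolding sq_integrable_def
proof
  have [measurable]: "f \<in> borel_measurable lebesgue" "b \<in> borel_measurable lebesgue"
    using assms by (auto simp: sq_integrable_def)
  show "(\<lambda>x. b x * f x) \<in> borel_measurable lebesgue" by measurable
  have "integrable lebesgue (\<lambda>x. K\<^sup>2 * (norm (f x))\<^sup>2)"
    using assms by (simp add: sq_integrable_def)
  then show "integrable lebesgue (\<lambda>x. (norm (b x * f x))\<^sup>2)"
    by (rule Bochner_Integration.integrable_bound)
       (auto simp: norm_mult power_mult_distrib intro!: AE_I2 mult_right_mono power_mono assms)
qed

lemma norm_bounded_mult:
  assumes f: "sq_integrable f" and b: "b \<in> borel_measurable lebesgue" "\<And>x. norm (b x) \<le> K"
  shows "norm (abs_L2 (\<lambda>x. b x * f x)) \<le> K * norm (abs_L2 f)"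
proof (rule power2_le_imp_le)
  have K: "0 \<le> K" using b(2)[of 0] norm_ge_zero[of "b 0"] by linarith
  have "(norm (abs_L2 (\<lambda>x. b x * f x)))\<^sup>2 = (\<integral>x. (norm (b x * f x))\<^sup>2 \<partial>lebesgue)"
    by (rule norm_abs_L2_sq[OF sq_integrable_bounded_mult[OF f b]])
  also have "\<dots> \<le> (\<integral>x. K\<^sup>2 * (norm (f x))\<^sup>2 \<partial>lebesgue)"
    using sq_integrable_bounded_mult[OF f b] f
    by (intro integral_mono) (auto simp: sq_integrable_def norm_mult power_mult_distrib intro!: mult_right_mono power_mono b)
  also have "\<dots> = (K * norm (abs_L2 f))\<^sup>2"
    by (simp add: power_mult_distrib norm_abs_L2_sq[OF f])
  finally show "(norm (abs_L2 (\<lambda>x. b x * f x)))\<^sup>2 \<le> (K * norm (abs_L2 f))\<^sup>2" .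
  show "0 \<le> K * norm (abs_L2 f)" using K by simp
qed

lemma norm_scaleC: "norm (scaleC c f) = norm c * norm f"
proof -
  have "(norm (scaleC c (abs_L2 (rep_L2 f))))\<^sup>2 = (norm c * norm (abs_L2 (rep_L2 f)))\<^sup>2"
    by (subst abs_L2_scaleC, simp)
       (simp only: norm_abs_L2_sq sq_integrable_cmult sq_integrable_rep power_mult_distrib norm_mult, simp)
  then show ?thesis by (simp add: power2_eq_iff_nonneg)
qed

lemma bounded_linear_scaleC: "bounded_linear (scaleC c)"
proof (rule bounded_linear_intro)
  show "scaleC c (r *\<^sub>R f) = r *\<^sub>R scaleC c f" for r f
    by (simp add: scaleC_of_real[symmetric] scaleC_scaleC mult.commute)
  show "norm (scaleC c f) \<le> norm f * norm c" for f
    by (simp add: norm_scaleC)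
qed (rule scaleC_add)

text \<open>
  Dominated convergence for \<open>|F n - f|\<^sup>2\<close> with majorant \<open>4 |g|\<^sup>2\<close>; this carries pointwise limits of
  representatives over to limits in the quotient.
\<close>

lemma L2_dominated_convergence:
  fixes F :: "nat \<Rightarrow> 'a::euclidean_space \<Rightarrow> complex"
  assumes [measurable]: "\<And>n. F n \<in> borel_measurable lebesgue" "f \<in> borel_measurable lebesgue"
    and lim: "AE x in lebesgue. (\<lambda>n. F n x) \<longlonglongrightarrow> f x"
    and le: "\<And>n. AE x in lebesgue. norm (F n x) \<le> norm (g x)" and g: "sq_integrable g"
  shows "sq_integrable f" "\<And>n. sq_integrable (F n)" "(\<lambda>n. abs_L2 (F n)) \<longlonglongrightarrow> abs_L2 f"
proof -
  have gi: "integrable lebesgue (\<lambda>x. (norm (g x))\<^sup>2)" and [measurable]: "g \<in> borel_measurable lebesgue"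
    using g by (auto simp: sq_integrable_def)
  have sq: "sq_integrable h" if "h \<in> borel_measurable lebesgue" "AE x in lebesgue. norm (h x) \<le> norm (g x)" for h
    unfolding sq_integrable_def using that
    by (intro conjI Bochner_Integration.integrable_bound[OF gi]) (auto intro: power_mono)
  show F: "sq_integrable (F n)" for n by (intro sq le) simp
  have "AE x in lebesgue. \<forall>n. norm (F n x) \<le> norm (g x)"
    using le by (simp add: AE_all_countable)
  with lim have fle: "AE x in lebesgue. norm (f x) \<le> norm (g x)"
  proof eventually_elim
    case (elim x)
    then have "(\<lambda>n. norm (F n x)) \<longlonglongrightarrow> norm (f x)" by (intro tendsto_norm)
    then show ?case by (rule LIMSEQ_le_const2) (use elim in auto)
  qed
  then show f: "sq_integrable f" by (intro sq) simp_all
  have "(\<lambda>n. \<integral>x. (norm (F n x - f x))\<^sup>2 \<partial>lebesgue) \<longlonglongrightarrow> integral\<^sup>L (lebesgue :: 'a measure) (\<lambda>x. 0)"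
  proof (rule integral_dominated_convergence)
    show "integrable lebesgue (\<lambda>x. 4 * (norm (g x))\<^sup>2)" using gi by simp
    show "AE x in lebesgue. (\<lambda>n. (norm (F n x - f x))\<^sup>2) \<longlonglongrightarrow> 0"
      using lim
    proof eventually_elim
      case (elim x)
      have "(\<lambda>n. (norm (F n x - f x))\<^sup>2) \<longlonglongrightarrow> (norm (f x - f x))\<^sup>2"
        by (intro tendsto_intros elim)
      then show ?case by simp
    qed
    show "AE x in lebesgue. norm ((norm (F n x - f x))\<^sup>2) \<le> 4 * (norm (g x))\<^sup>2" for n
      using le[of n] fle
    proof eventually_elim
      case (elim x)
      then have "norm (F n x - f x) \<le> 2 * norm (g x)"
        using norm_triangle_ineq4[of "F n x" "f x"] by linarith
      then have "(norm (F n x - f x))\<^sup>2 \<le> (2 * norm (g x))\<^sup>2"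
        by (intro power_mono) auto
      then show ?case by (simp add: power_mult_distrib)
    qed
  qed measurable
  moreover have "(\<integral>x. (norm (F n x - f x))\<^sup>2 \<partial>lebesgue) = (norm (abs_L2 (F n) - abs_L2 f))\<^sup>2" for n
    using F f by (simp add: abs_L2_diff norm_abs_L2_sq sq_integrable_diff)
  ultimately have "(\<lambda>n. sqrt ((norm (abs_L2 (F n) - abs_L2 f))\<^sup>2)) \<longlonglongrightarrow> sqrt 0"
    by (intro tendsto_real_sqrt) simp
  then show "(\<lambda>n. abs_L2 (F n)) \<longlonglongrightarrow> abs_L2 f"
    by (simp add: tendsto_norm_zero_iff LIM_zero_iff)
qed

text \<open>
  On these functions the transform is given by its integral, and they are dense among the
  square-integrable ones.
\<close>

definition L1L2 :: "('a::euclidean_space \<Rightarrow> complex) \<Rightarrow> bool" where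
  "L1L2 f \<longleftrightarrow> integrable lebesgue f \<and> sq_integrable f"

lemma L1L2_diff: "L1L2 f \<Longrightarrow> L1L2 g \<Longrightarrow> L1L2 (\<lambda>x. f x - g x)"
  by (auto simp: L1L2_def sq_integrable_diff)

lemma ft_integrand: "L1L2 f \<Longrightarrow> integrable lebesgue (\<lambda>x. cis (- (x \<bullet> \<xi>)) * f x)"
proof -
  assume f: "L1L2 f"
  then have [measurable]: "f \<in> borel_measurable lebesgue" by (auto simp: L1L2_def sq_integrable_def)
  have [measurable]: "(\<lambda>x. cis (- (x \<bullet> \<xi>))) \<in> borel_measurable lebesgue"
    by (rule measurable_completion) simp
  from f show ?thesis
    unfolding L1L2_def by (elim conjE Bochner_Integration.integrable_bound) (auto simp: norm_mult)
qed

lemma ft_diff: "L1L2 f \<Longrightarrow> L1L2 g \<Longrightarrow> ft (\<lambda>x. f x - g x) \<xi> = ft f \<xi> - ft g \<xi>"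
  and ft_add: "L1L2 f \<Longrightarrow> L1L2 g \<Longrightarrow> ft (\<lambda>x. f x + g x) \<xi> = ft f \<xi> + ft g \<xi>"
  and ft_cmult: "ft (\<lambda>x. c * f x) \<xi> = c * ft f \<xi>"
  by (simp_all add: ft_def ring_distribs Bochner_Integration.integral_diff Bochner_Integration.integral_add ft_integrand mult.left_commute[of _ c])

lemma L2_borel_rep:
  fixes f :: "'a::euclidean_space \<Rightarrow> complex"
  assumes "f \<in> borel_measurable lebesgue"
  obtains g where "g \<in> borel_measurable borel" "AE x in lebesgue. f x = g x"
proof -
  have "(\<lambda>x. Re (f x)) \<in> borel_measurable (completion lborel)" "(\<lambda>x. Im (f x)) \<in> borel_measurable (completion lborel)"
    using assms by measurable
  from completion_ex_borel_measurable_real[OF this(1)] completion_ex_borel_measurable_real[OF this(2)]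
  obtain a b where ab: "a \<in> borel_measurable lborel" "AE x in lborel. Re (f x) = a x"
    "b \<in> borel_measurable lborel" "AE x in lborel. Im (f x) = b x" by blast
  show ?thesis
  proof
    show "(\<lambda>x. Complex (a x) (b x)) \<in> borel_measurable borel"
      using ab(1,3) by (simp add: Complex_eq)
    have "AE x in lborel. f x = Complex (a x) (b x)"
      using ab(2,4) by eventually_elim (simp add: complex_eq_iff)
    then show "AE x in lebesgue. f x = Complex (a x) (b x)"
      by (rule AE_completion)
  qed
qed

lemma ft_L1L2:
  assumes f: "L1L2 f"
  shows "sq_integrable (ft f)" "norm (abs_L2 (ft f)) \<le> norm (abs_L2 f)"
proof -
  have fi: "integrable lebesgue f" and fs: "sq_integrable f" using f by (auto simp: L1L2_def)
  then obtain g where g [measurable]: "g \<in> borel_measurable borel" and fg: "AE x in lebesgue. f x = g x"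
    using L2_borel_rep by (metis sq_integrable_measurable)
  have [measurable]: "g \<in> borel_measurable lebesgue" by (rule measurable_completion) simp
  have [measurable]: "f \<in> borel_measurable lebesgue" using fs by (rule sq_integrable_measurable)
  have "integrable lebesgue g"
    using fi fg by (subst integrable_cong_AE[of _ _ f]) auto
  then have gi: "integrable lborel g" by (simp add: integrable_completion)
  have "ft f \<xi> = ft g \<xi>" for \<xi>
  proof -
    have [measurable]: "(\<lambda>x. cis (- (x \<bullet> \<xi>))) \<in> borel_measurable lebesgue"
      by (rule measurable_completion) simp
    show ?thesis
      unfolding ft_def using fg by (intro arg_cong2[where f = "(*)"] refl integral_cong_AE) auto
  qed
  then have eq: "ft f = ft g" ..
  have [measurable]: "ft f \<in> borel_measurable borel" unfolding eq by (rule ft_measurable) simp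
  have m: "ft f \<in> borel_measurable lebesgue" by (rule measurable_completion) simp
  have "(\<integral>\<^sup>+x. ennreal ((norm (ft f x))\<^sup>2) \<partial>lebesgue) \<le> (\<integral>\<^sup>+x. ennreal ((norm (g x))\<^sup>2) \<partial>lebesgue)"
    unfolding eq nn_integral_completion by (rule ft_contraction[OF gi])
  also have "\<dots> = (\<integral>\<^sup>+x. ennreal ((norm (f x))\<^sup>2) \<partial>lebesgue)"
    using fg by (intro nn_integral_cong_AE) auto
  also have "\<dots> = ennreal ((norm (abs_L2 f))\<^sup>2)"
    using fs by (simp add: norm_abs_L2)
  finally have *: "(\<integral>\<^sup>+x. ennreal ((norm (ft f x))\<^sup>2) \<partial>lebesgue) \<le> ennreal ((norm (abs_L2 f))\<^sup>2)" .
  also have "\<dots> < \<infinity>" by simp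
  finally show s: "sq_integrable (ft f)"
    by (rule sq_integrableI[OF m])
  show "norm (abs_L2 (ft f)) \<le> norm (abs_L2 f)"
    using * unfolding norm_abs_L2[OF s, symmetric] by (simp add: power2_le_iff_abs_le)
qed

lemma L1L2_mult_compact_support:
  assumes f: "sq_integrable f" and b[measurable]: "b \<in> borel_measurable lebesgue"
    and K: "\<And>x. norm (b x) \<le> K" and supp: "\<And>x. norm x > r \<Longrightarrow> b x = 0"
  shows "L1L2 (\<lambda>x::'a::euclidean_space. b x * f x)"
proof -
  have sq: "sq_integrable (\<lambda>x. b x * f x)" using f b K by (rule sq_integrable_bounded_mult)
  have [measurable]: "f \<in> borel_measurable lebesgue" using f by (rule sq_integrable_measurable)
  have "integrable lebesgue (indicator (cball (0::'a) r) :: _ \<Rightarrow> real)"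
    by (intro integrable_real_indicator) (use lmeasurable_cball[of "0::'a" r] in \<open>auto simp: fmeasurable_def\<close>)
  then have "integrable lebesgue (\<lambda>x. indicator (cball 0 r) x + (norm (b x * f x))\<^sup>2)"
    using sq unfolding sq_integrable_def by (intro Bochner_Integration.integrable_add) auto
  then have "integrable lebesgue (\<lambda>x. b x * f x)"
  proof (rule Bochner_Integration.integrable_bound)
    have "norm (b x * f x) \<le> indicator (cball 0 r) x + (norm (b x * f x))\<^sup>2" for x
    proof (cases "norm x \<le> r")
      case True
      have "2 * norm (b x * f x) * 1 \<le> (norm (b x * f x))\<^sup>2 + 1\<^sup>2" by (rule sum_squares_bound)
      \<comment> \<open>\<open>z \<le> 1 + z\<^sup>2\<close> bounds the product by an integrable function on the ball\<close>
      then have "norm (b x * f x) \<le> 1 + (norm (b x * f x))\<^sup>2" using norm_ge_zero[of "b x * f x"] unfolding power_one mult_1_right by linarith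
      with True show ?thesis by simp
    next
      case False with supp[of x] show ?thesis by (simp add: indicator_def)
    qed
    moreover have "indicator (cball 0 r) x + (norm (b x * f x))\<^sup>2 \<le> norm (indicator (cball 0 r) x + (norm (b x * f x))\<^sup>2)" for x
      unfolding real_norm_def by (rule abs_ge_self)
    ultimately show "AE x in lebesgue. norm (b x * f x) \<le> norm (indicator (cball 0 r) x + (norm (b x * f x))\<^sup>2)"
      by (meson AE_I2 order_trans)
  qed simp
  with sq show ?thesis by (simp add: L1L2_def)
qed

definition ball_cut :: "nat \<Rightarrow> 'a::euclidean_space \<Rightarrow> complex" where
  "ball_cut k x = (if norm x \<le> real k then 1 else 0)"

lemma ball_cut: "(ball_cut k :: 'a::euclidean_space \<Rightarrow> complex) \<in> borel_measurable lebesgue" "norm (ball_cut k x) \<le> 1" "norm x > real k \<Longrightarrow> ball_cut k x = 0"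
proof -
  have "(ball_cut k :: 'a \<Rightarrow> complex) \<in> borel_measurable lborel" unfolding ball_cut_def by measurable
  then show "(ball_cut k :: 'a \<Rightarrow> complex) \<in> borel_measurable lebesgue"
    by (rule measurable_completion)
qed (auto simp: ball_cut_def )

lemma ball_cut_lim: "(\<lambda>k. ball_cut k x) \<longlonglongrightarrow> 1"
proof (rule tendsto_eventually)
  obtain k0 :: nat where "norm x \<le> real k0" using real_arch_simple by blast
  then show "\<forall>\<^sub>F k in sequentially. ball_cut k x = 1"
    unfolding eventually_sequentially ball_cut_def by (intro exI[of _ k0]) auto
qed

lemma cut_limit:
  assumes f: "sq_integrable f" and b[measurable]: "\<And>k. b k \<in> borel_measurable lebesgue"
    and K: "\<And>k x. norm (b k x) \<le> K" and lim: "\<And>x. (\<lambda>k. b k x) \<longlonglongrightarrow> c"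
  shows "(\<lambda>k. abs_L2 (\<lambda>x. b k x * f x)) \<longlonglongrightarrow> scaleC c (abs_L2 f)"
  unfolding abs_L2_scaleC[OF f]
proof (rule L2_dominated_convergence)
  have [measurable]: "f \<in> borel_measurable lebesgue" using f by (rule sq_integrable_measurable)
  show "(\<lambda>x. b n x * f x) \<in> borel_measurable lebesgue" "(\<lambda>x. c * f x) \<in> borel_measurable lebesgue" for n
    by measurable
  show "AE x in lebesgue. (\<lambda>n. b n x * f x) \<longlonglongrightarrow> c * f x"
    by (intro AE_I2 tendsto_mult lim tendsto_const)
  have "K \<ge> 0" using K[of 0 0] norm_ge_zero by (rule order_trans[rotated])
  then show "AE x in lebesgue. norm (b n x * f x) \<le> norm (of_real K * f x)" for n
    using K by (auto simp: norm_mult intro!: AE_I2 mult_right_mono)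
  show "sq_integrable (\<lambda>x. of_real K * f x)" using f by (rule sq_integrable_cmult)
qed

text \<open>
  The transform of a general square-integrable function is the limit of the transforms of its
  restrictions to balls, which are integrable.
\<close>

definition four_cut :: "nat \<Rightarrow> 'a::euclidean_space L2 \<Rightarrow> 'a L2" where
  "four_cut k f = abs_L2 (ft (\<lambda>x. ball_cut k x * rep_L2 f x))"

definition four :: "'a::euclidean_space L2 \<Rightarrow> 'a L2" where
  "four f = lim (\<lambda>k. four_cut k f)"

lemma L1L2_cut: "sq_integrable f \<Longrightarrow> L1L2 (\<lambda>x. ball_cut k x * f x)"
  by (rule L1L2_mult_compact_support[OF _ ball_cut])

lemma dist_ft:
  assumes "L1L2 f" "L1L2 g"
  shows "dist (abs_L2 (ft f)) (abs_L2 (ft g)) \<le> dist (abs_L2 f) (abs_L2 g)"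
proof -
  have "ft (\<lambda>x. f x - g x) = (\<lambda>\<xi>. ft f \<xi> - ft g \<xi>)" using assms by (auto simp: ft_diff)
  then show ?thesis
    using ft_L1L2[OF L1L2_diff[OF assms]] ft_L1L2[OF assms(1)] ft_L1L2[OF assms(2)] assms
    by (simp add: dist_norm abs_L2_diff L1L2_def)
qed

lemma four_limit: "(\<lambda>k. four_cut k f) \<longlonglongrightarrow> four f"
proof -
  have "(\<lambda>k. abs_L2 (\<lambda>x. ball_cut k x * rep_L2 f x)) \<longlonglongrightarrow> scaleC 1 (abs_L2 (rep_L2 f))"
    by (rule cut_limit[OF _ _ _ ball_cut_lim]) (auto intro: ball_cut)
  then have "Cauchy (\<lambda>k. abs_L2 (\<lambda>x. ball_cut k x * rep_L2 f x))"
    by (rule LIMSEQ_imp_Cauchy)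
  then have "Cauchy (\<lambda>k. four_cut k f)"
    unfolding Cauchy_def four_cut_def
    using dist_ft[OF L1L2_cut[OF sq_integrable_rep] L1L2_cut[OF sq_integrable_rep], of _ f _ f]
    by (meson le_less_trans)
  then show ?thesis
    unfolding four_def by (simp add: Cauchy_convergent_iff convergent_LIMSEQ_iff)
qed

lemma scaleC_1 [simp]: "scaleC 1 f = f"
  using scaleC_of_real[of 1 f] by simp

text \<open>
  The extended transform agrees with the integral wherever the latter makes sense, because both are
  limits of the transforms of the restrictions.
\<close>

lemma four_abs:
  assumes "L1L2 h" shows "four (abs_L2 h) = abs_L2 (ft h)"
proof -
  have h: "sq_integrable h" using assms by (simp add: L1L2_def)
  have lim: "(\<lambda>k. abs_L2 (\<lambda>x. ball_cut k x * h x)) \<longlonglongrightarrow> abs_L2 h"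
    using cut_limit[OF h ball_cut(1,2) ball_cut_lim] by simp
  have eq: "abs_L2 (\<lambda>x. ball_cut k x * rep_L2 (abs_L2 h) x) = abs_L2 (\<lambda>x. ball_cut k x * h x)" for k
    using rep_abs_L2[OF h] L1L2_cut[of "rep_L2 (abs_L2 h)" k] L1L2_cut[OF h, of k]
    by (subst abs_L2_eq_iff) (auto simp: L1L2_def)
  have "dist (four_cut k (abs_L2 h)) (abs_L2 (ft h)) \<le> dist (abs_L2 (\<lambda>x. ball_cut k x * h x)) (abs_L2 h)" for k
    unfolding four_cut_def eq[symmetric] by (rule dist_ft[OF L1L2_cut assms]) simp
  then have "(\<lambda>k. four_cut k (abs_L2 h)) \<longlonglongrightarrow> abs_L2 (ft h)"
    by (intro metric_tendsto_imp_tendsto[OF lim] always_eventually allI)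
  with four_limit show ?thesis by (rule LIMSEQ_unique)
qed

lemma abs_cut_eqI:
  fixes f g :: "'a::euclidean_space \<Rightarrow> complex"
  assumes "sq_integrable f" "sq_integrable g" "AE x in lebesgue. f x = g x"
  shows "ft (\<lambda>x. ball_cut k x * f x) = ft (\<lambda>x. ball_cut k x * g x)"
proof
  fix \<xi> :: 'a
  have [measurable]: "(\<lambda>x. cis (- (x \<bullet> \<xi>))) \<in> borel_measurable lebesgue"
    by (rule measurable_completion) simp
  have [measurable]: "f \<in> borel_measurable lebesgue" "g \<in> borel_measurable lebesgue" "ball_cut k \<in> borel_measurable (lebesgue :: 'a measure)"
    using assms ball_cut by (auto simp: sq_integrable_def)
  show "ft (\<lambda>x. ball_cut k x * f x) \<xi> = ft (\<lambda>x. ball_cut k x * g x) \<xi>"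
    unfolding ft_def using assms(3) by (intro arg_cong2[where f = "(*)"] refl integral_cong_AE) auto
qed

lemma four_add: "four (f + g) = four f + four g"
proof -
  have "four_cut k (f + g) = four_cut k f + four_cut k g" for k
  proof -
    have "f + g = abs_L2 (\<lambda>x. rep_L2 f x + rep_L2 g x)"
      by (simp flip: abs_L2_add)
    then have "AE x in lebesgue. rep_L2 (f + g) x = rep_L2 f x + rep_L2 g x"
      using rep_abs_L2[of "\<lambda>x. rep_L2 f x + rep_L2 g x"] by (simp add: sq_integrable_add)
    then have "ft (\<lambda>x. ball_cut k x * rep_L2 (f + g) x) = ft (\<lambda>x. ball_cut k x * (rep_L2 f x + rep_L2 g x))"
      by (intro abs_cut_eqI) (auto intro: sq_integrable_add)
    also have "\<dots> = (\<lambda>\<xi>. ft (\<lambda>x. ball_cut k x * rep_L2 f x) \<xi> + ft (\<lambda>x. ball_cut k x * rep_L2 g x) \<xi>)"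
      by (auto simp: distrib_left ft_add L1L2_cut)
    finally show ?thesis
      unfolding four_cut_def by (simp add: abs_L2_add ft_L1L2 L1L2_cut)
  qed
  then show ?thesis
    using LIMSEQ_unique[OF four_limit[of "f + g"]] tendsto_add[OF four_limit[of f] four_limit[of g]] by simp
qed

lemma four_scaleC: "four (scaleC c f) = scaleC c (four f)"
proof -
  have "four_cut k (scaleC c f) = scaleC c (four_cut k f)" for k
  proof -
    have "scaleC c f = abs_L2 (\<lambda>x. c * rep_L2 f x)"
      by (simp flip: abs_L2_scaleC)
    then have "AE x in lebesgue. rep_L2 (scaleC c f) x = c * rep_L2 f x"
      using rep_abs_L2[of "\<lambda>x. c * rep_L2 f x"] by (simp add: sq_integrable_cmult)
    then have "ft (\<lambda>x. ball_cut k x * rep_L2 (scaleC c f) x) = ft (\<lambda>x. ball_cut k x * (c * rep_L2 f x))"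
      by (intro abs_cut_eqI) (auto intro: sq_integrable_cmult)
    also have "\<dots> = (\<lambda>\<xi>. c * ft (\<lambda>x. ball_cut k x * rep_L2 f x) \<xi>)"
      by (auto simp: mult.left_commute[of _ c] ft_cmult)
    finally show ?thesis
      unfolding four_cut_def by (simp add: abs_L2_scaleC ft_L1L2 L1L2_cut)
  qed
  then show ?thesis
    using LIMSEQ_unique[OF four_limit[of "scaleC c f"]] bounded_linear.tendsto[OF bounded_linear_scaleC four_limit[of f], of c]
    by simp
qed

lemma norm_four_le: "norm (four f) \<le> norm f"
proof (rule LIMSEQ_le_const2[OF tendsto_norm[OF four_limit]], intro exI allI impI)
  fix k
  have "norm (four_cut k f) \<le> norm (abs_L2 (\<lambda>x. ball_cut k x * rep_L2 f x))"
    unfolding four_cut_def by (intro ft_L1L2 L1L2_cut) simp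
  also have "\<dots> \<le> 1 * norm (abs_L2 (rep_L2 f))"
    by (rule norm_bounded_mult) (simp_all add: ball_cut)
  finally show "norm (four_cut k f) \<le> norm f" by simp
qed

lemma bounded_linear_four: "bounded_linear four"
proof (rule bounded_linear_intro)
  show "four (r *\<^sub>R f) = r *\<^sub>R four f" for r f
    by (simp flip: scaleC_of_real add: four_scaleC)
  show "norm (four f) \<le> norm f * 1" for f by (simp add: norm_four_le)
qed (rule four_add)

lemma norm_four_Cc:
  fixes f :: "'a::euclidean_space \<Rightarrow> complex"
  assumes cont: "continuous_on UNIV f" and K: "compact K" "\<And>x. x \<notin> K \<Longrightarrow> f x = 0"
  shows "sq_integrable f" "norm (four (abs_L2 f)) = norm (abs_L2 f)"
proof -
  note P = plancherel_Cc[OF cont K]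
  have m: "f \<in> borel_measurable borel" using cont by (rule borel_measurable_continuous_onI)
  have ml: "h \<in> borel_measurable lebesgue" if "h \<in> borel_measurable borel" for h :: "'a \<Rightarrow> 'b::topological_space"
    using that by (intro measurable_completion) simp
  have f: "L1L2 f"
    using P(2,3) m by (auto simp: L1L2_def sq_integrable_def integrable_completion ml)
  then show sq: "sq_integrable f" by (simp add: L1L2_def)
  have "(norm (abs_L2 (ft f)))\<^sup>2 = (norm (abs_L2 f))\<^sup>2"
    using ft_measurable[OF m] m
    by (simp add: norm_abs_L2_sq[OF sq] norm_abs_L2_sq[OF ft_L1L2(1)[OF f]] integral_completion P(1))
  then show "norm (four (abs_L2 f)) = norm (abs_L2 f)"
    by (simp add: four_abs[OF f] power2_eq_iff_nonneg)
qed

text \<open>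
  The radial retraction onto the disc of radius \<open>K\<close>; it is the identity on that disc.
\<close>

definition clamp_disc :: "real \<Rightarrow> complex \<Rightarrow> complex" where
  "clamp_disc K z = of_real (K / max K (norm z)) * z"

definition tent :: "real \<Rightarrow> 'a::euclidean_space \<Rightarrow> complex" where
  "tent K x = of_real (max 0 (min 1 (K + 1 - norm x)))"

text \<open>
  The isometry holds on continuous functions of compact support and passes to limits. An arbitrary
  \<open>f\<close> is reached in two steps: cut off in space and in size it becomes a dominated pointwise limit of
  continuous functions (measurability), and the bounds are then removed.
\<close>

lemma norm_four: "norm (four f) = norm (f :: 'a::euclidean_space L2)"
proof -
  have lim_eq: "norm (four h) = norm h" if "H \<longlonglongrightarrow> h" "\<And>n. norm (four (H n)) = norm (H n)" for H and h :: "'a L2"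
  proof (rule LIMSEQ_unique)
    show "(\<lambda>n. norm (H n)) \<longlonglongrightarrow> norm (four h)"
      using tendsto_norm[OF bounded_linear.tendsto[OF bounded_linear_four that(1)]] unfolding that(2) .
    show "(\<lambda>n. norm (H n)) \<longlonglongrightarrow> norm h" by (rule tendsto_norm[OF that(1)])
  qed
  have clamp: "continuous_on UNIV (clamp_disc K)" "norm (clamp_disc K z) \<le> K" "norm (clamp_disc K z) \<le> norm z"
      "norm z \<le> K \<Longrightarrow> clamp_disc K z = z" if K: "K > 0" for K z
  proof -
    show "continuous_on UNIV (clamp_disc K)"
      unfolding clamp_disc_def by (intro continuous_intros) (use K in auto)
    have m: "0 < max K (norm z)" "norm z \<le> max K (norm z)" "K \<le> max K (norm z)" using K by auto
    have n: "norm (clamp_disc K z) = K * norm z / max K (norm z)"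
      using K m(1) by (simp add: clamp_disc_def norm_mult norm_divide)
    show "norm (clamp_disc K z) \<le> K" "norm (clamp_disc K z) \<le> norm z"
      unfolding n using m K by (simp_all add: divide_le_eq mult_left_mono mult.commute[of "norm z"] mult_right_mono)
    show "norm z \<le> K \<Longrightarrow> clamp_disc K z = z"
      using K by (simp add: clamp_disc_def max_absorb1)
  qed
  have tent: "continuous_on UNIV (tent K :: 'a \<Rightarrow> complex)" "norm (tent K x) \<le> 1" "x \<notin> cball 0 (K + 1) \<Longrightarrow> tent K x = 0"
    "norm x \<le> K \<Longrightarrow> tent K x = 1" for K and x :: 'a
    unfolding tent_def by (intro continuous_intros) (auto simp: dist_norm)
  have ml: "h \<in> borel_measurable lebesgue" if "continuous_on UNIV h" for h :: "'a \<Rightarrow> complex"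
    by (intro measurable_completion) (simp add: borel_measurable_continuous_onI[OF that])
  have [measurable]: "clamp_disc K \<in> borel_measurable borel" if "K > 0" for K
    by (rule borel_measurable_continuous_onI) (rule clamp[OF that])
  have [measurable]: "(tent K :: 'a \<Rightarrow> complex) \<in> borel_measurable lebesgue" for K
    by (rule ml) (rule tent)
  define h where "h K x = tent K x * clamp_disc K (rep_L2 f x)" for K x
  obtain N g where N: "negligible N" and gc: "\<And>n. continuous_on UNIV (g n)"
    and glim: "\<And>x. x \<notin> N \<Longrightarrow> (\<lambda>n. g n x) \<longlonglongrightarrow> rep_L2 f x"
    using lebesgue_measurable_imp_measurable_on[OF rep_L2_measurable, of UNIV f] unfolding measurable_on_def by auto
  have hK: "norm (four (abs_L2 (h K))) = norm (abs_L2 (h K))" if K: "K > 0" for K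
  proof (rule lim_eq)
    let ?H = "\<lambda>n x. tent K x * clamp_disc K (g n x)"
    have Hc: "continuous_on UNIV (?H n)" for n
      by (intro continuous_intros tent continuous_on_compose2[OF clamp(1)[OF K] gc]) auto
    show "(\<lambda>n. abs_L2 (?H n)) \<longlonglongrightarrow> abs_L2 (h K)"
    proof (rule L2_dominated_convergence)
      show "?H n \<in> borel_measurable lebesgue" for n by (rule ml[OF Hc])
      show "h K \<in> borel_measurable lebesgue" unfolding h_def using K by measurable
      have "AE x in lebesgue. x \<notin> N" using N by (simp add: negligible_iff_null_sets AE_not_in)
      then show "AE x in lebesgue. (\<lambda>n. ?H n x) \<longlonglongrightarrow> h K x"
      proof eventually_elim
        case (elim x)
        show ?case unfolding h_def
          by (intro tendsto_intros continuous_on_tendsto_compose[OF clamp(1)[OF K] glim[OF elim]]) auto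
      qed
      show "sq_integrable (\<lambda>x. indicator (cball 0 (K + 1)) x *\<^sub>R complex_of_real K :: complex)"
        by (rule sq_integrable_ind) simp
      show "AE x in lebesgue. norm (?H n x) \<le> norm (indicator (cball 0 (K + 1)) x *\<^sub>R complex_of_real K)" for n
      proof (rule AE_I2)
        fix x :: 'a
        have "norm (?H n x) \<le> 1 * K"
          unfolding norm_mult by (intro mult_mono tent clamp K) auto
        then show "norm (?H n x) \<le> norm (indicator (cball 0 (K + 1)) x *\<^sub>R complex_of_real K)"
          using tent(3)[of x K] K by (cases "x \<in> cball 0 (K + 1)") auto
      qed
    qed
    show "norm (four (abs_L2 (?H n))) = norm (abs_L2 (?H n))" for n
      by (rule norm_four_Cc[OF Hc compact_cball[of 0 "K + 1"]]) (simp add: tent(3))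
  qed
  \<comment> \<open>at each point the truncation is inactive from some index on\<close>
  have "(\<lambda>k. abs_L2 (h (real (Suc k)))) \<longlonglongrightarrow> abs_L2 (rep_L2 f)"
  proof (rule L2_dominated_convergence)
    show "h (real (Suc k)) \<in> borel_measurable lebesgue" for k
      unfolding h_def by measurable
    show "AE x in lebesgue. (\<lambda>k. h (real (Suc k)) x) \<longlonglongrightarrow> rep_L2 f x"
    proof (intro AE_I2 tendsto_eventually)
      fix x :: 'a
      obtain k0 :: nat where k0: "max (norm x) (norm (rep_L2 f x)) \<le> real k0" using real_arch_simple by blast
      show "\<forall>\<^sub>F k in sequentially. h (real (Suc k)) x = rep_L2 f x"
        unfolding eventually_sequentially
      proof (intro exI allI impI)
        fix k assume "k0 \<le> k"
        with k0 have "norm x \<le> real (Suc k)" "norm (rep_L2 f x) \<le> real (Suc k)" by auto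
        then show "h (real (Suc k)) x = rep_L2 f x"
          unfolding h_def by (simp only: tent(4) clamp(4) of_nat_0_less_iff zero_less_Suc mult_1)
      qed
    qed
    show "AE x in lebesgue. norm (h (real (Suc k)) x) \<le> norm (rep_L2 f x)" for k
    proof (rule AE_I2)
      fix x
      have "norm (h (real (Suc k)) x) \<le> 1 * norm (rep_L2 f x)"
        unfolding h_def norm_mult by (intro mult_mono tent clamp) auto
      then show "norm (h (real (Suc k)) x) \<le> norm (rep_L2 f x)" by simp
    qed
  qed simp_all
  then have "norm (four (abs_L2 (rep_L2 f))) = norm (abs_L2 (rep_L2 f))"
    by (rule lim_eq) (rule hK, simp)
  then show ?thesis by simp
qed

section \<open>Bounded real Fourier multipliers\<close>

text \<open>
  Multipliers are real and Borel measurable. Real ones suffice because the symbols of the problem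
  are real, and they act symmetrically.
\<close>

definition bmult :: "('a::euclidean_space \<Rightarrow> real) \<Rightarrow> bool" where
  "bmult b \<longleftrightarrow> b \<in> borel_measurable borel \<and> (\<exists>K. \<forall>x. \<bar>b x\<bar> \<le> K)"

definition mulL :: "('a::euclidean_space \<Rightarrow> real) \<Rightarrow> 'a L2 \<Rightarrow> 'a L2" where
  "mulL b f = abs_L2 (\<lambda>x. of_real (b x) * rep_L2 f x)"

lemma bmult_const [simp]: "bmult (\<lambda>_. c)"
  by (auto simp: bmult_def)

lemma bmult_mult:
  assumes "bmult b" "bmult c" shows "bmult (\<lambda>x. b x * c x)"
proof -
  obtain K L where *: "\<And>x. \<bar>b x\<bar> \<le> K" "\<And>x. \<bar>c x\<bar> \<le> L" using assms by (auto simp: bmult_def)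
  have "\<bar>b x * c x\<bar> \<le> K * L" for x
    unfolding abs_mult using *(1)[of x] *(2)[of x] by (intro mult_mono) auto
  with assms show ?thesis by (auto simp: bmult_def)
qed

lemma bmult_add:
  assumes "bmult b" "bmult c" shows "bmult (\<lambda>x. b x + c x)"
proof -
  obtain K L where *: "\<And>x. \<bar>b x\<bar> \<le> K" "\<And>x. \<bar>c x\<bar> \<le> L" using assms by (auto simp: bmult_def)
  have "\<bar>b x + c x\<bar> \<le> K + L" for x
    using *(1)[of x] *(2)[of x] by linarith
  with assms show ?thesis by (auto simp: bmult_def)
qed

lemma bmult_sum: "(\<And>i. i \<in> A \<Longrightarrow> bmult (b i)) \<Longrightarrow> bmult (\<lambda>x. \<Sum>i\<in>A. b i x)"
  by (induction A rule: infinite_finite_induct) (auto intro: bmult_add)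

lemma bmult_complex:
  assumes "bmult b"
  obtains K where "(\<lambda>x. complex_of_real (b x)) \<in> borel_measurable lebesgue" "\<And>x. norm (complex_of_real (b x)) \<le> K"
proof -
  have "(\<lambda>x. complex_of_real (b x)) \<in> borel_measurable lborel" using assms by (auto simp: bmult_def)
  then have "(\<lambda>x. complex_of_real (b x)) \<in> borel_measurable lebesgue" by (rule measurable_completion)
  with assms that show ?thesis by (auto simp: bmult_def)
qed

lemma sq_integrable_bmult: "bmult b \<Longrightarrow> sq_integrable f \<Longrightarrow> sq_integrable (\<lambda>x. of_real (b x) * f x)"
  by (erule bmult_complex) (rule sq_integrable_bounded_mult)

lemma mulL_abs:
  assumes "bmult b" "sq_integrable h" shows "mulL b (abs_L2 h) = abs_L2 (\<lambda>x. of_real (b x) * h x)"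
  unfolding mulL_def using rep_abs_L2[OF assms(2)] assms
  by (subst abs_L2_eq_iff) (auto intro!: sq_integrable_bmult)

lemma mulL_add_fun: "bmult b \<Longrightarrow> bmult c \<Longrightarrow> mulL (\<lambda>x. b x + c x) f = mulL b f + mulL c f"
  unfolding mulL_def by (subst abs_L2_add) (auto intro: sq_integrable_bmult simp: distrib_right)

lemma mulL_scale_fun: "bmult b \<Longrightarrow> mulL (\<lambda>x. r * b x) f = r *\<^sub>R mulL b f"
  unfolding mulL_def by (subst abs_L2_scaleR) (auto intro: sq_integrable_bmult simp: scaleR_conv_of_real mult.assoc)

lemma mulL_zero_fun: "mulL (\<lambda>_. 0) f = 0"
  by (simp add: mulL_def zero_L2_def)

lemma mulL_one_fun: "mulL (\<lambda>_. 1) f = f"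
  by (simp add: mulL_def)

lemma mulL_sum_fun: "(\<And>i. i \<in> A \<Longrightarrow> bmult (b i)) \<Longrightarrow> mulL (\<lambda>x. \<Sum>i\<in>A. b i x) f = (\<Sum>i\<in>A. mulL (b i) f)"
  by (induction A rule: infinite_finite_induct) (auto simp: mulL_zero_fun mulL_add_fun bmult_sum)

lemma mulL_mult_fun:
  assumes "bmult b" "bmult c" shows "mulL (\<lambda>x. b x * c x) f = mulL b (mulL c f)"
proof -
  have "mulL b (mulL c f) = abs_L2 (\<lambda>x. of_real (b x) * (of_real (c x) * rep_L2 f x))"
    unfolding mulL_def[of c] by (intro mulL_abs sq_integrable_bmult assms) simp
  then show ?thesis by (simp add: mulL_def mult.assoc)
qed

lemma mulL_scaleC: "bmult b \<Longrightarrow> mulL b (scaleC c f) = scaleC c (mulL b f)"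
proof -
  assume b: "bmult b"
  have "scaleC c f = abs_L2 (\<lambda>x. c * rep_L2 f x)" by (simp flip: abs_L2_scaleC)
  then have "mulL b (scaleC c f) = abs_L2 (\<lambda>x. of_real (b x) * (c * rep_L2 f x))"
    using mulL_abs[OF b sq_integrable_cmult[OF sq_integrable_rep]] by simp
  also have "\<dots> = scaleC c (mulL b f)"
    unfolding mulL_def using abs_L2_scaleC[OF sq_integrable_bmult[OF b sq_integrable_rep]] by (simp add: mult.left_commute)
  finally show ?thesis .
qed

lemma bounded_linear_mulL:
  assumes "bmult b" shows "bounded_linear (mulL b)"
proof -
  obtain K where K: "(\<lambda>x. complex_of_real (b x)) \<in> borel_measurable lebesgue" "\<And>x. norm (complex_of_real (b x)) \<le> K"
    using bmult_complex[OF assms] by blast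
  show ?thesis
  proof (rule bounded_linear_intro)
    show "mulL b (f + g) = mulL b f + mulL b g" for f g
    proof -
      have "mulL b (abs_L2 (rep_L2 f) + abs_L2 (rep_L2 g)) = mulL b (abs_L2 (rep_L2 f)) + mulL b (abs_L2 (rep_L2 g))"
        by (subst abs_L2_add, simp, simp, simp only: mulL_abs[OF assms] sq_integrable_add sq_integrable_rep,
            subst abs_L2_add) (auto intro: sq_integrable_bmult assms simp: distrib_left)
      then show ?thesis by simp
    qed
    show "mulL b (r *\<^sub>R f) = r *\<^sub>R mulL b f" for r f
      by (simp add: scaleC_of_real[symmetric] mulL_scaleC assms)
    show "norm (mulL b f) \<le> norm f * K" for f
      using norm_bounded_mult[OF sq_integrable_rep K, of f] by (simp add: mulL_def mult.commute)
  qed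
qed

lemma inner_mulL:
  assumes "bmult b" "bmult c"
  shows "mulL b f \<bullet> mulL c g = (\<integral>x. b x * c x * (rep_L2 f x \<bullet> rep_L2 g x) \<partial>lebesgue)"
proof -
  have "(of_real r * z) \<bullet> (of_real q * w) = r * q * (z \<bullet> w)" for r q :: real and z w :: complex
    by (simp flip: scaleR_conv_of_real)
  then show ?thesis
    unfolding mulL_def using assms by (subst inner_abs_L2) (auto intro: sq_integrable_bmult)
qed

lemma inner_mulL_right: "bmult b \<Longrightarrow> bmult c \<Longrightarrow> mulL b f \<bullet> mulL c g = mulL (\<lambda>x. b x * c x) f \<bullet> g"
  using inner_mulL[of "\<lambda>x. b x * c x" "\<lambda>_. 1" f g] inner_mulL[of b c f g]
  by (simp add: bmult_mult mulL_one_fun)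

lemma inner_mulL_commute: "bmult b \<Longrightarrow> mulL b f \<bullet> g = f \<bullet> mulL b g"
  using inner_mulL_right[of b "\<lambda>_. 1" f g] inner_mulL_right[of "\<lambda>_. 1" b f g] by (simp add: mulL_one_fun)

lemma mulL_mono:
  assumes "bmult b" "bmult c" "\<And>x. b x \<le> c x"
  shows "mulL b f \<bullet> f \<le> mulL c f \<bullet> f"
proof -
  have i: "integrable lebesgue (\<lambda>x. d x * (rep_L2 f x \<bullet> rep_L2 f x))" if "bmult d" for d
    using sq_integrable_inner[OF sq_integrable_bmult[OF that, of "rep_L2 f"], of "rep_L2 f"]
    by (simp flip: scaleR_conv_of_real)
  have "mulL d f \<bullet> f = (\<integral>x. d x * (rep_L2 f x \<bullet> rep_L2 f x) \<partial>lebesgue)" if "bmult d" for d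
    using inner_mulL[OF that bmult_const[of 1], of f f] by (simp add: mulL_one_fun)
  then show ?thesis
    using assms by (auto intro!: integral_mono mult_right_mono i)
qed

definition fcut :: "nat \<Rightarrow> 'a::euclidean_space \<Rightarrow> real" where
  "fcut N \<xi> = (if norm \<xi> \<le> real N then 1 else 0)"

lemma fcut_idem: "fcut N \<xi> * fcut N \<xi> = fcut N \<xi>"
  by (simp add: fcut_def)

lemma bmult_cut:
  assumes "continuous_on UNIV g" shows "bmult (\<lambda>\<xi>::'a::euclidean_space. g \<xi> * fcut N \<xi>)"
proof -
  have [measurable]: "g \<in> borel_measurable borel" using assms by (rule borel_measurable_continuous_onI)
  have "bounded (g ` cball 0 (real N))"
    by (intro compact_imp_bounded compact_continuous_image continuous_on_subset[OF assms]) auto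
  then obtain B where "B > 0" "\<And>x. x \<in> cball 0 (real N) \<Longrightarrow> norm (g x) \<le> B"
    by (auto simp: bounded_pos)
  then have "\<bar>g x * fcut N x\<bar> \<le> B" for x by (auto simp: fcut_def)
  moreover have "(\<lambda>\<xi>. g \<xi> * fcut N \<xi>) \<in> borel_measurable borel" unfolding fcut_def by measurable
  ultimately show ?thesis by (auto simp: bmult_def)
qed

lemma bmult_fcut: "bmult (fcut N)"
  using bmult_cut[of "\<lambda>_. 1" N] by simp

text \<open>
  The cut-offs in frequency are lossless in the limit, which recovers statements about \<open>f\<close> itself.
\<close>

lemma fcut_limit: "(\<lambda>N. mulL (fcut N) f) \<longlonglongrightarrow> f"
proof -
  have "(\<lambda>k. abs_L2 (\<lambda>x. ball_cut k x * rep_L2 f x)) \<longlonglongrightarrow> scaleC 1 (abs_L2 (rep_L2 f))"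
    by (rule cut_limit[OF _ _ _ ball_cut_lim]) (auto intro: ball_cut)
  moreover have "ball_cut k x = complex_of_real (fcut k x)" for k and x :: 'a by (simp add: ball_cut_def fcut_def)
  ultimately show ?thesis by (simp add: mulL_def)
qed

section \<open>Smooth functions of one variable\<close>

abbreviation vderiv :: "(real \<Rightarrow> 'a::real_normed_vector) \<Rightarrow> real \<Rightarrow> 'a" where
  "vderiv f \<equiv> (\<lambda>t. vector_derivative f (at t))"

text \<open>
  Smoothness of finite order is recursive in the derivative, so that closure under products and
  compositions follows by induction on the order from the rules for first derivatives.
\<close>

primrec nsmooth :: "nat \<Rightarrow> (real \<Rightarrow> 'a::real_normed_vector) \<Rightarrow> bool" where
  "nsmooth 0 f \<longleftrightarrow> True"
| "nsmooth (Suc k) f \<longleftrightarrow> (\<forall>t. f differentiable (at t)) \<and> nsmooth k (vderiv f)"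

definition smooth :: "(real \<Rightarrow> 'a::real_normed_vector) \<Rightarrow> bool" where
  "smooth f \<longleftrightarrow> (\<forall>k. nsmooth k f)"

lemma nsmooth_SucI:
  assumes "\<And>t. (f has_vector_derivative g t) (at t)" "nsmooth k g"
  shows "nsmooth (Suc k) f"
proof -
  have "vderiv f = g" using assms(1) by (intro ext vector_derivative_at)
  moreover have "f differentiable (at t)" for t
    using assms(1) by (rule differentiableI_vector)
  ultimately show ?thesis using assms(2) by simp
qed

lemma nsmooth_SucE:
  assumes "nsmooth (Suc k) f"
  shows "(f has_vector_derivative vderiv f t) (at t)" "nsmooth k (vderiv f)"
  using assms by (auto simp: vector_derivative_works[symmetric])

lemma nsmooth_Suc_imp: "nsmooth (Suc k) f \<Longrightarrow> nsmooth k f"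
  by (induction k arbitrary: f) auto

lemma smooth_has_derivative: "smooth f \<Longrightarrow> (f has_vector_derivative vderiv f t) (at t)"
  unfolding smooth_def using nsmooth_SucE(1) by blast

lemma smooth_vderiv: "smooth f \<Longrightarrow> smooth (vderiv f)"
  unfolding smooth_def using nsmooth_SucE(2) by blast

lemma smooth_vderiv_pow: "smooth f \<Longrightarrow> smooth ((vderiv ^^ k) f)"
  by (induction k) (auto intro: smooth_vderiv)

lemma smooth_continuous: "smooth f \<Longrightarrow> continuous_on S f"
  by (meson smooth_has_derivative continuous_at_imp_continuous_on has_vector_derivative_continuous)

lemma nsmooth_const: "nsmooth k (\<lambda>_. c)"
  by (induction k arbitrary: c) (auto intro: nsmooth_SucI[where g = "\<lambda>_. 0"] simp del: nsmooth.simps(2))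

lemma nsmooth_add: "nsmooth k f \<Longrightarrow> nsmooth k g \<Longrightarrow> nsmooth k (\<lambda>t. f t + g t)"
proof (induction k arbitrary: f g)
  case (Suc k)
  show ?case
    by (rule nsmooth_SucI[where g = "\<lambda>t. vderiv f t + vderiv g t"])
       (intro has_vector_derivative_add nsmooth_SucE[OF Suc.prems(1)] nsmooth_SucE[OF Suc.prems(2)] Suc.IH)+
qed simp

lemma nsmooth_mult:
  fixes f g :: "real \<Rightarrow> 'a::real_normed_algebra"
  shows "nsmooth k f \<Longrightarrow> nsmooth k g \<Longrightarrow> nsmooth k (\<lambda>t. f t * g t)"
proof (induction k arbitrary: f g)
  case (Suc k)
  show ?case
    by (rule nsmooth_SucI[where g = "\<lambda>t. f t * vderiv g t + vderiv f t * g t"])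
       (intro has_vector_derivative_mult nsmooth_add nsmooth_SucE[OF Suc.prems(1)] nsmooth_SucE[OF Suc.prems(2)]
          Suc.IH nsmooth_Suc_imp[OF Suc.prems(1)] nsmooth_Suc_imp[OF Suc.prems(2)])+
qed simp

lemma nsmooth_linear:
  assumes "bounded_linear L" shows "nsmooth k f \<Longrightarrow> nsmooth k (\<lambda>t. L (f t))"
proof (induction k arbitrary: f)
  case (Suc k)
  show ?case
    by (rule nsmooth_SucI[where g = "\<lambda>t. L (vderiv f t)"])
       (intro bounded_linear.has_vector_derivative[OF assms] nsmooth_SucE[OF Suc.prems] Suc.IH)+
qed simp

lemma nsmooth_affine: "nsmooth k f \<Longrightarrow> nsmooth k (\<lambda>t. f (a * t + b))"
proof (induction k arbitrary: f)
  case (Suc k)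
  show ?case
  proof (rule nsmooth_SucI[where g = "\<lambda>t. a *\<^sub>R vderiv f (a * t + b)"])
    fix t
    have "((\<lambda>t. a * t + b) has_vector_derivative a) (at t)"
      by (auto intro!: derivative_eq_intros)
    from vector_diff_chain_at[OF this nsmooth_SucE(1)[OF Suc.prems]]
    show "((\<lambda>t. f (a * t + b)) has_vector_derivative a *\<^sub>R vderiv f (a * t + b)) (at t)"
      by (simp add: o_def)
    show "nsmooth k (\<lambda>t. a *\<^sub>R vderiv f (a * t + b))"
      by (intro nsmooth_linear[OF bounded_linear_scaleR_right] Suc.IH nsmooth_SucE[OF Suc.prems])
  qed
qed simp

lemma nsmooth_cis: "nsmooth k (\<lambda>t. cis (a * t))"
proof (induction k)
  case (Suc k)
  show ?case
  proof (rule nsmooth_SucI[where g = "\<lambda>t. of_real a * \<i> * cis (a * t)"])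
    show "((\<lambda>t. cis (a * t)) has_vector_derivative of_real a * \<i> * cis (a * t)) (at t)" for t
    proof -
      have "((\<lambda>z. exp (\<i> * of_real a * z)) has_field_derivative of_real a * \<i> * exp (\<i> * of_real a * of_real t)) (at (of_real t))"
        by (auto intro!: derivative_eq_intros)
      from has_vector_derivative_real_field[OF this] show ?thesis
        by (simp add: cis_conv_exp mult.assoc)
    qed
    show "nsmooth k (\<lambda>t. of_real a * \<i> * cis (a * t))"
      by (intro nsmooth_mult nsmooth_const Suc.IH)
  qed
qed simp

text \<open>
  For \<open>p = 1\<close> this is the standard smooth function that vanishes to infinite order at 0. The family
  over all polynomials \<open>p\<close> is closed under differentiation.
\<close>

definition flat :: "real poly \<Rightarrow> real \<Rightarrow> real" where
  "flat p x = (if x > 0 then poly p (1 / x) * exp (- (1 / x)) else 0)"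

lemma poly_exp_limit: "((\<lambda>y. poly p y * exp (- y)) \<longlongrightarrow> 0) (at_top :: real filter)"
proof -
  have "((\<lambda>y. \<Sum>i\<le>degree p. coeff p i * (y ^ i / exp y)) \<longlongrightarrow> (\<Sum>i\<le>degree p. coeff p i * 0)) at_top"
    by (intro tendsto_intros tendsto_power_div_exp_0)
  moreover have "(\<Sum>i\<le>degree p. coeff p i * (y ^ i / exp y)) = poly p y * exp (- y)" for y :: real
    by (simp add: poly_altdef sum_distrib_right exp_minus divide_inverse mult.assoc)
  ultimately show ?thesis by simp
qed

lemma flat_limit: "((\<lambda>x. poly p (1 / x) * exp (- (1 / x))) \<longlongrightarrow> 0) (at_right (0::real))"
  using filterlim_compose[OF poly_exp_limit[of p] filterlim_inverse_at_top_right] by (simp add: inverse_eq_divide)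

text \<open>
  For \<open>x > 0\<close> the derivative of \<open>p (1 / x) exp (- 1 / x)\<close> is \<open>(p - p') (1 / x) exp (- 1 / x) / x\<^sup>2\<close>. At 0 the
  exponential beats every power of \<open>1 / x\<close>, also in the difference quotient.
\<close>

lemma flat_has_derivative:
  "(flat p has_vector_derivative flat ([:0, 0, 1:] * (p - pderiv p)) x) (at x)"
proof -
  let ?q = "[:0, 0, 1:] * (p - pderiv p)"
  consider "x > 0" | "x = 0" | "x < 0" by linarith
  then have "(flat p has_field_derivative flat ?q x) (at x)"
  proof cases
    case 1
    have "((\<lambda>x. poly p (1 / x) * exp (- (1 / x))) has_field_derivative flat ?q x) (at x)"
      using 1 by (auto intro!: derivative_eq_intros simp: flat_def field_simps power2_eq_square)
    then show ?thesis
      by (rule has_field_derivative_transform_within_open[where S = "{0<..}"]) (use 1 in \<open>auto simp: flat_def\<close>)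
  next
    case 2
    have "((\<lambda>y. (flat p y - flat p 0) / (y - 0)) \<longlongrightarrow> 0) (at 0)"
    proof (rule filterlim_split_at)
      show "((\<lambda>y. (flat p y - flat p 0) / (y - 0)) \<longlongrightarrow> 0) (at_left 0)"
        by (rule tendsto_eventually) (auto simp: eventually_at_filter flat_def)
      have "\<forall>\<^sub>F y in at_right 0. poly (pCons 0 p) (1 / y) * exp (- (1 / y)) = (flat p y - flat p 0) / (y - 0)"
        by (auto simp: eventually_at_filter flat_def)
      with flat_limit[of "pCons 0 p"] show "((\<lambda>y. (flat p y - flat p 0) / (y - 0)) \<longlongrightarrow> 0) (at_right 0)"
        by (rule Lim_transform_eventually)
    qed
    then show ?thesis using 2 by (simp add: has_field_derivative_iff flat_def)
  next
    case 3
    have "((\<lambda>x. 0) has_field_derivative flat ?q x) (at x)"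
      using 3 by (simp add: flat_def)
    then show ?thesis
      by (rule has_field_derivative_transform_within_open[where S = "{..<0}"]) (use 3 in \<open>auto simp: flat_def\<close>)
  qed
  then show ?thesis by (simp add: has_real_derivative_iff_has_vector_derivative)
qed

lemma nsmooth_flat: "nsmooth k (flat p)"
  by (induction k arbitrary: p) (auto intro: nsmooth_SucI flat_has_derivative simp del: nsmooth.simps(2))

text \<open>
  The factor \<open>exp 2\<close> normalises the value at 0 to 1.
\<close>

definition bump :: "real \<Rightarrow> real" where
  "bump t = exp 2 * (flat 1 (1 - t) * flat 1 (1 + t))"

lemma smooth_bump: "smooth bump"
proof -
  have "nsmooth k (\<lambda>t. exp 2 * (flat 1 ((-1) * t + 1) * flat 1 (1 * t + 1)))" for k
    by (intro nsmooth_mult nsmooth_const nsmooth_affine nsmooth_flat)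
  moreover have "(\<lambda>t. exp 2 * (flat 1 ((-1) * t + 1) * flat 1 (1 * t + 1))) = bump"
    by (auto simp: bump_def add.commute)
  ultimately show ?thesis by (simp add: smooth_def)
qed

lemma bump_0: "bump 0 = 1"
  by (simp add: bump_def flat_def flip: exp_add)

lemma bump_outside: "\<bar>t\<bar> \<ge> 1 \<Longrightarrow> bump t = 0"
  by (auto simp: bump_def flat_def)

lemma vderiv_outside:
  assumes "\<And>t. \<bar>t\<bar> \<ge> r \<Longrightarrow> f t = 0" "\<bar>t\<bar> > r" shows "vderiv f t = 0"
proof -
  have "((\<lambda>_. 0) has_vector_derivative 0) (at t)" by simp
  then have "(f has_vector_derivative 0) (at t)"
    by (rule has_vector_derivative_transform_within_open[where S = "{..<-r} \<union> {r<..}"])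
       (use assms in \<open>auto simp: abs_if split: if_splits\<close>)
  then show ?thesis by (rule vector_derivative_at)
qed

lemma bump_bounds: obtains B where "B \<ge> 1" "\<And>t. \<bar>bump t\<bar> \<le> B" "\<And>t. \<bar>vderiv bump t\<bar> \<le> B"
proof -
  have "bounded (f ` {-1..1})" if "smooth f" for f :: "real \<Rightarrow> real"
    by (intro compact_imp_bounded compact_continuous_image smooth_continuous that) auto
  note b = this
  obtain B where B: "\<forall>y\<in>bump ` {-1..1}. norm y \<le> B"
    using b[OF smooth_bump] unfolding bounded_iff by blast
  obtain C where C: "\<forall>y\<in>vderiv bump ` {-1..1}. norm y \<le> C"
    using b[OF smooth_vderiv[OF smooth_bump]] unfolding bounded_iff by blast
  show ?thesis
  proof (rule that[of "max 1 (max B C)"])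
    fix t
    show "\<bar>bump t\<bar> \<le> max 1 (max B C)"
    proof (cases "\<bar>t\<bar> \<ge> 1")
      case False
      then have "bump t \<in> bump ` {-1..1}" by (intro imageI) auto
      with B have "norm (bump t) \<le> B" by blast
      then show ?thesis by simp
    qed (simp add: bump_outside)
    show "\<bar>vderiv bump t\<bar> \<le> max 1 (max B C)"
    proof (cases "\<bar>t\<bar> > 1")
      case False
      then have "vderiv bump t \<in> vderiv bump ` {-1..1}" by (intro imageI) auto
      with C have "norm (vderiv bump t) \<le> C" by blast
      then show ?thesis by simp
    qed (simp add: vderiv_outside[of 1] bump_outside)
  qed simp
qed

section \<open>Weak derivatives on the frequency side\<close>

text \<open>
  Tensor products provide enough test functions, and all their mixed derivatives can be computed in
  one variable.
\<close>

definition tens :: "('n::finite \<Rightarrow> real \<Rightarrow> complex) \<Rightarrow> real^'n \<Rightarrow> complex" where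
  "tens f x = (\<Prod>j\<in>UNIV. f j (x $ j))"

lemma tens_has_derivative:
  fixes f :: "'n::finite \<Rightarrow> real \<Rightarrow> complex"
  assumes "\<And>j t. (f j has_vector_derivative vderiv (f j) t) (at t)"
  shows "(tens f has_derivative (\<lambda>h. \<Sum>i\<in>UNIV. (h $ i *\<^sub>R vderiv (f i) (x $ i)) * (\<Prod>j\<in>UNIV - {i}. f j (x $ j)))) (at x)"
  unfolding tens_def[abs_def]
proof (rule has_derivative_prod)
  fix i :: 'n
  have "((\<lambda>x. x $ i) has_derivative (\<lambda>h. h $ i)) (at x)"
    by (rule bounded_linear_imp_has_derivative[OF bounded_linear_vec_nth])
  from has_derivative_compose[OF this assms[of i "x $ i", unfolded has_vector_derivative_def]]
  show "((\<lambda>x. f i (x $ i)) has_derivative (\<lambda>h. h $ i *\<^sub>R vderiv (f i) (x $ i))) (at x)" .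
qed

lemma tens_upd: "tens (f(i := g)) x = g (x $ i) * (\<Prod>j\<in>UNIV - {i}. f j (x $ j))"
proof -
  have "tens (f(i := g)) x = (f(i := g)) i (x $ i) * (\<Prod>j\<in>UNIV - {i}. (f(i := g)) j (x $ j))"
    unfolding tens_def by (rule prod.remove) auto
  also have "(\<Prod>j\<in>UNIV - {i}. (f(i := g)) j (x $ j)) = (\<Prod>j\<in>UNIV - {i}. f j (x $ j))"
    by (intro prod.cong) auto
  finally show ?thesis by (simp only: fun_upd_same)
qed

lemma partial_deriv_tens:
  assumes "\<And>j. smooth (f j)"
  shows "partial_deriv i (tens f) = tens (f(i := vderiv (f i)))"
proof
  fix x
  have "partial_deriv i (tens f) x = (\<Sum>k\<in>UNIV. (axis i 1 $ k *\<^sub>R vderiv (f k) (x $ k)) * (\<Prod>j\<in>UNIV - {k}. f j (x $ j)))"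
    unfolding partial_deriv_def
    by (subst frechet_derivative_at[symmetric, OF tens_has_derivative]) (auto intro: smooth_has_derivative assms)
  also have "\<dots> = (\<Sum>k\<in>UNIV. if k = i then vderiv (f i) (x $ i) * (\<Prod>j\<in>UNIV - {i}. f j (x $ j)) else 0)"
    by (intro sum.cong) (auto simp: axis_def)
  finally show "partial_deriv i (tens f) x = tens (f(i := vderiv (f i))) x"
    by (simp add: tens_upd)
qed

lemma partial_derivs_tens:
  assumes "\<And>j. smooth (f j)"
  shows "partial_derivs is (tens f) = tens (\<lambda>j. (vderiv ^^ count_list is j) (f j))"
  unfolding partial_derivs_def
proof (induction "is")
  case (Cons i "is")
  show ?case
    by (simp add: Cons partial_deriv_tens smooth_vderiv_pow assms) (intro arg_cong[where f = tens] ext, auto)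
qed simp

lemma tens_test_function:
  fixes f :: "'n::finite \<Rightarrow> real \<Rightarrow> complex"
  assumes f: "\<And>j. smooth (f j)" and R: "\<And>j t. \<bar>t\<bar> > R \<Longrightarrow> f j t = 0"
  shows "tens f \<in> test_functions"
  unfolding test_functions_def
proof (intro CollectI conjI allI)
  fix "is" :: "'n list"
  show "partial_derivs is (tens f) differentiable_on UNIV"
    unfolding partial_derivs_tens[OF f] differentiable_on_def differentiable_def
    by (auto intro!: tens_has_derivative smooth_has_derivative smooth_vderiv_pow f)
  show "\<exists>K. compact K \<and> (\<forall>x. x \<notin> K \<longrightarrow> tens f x = 0)"
  proof (intro exI conjI allI impI)
    show "compact (cbox (\<chi> j. - R) (\<chi> j. R) :: (real^'n) set)" by (rule compact_cbox)
    fix x :: "real^'n" assume "x \<notin> cbox (\<chi> j. - R) (\<chi> j. R)"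
    then obtain j where "x $ j < - R \<or> R < x $ j" by (auto simp: mem_box_cart not_le)
    then have "\<bar>x $ j\<bar> > R" by linarith
    then have "f j (x $ j) = 0" by (rule R)
    then show "tens f x = 0" unfolding tens_def by (auto intro!: prod_zero)
  qed
qed

text \<open>
  Mixed derivatives are iterated along a list of directions; for tensor products only the number of
  occurrences of each direction matters.
\<close>

lemma exists_list_with_counts: "\<exists>is. \<forall>i. count_list is i = \<alpha> (i::'n::finite)"
proof -
  have "finite A \<Longrightarrow> \<exists>is. \<forall>i. count_list is i = (if i \<in> A then \<alpha> i else 0)" for A
  proof (induction rule: finite_induct)
    case (insert a A)
    then obtain "is" where "\<forall>i. count_list is i = (if i \<in> A then \<alpha> i else 0)" by blast
    moreover have "count_list (replicate k a) i = (if i = a then k else 0)" for k i by (induction k) auto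
    ultimately show ?case
      using insert by (intro exI[of _ "replicate (\<alpha> a) a @ is"]) auto
  qed (auto intro: exI[of _ "[]"])
  from this[OF finite_class.finite_UNIV] show ?thesis by simp
qed

lemma multi_deriv_tens:
  assumes "\<And>j. smooth (f j)"
  shows "multi_deriv \<alpha> (tens f) = tens (\<lambda>j. (vderiv ^^ \<alpha> j) (f j))"
  unfolding multi_deriv_def partial_derivs_tens[OF assms]
  using someI_ex[OF exists_list_with_counts[of \<alpha>]] by simp

text \<open>
  Plane waves are no test functions. Multiplied by a smooth window of width \<open>1 / r\<close> they become
  admissible, and the window disappears as \<open>r \<longrightarrow> 0\<close>; each derivative that falls on the window
  produces a factor \<open>r\<close>.
\<close>

definition window :: "real \<Rightarrow> real^'n::finite \<Rightarrow> complex" where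
  "window r x = (\<Prod>j\<in>UNIV. of_real (bump (r * x $ j)))"

definition window_deriv :: "'n \<Rightarrow> real \<Rightarrow> real^'n::finite \<Rightarrow> complex" where
  "window_deriv i r x = (\<Prod>j\<in>UNIV. of_real (if j = i then r * vderiv bump (r * x $ i) else bump (r * x $ j)))"

text \<open>
  The bump is written at the affine argument \<open>r * t + 0\<close> to match the rule for affine substitutions.
\<close>

definition wave :: "real \<Rightarrow> real \<Rightarrow> real \<Rightarrow> complex" where
  "wave r \<eta> t = cis (- \<eta> * t) * of_real (bump (r * t + 0))"

lemma smooth_wave: "smooth (wave r \<eta>)"
  unfolding smooth_def wave_def
  by (intro allI nsmooth_mult nsmooth_cis nsmooth_linear[OF bounded_linear_of_real] nsmooth_affine)
     (use smooth_bump in \<open>auto simp: smooth_def\<close>)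

lemma wave_outside: "r > 0 \<Longrightarrow> \<bar>t\<bar> \<ge> 1 / r \<Longrightarrow> wave r \<eta> t = 0"
  by (auto simp: wave_def field_simps abs_mult intro!: bump_outside)

lemma wave_deriv:
  "vderiv (wave r \<eta>) t = - \<i> * of_real \<eta> * wave r \<eta> t + cis (- \<eta> * t) * of_real (r * vderiv bump (r * t))"
proof -
  have c: "((\<lambda>t. cis (- \<eta> * t)) has_vector_derivative - \<i> * of_real \<eta> * cis (- \<eta> * t)) (at t)"
  proof -
    have "((\<lambda>z. exp (\<i> * of_real (- \<eta>) * z)) has_field_derivative - \<i> * of_real \<eta> * exp (\<i> * of_real (- \<eta>) * of_real t)) (at (of_real t))"
      by (auto intro!: derivative_eq_intros)
    from has_vector_derivative_real_field[OF this] show ?thesis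
      by (simp add: cis_conv_exp mult.assoc)
  qed
  have "((\<lambda>t. r * t + 0) has_vector_derivative r) (at t)"
    by (auto intro!: derivative_eq_intros)
  from vector_diff_chain_at[OF this smooth_has_derivative[OF smooth_bump]]
  have "((\<lambda>t. bump (r * t + 0)) has_vector_derivative r * vderiv bump (r * t)) (at t)"
    by (simp add: o_def)
  then have b: "((\<lambda>t. complex_of_real (bump (r * t + 0))) has_vector_derivative of_real (r * vderiv bump (r * t))) (at t)"
    by (rule bounded_linear.has_vector_derivative[OF bounded_linear_of_real])
  show ?thesis
    unfolding wave_def[abs_def]
    by (rule vector_derivative_at) (use has_vector_derivative_mult[OF c b] in \<open>simp add: algebra_simps\<close>)
qed

lemma tens_wave: "tens (\<lambda>j. wave r (\<xi> $ j)) x = cis (- (x \<bullet> \<xi>)) * window r x"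
proof -
  have "cis (- (x \<bullet> \<xi>)) = (\<Prod>j\<in>UNIV. cis (- (\<xi> $ j) * x $ j))"
    by (simp add: inner_vec_def cis_conv_exp exp_sum[symmetric] sum_negf sum_distrib_left mult.commute)
  then show ?thesis by (simp add: tens_def wave_def window_def prod.distrib)
qed

lemma tens_wave_deriv:
  "tens ((\<lambda>j. wave r (\<xi> $ j))(i := vderiv (wave r (\<xi> $ i)))) x
    = - \<i> * of_real (\<xi> $ i) * (cis (- (x \<bullet> \<xi>)) * window r x) + cis (- (x \<bullet> \<xi>)) * window_deriv i r x"
proof -
  let ?P = "\<Prod>j\<in>UNIV - {i}. wave r (\<xi> $ j) (x $ j)"
  have 1: "cis (- (x \<bullet> \<xi>)) * window r x = wave r (\<xi> $ i) (x $ i) * ?P"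
    unfolding tens_wave[symmetric] tens_def by (rule prod.remove) auto
  have c: "cis (- (x \<bullet> \<xi>)) = (\<Prod>j\<in>UNIV. cis (- (\<xi> $ j) * x $ j))"
    by (simp add: inner_vec_def cis_conv_exp exp_sum[symmetric] sum_negf sum_distrib_left mult.commute)
  have "cis (- (x \<bullet> \<xi>)) * window_deriv i r x = (\<Prod>j\<in>UNIV. cis (- (\<xi> $ j) * x $ j) * of_real (if j = i then r * vderiv bump (r * x $ i) else bump (r * x $ j)))"
    by (simp add: c window_deriv_def prod.distrib)
  also have "\<dots> = cis (- (\<xi> $ i) * x $ i) * of_real (r * vderiv bump (r * x $ i)) * ?P"
    by (subst prod.remove[of _ i]) (auto intro!: prod.cong simp: wave_def)
  finally show ?thesis
    unfolding tens_upd 1 wave_deriv by (simp add: algebra_simps)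
qed

lemma window_continuous:
  "continuous_on UNIV (window r :: real^'n::finite \<Rightarrow> complex)" "continuous_on UNIV (window_deriv i r :: real^'n \<Rightarrow> complex)"
proof -
  have "continuous_on UNIV (\<lambda>x::real^'n. f (r * x $ j))" if "smooth f" for f :: "real \<Rightarrow> real" and j :: 'n
    by (intro continuous_on_compose2[OF smooth_continuous[OF that, of UNIV]] continuous_intros) auto
  note c = this[OF smooth_bump] this[OF smooth_vderiv[OF smooth_bump]]
  show "continuous_on UNIV (window r :: real^'n \<Rightarrow> complex)"
    unfolding window_def using c(1) by (intro continuous_on_prod continuous_on_of_real)
  show "continuous_on UNIV (window_deriv i r :: real^'n \<Rightarrow> complex)"
    unfolding window_deriv_def
  proof (intro continuous_on_prod continuous_on_of_real)
    fix j :: 'n show "continuous_on UNIV (\<lambda>x::real^'n. if j = i then r * vderiv bump (r * x $ i) else bump (r * x $ j))"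
      by (cases "j = i") (auto intro!: continuous_intros c)
  qed
qed

lemma window_bounds:
  obtains B where "\<And>r x. norm (window r (x::real^'n::finite)) \<le> B" "\<And>i r x. 0 \<le> r \<Longrightarrow> r \<le> 1 \<Longrightarrow> norm (window_deriv i r (x::real^'n)) \<le> B"
proof -
  obtain B where B: "B \<ge> 1" "\<And>t. \<bar>bump t\<bar> \<le> B" "\<And>t. \<bar>vderiv bump t\<bar> \<le> B"
    using bump_bounds by blast
  show ?thesis
  proof (rule that[of "B ^ CARD('n)"])
    fix r and x :: "real^'n" and i
    show "norm (window r x) \<le> B ^ CARD('n)"
      unfolding window_def prod_norm[symmetric] prod_constant[symmetric] by (intro prod_mono) (auto intro: B)
    assume r: "0 \<le> r" "r \<le> 1"
    have "\<bar>r * vderiv bump (r * x $ i)\<bar> \<le> 1 * B"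
      unfolding abs_mult using r by (intro mult_mono B) auto
    then show "norm (window_deriv i r x) \<le> B ^ CARD('n)"
      unfolding window_deriv_def prod_norm[symmetric] prod_constant[symmetric] by (intro prod_mono) (auto intro: B)
  qed
qed

lemma window_outside:
  assumes r: "r > 0" and x: "norm (x::real^'n::finite) > real CARD('n) / r"
  shows "window r x = 0" "window_deriv i r x = 0"
proof -
  have "\<exists>j. \<bar>x $ j\<bar> > 1 / r"
  proof (rule ccontr)
    assume "\<not> ?thesis"
    then have "(\<Sum>j\<in>UNIV. \<bar>x $ j\<bar>) \<le> (\<Sum>j\<in>(UNIV::'n set). 1 / r)" by (intro sum_mono) (auto simp: not_less)
    then show False using norm_le_l1_cart[of x] x by simp
  qed
  then obtain j where j: "\<bar>x $ j\<bar> > 1 / r" by blast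
  then have "\<bar>r * x $ j\<bar> > 1" using r by (simp add: abs_mult field_simps)
  then have *: "bump (r * x $ j) = 0" "vderiv bump (r * x $ j) = 0"
    by (auto intro: bump_outside vderiv_outside[of 1])
  show "window r x = 0" unfolding window_def by (rule prod_zero) (use * in auto)
  show "window_deriv i r x = 0" unfolding window_deriv_def by (rule prod_zero) (use * in auto)
qed

lemma window_limit:
  assumes r: "r \<longlonglongrightarrow> 0"
  shows "(\<lambda>k. window (r k) (x::real^'n::finite)) \<longlonglongrightarrow> 1" "(\<lambda>k. window_deriv i (r k) x) \<longlonglongrightarrow> 0"
proof -
  have c: "(\<lambda>k. f (r k * a)) \<longlonglongrightarrow> f 0" if "smooth f" for f :: "real \<Rightarrow> real" and a
  proof -
    have "(\<lambda>k. f (r k * a)) \<longlonglongrightarrow> f (0 * a)"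
      by (intro continuous_on_tendsto_compose[OF smooth_continuous[OF that, of UNIV]] tendsto_intros r) auto
    then show ?thesis by simp
  qed
  note cb = c[OF smooth_bump] and cv = c[OF smooth_vderiv[OF smooth_bump]]
  have "(\<lambda>k. window (r k) x) \<longlonglongrightarrow> (\<Prod>j\<in>(UNIV::'n set). of_real (bump 0))"
    unfolding window_def by (intro tendsto_prod tendsto_of_real cb)
  then show "(\<lambda>k. window (r k) x) \<longlonglongrightarrow> 1" by (simp add: bump_0)
  have "(\<lambda>k. window_deriv i (r k) x) \<longlonglongrightarrow> (\<Prod>j\<in>(UNIV::'n set). of_real (if j = i then 0 * vderiv bump 0 else bump 0))"
    unfolding window_deriv_def
  proof (intro tendsto_prod tendsto_of_real)
    fix j show "(\<lambda>k. if j = i then r k * vderiv bump (r k * x $ i) else bump (r k * x $ j)) \<longlonglongrightarrow> (if j = i then 0 * vderiv bump 0 else bump 0)"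
      by (cases "j = i") (auto intro!: tendsto_mult[OF r cv, simplified] cb)
  qed
  moreover have "(\<Prod>j\<in>(UNIV::'n set). complex_of_real (if j = i then 0 * vderiv bump 0 else bump 0)) = 0"
    by (rule prod_zero) auto
  ultimately show "(\<lambda>k. window_deriv i (r k) x) \<longlonglongrightarrow> 0" by simp
qed

lemma L1L2_window:
  fixes f :: "real^'n::finite \<Rightarrow> complex"
  assumes f: "sq_integrable f" and r: "0 < r" "r \<le> 1"
  shows "L1L2 (\<lambda>x. window r x * f x)" "L1L2 (\<lambda>x. window_deriv i r x * f x)"
proof -
  obtain B where B: "\<And>r x. norm (window r (x::real^'n)) \<le> B" "\<And>i r x. 0 \<le> r \<Longrightarrow> r \<le> 1 \<Longrightarrow> norm (window_deriv i r (x::real^'n)) \<le> B"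
    using window_bounds by blast
  have m: "h \<in> borel_measurable lebesgue" if "continuous_on UNIV h" for h :: "real^'n \<Rightarrow> complex"
    by (intro measurable_completion) (simp add: borel_measurable_continuous_onI[OF that])
  show "L1L2 (\<lambda>x. window r x * f x)"
    by (rule L1L2_mult_compact_support[OF f m[OF window_continuous(1)] B(1) window_outside(1)[OF r(1)]])
  show "L1L2 (\<lambda>x. window_deriv i r x * f x)"
    by (rule L1L2_mult_compact_support[OF f m[OF window_continuous(2)] B(2) window_outside(2)[OF r(1)]]) (use r in auto)
qed

lemma wave_tests:
  assumes r: "r > 0"
  shows "tens (\<lambda>j. wave r (\<xi> $ j)) \<in> test_functions"
    "tens ((\<lambda>j. wave r (\<xi> $ j))(i := vderiv (wave r (\<xi> $ i)))) \<in> test_functions"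
  using wave_outside[OF r] vderiv_outside[of "1 / r" "wave r (\<xi> $ i)"]
  by (auto intro!: tens_test_function[where R = "1 / r"] smooth_wave smooth_vderiv)

lemma vderiv_pow_Suc: "(vderiv ^^ k) (vderiv h) = (vderiv ^^ Suc k) h"
  by (simp only: funpow_Suc_right o_apply)

lemma sum_upd_Suc: "sum (\<alpha>(i := Suc (\<alpha> i))) UNIV = Suc (sum \<alpha> (UNIV :: 'n::finite set))"
proof -
  have "sum (\<alpha>(i := Suc (\<alpha> i))) UNIV = Suc (\<alpha> i) + sum (\<alpha>(i := Suc (\<alpha> i))) (UNIV - {i})"
    by (subst sum.remove[of UNIV i]) auto
  also have "sum (\<alpha>(i := Suc (\<alpha> i))) (UNIV - {i}) = sum \<alpha> (UNIV - {i})"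
    by (intro sum.cong) auto
  also have "Suc (\<alpha> i) + sum \<alpha> (UNIV - {i}) = Suc (sum \<alpha> UNIV)"
    using sum.remove[of UNIV i \<alpha>] by simp
  finally show ?thesis .
qed

text \<open>
  The definition of the weak derivative is tested with the windowed wave for \<open>\<alpha>\<close> increased in
  direction \<open>i\<close>, and with its \<open>i\<close>-th derivative for \<open>\<alpha>\<close> itself. Both tests involve the same mixed derivative
  of the wave, so \<open>f\<close> drops out and a first-order relation between \<open>g\<close> and \<open>g'\<close> remains.
\<close>

lemma weak_deriv_windowed:
  fixes f g g' :: "(real^'n::finite) L2"
  assumes 1: "is_weak_deriv \<alpha> f g" and 2: "is_weak_deriv (\<alpha>(i := Suc (\<alpha> i))) f g'" and r: "0 < r" "r \<le> 1"
  shows "ft (\<lambda>x. window r x * rep_L2 g' x) \<xi>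
    = \<i> * of_real (\<xi> $ i) * ft (\<lambda>x. window r x * rep_L2 g x) \<xi> - ft (\<lambda>x. window_deriv i r x * rep_L2 g x) \<xi>"
proof -
  let ?\<phi> = "\<lambda>j. wave r (\<xi> $ j)"
  let ?\<psi> = "?\<phi>(i := vderiv (?\<phi> i))"
  let ?\<alpha>' = "\<alpha>(i := Suc (\<alpha> i))"
  have sm: "smooth (?\<phi> j)" "smooth (?\<psi> j)" for j
    by (auto intro: smooth_wave smooth_vderiv)
  have "multi_deriv \<alpha> (tens ?\<psi>) = multi_deriv ?\<alpha>' (tens ?\<phi>)"
    unfolding multi_deriv_tens[OF sm(1)] multi_deriv_tens[OF sm(2)]
  proof (intro arg_cong[where f = tens] ext)
    fix j t
    show "(vderiv ^^ \<alpha> j) (?\<psi> j) t = (vderiv ^^ ?\<alpha>' j) (?\<phi> j) t"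
      by (cases "j = i") (simp_all only: fun_upd_same fun_upd_other vderiv_pow_Suc not_False_eq_True)
  qed
  moreover note sum_upd_Suc[of \<alpha> i]
  moreover have "(\<integral>x. rep_L2 f x * multi_deriv \<alpha> (tens ?\<psi>) x \<partial>lebesgue) = (-1) ^ sum \<alpha> UNIV * (\<integral>x. rep_L2 g x * tens ?\<psi> x \<partial>lebesgue)"
    using 1 wave_tests(2)[OF r(1)] unfolding is_weak_deriv_def by (rule bspec)
  moreover have "(\<integral>x. rep_L2 f x * multi_deriv ?\<alpha>' (tens ?\<phi>) x \<partial>lebesgue) = (-1) ^ sum ?\<alpha>' UNIV * (\<integral>x. rep_L2 g' x * tens ?\<phi> x \<partial>lebesgue)"
    using 2 wave_tests(1)[OF r(1)] unfolding is_weak_deriv_def by (rule bspec)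
  ultimately have "(-1) ^ sum \<alpha> UNIV * (\<integral>x. rep_L2 g x * tens ?\<psi> x \<partial>lebesgue) = (-1) ^ Suc (sum \<alpha> UNIV) * (\<integral>x. rep_L2 g' x * tens ?\<phi> x \<partial>lebesgue)"
    by (simp only:)
  then have *: "(\<integral>x. rep_L2 g' x * tens ?\<phi> x \<partial>lebesgue) = - (\<integral>x. rep_L2 g x * tens ?\<psi> x \<partial>lebesgue)"
    by (auto simp: minus_one_power_iff split: if_splits)
  note I = ft_integrand[OF L1L2_window(1)[OF _ r], of "rep_L2 g", simplified]
    and J = ft_integrand[OF L1L2_window(2)[OF _ r], of "rep_L2 g", simplified]
  have "(\<integral>x. rep_L2 g x * tens ?\<psi> x \<partial>lebesgue) = (\<integral>x. (- \<i> * of_real (\<xi> $ i)) * (cis (- (x \<bullet> \<xi>)) * (window r x * rep_L2 g x)) + cis (- (x \<bullet> \<xi>)) * (window_deriv i r x * rep_L2 g x) \<partial>lebesgue)"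
    unfolding tens_wave_deriv by (intro Bochner_Integration.integral_cong refl) (simp add: algebra_simps)
  also have "\<dots> = (- \<i> * of_real (\<xi> $ i)) * (\<integral>x. cis (- (x \<bullet> \<xi>)) * (window r x * rep_L2 g x) \<partial>lebesgue) + (\<integral>x. cis (- (x \<bullet> \<xi>)) * (window_deriv i r x * rep_L2 g x) \<partial>lebesgue)"
    by (subst Bochner_Integration.integral_add) (auto intro: I J)
  finally have "(\<integral>x. cis (- (x \<bullet> \<xi>)) * (window r x * rep_L2 g' x) \<partial>lebesgue) = - \<dots>"
    using * unfolding tens_wave by (simp add: mult_ac)
  then have eq: "(\<integral>x. cis (- (x \<bullet> \<xi>)) * (window r x * rep_L2 g' x) \<partial>lebesgue)
     = \<i> * of_real (\<xi> $ i) * (\<integral>x. cis (- (x \<bullet> \<xi>)) * (window r x * rep_L2 g x) \<partial>lebesgue) - (\<integral>x. cis (- (x \<bullet> \<xi>)) * (window_deriv i r x * rep_L2 g x) \<partial>lebesgue)"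
    by simp
  show ?thesis
    unfolding ft_def eq by (simp only: right_diff_distrib mult_ac)
qed

lemma four_window_limit:
  fixes f :: "(real^'n::finite) L2"
  assumes r_def: "r = (\<lambda>k::nat. inverse (real (Suc k)))"
  shows "(\<lambda>k. abs_L2 (ft (\<lambda>x. window (r k) x * rep_L2 f x))) \<longlonglongrightarrow> four f"
    and "(\<lambda>k. abs_L2 (ft (\<lambda>x. window_deriv i (r k) x * rep_L2 f x))) \<longlonglongrightarrow> 0"
proof -
  have r: "0 < r k" "r k \<le> 1" for k
    by (auto simp: r_def divide_simps inverse_eq_divide)
  have r0: "r \<longlonglongrightarrow> 0" unfolding r_def by (rule LIMSEQ_inverse_real_of_nat)
  obtain B where B: "\<And>r x. norm (window r (x::real^'n)) \<le> B" "\<And>i r x. 0 \<le> r \<Longrightarrow> r \<le> 1 \<Longrightarrow> norm (window_deriv i r (x::real^'n)) \<le> B"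
    using window_bounds by blast
  have m: "h \<in> borel_measurable lebesgue" if "continuous_on UNIV h" for h :: "real^'n \<Rightarrow> complex"
    by (intro measurable_completion) (simp add: borel_measurable_continuous_onI[OF that])
  have "(\<lambda>k. four (abs_L2 (\<lambda>x. window (r k) x * rep_L2 f x))) \<longlonglongrightarrow> four (scaleC 1 (abs_L2 (rep_L2 f)))"
    by (intro bounded_linear.tendsto[OF bounded_linear_four] cut_limit[OF sq_integrable_rep m[OF window_continuous(1)] B(1) window_limit(1)[OF r0]])
  then show "(\<lambda>k. abs_L2 (ft (\<lambda>x. window (r k) x * rep_L2 f x))) \<longlonglongrightarrow> four f"
    by (simp add: four_abs L1L2_window r)
  have "(\<lambda>k. four (abs_L2 (\<lambda>x. window_deriv i (r k) x * rep_L2 f x))) \<longlonglongrightarrow> four (scaleC 0 (abs_L2 (rep_L2 f)))"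
    by (intro bounded_linear.tendsto[OF bounded_linear_four] cut_limit[OF sq_integrable_rep m[OF window_continuous(2)] B(2)[OF less_imp_le[OF r(1)] r(2)] window_limit(2)[OF r0]])
  moreover have "four (scaleC 0 (abs_L2 (rep_L2 f))) = 0"
    using scaleC_of_real[of 0 f] by (simp add: linear_simps[OF bounded_linear_four])
  ultimately show "(\<lambda>k. abs_L2 (ft (\<lambda>x. window_deriv i (r k) x * rep_L2 f x))) \<longlonglongrightarrow> 0"
    by (simp add: four_abs L1L2_window r)
qed

text \<open>
  The limit \<open>r \<longrightarrow> 0\<close> of the windowed identity. The cut-off in frequency makes multiplication by
  \<open>\<xi> $ i\<close> bounded, hence continuous along this limit.
\<close>

lemma four_weak_deriv_step:
  fixes f g g' :: "(real^'n::finite) L2"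
  assumes 1: "is_weak_deriv \<alpha> f g" and 2: "is_weak_deriv (\<alpha>(i := Suc (\<alpha> i))) f g'"
  shows "mulL (fcut N) (four g') = scaleC \<i> (mulL (\<lambda>\<xi>. \<xi> $ i * fcut N \<xi>) (four g))"
proof -
  define r where "r = (\<lambda>k::nat. inverse (real (Suc k)))"
  have r: "0 < r k" "r k \<le> 1" for k
    by (auto simp: r_def divide_simps inverse_eq_divide)
  have b: "bmult (fcut N)" "bmult (\<lambda>\<xi>::real^'n. \<xi> $ i * fcut N \<xi>)"
    by (auto intro!: bmult_fcut bmult_cut continuous_intros)
  note L = four_window_limit[OF r_def]
  have "mulL (fcut N) (abs_L2 (ft (\<lambda>x. window (r k) x * rep_L2 g' x)))
      = scaleC \<i> (mulL (\<lambda>\<xi>. \<xi> $ i * fcut N \<xi>) (abs_L2 (ft (\<lambda>x. window (r k) x * rep_L2 g x))))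
        - mulL (fcut N) (abs_L2 (ft (\<lambda>x. window_deriv i (r k) x * rep_L2 g x)))" for k
  proof -
    have sq: "sq_integrable (ft (\<lambda>x. window (r k) x * rep_L2 h x))" "sq_integrable (ft (\<lambda>x. window_deriv i (r k) x * rep_L2 h x))" for h :: "(real^'n) L2"
      by (auto intro!: ft_L1L2 L1L2_window r)
    have "scaleC \<i> (mulL (\<lambda>\<xi>. \<xi> $ i * fcut N \<xi>) (abs_L2 (ft (\<lambda>x. window (r k) x * rep_L2 g x))))
        - mulL (fcut N) (abs_L2 (ft (\<lambda>x. window_deriv i (r k) x * rep_L2 g x)))
      = abs_L2 (\<lambda>\<xi>. \<i> * (of_real (\<xi> $ i * fcut N \<xi>) * ft (\<lambda>x. window (r k) x * rep_L2 g x) \<xi>) - of_real (fcut N \<xi>) * ft (\<lambda>x. window_deriv i (r k) x * rep_L2 g x) \<xi>)"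
      by (simp only: mulL_abs[OF b(1)] mulL_abs[OF b(2)] sq abs_L2_scaleC sq_integrable_bmult[OF b(1)] sq_integrable_bmult[OF b(2)]
          abs_L2_diff sq_integrable_cmult)
    also have "(\<lambda>\<xi>. \<i> * (of_real (\<xi> $ i * fcut N \<xi>) * ft (\<lambda>x. window (r k) x * rep_L2 g x) \<xi>) - of_real (fcut N \<xi>) * ft (\<lambda>x. window_deriv i (r k) x * rep_L2 g x) \<xi>)
      = (\<lambda>\<xi>. of_real (fcut N \<xi>) * ft (\<lambda>x. window (r k) x * rep_L2 g' x) \<xi>)"
      unfolding weak_deriv_windowed[OF 1 2 r] by (rule ext) (simp add: algebra_simps)
    finally show ?thesis by (simp only: mulL_abs[OF b(1)] sq)
  qed
  moreover have "(\<lambda>k. scaleC \<i> (mulL (\<lambda>\<xi>. \<xi> $ i * fcut N \<xi>) (abs_L2 (ft (\<lambda>x. window (r k) x * rep_L2 g x))))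
        - mulL (fcut N) (abs_L2 (ft (\<lambda>x. window_deriv i (r k) x * rep_L2 g x))))
     \<longlonglongrightarrow> scaleC \<i> (mulL (\<lambda>\<xi>. \<xi> $ i * fcut N \<xi>) (four g)) - mulL (fcut N) 0"
    by (intro tendsto_diff bounded_linear.tendsto[OF bounded_linear_scaleC] bounded_linear.tendsto[OF bounded_linear_mulL] b L)
  moreover have "(\<lambda>k. mulL (fcut N) (abs_L2 (ft (\<lambda>x. window (r k) x * rep_L2 g' x)))) \<longlonglongrightarrow> mulL (fcut N) (four g')"
    by (intro bounded_linear.tendsto[OF bounded_linear_mulL] b L)
  ultimately have "mulL (fcut N) (four g') = scaleC \<i> (mulL (\<lambda>\<xi>. \<xi> $ i * fcut N \<xi>) (four g)) - mulL (fcut N) 0"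
    by (simp only:) (rule LIMSEQ_unique)
  then show ?thesis
    by (simp add: linear_simps[OF bounded_linear_mulL[OF b(1)]])
qed

lemma four_weak_deriv_0:
  fixes f g :: "(real^'n::finite) L2"
  assumes "is_weak_deriv (\<lambda>_. 0) f g" shows "four g = four f"
proof -
  define r where "r = (\<lambda>k::nat. inverse (real (Suc k)))"
  have r: "0 < r k" for k by (auto simp: r_def)
  have "ft (\<lambda>x. window (r k) x * rep_L2 f x) \<xi> = ft (\<lambda>x. window (r k) x * rep_L2 g x) \<xi>" for k \<xi>
  proof -
    have "multi_deriv (\<lambda>_. 0) (tens (\<lambda>j. wave (r k) (\<xi> $ j))) = tens (\<lambda>j. wave (r k) (\<xi> $ j))"
      by (simp add: multi_deriv_tens smooth_wave)
    then have "(\<integral>x. rep_L2 f x * tens (\<lambda>j. wave (r k) (\<xi> $ j)) x \<partial>lebesgue) = (\<integral>x. rep_L2 g x * tens (\<lambda>j. wave (r k) (\<xi> $ j)) x \<partial>lebesgue)"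
      using assms wave_tests(1)[OF r[of k], of \<xi>] unfolding is_weak_deriv_def by force
    then show ?thesis unfolding ft_def tens_wave by (simp add: mult_ac)
  qed
  then have "(\<lambda>k. abs_L2 (ft (\<lambda>x. window (r k) x * rep_L2 f x))) = (\<lambda>k. abs_L2 (ft (\<lambda>x. window (r k) x * rep_L2 g x)))"
    by (intro ext arg_cong[where f = abs_L2]) auto
  with four_window_limit(1)[OF r_def, of f] have "(\<lambda>k. abs_L2 (ft (\<lambda>x. window (r k) x * rep_L2 g x))) \<longlonglongrightarrow> four f"
    by (simp only:)
  with four_window_limit(1)[OF r_def, of g] show ?thesis
    by (rule LIMSEQ_unique)
qed

text \<open>
  Induction on the order: \<open>four_weak_deriv_step\<close> raises \<open>\<alpha>\<close> by one in a single direction, and the order 0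
  case identifies the weak derivative of order 0 with \<open>f\<close>.
\<close>

lemma four_weak_deriv:
  fixes f :: "(real^'n::finite) L2"
  assumes f: "f \<in> sobolev k" and \<alpha>: "\<alpha> \<in> multiindices_le k"
  shows "mulL (fcut N) (four (weak_deriv \<alpha> f)) = scaleC (\<i> ^ sum \<alpha> UNIV) (mulL (\<lambda>\<xi>. multi_power \<xi> \<alpha> * fcut N \<xi>) (four f))"
  using \<alpha>
proof (induction "sum \<alpha> UNIV" arbitrary: \<alpha>)
  case 0
  then have \<alpha>: "\<alpha> = (\<lambda>_. 0)" by auto
  have "is_weak_deriv \<alpha> f (weak_deriv \<alpha> f)"
    unfolding weak_deriv_def by (rule someI_ex) (use f 0(2) in \<open>unfold sobolev_def, blast\<close>)
  then show ?case unfolding \<alpha> by (simp add: four_weak_deriv_0 multi_power_def)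
next
  case (Suc k' \<alpha>)
  then have "sum \<alpha> UNIV \<noteq> 0" by linarith
  then obtain i where i: "\<alpha> i \<noteq> 0" by (auto simp: sum_eq_0_iff)
  define \<beta> where "\<beta> = \<alpha>(i := \<alpha> i - 1)"
  have \<alpha>: "\<alpha> = \<beta>(i := Suc (\<beta> i))" using i by (auto simp: \<beta>_def)
  have s: "sum \<alpha> UNIV = Suc (sum \<beta> UNIV)"
    by (subst \<alpha>) (rule sum_upd_Suc)
  then have \<beta>: "\<beta> \<in> multiindices_le k" and k': "k' = sum \<beta> UNIV"
    using Suc by (auto simp: multiindices_le_def)
  have wd: "is_weak_deriv \<gamma> f (weak_deriv \<gamma> f)" if "\<gamma> \<in> multiindices_le k" for \<gamma>
    unfolding weak_deriv_def by (rule someI_ex) (use f that in \<open>unfold sobolev_def, blast\<close>)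
  have mc: "continuous_on UNIV (\<lambda>\<xi>::real^'n. multi_power \<xi> \<beta>)"
    unfolding multi_power_def by (intro continuous_intros)
  have b: "bmult (fcut N)" "bmult (\<lambda>\<xi>::real^'n. \<xi> $ i * fcut N \<xi>)" "bmult (\<lambda>\<xi>::real^'n. multi_power \<xi> \<beta> * fcut N \<xi>)"
    by (auto intro!: bmult_fcut bmult_cut continuous_intros mc)
  have mp: "multi_power \<xi> \<alpha> = \<xi> $ i * multi_power \<xi> \<beta>" for \<xi> :: "real^'n"
  proof -
    have "multi_power \<xi> \<alpha> = (\<xi> $ i) ^ \<alpha> i * (\<Prod>j\<in>UNIV - {i}. (\<xi> $ j) ^ \<alpha> j)"
      unfolding multi_power_def by (rule prod.remove) auto
    also have "(\<Prod>j\<in>UNIV - {i}. (\<xi> $ j) ^ \<alpha> j) = (\<Prod>j\<in>UNIV - {i}. (\<xi> $ j) ^ \<beta> j)"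
      by (intro prod.cong) (auto simp: \<beta>_def)
    also have "(\<xi> $ i) ^ \<alpha> i = \<xi> $ i * (\<xi> $ i) ^ \<beta> i"
      using i by (cases "\<alpha> i") (auto simp: \<beta>_def)
    finally show ?thesis unfolding multi_power_def by (subst prod.remove[of UNIV i]) (auto simp: mult.assoc)
  qed
  have cut: "mulL (\<lambda>\<xi>. \<xi> $ i * fcut N \<xi>) h = mulL (\<lambda>\<xi>. \<xi> $ i * fcut N \<xi>) (mulL (fcut N) h)" for h
    by (subst mulL_mult_fun[OF b(2,1), symmetric]) (simp add: mult.assoc fcut_idem)
  have "mulL (fcut N) (four (weak_deriv \<alpha> f)) = scaleC \<i> (mulL (\<lambda>\<xi>. \<xi> $ i * fcut N \<xi>) (four (weak_deriv \<beta> f)))"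
    using four_weak_deriv_step[OF wd[OF \<beta>], of i "weak_deriv \<alpha> f" N] wd[OF Suc.prems] \<alpha> by simp
  also have "\<dots> = scaleC \<i> (mulL (\<lambda>\<xi>. \<xi> $ i * fcut N \<xi>) (scaleC (\<i> ^ sum \<beta> UNIV) (mulL (\<lambda>\<xi>. multi_power \<xi> \<beta> * fcut N \<xi>) (four f))))"
    by (subst cut) (simp only: Suc.hyps(1)[OF k' \<beta>])
  also have "\<dots> = scaleC (\<i> ^ sum \<alpha> UNIV) (mulL (\<lambda>\<xi>. multi_power \<xi> \<alpha> * fcut N \<xi>) (four f))"
  proof -
    have e: "(\<lambda>\<xi>. multi_power \<xi> \<alpha> * fcut N \<xi>) = (\<lambda>\<xi>. (\<xi> $ i * fcut N \<xi>) * (multi_power \<xi> \<beta> * fcut N \<xi>))"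
      by (auto simp: mp fcut_def)
    show ?thesis unfolding e mulL_mult_fun[OF b(2,3)] mulL_scaleC[OF b(2)] scaleC_scaleC s power_Suc ..
  qed
  finally show ?case .
qed

section \<open>Absolutely continuous functions of time\<close>

text \<open>
  Absolute continuity with derivative \<open>g\<close>, expressed by integrals. All differentiation in time is done in
  this form, because the derivative exists only as an integrable function.
\<close>

definition primitive_on :: "real \<Rightarrow> (real \<Rightarrow> 'a::{banach, second_countable_topology}) \<Rightarrow> (real \<Rightarrow> 'a) \<Rightarrow> bool" where
  "primitive_on T U g \<longleftrightarrow> integrable (lebesgue_on {0..T}) g \<and>
     (\<forall>s t. 0 \<le> s \<longrightarrow> s \<le> t \<longrightarrow> t \<le> T \<longrightarrow> U t - U s = (\<integral>r. indicator {s<..t} r *\<^sub>R g r \<partial>lebesgue_on {0..T}))"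

lemma primitive_onD:
  assumes "primitive_on T U g"
  shows "integrable (lebesgue_on {0..T}) g"
    "0 \<le> s \<Longrightarrow> s \<le> t \<Longrightarrow> t \<le> T \<Longrightarrow> U t - U s = (\<integral>r. indicator {s<..t} r *\<^sub>R g r \<partial>lebesgue_on {0..T})"
  using assms by (auto simp: primitive_on_def)

lemma borel_measurable_time: "(f :: real \<Rightarrow> 'b::topological_space) \<in> borel_measurable borel \<Longrightarrow> f \<in> borel_measurable (lebesgue_on {0..T})"
  by (intro measurable_restrict_space1 measurable_completion) simp

lemma integrable_indicator_time:
  fixes g :: "real \<Rightarrow> 'a::{banach, second_countable_topology}"
  assumes "integrable (lebesgue_on {0..T}) g" "A \<in> sets borel"
  shows "integrable (lebesgue_on {0..T}) (\<lambda>r. indicator A r *\<^sub>R g r)"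
proof (rule Bochner_Integration.integrable_bound[OF assms(1)])
  have "(indicator A :: real \<Rightarrow> real) \<in> borel_measurable (lebesgue_on {0..T})"
    using assms(2) by (intro borel_measurable_time) simp
  then show "(\<lambda>r. indicator A r *\<^sub>R g r) \<in> borel_measurable (lebesgue_on {0..T})"
    by (rule borel_measurable_scaleR[OF _ borel_measurable_integrable[OF assms(1)]])
qed (auto simp: indicator_def)

lemma primitive_on_linear:
  assumes "bounded_linear L" "primitive_on T U g" shows "primitive_on T (\<lambda>t. L (U t)) (\<lambda>t. L (g t))"
  unfolding primitive_on_def
proof (intro conjI allI impI)
  note g = primitive_onD[OF assms(2)]
  show "integrable (lebesgue_on {0..T}) (\<lambda>t. L (g t))"
    using assms(1) g(1) by (rule integrable_bounded_linear)
  fix s t assume *: "0 \<le> s" "s \<le> t" "t \<le> T"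
  have "L (U t) - L (U s) = L (\<integral>r. indicator {s<..t} r *\<^sub>R g r \<partial>lebesgue_on {0..T})"
    by (simp add: g(2)[OF *, symmetric] linear_simps[OF assms(1)])
  also have "\<dots> = (\<integral>r. L (indicator {s<..t} r *\<^sub>R g r) \<partial>lebesgue_on {0..T})"
    by (intro integral_bounded_linear[symmetric] assms(1) integrable_indicator_time g(1)) simp
  finally show "L (U t) - L (U s) = (\<integral>r. indicator {s<..t} r *\<^sub>R L (g r) \<partial>lebesgue_on {0..T})"
    by (simp add: linear_simps[OF assms(1)])
qed

lemma primitive_on_add:
  assumes "primitive_on T U g" "primitive_on T V h" shows "primitive_on T (\<lambda>t. U t + V t) (\<lambda>t. g t + h t)"
  unfolding primitive_on_def
proof (intro conjI allI impI)
  note g = primitive_onD[OF assms(1)] and h = primitive_onD[OF assms(2)]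
  show "integrable (lebesgue_on {0..T}) (\<lambda>t. g t + h t)" using g h by simp
  fix s t assume *: "0 \<le> s" "s \<le> t" "t \<le> T"
  show "U t + V t - (U s + V s) = (\<integral>r. indicator {s<..t} r *\<^sub>R (g r + h r) \<partial>lebesgue_on {0..T})"
    using g(2)[OF *] h(2)[OF *]
    by (simp add: scaleR_add_right Bochner_Integration.integral_add integrable_indicator_time g h algebra_simps)
qed

lemma primitive_on_const: "primitive_on T (\<lambda>_. c) (\<lambda>_. 0)"
  by (simp add: primitive_on_def)

lemma primitive_on_sum:
  "(\<And>i. i \<in> A \<Longrightarrow> primitive_on T (U i) (g i)) \<Longrightarrow> primitive_on T (\<lambda>t. \<Sum>i\<in>A. U i t) (\<lambda>t. \<Sum>i\<in>A. g i t)"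
  by (induction A rule: infinite_finite_induct) (auto intro: primitive_on_const primitive_on_add)

lemma primitive_on_exists:
  assumes g: "integrable (lebesgue_on {0..T}) g"
  shows "primitive_on T (\<lambda>t. c + (\<integral>r. indicator {0<..t} r *\<^sub>R g r \<partial>lebesgue_on {0..T})) g"
  unfolding primitive_on_def
proof (intro conjI allI impI g)
  fix s t :: real assume *: "0 \<le> s" "s \<le> t" "t \<le> T"
  have "indicator {0<..t} r *\<^sub>R g r = indicator {0<..s} r *\<^sub>R g r + indicator {s<..t} r *\<^sub>R g r" for r
    using * by (auto simp: indicator_def)
  then show "c + (\<integral>r. indicator {0<..t} r *\<^sub>R g r \<partial>lebesgue_on {0..T}) - (c + (\<integral>r. indicator {0<..s} r *\<^sub>R g r \<partial>lebesgue_on {0..T}))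
     = (\<integral>r. indicator {s<..t} r *\<^sub>R g r \<partial>lebesgue_on {0..T})"
    by (simp add: Bochner_Integration.integral_add integrable_indicator_time g)
qed

lemma AE_time_neq: "AE r in lebesgue_on {0..T}. r \<noteq> (t::real)"
proof -
  have "AE r in lebesgue. r \<noteq> t" by (intro AE_completion AE_lborel_singleton)
  then have "AE r in lebesgue. r \<in> {0..T} \<longrightarrow> r \<noteq> t" by eventually_elim simp
  then show ?thesis by (simp add: AE_restrict_space_iff)
qed

text \<open>
  Dominated convergence, as a single time is a null set.
\<close>

lemma primitive_on_continuous:
  assumes "primitive_on T U g" shows "continuous_on {0..T} U"
  unfolding continuous_on_sequentially
proof (intro allI ballI impI)
  note g = primitive_onD[OF assms]
  fix x t assume t: "t \<in> {0..T}" and "(\<forall>n. x n \<in> {0..T}) \<and> x \<longlonglongrightarrow> t"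
  then have x: "x n \<in> {0..T}" "x \<longlonglongrightarrow> t" for n by auto
  have U: "U r = U 0 + (\<integral>s. indicator {0<..r} s *\<^sub>R g s \<partial>lebesgue_on {0..T})" if "r \<in> {0..T}" for r
    using g(2)[of 0 r] that by (simp add: algebra_simps)
  have "(\<lambda>n. \<integral>s. indicator {0<..x n} s *\<^sub>R g s \<partial>lebesgue_on {0..T}) \<longlonglongrightarrow> (\<integral>s. indicator {0<..t} s *\<^sub>R g s \<partial>lebesgue_on {0..T})"
  proof (rule integral_dominated_convergence[OF _ _ integrable_norm[OF g(1)]])
    show "AE s in lebesgue_on {0..T}. (\<lambda>n. indicator {0<..x n} s *\<^sub>R g s) \<longlonglongrightarrow> indicator {0<..t} s *\<^sub>R g s"
      using AE_time_neq[of t T]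
    proof eventually_elim
      case (elim s)
      have "\<forall>\<^sub>F n in sequentially. (s \<le> x n) = (s \<le> t)"
      proof (cases "s < t")
        case True
        then show ?thesis using order_tendstoD(1)[OF x(2), of s] by (auto elim!: eventually_mono)
      next
        case False
        with elim have "t < s" by auto
        then show ?thesis using order_tendstoD(2)[OF x(2), of s] by (auto elim!: eventually_mono)
      qed
      then have "\<forall>\<^sub>F n in sequentially. indicator {0<..x n} s *\<^sub>R g s = indicator {0<..t} s *\<^sub>R g s"
        by eventually_elim (auto simp: indicator_def)
      then show ?case by (rule tendsto_eventually)
    qed
    show "AE s in lebesgue_on {0..T}. norm (indicator {0<..x n} s *\<^sub>R g s) \<le> norm (g s)" for n
      by (auto simp: indicator_def)
  qed (use integrable_indicator_time[OF g(1)] in auto)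
  then have "(\<lambda>n. U 0 + (\<integral>s. indicator {0<..x n} s *\<^sub>R g s \<partial>lebesgue_on {0..T})) \<longlonglongrightarrow> U 0 + (\<integral>s. indicator {0<..t} s *\<^sub>R g s \<partial>lebesgue_on {0..T})"
    by (intro tendsto_intros)
  then show "(U \<circ> x) \<longlonglongrightarrow> U t"
    using U[OF t] U[OF x(1)] by (simp add: o_def)
qed

lemma continuous_time_measurable:
  fixes f :: "real \<Rightarrow> 'a::{second_countable_topology, real_normed_vector}"
  assumes "continuous_on {0..T} f" shows "f \<in> borel_measurable (lebesgue_on {0..T})"
  using assms by (intro continuous_imp_measurable_on_sets_lebesgue) auto

lemma primitive_on_C1:
  fixes f :: "real \<Rightarrow> real"
  assumes f: "\<And>t. t \<in> {0..T} \<Longrightarrow> (f has_real_derivative f' t) (at t within {0..T})"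
    and c: "continuous_on {0..T} f'"
  shows "primitive_on T f f'"
  unfolding primitive_on_def
proof (intro conjI allI impI)
  have lb: "integrable (lebesgue_on {0..T}) (\<lambda>r. indicator {s<..t} r *\<^sub>R f' r)
     \<and> (\<integral>r. indicator {s<..t} r *\<^sub>R f' r \<partial>lebesgue_on {0..T}) = f t - f s"
    if *: "0 \<le> s" "s \<le> t" "t \<le> T" for s t
  proof -
    have c': "continuous_on {s..t} f'" by (rule continuous_on_subset[OF c]) (use * in auto)
    have F: "(\<integral>r. indicator {s..t} r *\<^sub>R f' r \<partial>lborel) = f t - f s"
    proof (rule integral_FTC_atLeastAtMost[OF *(2) _ c'])
      fix x assume "s \<le> x" "x \<le> t"
      then show "(f has_vector_derivative f' x) (at x within {s..t})"
        using has_field_derivative_subset[OF f[of x], of "{s..t}"] * by (auto simp: has_real_derivative_iff_has_vector_derivative)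
    qed
    have i: "integrable lborel (\<lambda>r. indicator {s..t} r *\<^sub>R f' r)"
      using borel_integrable_atLeastAtMost'[OF c'] by (simp add: set_integrable_def)
    then have m: "(\<lambda>r. indicator {s..t} r *\<^sub>R f' r) \<in> borel_measurable lborel" by auto
    have il: "integrable lebesgue (\<lambda>r. indicator {s..t} r *\<^sub>R f' r)" "(\<integral>r. indicator {s..t} r *\<^sub>R f' r \<partial>lebesgue) = f t - f s"
      using i F integrable_completion[OF m] integral_completion[OF m] by auto
    have ae: "AE r in lebesgue. indicator {0..T} r *\<^sub>R (indicator {s<..t} r *\<^sub>R f' r) = indicator {s..t} r *\<^sub>R f' r"
    proof -
      have "AE r in lebesgue. r \<noteq> s" by (intro AE_completion AE_lborel_singleton)
      then show ?thesis by eventually_elim (use * in \<open>auto simp: indicator_def\<close>)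
    qed
    have "(\<lambda>r. indicator {s..t} r *\<^sub>R f' r) \<in> borel_measurable lebesgue" using il(1) by auto
    moreover have "(\<lambda>r. indicator {0..T} r *\<^sub>R (indicator {s<..t} r *\<^sub>R f' r)) \<in> borel_measurable lebesgue"
    proof (subst borel_measurable_restrict_space_iff[symmetric])
      have "(indicator {s<..t} :: real \<Rightarrow> real) \<in> borel_measurable (lebesgue_on {0..T})"
        by (rule borel_measurable_time) simp
      then show "(\<lambda>r. indicator {s<..t} r *\<^sub>R f' r) \<in> borel_measurable (lebesgue_on {0..T})"
        by (rule borel_measurable_scaleR[OF _ continuous_time_measurable[OF c]])
    qed simp
    ultimately show ?thesis
      using il ae integrable_cong_AE[OF _ _ ae] integral_cong_AE[OF _ _ ae]
      by (auto simp: integrable_restrict_space integral_restrict_space)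
  qed
  show "f t - f s = (\<integral>r. indicator {s<..t} r *\<^sub>R f' r \<partial>lebesgue_on {0..T})" if "0 \<le> s" "s \<le> t" "t \<le> T" for s t
    using lb[OF that] by simp
  show "integrable (lebesgue_on {0..T}) f'"
  proof (cases "0 \<le> T")
    case True
    have "AE r in lebesgue_on {0..T}. indicator {0<..T} r *\<^sub>R f' r = f' r"
      using AE_time_neq[of 0 T] AE_space by eventually_elim (auto simp: indicator_def)
    moreover have "f' \<in> borel_measurable (lebesgue_on {0..T})" by (rule continuous_time_measurable[OF c])
    ultimately show ?thesis
      using lb[of 0 T] True by (subst integrable_cong_AE[of _ _ "\<lambda>r. indicator {0<..T} r *\<^sub>R f' r"]) auto
  next
    case False
    then have "space (lebesgue_on {0..T}) = {}" by simp
    then show ?thesis by (simp add: integrable_iff_bounded nn_integral_empty measurable_def)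
  qed
qed

text \<open>
  The bound is additive over adjacent intervals, and \<open>[a, b]\<close> is a finite union of short ones.
\<close>

lemma chaining:
  fixes D :: "real \<Rightarrow> 'a::real_normed_vector" and m :: "real \<Rightarrow> real"
  assumes d: "d > 0" and ab: "a \<le> b"
    and loc: "\<And>s t. a \<le> s \<Longrightarrow> s \<le> t \<Longrightarrow> t \<le> b \<Longrightarrow> t - s \<le> d \<Longrightarrow> norm (D t - D s) \<le> m t - m s"
  shows "norm (D b - D a) \<le> m b - m a"
proof -
  have "norm (D t - D a) \<le> m t - m a" if "t - a \<le> real n * d" "a \<le> t" "t \<le> b" for n t
    using that
  proof (induction n arbitrary: t)
    case 0
    then show ?case by simp
  next
    case (Suc n)
    define c where "c = max a (t - d)"
    have c: "a \<le> c" "c \<le> t" "t - c \<le> d" "c - a \<le> real n * d"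
      using Suc.prems d by (auto simp: c_def max_def algebra_simps)
    have "norm (D t - D c) \<le> m t - m c" using c Suc.prems by (intro loc) auto
    moreover have "norm (D c - D a) \<le> m c - m a" using c Suc.prems by (intro Suc.IH) auto
    moreover have "norm (D t - D a) \<le> norm (D t - D c) + norm (D c - D a)"
      by (rule norm_diff_triangle_ineq[of "D t" "D c" "D c" "D a", simplified])
    ultimately show ?case by linarith
  qed
  moreover obtain n where "b - a \<le> real n * d"
    using real_arch_simple[of "(b - a) / d"] d by (auto simp: field_simps)
  ultimately show ?thesis using ab by auto
qed

text \<open>
  On a short interval \<open>[x, y]\<close> the increment of \<open>p (U t) (V t)\<close> is the integral of \<open>p (g r) (V y) + p (U x) (h r)\<close>.
  By uniform continuity of \<open>U\<close> and \<open>V\<close> it differs from the integral of \<open>p (g r) (V r) + p (U r) (h r)\<close> by at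
  most a small multiple of the integral of \<open>|g| + |h|\<close>. These errors add up to a small multiple of the
  same integral over the whole interval.
\<close>

lemma primitive_on_bilinear:
  fixes p :: "'a::{banach, second_countable_topology} \<Rightarrow> 'b::{banach, second_countable_topology} \<Rightarrow> 'c::{banach, second_countable_topology}"
  assumes p: "bounded_bilinear p" and U: "primitive_on T U g" and V: "primitive_on T V h"
  shows "primitive_on T (\<lambda>t. p (U t) (V t)) (\<lambda>t. p (g t) (V t) + p (U t) (h t))"
proof -
  interpret p: bounded_bilinear p by fact
  note g = primitive_onD[OF U] and h = primitive_onD[OF V]
  let ?M = "lebesgue_on {0..T}"
  have cU: "continuous_on {0..T} U" and cV: "continuous_on {0..T} V"
    using U V by (auto intro: primitive_on_continuous)
  have [measurable]: "U \<in> borel_measurable ?M" "V \<in> borel_measurable ?M" "g \<in> borel_measurable ?M" "h \<in> borel_measurable ?M"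
    using cU cV g(1) h(1) by (auto intro: continuous_time_measurable)
  have pm [measurable]: "(\<lambda>t. p (a t) (b t)) \<in> borel_measurable ?M"
    if "a \<in> borel_measurable ?M" "b \<in> borel_measurable ?M" for a b
    by (rule borel_measurable_continuous_Pair[OF that]) (intro p.continuous_on continuous_intros)
  obtain K where K: "K > 0" "\<And>a b. norm (p a b) \<le> norm a * norm b * K"
    using p.pos_bounded by blast
  have bd: "\<exists>B. \<forall>t\<in>{0..T}. norm (f t) \<le> B" if "continuous_on {0..T} f" for f :: "real \<Rightarrow> 'd::real_normed_vector"
    using compact_imp_bounded[OF compact_continuous_image[OF that]] by (auto simp: bounded_iff)
  obtain BU BV where "\<forall>t\<in>{0..T}. norm (U t) \<le> BU" "\<forall>t\<in>{0..T}. norm (V t) \<le> BV"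
    using bd[OF cU] bd[OF cV] by blast
  note B = this[THEN bspec]
  have i1: "integrable ?M (\<lambda>t. p (g t) (b t))" if "b \<in> borel_measurable ?M" "\<And>t. t \<in> {0..T} \<Longrightarrow> norm (b t) \<le> B" for b B
  proof (rule Bochner_Integration.integrable_bound)
    show "integrable ?M (\<lambda>t. K * B * norm (g t))" using g(1) by simp
    show "AE t in ?M. norm (p (g t) (b t)) \<le> norm (K * B * norm (g t))"
    proof (rule AE_I2)
      fix t assume "t \<in> space ?M"
      then have t: "t \<in> {0..T}" by simp
      have "norm (p (g t) (b t)) \<le> norm (g t) * norm (b t) * K" by (rule K)
      also have "\<dots> \<le> norm (g t) * B * K" using K that(2)[OF t] by (intro mult_right_mono mult_left_mono) auto
      also have "\<dots> \<le> norm (K * B * norm (g t))" by (simp add: mult_ac abs_mult[symmetric] del: abs_mult)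
      finally show "norm (p (g t) (b t)) \<le> norm (K * B * norm (g t))" .
    qed
  qed (use that in measurable)
  have i2: "integrable ?M (\<lambda>t. p (b t) (h t))" if "b \<in> borel_measurable ?M" "\<And>t. t \<in> {0..T} \<Longrightarrow> norm (b t) \<le> B" for b B
  proof (rule Bochner_Integration.integrable_bound)
    show "integrable ?M (\<lambda>t. K * B * norm (h t))" using h(1) by simp
    show "AE t in ?M. norm (p (b t) (h t)) \<le> norm (K * B * norm (h t))"
    proof (rule AE_I2)
      fix t assume "t \<in> space ?M"
      then have t: "t \<in> {0..T}" by simp
      have "norm (p (b t) (h t)) \<le> norm (b t) * norm (h t) * K" by (rule K)
      also have "\<dots> \<le> B * norm (h t) * K" using K that(2)[OF t] by (intro mult_right_mono) auto
      also have "\<dots> \<le> norm (K * B * norm (h t))" by (simp add: mult_ac abs_mult[symmetric] del: abs_mult)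
      finally show "norm (p (b t) (h t)) \<le> norm (K * B * norm (h t))" .
    qed
  qed (use that in measurable)
  define G where "G t = p (g t) (V t) + p (U t) (h t)" for t
  have Gi: "integrable ?M G"
    unfolding G_def using i1[of V BV] i2[of U BU] B by auto
  define I where "I t = (\<integral>r. indicator {0<..t} r *\<^sub>R G r \<partial>?M)" for t
  define m where "m t = (\<integral>r. indicator {0<..t} r *\<^sub>R (norm (g r) + norm (h r)) \<partial>?M)" for t
  have mi: "integrable ?M (\<lambda>r. norm (g r) + norm (h r))" using g(1) h(1) by simp
  have I: "primitive_on T I G" and m: "primitive_on T m (\<lambda>r. norm (g r) + norm (h r))"
    unfolding I_def[abs_def] m_def[abs_def] using primitive_on_exists[OF Gi, of 0] primitive_on_exists[OF mi, of 0] by auto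
  have "p (U t) (V t) - p (U s) (V s) = I t - I s" if st: "0 \<le> s" "s \<le> t" "t \<le> T" for s t
  proof -
    define D where "D t = p (U t) (V t) - I t" for t
    have "norm (D t - D s) \<le> e * (m t - m s)" if e: "e > 0" for e
    proof -
      have "uniformly_continuous_on {0..T} U" "uniformly_continuous_on {0..T} V"
        using cU cV by (auto intro: compact_uniformly_continuous)
      moreover have "e / K > 0" using e K by simp
      ultimately obtain d1 d2 where d: "d1 > 0" "d2 > 0"
        "\<And>x y. x \<in> {0..T} \<Longrightarrow> y \<in> {0..T} \<Longrightarrow> dist y x < d1 \<Longrightarrow> dist (U y) (U x) < e / K"
        "\<And>x y. x \<in> {0..T} \<Longrightarrow> y \<in> {0..T} \<Longrightarrow> dist y x < d2 \<Longrightarrow> dist (V y) (V x) < e / K"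
        unfolding uniformly_continuous_on_def by metis
      define d where "d = min d1 d2 / 2"
      have "d > 0" "d < d1" "d < d2" using d by (auto simp: d_def)
      show ?thesis
        unfolding right_diff_distrib
      proof (rule chaining[OF \<open>d > 0\<close> st(2)])
        fix x y assume xy: "s \<le> x" "x \<le> y" "y \<le> t" "y - x \<le> d"
        have xyT: "0 \<le> x" "x \<le> y" "y \<le> T" using xy st by auto
        let ?i = "\<lambda>r. indicator {x<..y} r :: real"
        have "p (U y) (V y) - p (U x) (V x) = p (U y - U x) (V y) + p (U x) (V y - V x)"
          by (simp add: p.diff_left p.diff_right)
        also have "\<dots> = (\<integral>r. p (?i r *\<^sub>R g r) (V y) \<partial>?M) + (\<integral>r. p (U x) (?i r *\<^sub>R h r) \<partial>?M)"
          unfolding g(2)[OF xyT] h(2)[OF xyT]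
          by (intro arg_cong2[where f = "(+)"] integral_bounded_linear[symmetric] p.bounded_linear_left p.bounded_linear_right
              integrable_indicator_time g(1) h(1)) auto
        also have "\<dots> = (\<integral>r. ?i r *\<^sub>R (p (g r) (V y) + p (U x) (h r)) \<partial>?M)"
          by (subst Bochner_Integration.integral_add[symmetric])
             (auto simp: p.scaleR_left p.scaleR_right scaleR_add_right
               intro!: integrable_indicator_time i1[of "\<lambda>_. V y" "norm (V y)"] i2[of "\<lambda>_. U x" "norm (U x)"])
        finally have "D y - D x = (\<integral>r. ?i r *\<^sub>R (p (g r) (V y) + p (U x) (h r)) \<partial>?M) - (\<integral>r. ?i r *\<^sub>R G r \<partial>?M)"
          unfolding D_def using primitive_onD(2)[OF I xyT] by (simp add: algebra_simps)
        also have "\<dots> = (\<integral>r. ?i r *\<^sub>R (p (g r) (V y) + p (U x) (h r)) - ?i r *\<^sub>R G r \<partial>?M)"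
          by (intro Bochner_Integration.integral_diff[symmetric] integrable_indicator_time Gi Bochner_Integration.integrable_add
              i1[of "\<lambda>_. V y" "norm (V y)"] i2[of "\<lambda>_. U x" "norm (U x)"]) auto
        also have "norm \<dots> \<le> (\<integral>r. e * (?i r *\<^sub>R (norm (g r) + norm (h r))) \<partial>?M)"
        proof (rule order_trans[OF integral_norm_bound integral_mono[OF integrable_norm]])
          show "integrable ?M (\<lambda>r. ?i r *\<^sub>R (p (g r) (V y) + p (U x) (h r)) - ?i r *\<^sub>R G r)"
            by (intro Bochner_Integration.integrable_diff integrable_indicator_time Gi Bochner_Integration.integrable_add
              i1[of "\<lambda>_. V y" "norm (V y)"] i2[of "\<lambda>_. U x" "norm (U x)"]) auto
          show "integrable ?M (\<lambda>r. e * (?i r *\<^sub>R (norm (g r) + norm (h r))))"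
            by (intro integrable_mult_right integrable_indicator_time mi) auto
          fix r assume "r \<in> space ?M"
          show "norm (?i r *\<^sub>R (p (g r) (V y) + p (U x) (h r)) - ?i r *\<^sub>R G r) \<le> e * (?i r *\<^sub>R (norm (g r) + norm (h r)))"
          proof (cases "r \<in> {x<..y}")
            case True
            then have r: "r \<in> {0..T}" "dist y r < d2" "dist r x < d1"
              using xy st \<open>d < d1\<close> \<open>d < d2\<close> by (auto simp: dist_real_def)
            have VV: "norm (V y - V r) \<le> e / K" using d(4)[of r y] r xy st by (auto simp: dist_norm)
            have UU: "norm (U x - U r) \<le> e / K" using d(3)[of x r] r xy st by (auto simp: dist_norm norm_minus_commute)
            have "?i r *\<^sub>R (p (g r) (V y) + p (U x) (h r)) - ?i r *\<^sub>R G r = p (g r) (V y - V r) + p (U x - U r) (h r)"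
              using True by (simp add: G_def p.diff_left p.diff_right)
            also have "norm \<dots> \<le> norm (g r) * norm (V y - V r) * K + norm (U x - U r) * norm (h r) * K"
              by (intro norm_triangle_mono K)
            also have "\<dots> \<le> norm (g r) * (e / K) * K + (e / K) * norm (h r) * K"
              using K(1) VV UU by (intro add_mono mult_right_mono mult_left_mono) auto
            also have "\<dots> = e * (?i r *\<^sub>R (norm (g r) + norm (h r)))"
              using True K(1) by (simp add: field_simps)
            finally show ?thesis .
          qed simp
        qed
        also have "\<dots> = e * (m y - m x)"
          using primitive_onD(2)[OF m xyT] by simp
        finally show "norm (D y - D x) \<le> e * m y - e * m x" by (simp add: algebra_simps)
      qed
    qed
    note bound = this
    have "m t - m s \<ge> 0"
      unfolding primitive_onD(2)[OF m st] by (intro integral_nonneg_AE) auto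
    have "norm (D t - D s) \<le> 0"
    proof (rule field_le_epsilon)
      fix e :: real assume "e > 0"
      have "norm (D t - D s) \<le> e / (m t - m s + 1) * (m t - m s)"
        using \<open>e > 0\<close> \<open>m t - m s \<ge> 0\<close> by (intro bound) auto
      also have "\<dots> \<le> e" using \<open>e > 0\<close> \<open>m t - m s \<ge> 0\<close> by (simp add: field_simps)
      finally show "norm (D t - D s) \<le> 0 + e" by simp
    qed
    then show ?thesis by (simp add: D_def algebra_simps)
  qed
  with primitive_onD(2)[OF I] Gi show ?thesis
    unfolding primitive_on_def G_def by auto
qed

section \<open>Weak time derivatives\<close>

lemma integrable_const_time: "integrable (lebesgue_on {0..T::real}) (\<lambda>_. c :: real)"
proof -
  have "primitive_on T (\<lambda>t. c * t) (\<lambda>_. c)"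
    by (rule primitive_on_C1) (auto intro!: derivative_eq_intros)
  then show ?thesis by (rule primitive_onD(1))
qed

lemma integrable_continuous_time:
  fixes f :: "real \<Rightarrow> 'a::{banach, second_countable_topology}"
  assumes c: "continuous_on {0..T} f" shows "integrable (lebesgue_on {0..T}) f"
proof -
  obtain B where B: "\<forall>t\<in>{0..T}. norm (f t) \<le> B"
    using compact_imp_bounded[OF compact_continuous_image[OF c]] unfolding bounded_iff by auto
  show ?thesis
    by (rule Bochner_Integration.integrable_bound[OF integrable_const_time[of T B]])
       (use B c in \<open>auto intro!: AE_I2 continuous_time_measurable order_trans[OF _ abs_ge_self]\<close>)
qed

lemma integrable_scaleR_continuous:
  fixes z :: "real \<Rightarrow> 'a::{banach, second_countable_topology}" and f :: "real \<Rightarrow> real"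
  assumes c: "continuous_on {0..T} f" and z: "integrable (lebesgue_on {0..T}) z"
  shows "integrable (lebesgue_on {0..T}) (\<lambda>t. f t *\<^sub>R z t)"
proof -
  obtain B where B: "\<forall>t\<in>{0..T}. norm (f t) \<le> B"
    using compact_imp_bounded[OF compact_continuous_image[OF c]] unfolding bounded_iff by auto
  show ?thesis
  proof (rule Bochner_Integration.integrable_bound[OF integrable_mult_right[OF integrable_norm[OF z], of B]])
    show "(\<lambda>t. f t *\<^sub>R z t) \<in> borel_measurable (lebesgue_on {0..T})"
      using z continuous_time_measurable[OF c] by (intro borel_measurable_scaleR) auto
    show "AE t in lebesgue_on {0..T}. norm (f t *\<^sub>R z t) \<le> norm (B * norm (z t))"
      using B by (intro AE_I2) (auto simp: abs_mult intro!: mult_right_mono order_trans[OF _ abs_ge_self])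
  qed
qed

lemma continuous_AE_zero:
  fixes f :: "real \<Rightarrow> 'a::real_normed_vector"
  assumes c: "continuous_on {0..T} f" and T: "T > 0" and ae: "AE t in lebesgue_on {0..T}. f t = 0"
    and t0: "t0 \<in> {0..T}"
  shows "f t0 = 0"
proof (rule ccontr)
  assume "f t0 \<noteq> 0"
  then have "norm (f t0) > 0" by simp
  then obtain d where d: "d > 0" "\<And>t. t \<in> {0..T} \<Longrightarrow> dist t t0 < d \<Longrightarrow> dist (f t) (f t0) < norm (f t0)"
    using c t0 unfolding continuous_on_iff by metis
  define a b where "a = max 0 (t0 - d)" and "b = min T (t0 + d)"
  have ab: "a < b" using d(1) t0 T by (auto simp: a_def b_def)
  have ne: "f t \<noteq> 0" if "t \<in> {a<..<b}" for t
  proof -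
    have "t \<in> {0..T}" "dist t t0 < d" using that by (auto simp: a_def b_def dist_real_def)
    then have "dist (f t) (f t0) < norm (f t0)" by (rule d)
    then show ?thesis by (auto simp: dist_norm)
  qed
  have "AE t in lebesgue. t \<in> {0..T} \<longrightarrow> f t = 0"
    using ae by (simp add: AE_restrict_space_iff)
  then have "AE t in lebesgue. t \<notin> {a<..<b}"
    by eventually_elim (use ne in \<open>auto simp: a_def b_def\<close>)
  then have "{a<..<b} \<in> null_sets lebesgue"
    by (subst AE_iff_null_sets) auto
  then have "emeasure lebesgue {a<..<b} = 0" by auto
  then show False using ab by simp
qed

text \<open>
  The Borel sets over which \<open>y\<close> integrates to 0 form a Dynkin system that contains all half-lines, and
  every Lebesgue measurable set differs from a Borel set by a null set.
\<close>

lemma AE_zero_of_intervals: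
  fixes y :: "real \<Rightarrow> 'a::{banach, second_countable_topology}"
  assumes T: "T > 0" and y: "integrable (lebesgue_on {0..T}) y"
    and ab: "\<And>a b. 0 < a \<Longrightarrow> a < b \<Longrightarrow> b < T \<Longrightarrow> (\<integral>r. indicator {a<..<b} r *\<^sub>R y r \<partial>lebesgue_on {0..T}) = 0"
  shows "AE t in lebesgue_on {0..T}. y t = 0"
proof -
  let ?M = "lebesgue_on {0..T}"
  define Y where "Y t = 0 + (\<integral>r. indicator {0<..t} r *\<^sub>R y r \<partial>?M)" for t
  have Y: "primitive_on T Y y" unfolding Y_def[abs_def] by (rule primitive_on_exists[OF y])
  have cY: "continuous_on {0..T} Y" by (rule primitive_on_continuous[OF Y])
  have yi: "integrable ?M (\<lambda>r. indicator A r *\<^sub>R y r)" if "A \<in> sets borel" for A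
    using y that by (rule integrable_indicator_time)
  have cong: "(\<integral>r. indicator A r *\<^sub>R y r \<partial>?M) = (\<integral>r. indicator B r *\<^sub>R y r \<partial>?M)"
    if "A \<in> sets borel" "B \<in> sets borel" "\<And>r. r \<in> {0..T} \<Longrightarrow> r \<noteq> s \<Longrightarrow> r \<in> A \<longleftrightarrow> r \<in> B" for A B s
  proof (rule integral_cong_AE)
    show "AE r in ?M. indicator A r *\<^sub>R y r = indicator B r *\<^sub>R y r"
      using AE_time_neq[of s T] AE_space
    proof eventually_elim
      case (elim r)
      with that(3)[of r] show ?case by (simp add: indicator_def)
    qed
  qed (use yi that in auto)
  have Yab: "Y a = Y b" if "0 < a" "a \<le> b" "b < T" for a b
  proof (cases "a = b")
    case False
    have "Y b - Y a = (\<integral>r. indicator {a<..b} r *\<^sub>R y r \<partial>?M)"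
      using that by (intro primitive_onD(2)[OF Y]) auto
    also have "\<dots> = (\<integral>r. indicator {a<..<b} r *\<^sub>R y r \<partial>?M)"
      by (rule cong[of _ _ b]) auto
    finally show ?thesis using ab[of a b] that False by simp
  qed simp
  have "Y t = Y (T / 2)" if "t \<in> {0..T}" for t
  proof -
    have cl: "closure {0<..<T} = {0..T}" using T by simp
    have "Y r = Y (T / 2)" if "r \<in> {0<..<T}" for r
      using Yab[of r "T / 2"] Yab[of "T / 2" r] that T by (cases "r \<le> T / 2") auto
    then show ?thesis
      by (rule continuous_constant_on_closure[of "{0<..<T}" Y, unfolded cl, OF cY]) (use that in auto)
  qed
  moreover have "Y 0 = 0" by (simp add: Y_def)
  ultimately have Y0: "Y t = 0" if "t \<in> {0..T}" for t using that T by (metis atLeastAtMost_iff less_imp_le order_refl)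
  have atMost: "(\<integral>r. indicator {..x} r *\<^sub>R y r \<partial>?M) = 0" for x
  proof -
    have "(\<integral>r. indicator {..x} r *\<^sub>R y r \<partial>?M) = (\<integral>r. indicator {0<..max 0 (min x T)} r *\<^sub>R y r \<partial>?M)"
      by (rule cong[of _ _ 0]) auto
    also have "\<dots> = Y (max 0 (min x T))" by (simp add: Y_def)
    also have "\<dots> = 0" using T by (intro Y0) auto
    finally show ?thesis .
  qed
  have total: "(\<integral>r. y r \<partial>?M) = 0"
  proof -
    have "(\<integral>r. y r \<partial>?M) = (\<integral>r. indicator {..T} r *\<^sub>R y r \<partial>?M)"
      by (intro Bochner_Integration.integral_cong) auto
    then show ?thesis by (simp add: atMost)
  qed
  have borel: "(\<integral>r. indicator A r *\<^sub>R y r \<partial>?M) = 0" if "A \<in> sets borel" for A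
  proof -
    have "Int_stable (range (\<lambda>x::real. {..x}))" by (auto simp: Int_stable_def)
    moreover have "range (\<lambda>x::real. {..x}) \<subseteq> Pow UNIV" by simp
    moreover have "A \<in> sigma_sets UNIV (range (\<lambda>x::real. {..x}))" using that by (simp add: borel_eq_atMost)
    ultimately show ?thesis
    proof (induction rule: sigma_sets_induct_disjoint)
      case (compl A)
      then have A: "A \<in> sets borel" by (simp add: borel_eq_atMost)
      have "(\<integral>r. indicator (UNIV - A) r *\<^sub>R y r \<partial>?M) = (\<integral>r. y r - indicator A r *\<^sub>R y r \<partial>?M)"
        by (intro Bochner_Integration.integral_cong) (auto simp: indicator_def)
      also have "\<dots> = 0" using compl y yi[OF A] total by (simp add: Bochner_Integration.integral_diff)
      finally show ?case .
    next
      case (union A)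
      then have A: "A i \<in> sets borel" for i by (auto simp: borel_eq_atMost)
      have "set_lebesgue_integral ?M ((\<Union>i. A i) \<inter> {0..T}) y = (\<Sum>i. set_lebesgue_integral ?M (A i \<inter> {0..T}) y)"
        unfolding Int_UN_distrib2 UN_extend_simps(4)
      proof (rule lebesgue_integral_countable_add)
        show "A i \<inter> {0..T} \<in> sets ?M" for i using A[of i] by (auto simp: sets_restrict_space)
        show "A i \<inter> {0..T} \<inter> (A j \<inter> {0..T}) = {}" if "i \<noteq> j" for i j
          using union(1) that by (auto simp: disjoint_family_on_def)
        show "set_integrable ?M (\<Union>i. A i \<inter> {0..T}) y"
          unfolding set_integrable_def using A by (intro yi) auto
      qed
      moreover have "set_lebesgue_integral ?M (B \<inter> {0..T}) y = (\<integral>r. indicator B r *\<^sub>R y r \<partial>?M)" for B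
        unfolding set_lebesgue_integral_def by (intro Bochner_Integration.integral_cong) (auto simp: indicator_def)
      ultimately show ?case using union(3) by simp
    qed (use atMost in auto)
  qed
  have "finite_measure ?M"
    by (rule finite_measure_lebesgue_on) simp
  then have sf: "sigma_finite_measure ?M" by (rule finite_measure.axioms(1))
  show ?thesis
  proof (rule sigma_finite_measure.density_unique_banach[OF sf y])
    fix A assume "A \<in> sets ?M"
    then have A: "A \<in> sets lebesgue" "A \<subseteq> {0..T}" by (auto simp: sets_restrict_space)
    define B where "B = main_part lborel A"
    have B: "B \<in> sets borel" using main_part_sets[of A lborel] A by (simp add: B_def)
    have "AE x in lebesgue. x \<notin> null_part lborel A"
    proof -
      obtain N where N: "N \<in> null_sets lborel" "null_part lborel A \<subseteq> N" using null_part[OF A(1)] by blast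
      have "AE x in lebesgue. x \<notin> N" by (intro AE_completion AE_not_in N)
      then show ?thesis by eventually_elim (use N in auto)
    qed
    then have "AE x in lebesgue. x \<in> A \<longleftrightarrow> x \<in> B"
      by eventually_elim (use main_part_null_part_Un[OF A(1)] in \<open>auto simp: B_def\<close>)
    then have "AE x in ?M. x \<in> A \<longleftrightarrow> x \<in> B"
      by (subst AE_restrict_space_iff) auto
    then have "AE x in ?M. indicator A x *\<^sub>R y x = indicator B x *\<^sub>R y x"
      by eventually_elim (simp add: indicator_def)
    moreover have "(\<lambda>x. indicator A x *\<^sub>R y x) \<in> borel_measurable ?M"
      using \<open>A \<in> sets ?M\<close> y by (intro borel_measurable_scaleR) auto
    ultimately have "set_lebesgue_integral ?M A y = (\<integral>r. indicator B r *\<^sub>R y r \<partial>?M)"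
      unfolding set_lebesgue_integral_def using yi[OF B] by (intro integral_cong_AE) auto
    then show "set_lebesgue_integral ?M A y = set_lebesgue_integral ?M A (\<lambda>_. 0)"
      using borel[OF B] by (simp add: set_lebesgue_integral_def)
  qed simp
qed

lemma nsmooth_exp:
  fixes f :: "real \<Rightarrow> real"
  shows "nsmooth k f \<Longrightarrow> nsmooth k (\<lambda>t. exp (c * f t))"
proof (induction k)
  case (Suc k)
  show ?case
  proof (rule nsmooth_SucI[where g = "\<lambda>t. c * vderiv f t * exp (c * f t)"])
    fix t
    have "(f has_real_derivative vderiv f t) (at t)"
      using nsmooth_SucE(1)[OF Suc.prems] by (simp add: has_real_derivative_iff_has_vector_derivative)
    then have "((\<lambda>t. exp (c * f t)) has_real_derivative c * vderiv f t * exp (c * f t)) (at t)"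
      by (auto intro!: derivative_eq_intros)
    then show "((\<lambda>t. exp (c * f t)) has_vector_derivative c * vderiv f t * exp (c * f t)) (at t)"
      by (simp add: has_real_derivative_iff_has_vector_derivative)
    show "nsmooth k (\<lambda>t. c * vderiv f t * exp (c * f t))"
      by (intro nsmooth_mult nsmooth_const Suc.IH nsmooth_SucE(2)[OF Suc.prems] nsmooth_Suc_imp[OF Suc.prems])
  qed
qed simp

lemma smooth_has_real_derivative:
  fixes f :: "real \<Rightarrow> real"
  shows "smooth f \<Longrightarrow> (f has_real_derivative vderiv f t) (at t)"
  by (simp add: has_real_derivative_iff_has_vector_derivative smooth_has_derivative)

lemma deriv_eq_vderiv:
  fixes f :: "real \<Rightarrow> real"
  shows "smooth f \<Longrightarrow> deriv f = vderiv f"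
  by (intro ext DERIV_imp_deriv smooth_has_real_derivative)

lemma time_test_functionI:
  assumes s: "smooth \<phi>" and ab: "0 < a" "b < T" and z: "\<And>t. t \<notin> {a..b} \<Longrightarrow> \<phi> t = 0"
  shows "\<phi> \<in> time_test_functions T"
  unfolding time_test_functions_def
proof (intro CollectI conjI allI)
  fix k
  have "(deriv ^^ k) \<phi> = (vderiv ^^ k) \<phi>"
    by (induction k) (auto simp: deriv_eq_vderiv smooth_vderiv_pow s)
  then show "(deriv ^^ k) \<phi> differentiable_on UNIV"
    using smooth_has_real_derivative[OF smooth_vderiv_pow[OF s, of k]]
    by (auto simp: differentiable_on_def real_differentiable_def)
  show "\<exists>K. compact K \<and> K \<subseteq> {0<..<T} \<and> (\<forall>t. t \<notin> K \<longrightarrow> \<phi> t = 0)"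
    using ab z by (intro exI[of _ "{a..b}"]) auto
qed

lemma continuous_antiderivative:
  fixes f :: "real \<Rightarrow> real"
  assumes "continuous_on UNIV f"
  obtains F where "F 0 = 0" "\<And>t. (F has_real_derivative f t) (at t)"
proof -
  define F where "F u = (LBINT y=ereal 0..ereal u. f y)" for u
  have "(F has_real_derivative f x) (at x)" for x
  proof -
    have "(F has_vector_derivative f x) (at x within {- \<bar>x\<bar> - 1..\<bar>x\<bar> + 1})"
      unfolding F_def[abs_def] by (rule interval_integral_FTC2) (auto intro: continuous_on_subset[OF assms])
    moreover have "at x within {- \<bar>x\<bar> - 1..\<bar>x\<bar> + 1} = at x" by (rule at_within_interior) auto
    ultimately show ?thesis by (simp add: has_real_derivative_iff_has_vector_derivative)
  qed
  with that[of F] show ?thesis by (simp add: F_def)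
qed

text \<open>
  The fundamental theorem of calculus; the antiderivative is once more differentiable than \<open>\<theta>\<close>.
\<close>

lemma smooth_antiderivative:
  fixes \<theta> :: "real \<Rightarrow> real"
  assumes s: "smooth \<theta>"
  obtains F where "smooth F" "vderiv F = \<theta>" "F 0 = 0" "\<And>t. (F has_real_derivative \<theta> t) (at t)"
proof -
  obtain F where F: "F 0 = 0" "\<And>t. (F has_real_derivative \<theta> t) (at t)"
    by (rule continuous_antiderivative[OF smooth_continuous[OF s]]) (rule that)
  then have d: "(F has_vector_derivative \<theta> x) (at x)" for x
    by (simp add: has_real_derivative_iff_has_vector_derivative)
  have v: "vderiv F = \<theta>" using d by (intro ext vector_derivative_at)
  have "nsmooth k F" for k
    using s nsmooth_SucI[OF d, of k] by (auto simp: smooth_def intro: nsmooth_Suc_imp)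
  then have "smooth F" by (simp add: smooth_def)
  with v F show ?thesis using that[of F] by blast
qed

text \<open>
  A test function is a derivative of a test function exactly if its integral vanishes. Subtracting a
  multiple of a fixed bump \<open>\<eta>\<^sub>0\<close> from a test function \<open>\<psi>\<close> achieves this, so the integral of \<open>\<psi> z\<close> is
  the integral of \<open>\<psi>\<close> times a constant vector \<open>c\<close>. The indicator of an interval is a bounded limit
  of such \<open>\<psi>\<close>, whence \<open>z - c\<close> integrates to 0 over all intervals.
\<close>

lemma weak_constant:
  fixes z :: "real \<Rightarrow> 'a::{banach, second_countable_topology}"
  assumes T: "T > 0" and z: "integrable (lebesgue_on {0..T}) z"
    and weak: "\<And>\<phi>. \<phi> \<in> time_test_functions T \<Longrightarrow> (\<integral>t. deriv \<phi> t *\<^sub>R z t \<partial>lebesgue_on {0..T}) = 0"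
  shows "\<exists>c. AE t in lebesgue_on {0..T}. z t = c"
proof -
  let ?M = "lebesgue_on {0..T}"
  have bz: "integrable ?M (\<lambda>t. f t *\<^sub>R z t)" if "continuous_on UNIV f" for f :: "real \<Rightarrow> real"
    by (rule integrable_scaleR_continuous[OF continuous_on_subset[OF that] z]) simp
  have bi: "integrable ?M f" if "continuous_on UNIV f" for f :: "real \<Rightarrow> real"
    by (rule integrable_continuous_time, rule continuous_on_subset[OF that]) simp
  \<comment> \<open>supported in \<open>[T / 4, 3 T / 4]\<close>\<close>
  define \<eta>0 where "\<eta>0 t = bump (4 / T * t + (-2))" for t
  have \<eta>0: "smooth \<eta>0"
    unfolding smooth_def \<eta>0_def by (intro allI nsmooth_affine) (use smooth_bump in \<open>simp add: smooth_def\<close>)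
  have \<eta>0_out: "\<eta>0 t = 0" if "t \<notin> {T/4..3*T/4}" for t
    using that T by (auto simp: \<eta>0_def field_simps intro!: bump_outside)
  have \<eta>0_nn: "\<eta>0 t \<ge> 0" for t by (auto simp: \<eta>0_def bump_def flat_def)
  define N where "N = (\<integral>t. \<eta>0 t \<partial>?M)"
  have "N \<noteq> 0"
  proof
    assume "N = 0"
    then have "AE t in ?M. \<eta>0 t = 0"
      unfolding N_def using bi[OF smooth_continuous[OF \<eta>0]] \<eta>0_nn by (subst (asm) integral_nonneg_eq_0_iff_AE) auto
    then have "\<eta>0 (T / 2) = 0"
      by (rule continuous_AE_zero[OF smooth_continuous[OF \<eta>0] T]) (use T in auto)
    then show False using T bump_0 by (simp add: \<eta>0_def)
  qed
  define c where "c = (\<integral>t. (\<eta>0 t / N) *\<^sub>R z t \<partial>?M)"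
  have key: "(\<integral>t. \<psi> t *\<^sub>R z t \<partial>?M) = (\<integral>t. \<psi> t \<partial>?M) *\<^sub>R c"
    if \<psi>: "smooth \<psi>" and ab: "0 < a" "b < T" and out: "\<And>t. t \<notin> {a..b} \<Longrightarrow> \<psi> t = 0" for \<psi> a b
  proof -
    define I where "I = (\<integral>t. \<psi> t \<partial>?M)"
    define \<theta> where "\<theta> t = \<psi> t + (- I / N) * \<eta>0 t" for t
    have s\<theta>: "smooth \<theta>" unfolding smooth_def \<theta>_def
      by (intro allI nsmooth_add nsmooth_mult nsmooth_const) (use \<psi> \<eta>0 in \<open>simp_all add: smooth_def\<close>)
    define a' b' where "a' = min a (T / 4)" and "b' = max b (3 * T / 4)"
    have ab': "0 < a'" "b' < T" "a' \<le> b'" using ab T by (auto simp: a'_def b'_def)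
    have \<theta>_out: "\<theta> t = 0" if "t < a' \<or> b' < t" for t
      using out[of t] \<eta>0_out[of t] that by (auto simp: \<theta>_def a'_def b'_def)
    obtain F where F: "smooth F" "vderiv F = \<theta>" "F 0 = 0" "\<And>t. (F has_real_derivative \<theta> t) (at t)"
      using smooth_antiderivative[OF s\<theta>] by blast
    have "primitive_on T F \<theta>"
      by (rule primitive_on_C1) (auto intro: has_field_derivative_at_within F(4) smooth_continuous s\<theta>)
    from primitive_onD(2)[OF this, of 0 T] have "F T = (\<integral>r. indicator {0<..T} r *\<^sub>R \<theta> r \<partial>?M)"
      using T F(3) by simp
    also have "\<dots> = (\<integral>r. \<theta> r \<partial>?M)"
      by (intro Bochner_Integration.integral_cong) (use \<theta>_out[of 0] ab' in \<open>auto simp: indicator_def\<close>)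
    also have "\<dots> = 0"
      unfolding \<theta>_def using bi[OF smooth_continuous[OF \<psi>]] bi[OF smooth_continuous[OF \<eta>0]] \<open>N \<noteq> 0\<close>
      by (simp add: Bochner_Integration.integral_add I_def[symmetric] N_def[symmetric])
    finally have "F T = 0" .
    have const: "F x = F y" if "\<And>t. t \<in> {x<..<y} \<Longrightarrow> \<theta> t = 0" "x < y" for x y
    proof -
      have "F y = F x"
      proof (rule DERIV_isconst2[OF that(2)])
        show "continuous_on {x..y} F" by (rule smooth_continuous[OF F(1)])
        show "DERIV F t :> 0" if "x < t" "t < y" for t using F(4)[of t] \<open>\<And>t. t \<in> {x<..<y} \<Longrightarrow> \<theta> t = 0\<close>[of t] that by simp
      qed (use that in auto)
      then show ?thesis by simp
    qed
    have "F t = 0" if "t \<notin> {a'..b'}" for t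
    proof (cases "t < a'")
      case True
      consider "t < 0" | "t = 0" | "t > 0" by linarith
      then show ?thesis
        using const[of t 0] const[of 0 t] \<theta>_out ab' True F(3) by cases auto
    next
      case False
      with that have t: "t > b'" by auto
      consider "t < T" | "t = T" | "t > T" by linarith
      then show ?thesis
        using const[of t T] const[of T t] \<theta>_out ab' t \<open>F T = 0\<close> by cases auto
    qed
    then have "F \<in> time_test_functions T"
      by (intro time_test_functionI[OF F(1) ab'(1,2)]) auto
    from weak[OF this] have "(\<integral>t. \<theta> t *\<^sub>R z t \<partial>?M) = 0"
      by (simp add: deriv_eq_vderiv[OF F(1)] F(2))
    moreover have "(\<lambda>t. \<theta> t *\<^sub>R z t) = (\<lambda>t. \<psi> t *\<^sub>R z t - I *\<^sub>R ((\<eta>0 t / N) *\<^sub>R z t))"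
      by (rule ext) (simp add: \<theta>_def algebra_simps)
    moreover have "integrable ?M (\<lambda>t. (\<eta>0 t / N) *\<^sub>R z t)"
      by (intro bz continuous_intros smooth_continuous \<eta>0) (use \<open>N \<noteq> 0\<close> in auto)
    then have "(\<integral>t. \<psi> t *\<^sub>R z t - I *\<^sub>R ((\<eta>0 t / N) *\<^sub>R z t) \<partial>?M) = (\<integral>t. \<psi> t *\<^sub>R z t \<partial>?M) - I *\<^sub>R c"
      using Bochner_Integration.integral_diff[OF bz[OF smooth_continuous[OF \<psi>]] integrable_scaleR_right[of I], of "\<lambda>t. (\<eta>0 t / N) *\<^sub>R z t"]
      by (simp only: integral_scaleR_right c_def simp_thms)
    ultimately show ?thesis by (simp only: I_def) simp
  qed
  have "AE t in ?M. z t - c = 0"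
  proof (rule AE_zero_of_intervals[OF T])
    show zc: "integrable ?M (\<lambda>t. z t - c)"
      by (intro Bochner_Integration.integrable_diff z integrable_continuous_time continuous_on_const)
    fix a b assume ab: "0 < a" "a < b" "b < T"
    define p where "p t = flat 1 (1 * t + (- a)) * flat 1 ((-1) * t + b)" for t
    have p: "nsmooth k p" for k unfolding p_def by (intro nsmooth_mult nsmooth_affine nsmooth_flat)
    have p_in: "p t > 0" if "t \<in> {a<..<b}" for t using that by (auto simp: p_def flat_def)
    have p_out: "p t = 0" if "t \<notin> {a<..<b}" for t using that by (auto simp: p_def flat_def)
    have p_nn: "p t \<ge> 0" for t using p_in[of t] p_out[of t] by fastforce
    \<comment> \<open>\<open>p\<close> is positive exactly on the interval, so \<open>1 - exp (- k p)\<close> increases to its indicator\<close>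
    define \<psi> where "\<psi> k t = 1 + (-1) * exp ((- real k) * p t)" for k t
    have \<psi>: "smooth (\<psi> k)" for k
      unfolding smooth_def \<psi>_def by (intro allI nsmooth_add nsmooth_mult nsmooth_const nsmooth_exp p)
    have \<psi>_le: "\<bar>\<psi> k t\<bar> \<le> 1" for k t
      using p_nn[of t] by (auto simp: \<psi>_def mult_nonneg_nonneg)
    have \<psi>_lim: "(\<lambda>k. \<psi> k t) \<longlonglongrightarrow> indicator {a<..<b} t" for t
    proof (cases "t \<in> {a<..<b}")
      case True
      have "norm (exp (- p t)) < 1" using p_in[OF True] by simp
      then have "(\<lambda>k. exp (- p t) ^ k) \<longlonglongrightarrow> 0" by (rule LIMSEQ_power_zero)
      then have "(\<lambda>k. 1 + (-1) * exp (- p t) ^ k) \<longlonglongrightarrow> 1 + (-1) * 0" by (intro tendsto_add tendsto_mult tendsto_const)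
      then show ?thesis using True by (simp add: \<psi>_def exp_of_nat_mult[symmetric])
    qed (simp add: \<psi>_def p_out)
    have mi: "(indicator {a<..<b} :: real \<Rightarrow> real) \<in> borel_measurable ?M" by (rule borel_measurable_time) simp
    have 1: "(\<lambda>k. \<integral>t. \<psi> k t *\<^sub>R z t \<partial>?M) \<longlonglongrightarrow> (\<integral>t. indicator {a<..<b} t *\<^sub>R z t \<partial>?M)"
    proof (rule integral_dominated_convergence[OF _ _ integrable_norm[OF z]])
      show "AE t in ?M. (\<lambda>k. \<psi> k t *\<^sub>R z t) \<longlonglongrightarrow> indicator {a<..<b} t *\<^sub>R z t"
        by (intro AE_I2 tendsto_intros \<psi>_lim)
      show "AE t in ?M. norm (\<psi> k t *\<^sub>R z t) \<le> norm (z t)" for k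
        using \<psi>_le by (intro AE_I2) (auto intro: mult_left_le_one_le)
      show "(\<lambda>t. \<psi> k t *\<^sub>R z t) \<in> borel_measurable ?M" for k
        using bz[OF smooth_continuous[OF \<psi>]] by auto
      show "(\<lambda>t. indicator {a<..<b} t *\<^sub>R z t) \<in> borel_measurable ?M"
        using z mi by (intro borel_measurable_scaleR) auto
    qed
    have 2: "(\<lambda>k. \<integral>t. \<psi> k t \<partial>?M) \<longlonglongrightarrow> (\<integral>t. indicator {a<..<b} t \<partial>?M)"
    proof (rule integral_dominated_convergence[OF _ _ bi[of "\<lambda>_. 1"]])
      show "AE t in ?M. (\<lambda>k. \<psi> k t) \<longlonglongrightarrow> indicator {a<..<b} t"
        by (intro AE_I2 \<psi>_lim)
      show "AE t in ?M. norm (\<psi> k t) \<le> 1" for k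
        using \<psi>_le by (intro AE_I2) auto
      show "\<psi> k \<in> borel_measurable ?M" for k
        using bi[OF smooth_continuous[OF \<psi>]] by auto
    qed (use mi in auto)
    have "(\<integral>t. \<psi> k t *\<^sub>R z t \<partial>?M) = (\<integral>t. \<psi> k t \<partial>?M) *\<^sub>R c" for k
    proof (rule key[OF \<psi> ab(1,3)])
      fix t assume "t \<notin> {a..b}"
      then have "p t = 0" by (intro p_out) auto
      then show "\<psi> k t = 0" by (simp add: \<psi>_def)
    qed
    with 1 have "(\<lambda>k. (\<integral>t. \<psi> k t \<partial>?M) *\<^sub>R c) \<longlonglongrightarrow> (\<integral>t. indicator {a<..<b} t *\<^sub>R z t \<partial>?M)" by simp
    moreover have "(\<lambda>k. (\<integral>t. \<psi> k t \<partial>?M) *\<^sub>R c) \<longlonglongrightarrow> (\<integral>t. indicator {a<..<b} t \<partial>?M) *\<^sub>R c"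
      by (intro tendsto_intros 2)
    ultimately have e: "(\<integral>t. indicator {a<..<b} t *\<^sub>R z t \<partial>?M) = (\<integral>t. indicator {a<..<b} t \<partial>?M) *\<^sub>R c"
      by (rule LIMSEQ_unique)
    have ii: "integrable ?M (indicator {a<..<b} :: real \<Rightarrow> real)"
      using integrable_indicator_time[OF bi[of "\<lambda>_. 1"], of "{a<..<b}"] by simp
    have "(\<integral>t. indicator {a<..<b} t *\<^sub>R (z t - c) \<partial>?M) = (\<integral>t. indicator {a<..<b} t *\<^sub>R z t \<partial>?M) - (\<integral>t. indicator {a<..<b} t *\<^sub>R c \<partial>?M)"
      unfolding scaleR_diff_right using ii integrable_indicator_time[OF z, of "{a<..<b}"]
      by (intro Bochner_Integration.integral_diff) auto
    also have "(\<integral>t. indicator {a<..<b} t *\<^sub>R c \<partial>?M) = (\<integral>t. indicator {a<..<b} t \<partial>?M) *\<^sub>R c"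
      by (rule integral_scaleR_left) (use ii in auto)
    finally show "(\<integral>t. indicator {a<..<b} t *\<^sub>R (z t - c) \<partial>?M) = 0" using e by simp
  qed
  then show ?thesis by auto
qed

lemma time_L2_integrable:
  fixes u :: "real \<Rightarrow> (real^'n::finite) L2"
  assumes u: "u \<in> time_L2 T" shows "integrable (lebesgue_on {0..T}) u"
proof -
  have "integrable (lebesgue_on {0..T}) (\<lambda>_. 1 :: real)"
    by (rule integrable_const_time)
  then have "integrable (lebesgue_on {0..T}) (\<lambda>t. 1 + (norm (u t))\<^sup>2)"
    using u by (intro Bochner_Integration.integrable_add) (auto simp: time_L2_def)
  then show ?thesis
  proof (rule Bochner_Integration.integrable_bound)
    show "u \<in> borel_measurable (lebesgue_on {0..T})" using u by (simp add: time_L2_def)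
    have "norm x \<le> norm (1 + (norm x)\<^sup>2)" for x :: "(real^'n) L2"
    proof -
      have "norm x \<le> 1 + (norm x)\<^sup>2"
        using sum_squares_bound[of "norm x" 1] norm_ge_zero[of x] unfolding power_one mult_1_right by linarith
      then show ?thesis unfolding real_norm_def by (rule order_trans) (rule abs_ge_self)
    qed
    then show "AE t in lebesgue_on {0..T}. norm (u t) \<le> norm (1 + (norm (u t))\<^sup>2)" by simp
  qed
qed

text \<open>
  The primitive of the weak derivative \<open>v\<close> has itself the weak derivative \<open>v\<close>, by the product rule. Its
  difference to \<open>u\<close> is constant almost everywhere, and a continuous representative is unique.
\<close>

lemma time_representation:
  fixes u v :: "real \<Rightarrow> (real^'n::finite) L2"
  assumes T: "T > 0" and u: "u \<in> time_L2 T" and v: "is_time_deriv T u v"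
  shows "primitive_on T (continuous_rep T u) v" "AE t in lebesgue_on {0..T}. continuous_rep T u t = u t"
proof -
  let ?M = "lebesgue_on {0..T}"
  have ui: "integrable ?M u" using u by (rule time_L2_integrable)
  have vi: "integrable ?M v" using v by (intro time_L2_integrable) (simp add: is_time_deriv_def)
  define W where "W t = 0 + (\<integral>r. indicator {0<..t} r *\<^sub>R v r \<partial>?M)" for t
  have W: "primitive_on T W v" unfolding W_def[abs_def] by (rule primitive_on_exists[OF vi])
  have cW: "continuous_on {0..T} W" by (rule primitive_on_continuous[OF W])
  have Wi: "integrable ?M W" using cW by (rule integrable_continuous_time)
  have "\<exists>c. AE t in ?M. u t - W t = c"
  proof (rule weak_constant[OF T])
    show "integrable ?M (\<lambda>t. u t - W t)" using ui Wi by simp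
    fix \<phi> assume \<phi>: "\<phi> \<in> time_test_functions T"
    then have d: "((deriv ^^ k) \<phi>) differentiable_on UNIV" for k by (simp add: time_test_functions_def)
    have D: "(\<phi> has_real_derivative deriv \<phi> t) (at t)" for t
      using d[of 0] by (auto simp: differentiable_on_def real_differentiable_def DERIV_deriv_iff_real_differentiable)
    have cd: "continuous_on UNIV (deriv \<phi>)"
      using differentiable_imp_continuous_on[OF d[of 1]] by simp
    have P: "primitive_on T \<phi> (deriv \<phi>)"
      by (rule primitive_on_C1) (auto intro: has_field_derivative_at_within D continuous_on_subset[OF cd])
    have "primitive_on T (\<lambda>t. \<phi> t *\<^sub>R W t) (\<lambda>t. deriv \<phi> t *\<^sub>R W t + \<phi> t *\<^sub>R v t)"
      by (rule primitive_on_bilinear[OF bounded_bilinear_scaleR P W])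
    from primitive_onD(1)[OF this] primitive_onD(2)[OF this, of 0 T] T
    have i: "integrable ?M (\<lambda>t. deriv \<phi> t *\<^sub>R W t + \<phi> t *\<^sub>R v t)"
      and e: "\<phi> T *\<^sub>R W T - \<phi> 0 *\<^sub>R W 0 = (\<integral>r. indicator {0<..T} r *\<^sub>R (deriv \<phi> r *\<^sub>R W r + \<phi> r *\<^sub>R v r) \<partial>?M)"
      by auto
    obtain K where K: "K \<subseteq> {0<..<T}" "\<And>t. t \<notin> K \<Longrightarrow> \<phi> t = 0"
      using \<phi> by (auto simp: time_test_functions_def)
    have "0 \<notin> K" "T \<notin> K" using K(1) by auto
    then have "\<phi> T = 0" "\<phi> 0 = 0" using K(2) by auto
    with e have "(\<integral>r. indicator {0<..T} r *\<^sub>R (deriv \<phi> r *\<^sub>R W r + \<phi> r *\<^sub>R v r) \<partial>?M) = 0" by simp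
    also have "(\<integral>r. indicator {0<..T} r *\<^sub>R (deriv \<phi> r *\<^sub>R W r + \<phi> r *\<^sub>R v r) \<partial>?M) = (\<integral>r. deriv \<phi> r *\<^sub>R W r + \<phi> r *\<^sub>R v r \<partial>?M)"
    proof (rule integral_cong_AE)
      show "AE r in ?M. indicator {0<..T} r *\<^sub>R (deriv \<phi> r *\<^sub>R W r + \<phi> r *\<^sub>R v r) = deriv \<phi> r *\<^sub>R W r + \<phi> r *\<^sub>R v r"
        using AE_time_neq[of 0 T] AE_space by eventually_elim (auto simp: indicator_def)
    qed (use i integrable_indicator_time[OF i, of "{0<..T}"] in auto)
    finally have sum0: "(\<integral>r. deriv \<phi> r *\<^sub>R W r + \<phi> r *\<^sub>R v r \<partial>?M) = 0" .
    have c1: "continuous_on {0..T} (deriv \<phi>)" by (rule continuous_on_subset[OF cd]) simp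
    have c2: "continuous_on {0..T} \<phi>" using primitive_on_continuous[OF P] .
    note I = integrable_scaleR_continuous[OF c1 ui] integrable_scaleR_continuous[OF c1 Wi] integrable_scaleR_continuous[OF c2 vi]
    have "(\<integral>r. deriv \<phi> r *\<^sub>R W r \<partial>?M) = - (\<integral>r. \<phi> r *\<^sub>R v r \<partial>?M)"
      using sum0 I by (simp add: Bochner_Integration.integral_add eq_neg_iff_add_eq_0)
    moreover have "(\<integral>t. deriv \<phi> t *\<^sub>R u t \<partial>?M) = - (\<integral>t. \<phi> t *\<^sub>R v t \<partial>?M)"
      using v \<phi> by (simp add: is_time_deriv_def)
    ultimately show "(\<integral>t. deriv \<phi> t *\<^sub>R (u t - W t) \<partial>?M) = 0"
      using I by (simp add: scaleR_diff_right Bochner_Integration.integral_diff)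
  qed
  then obtain c where c: "AE t in ?M. u t - W t = c" by blast
  define U where "U t = c + (\<integral>r. indicator {0<..t} r *\<^sub>R v r \<partial>?M)" for t
  have U: "primitive_on T U v" unfolding U_def[abs_def] by (rule primitive_on_exists[OF vi])
  have cU: "continuous_on {0..T} U" by (rule primitive_on_continuous[OF U])
  have Uu: "AE t in ?M. U t = u t"
    using c by eventually_elim (simp add: U_def W_def algebra_simps)
  have R: "continuous_on {0..T} (continuous_rep T u) \<and> (AE t in ?M. continuous_rep T u t = u t)"
    unfolding continuous_rep_def by (rule someI[of _ U]) (use cU Uu in simp)
  then show "AE t in ?M. continuous_rep T u t = u t" by simp
  have "AE t in ?M. continuous_rep T u t - U t = 0"
    using Uu conjunct2[OF R] by eventually_elim simp
  from continuous_AE_zero[OF _ T this]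
  have eq: "continuous_rep T u t = U t" if "t \<in> {0..T}" for t
    using that cU R by (auto intro!: continuous_intros)
  show "primitive_on T (continuous_rep T u) v"
    using U unfolding primitive_on_def by (auto simp: eq)
qed

section \<open>Osgood condition and averaged coefficients\<close>

text \<open>
  Monotone convergence: if the integrals over \<open>[a, b]\<close> stayed bounded as \<open>a \<longrightarrow> 0\<close>, the integral up to 0 would be finite.
\<close>

lemma divergent_truncation:
  fixes \<omega> :: "real \<Rightarrow> real"
  assumes c: "continuous_on UNIV \<omega>" and pos: "\<And>s. 0 < s \<Longrightarrow> s \<le> \<omega> s"
    and div: "(\<integral>\<^sup>+s. ennreal (1 / \<omega> s) * indicator {0<..1} s \<partial>lborel) = \<infinity>"
    and b: "0 < b" "b \<le> 1"
  shows "\<exists>a. 0 < a \<and> a < b \<and> C < integral {a..b} (\<lambda>s. 1 / \<omega> s)"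
proof (rule ccontr)
  assume neg: "\<not> ?thesis"
  have le: "integral {a..b} (\<lambda>s. 1 / \<omega> s) \<le> C" if "0 < a" "a < b" for a
    using neg that not_less by blast
  have [measurable]: "\<omega> \<in> borel_measurable borel" using c by (rule borel_measurable_continuous_onI)
  have \<omega>_nn: "0 \<le> \<omega> s" if "0 < s" for s using pos[OF that] that by linarith
  have ftc: "(\<integral>\<^sup>+s. ennreal (1 / \<omega> s) * indicator {a..b'} s \<partial>lborel) = ennreal (integral {a..b'} (\<lambda>s. 1 / \<omega> s))"
    if "0 < a" "a \<le> b'" for a b'
  proof -
    have "continuous_on UNIV (\<lambda>s. 1 / \<omega> (max a s))"
    proof (intro continuous_intros continuous_on_compose2[OF c] ballI)
      fix s show "\<omega> (max a s) \<noteq> 0" using pos[of "max a s"] that by (auto simp: less_max_iff_disj)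
    qed auto
    then obtain F where F: "\<And>t. (F has_real_derivative 1 / \<omega> (max a t)) (at t)"
      using continuous_antiderivative by blast
    have F': "(F has_real_derivative 1 / \<omega> t) (at t)" if "t \<in> {a..b'}" for t
      using F[of t] that by (simp add: max_absorb2)
    have "((\<lambda>s. 1 / \<omega> s) has_integral F b' - F a) {a..b'}"
      by (rule fundamental_theorem_of_calculus[OF that(2)])
         (auto intro!: has_field_derivative_at_within[OF F'] simp flip: has_real_derivative_iff_has_vector_derivative)
    moreover have "(\<integral>\<^sup>+s. ennreal (1 / \<omega> s) * indicator {a..b'} s \<partial>lborel) = ennreal (F b' - F a)"
      by (rule nn_integral_FTC_Icc[OF _ F' _ that(2)]) (use \<omega>_nn that in auto)
    ultimately show ?thesis by (simp add: integral_unique)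
  qed
  define a where "a n = b / real (Suc (Suc n))" for n
  have a: "0 < a n" "a n < b" for n
  proof -
    have "b * 1 < b * real (Suc (Suc n))" using b by (intro mult_strict_left_mono) auto
    then show "a n < b" unfolding a_def by (simp add: divide_less_eq)
    show "0 < a n" using b by (simp add: a_def)
  qed
  have dec: "a n \<le> a m" if "m \<le> n" for m n using b that by (auto simp: a_def intro!: divide_left_mono)
  have lim: "a \<longlonglongrightarrow> 0"
  proof -
    have "(\<lambda>n. b * inverse (real (Suc (Suc n)))) \<longlonglongrightarrow> b * 0"
      by (intro tendsto_intros LIMSEQ_Suc[OF LIMSEQ_inverse_real_of_nat])
    then show ?thesis by (simp add: a_def[abs_def] divide_inverse)
  qed
  have "(\<integral>\<^sup>+s. ennreal (1 / \<omega> s) * indicator {0<..b} s \<partial>lborel) = (\<integral>\<^sup>+s. (SUP n. ennreal (1 / \<omega> s) * indicator {a n..b} s) \<partial>lborel)"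
  proof (rule nn_integral_cong)
    fix s :: real
    have "indicator {0<..b} s = (SUP n. indicator {a n..b} s :: ennreal)"
    proof (cases "s \<in> {0<..b}")
      case True
      then obtain n where "a n < s" using order_tendstoD(2)[OF lim, of s] by (auto simp: eventually_sequentially)
      with True have "indicator {a n..b} s = (1::ennreal)" by simp
      then have "1 \<le> (SUP n. indicator {a n..b} s :: ennreal)" by (metis SUP_upper UNIV_I)
      moreover have "(SUP n. indicator {a n..b} s :: ennreal) \<le> 1" by (rule SUP_least) (simp add: indicator_def)
      ultimately have "(SUP n. indicator {a n..b} s :: ennreal) = 1" by (intro antisym)
      then show ?thesis using True by simp
    next
      case False
      then have "indicator {a n..b} s = (0::ennreal)" for n using a[of n] by (auto simp: indicator_def)
      with False show ?thesis by simp
    qed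
    then show "ennreal (1 / \<omega> s) * indicator {0<..b} s = (SUP n. ennreal (1 / \<omega> s) * indicator {a n..b} s)"
      by (simp add: SUP_mult_left_ennreal)
  qed
  also have "\<dots> = (SUP n. \<integral>\<^sup>+s. ennreal (1 / \<omega> s) * indicator {a n..b} s \<partial>lborel)"
  proof (rule nn_integral_monotone_convergence_SUP)
    show "incseq (\<lambda>n s. ennreal (1 / \<omega> s) * indicator {a n..b} s)"
      by (auto simp: incseq_def le_fun_def indicator_def intro: order_trans[OF dec])
  qed measurable
  also have "\<dots> \<le> ennreal C"
    by (intro SUP_least) (simp add: ftc a less_imp_le ennreal_leI le)
  finally have 1: "(\<integral>\<^sup>+s. ennreal (1 / \<omega> s) * indicator {0<..b} s \<partial>lborel) \<le> ennreal C" .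
  have "(\<integral>\<^sup>+s. ennreal (1 / \<omega> s) * indicator {0<..1} s \<partial>lborel)
      \<le> (\<integral>\<^sup>+s. ennreal (1 / \<omega> s) * indicator {0<..b} s + ennreal (1 / \<omega> s) * indicator {b..1} s \<partial>lborel)"
    by (intro nn_integral_mono) (auto simp: indicator_def)
  also have "\<dots> = (\<integral>\<^sup>+s. ennreal (1 / \<omega> s) * indicator {0<..b} s \<partial>lborel) + (\<integral>\<^sup>+s. ennreal (1 / \<omega> s) * indicator {b..1} s \<partial>lborel)"
    by (rule nn_integral_add) measurable
  also have "\<dots> \<le> ennreal C + ennreal (integral {b..1} (\<lambda>s. 1 / \<omega> s))"
    using 1 ftc[of b 1] b by (intro add_mono) auto
  also have "\<dots> < \<infinity>" by simp
  finally show False using div by simp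
qed

text \<open>
  Separation of variables: \<open>H s\<close>, the integral of \<open>1 / (K \<omega>)\<close> from \<open>a\<close> to \<open>s\<close>, is the time at which the solution that
  starts at \<open>a\<close> reaches \<open>s\<close>, and \<open>\<sigma>\<close> is the inverse of \<open>H\<close>. By divergence \<open>a\<close> can be so small that \<open>b\<close> is
  not reached before time \<open>T\<close>.
\<close>

lemma slow_growth_solution:
  fixes \<omega> :: "real \<Rightarrow> real"
  assumes c: "continuous_on UNIV \<omega>" and pos: "\<And>s. 0 < s \<Longrightarrow> s \<le> \<omega> s"
    and div: "(\<integral>\<^sup>+s. ennreal (1 / \<omega> s) * indicator {0<..1} s \<partial>lborel) = \<infinity>"
    and b: "0 < b" "b \<le> 1" and K: "K > 0" and T: "T > 0"
  obtains \<sigma> where "\<And>t. t \<in> {0..T} \<Longrightarrow> 0 < \<sigma> t \<and> \<sigma> t \<le> b"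
    "\<And>t. t \<in> {0..T} \<Longrightarrow> (\<sigma> has_real_derivative K * \<omega> (\<sigma> t)) (at t)"
proof -
  obtain a where a: "0 < a" "a < b" "K * T < integral {a..b} (\<lambda>s. 1 / \<omega> s)"
    using divergent_truncation[OF c pos div b] by blast
  have \<omega>_pos: "0 < \<omega> s" if "0 < s" for s using pos[OF that] that by linarith
  \<comment> \<open>freezing the argument below \<open>a / 4\<close> keeps \<open>f\<close> continuous and \<open>H\<close> strictly increasing, so that \<open>\<sigma>\<close>
    is also defined on a neighbourhood of time 0\<close>
  define f where "f s = 1 / \<omega> (max (a / 4) s)" for s
  have cf: "continuous_on UNIV f"
    unfolding f_def
  proof (intro continuous_intros continuous_on_compose2[OF c] ballI)
    fix s show "\<omega> (max (a / 4) s) \<noteq> 0" using \<omega>_pos[of "max (a/4) s"] a by (simp add: less_max_iff_disj)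
  qed auto
  obtain F where F: "\<And>t. (F has_real_derivative f t) (at t)"
    using continuous_antiderivative[OF cf] by blast
  have f_pos: "f s > 0" for s using \<omega>_pos[of "max (a/4) s"] a by (simp add: f_def less_max_iff_disj)
  define H where "H s = (F s - F a) / K" for s
  have H: "(H has_real_derivative f s / K) (at s)" for s
    unfolding H_def using K by (auto intro!: derivative_eq_intros F)
  have Hmono: "H x < H y" if "x < y" for x y
  proof (rule DERIV_pos_imp_increasing[OF that])
    fix s show "\<exists>z. (H has_real_derivative z) (at s) \<and> 0 < z"
      using H[of s] f_pos[of s] K by (intro exI[of _ "f s / K"]) auto
  qed
  then have Hinj: "H x = H y \<longleftrightarrow> x = y" for x y by (metis less_irrefl linorder_neqE)
  have isC: "isCont H s" for s using H by (rule DERIV_isCont)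
  have "H b > T"
  proof -
    have "((\<lambda>s. 1 / \<omega> s) has_integral F b - F a) {a..b}"
    proof (rule fundamental_theorem_of_calculus)
      fix x assume "x \<in> {a..b}"
      then have "f x = 1 / \<omega> x" using a by (simp add: f_def max_def)
      then show "(F has_vector_derivative 1 / \<omega> x) (at x within {a..b})"
        using has_field_derivative_at_within[OF F[of x]] by (simp add: has_real_derivative_iff_has_vector_derivative)
    qed (use a in auto)
    with a(3) have "K * T < F b - F a" by (simp add: integral_unique)
    then show ?thesis using K by (simp add: H_def field_simps)
  qed
  have Ha: "H a = 0" by (simp add: H_def)
  define \<sigma> where "\<sigma> t = (THE x. H x = t)" for t
  have \<sigma>H: "\<sigma> (H x) = x" for x unfolding \<sigma>_def by (simp add: Hinj)
  have ex: "\<exists>x. a / 2 < x \<and> x < b \<and> H x = t" if "H (a / 2) < t" "t < H b" for t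
  proof -
    have "\<exists>x. a / 2 \<le> x \<and> x \<le> b \<and> H x = t"
      by (rule IVT) (use that isC a in auto)
    then obtain x where x: "a / 2 \<le> x" "x \<le> b" "H x = t" by blast
    with that Hmono show ?thesis by (metis less_irrefl order_le_less)
  qed
  have l: "H (a / 2) < 0" using Hmono[of "a/2" a] Ha a by simp
  show ?thesis
  proof (rule that[of \<sigma>])
    fix t assume "t \<in> {0..T}"
    then have t: "H (a / 2) < t" "t < H b" using l \<open>H b > T\<close> by auto
    obtain x where x: "a / 2 < x" "x < b" "H x = t" using ex[OF t] by blast
    then have st: "\<sigma> t = x" using \<sigma>H by auto
    show "0 < \<sigma> t \<and> \<sigma> t \<le> b" using x a st by auto
    have "isCont \<sigma> (H x)"
      by (rule isCont_inverse_function2[OF x(1,2)]) (auto simp: \<sigma>H isC)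
    then have "(\<sigma> has_real_derivative inverse (f x / K)) (at t)"
    proof (intro DERIV_inverse_function[where f = H and a = "H (a / 2)" and b = "H b"])
      show "(H has_real_derivative f x / K) (at (\<sigma> t))" using H st by simp
      show "f x / K \<noteq> 0" using f_pos[of x] K by simp
      show "H (\<sigma> y) = y" if "H (a / 2) < y" "y < H b" for y using ex[OF that] \<sigma>H by auto
    qed (use t x in auto)
    moreover have "inverse (f x / K) = K * \<omega> (\<sigma> t)" using x a st by (simp add: f_def max_def)
    ultimately show "(\<sigma> has_real_derivative K * \<omega> (\<sigma> t)) (at t)" by simp
  qed
qed

text \<open>
  The average of \<open>r\<close> over \<open>[t, t + \<sigma>(t)]\<close> is a value of \<open>r\<close> in that interval, so it differs from \<open>r t\<close> by at
  most \<open>\<omega>(\<sigma>)\<close>. Its derivative is a combination of two differences of values of \<open>r\<close> in the interval, with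
  the factors \<open>1 / \<sigma>\<close> and \<open>\<sigma>' / \<sigma>\<close>; this is where \<open>|\<sigma>'| \<le> 1\<close> enters.
\<close>

lemma averaged_coefficient:
  fixes r \<sigma> \<sigma>' :: "real \<Rightarrow> real"
  assumes c: "continuous_on UNIV r" and osc: "\<And>x y h. \<bar>x - y\<bar> \<le> h \<Longrightarrow> h \<le> 1 \<Longrightarrow> \<bar>r x - r y\<bar> \<le> \<omega> h"
    and \<sigma>: "\<And>t. t \<in> {0..T} \<Longrightarrow> 0 < \<sigma> t \<and> \<sigma> t \<le> 1"
    and d\<sigma>: "\<And>t. t \<in> {0..T} \<Longrightarrow> (\<sigma> has_real_derivative \<sigma>' t) (at t within {0..T})"
    and c\<sigma>: "continuous_on {0..T} \<sigma>'" and \<sigma>'1: "\<And>t. t \<in> {0..T} \<Longrightarrow> \<bar>\<sigma>' t\<bar> \<le> 1"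
  obtains a a' where "\<And>t. t \<in> {0..T} \<Longrightarrow> (a has_real_derivative a' t) (at t within {0..T})"
    "continuous_on {0..T} a'" "\<And>t. t \<in> {0..T} \<Longrightarrow> \<bar>a t - r t\<bar> \<le> \<omega> (\<sigma> t)"
    "\<And>t. t \<in> {0..T} \<Longrightarrow> \<bar>a' t\<bar> \<le> 2 * \<omega> (\<sigma> t) / \<sigma> t"
proof -
  obtain P where "P 0 = 0" and P: "\<And>t. (P has_real_derivative r t) (at t)"
    by (rule continuous_antiderivative[OF c]) (rule that)
  define a where "a t = (P (t + \<sigma> t) - P t) / \<sigma> t" for t
  define a' where "a' t = (r (t + \<sigma> t) - r t) / \<sigma> t + \<sigma>' t / \<sigma> t * (r (t + \<sigma> t) - a t)" for t
  have mvt: "\<exists>s. t < s \<and> s < t + \<sigma> t \<and> a t = r s" if t: "t \<in> {0..T}" for t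
  proof -
    obtain s where "t < s" "s < t + \<sigma> t" "P (t + \<sigma> t) - P t = (t + \<sigma> t - t) * r s"
      using MVT2[of t "t + \<sigma> t" P r] \<sigma>[OF t] P by auto
    with \<sigma>[OF t] show ?thesis by (intro exI[of _ s]) (auto simp: a_def field_simps)
  qed
  show ?thesis
  proof (rule that[of a a'])
    fix t assume t: "t \<in> {0..T}"
    note s = \<sigma>[OF t]
    have P': "((\<lambda>t. P (t + \<sigma> t)) has_real_derivative r (t + \<sigma> t) * (1 + \<sigma>' t)) (at t within {0..T})"
      by (rule DERIV_chain2[OF P]) (auto intro!: derivative_eq_intros d\<sigma> t)
    have "(a has_real_derivative ((r (t + \<sigma> t) * (1 + \<sigma>' t) - r t) * \<sigma> t - (P (t + \<sigma> t) - P t) * \<sigma>' t) / (\<sigma> t * \<sigma> t)) (at t within {0..T})"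
      unfolding a_def[abs_def] using s
      by (intro DERIV_divide DERIV_diff P' has_field_derivative_at_within[OF P] d\<sigma> t) auto
    moreover have "((r (t + \<sigma> t) * (1 + \<sigma>' t) - r t) * \<sigma> t - (P (t + \<sigma> t) - P t) * \<sigma>' t) / (\<sigma> t * \<sigma> t) = a' t"
      using s by (simp add: a'_def a_def field_simps)
    ultimately show "(a has_real_derivative a' t) (at t within {0..T})" by simp
    obtain x where x: "t < x" "x < t + \<sigma> t" "a t = r x" using mvt[OF t] by blast
    show "\<bar>a t - r t\<bar> \<le> \<omega> (\<sigma> t)" unfolding x(3) using x s by (intro osc) auto
    have 1: "\<bar>r (t + \<sigma> t) - r t\<bar> \<le> \<omega> (\<sigma> t)" using s by (intro osc) auto
    have 2: "\<bar>r (t + \<sigma> t) - a t\<bar> \<le> \<omega> (\<sigma> t)" unfolding x(3) using x s by (intro osc) auto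
    have "\<bar>a' t\<bar> \<le> \<bar>r (t + \<sigma> t) - r t\<bar> / \<sigma> t + \<bar>\<sigma>' t\<bar> / \<sigma> t * \<bar>r (t + \<sigma> t) - a t\<bar>"
      unfolding a'_def using s by (intro order_trans[OF abs_triangle_ineq]) (simp add: abs_mult)
    also have "\<dots> \<le> \<omega> (\<sigma> t) / \<sigma> t + 1 / \<sigma> t * \<omega> (\<sigma> t)"
      using s 1 2 \<sigma>'1[OF t] by (intro add_mono mult_mono divide_right_mono) auto
    finally show "\<bar>a' t\<bar> \<le> 2 * \<omega> (\<sigma> t) / \<sigma> t" by simp
  next
    have cs: "continuous_on {0..T} \<sigma>"
      by (rule DERIV_continuous_on[OF d\<sigma>])
    have cr: "continuous_on {0..T} (\<lambda>t. r (t + \<sigma> t))" "continuous_on {0..T} r"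
      by (auto intro!: continuous_on_compose2[OF c] continuous_intros cs continuous_on_subset[OF c])
    have cP: "continuous_on UNIV P" using P by (meson DERIV_continuous_on has_field_derivative_at_within)
    have ca: "continuous_on {0..T} a" unfolding a_def
      by (intro continuous_intros continuous_on_compose2[OF cP] cs ballI) (use \<sigma> in fastforce)+
    show "continuous_on {0..T} a'" unfolding a'_def
      by (intro continuous_intros cs cr ca c\<sigma> ballI) (use \<sigma> in fastforce)+
  qed
qed

section \<open>Moduli of continuity and the symbol inequality\<close>

text \<open>
  Subadditivity holds because two times at distance at most \<open>\<tau> + \<tau>'\<close> have an intermediate time within
  \<open>\<tau>\<close> of one and \<open>\<tau>'\<close> of the other; smallness near 0 is uniform continuity.
\<close>

lemma modulus_properties:
  fixes R :: "real \<Rightarrow> 'i \<Rightarrow> real"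
  assumes A: "finite A" and R: "\<And>\<alpha>. \<alpha> \<in> A \<Longrightarrow> continuous_on {0..T} (\<lambda>t. R t \<alpha>)" and T: "T > 0"
  defines "\<mu> \<equiv> modulus_of_continuity (\<lambda>v. L2_set v A) {0..T} R"
  shows "\<And>s t \<tau>. s \<in> {0..T} \<Longrightarrow> t \<in> {0..T} \<Longrightarrow> \<bar>t - s\<bar> \<le> \<tau> \<Longrightarrow> L2_set (R t - R s) A \<le> \<mu> \<tau>"
    "\<And>\<tau>. 0 \<le> \<tau> \<Longrightarrow> 0 \<le> \<mu> \<tau>"
    "\<And>\<tau> \<tau>'. 0 \<le> \<tau> \<Longrightarrow> \<tau> \<le> \<tau>' \<Longrightarrow> \<mu> \<tau> \<le> \<mu> \<tau>'"
    "\<And>\<tau> \<tau>'. 0 \<le> \<tau> \<Longrightarrow> 0 \<le> \<tau>' \<Longrightarrow> \<mu> (\<tau> + \<tau>') \<le> \<mu> \<tau> + \<mu> \<tau>'"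
    "\<And>e. 0 < e \<Longrightarrow> \<exists>d>0. \<forall>\<tau>. 0 \<le> \<tau> \<and> \<tau> \<le> d \<longrightarrow> \<mu> \<tau> \<le> e"
proof -
  let ?S = "\<lambda>\<tau>. {(t, s). t \<in> {0..T} \<and> s \<in> {0..T} \<and> \<bar>t - s\<bar> \<le> \<tau>}"
  let ?N = "\<lambda>(t, s). L2_set (R t - R s) A"
  have \<mu>: "\<mu> \<tau> = (SUP p\<in>?S \<tau>. ?N p)" for \<tau> by (simp add: \<mu>_def modulus_of_continuity_def)
  have N_le: "L2_set v A \<le> (\<Sum>\<alpha>\<in>A. \<bar>v \<alpha>\<bar>)" for v :: "'i \<Rightarrow> real" by (rule L2_set_le_sum_abs)
  have "\<exists>B. \<forall>\<alpha>\<in>A. \<forall>t\<in>{0..T}. \<bar>R t \<alpha>\<bar> \<le> B \<alpha>"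
  proof (intro bchoice ballI)
    fix \<alpha> assume "\<alpha> \<in> A"
    then show "\<exists>B. \<forall>t\<in>{0..T}. \<bar>R t \<alpha>\<bar> \<le> B"
      using compact_imp_bounded[OF compact_continuous_image[OF R]] by (auto simp: bounded_iff)
  qed
  then obtain B where B: "\<And>\<alpha> t. \<alpha> \<in> A \<Longrightarrow> t \<in> {0..T} \<Longrightarrow> \<bar>R t \<alpha>\<bar> \<le> B \<alpha>" by blast
  have bdd: "bdd_above (?N ` ?S \<tau>)" for \<tau>
  proof (rule bdd_aboveI2)
    fix p assume p: "p \<in> ?S \<tau>"
    obtain t s where ts: "p = (t, s)" "t \<in> {0..T}" "s \<in> {0..T}" using p by auto
    have "L2_set (R t - R s) A \<le> (\<Sum>\<alpha>\<in>A. \<bar>(R t - R s) \<alpha>\<bar>)" by (rule N_le)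
    also have "\<dots> \<le> (\<Sum>\<alpha>\<in>A. 2 * B \<alpha>)"
    proof (rule sum_mono)
      fix \<alpha> assume \<alpha>: "\<alpha> \<in> A"
      show "\<bar>(R t - R s) \<alpha>\<bar> \<le> 2 * B \<alpha>"
        using B[OF \<alpha> ts(2)] B[OF \<alpha> ts(3)] by (simp add: fun_diff_def)
    qed
    finally show "?N p \<le> (\<Sum>\<alpha>\<in>A. 2 * B \<alpha>)" by (simp add: ts(1))
  qed
  show bound: "L2_set (R t - R s) A \<le> \<mu> \<tau>" if "s \<in> {0..T}" "t \<in> {0..T}" "\<bar>t - s\<bar> \<le> \<tau>" for s t \<tau>
    unfolding \<mu> using cSUP_upper[OF _ bdd, of "(t, s)" \<tau>] that by auto
  show nn: "0 \<le> \<mu> \<tau>" if "0 \<le> \<tau>" for \<tau>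
    by (rule order_trans[OF L2_set_nonneg bound[of 0 0]]) (use that T in auto)
  have least: "\<mu> \<tau> \<le> C" if "0 \<le> \<tau>" "\<And>t s. t \<in> {0..T} \<Longrightarrow> s \<in> {0..T} \<Longrightarrow> \<bar>t - s\<bar> \<le> \<tau> \<Longrightarrow> L2_set (R t - R s) A \<le> C" for \<tau> C
    unfolding \<mu>
  proof (rule cSUP_least)
    show "?S \<tau> \<noteq> {}" using T that(1) by (auto intro!: exI[of _ 0])
  qed (use that in auto)
  show "\<mu> \<tau> \<le> \<mu> \<tau>'" if "0 \<le> \<tau>" "\<tau> \<le> \<tau>'" for \<tau> \<tau>'
    using that by (intro least bound) auto
  have tri: "L2_set (R t - R s) A \<le> L2_set (R t - R r) A + L2_set (R r - R s) A" for t s r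
  proof -
    have "R t - R s = (\<lambda>\<alpha>. (R t - R r) \<alpha> + (R r - R s) \<alpha>)" by (auto simp: fun_diff_def)
    then show ?thesis using L2_set_triangle_ineq[of "R t - R r" "R r - R s" A] by simp
  qed
  show "\<mu> (\<tau> + \<tau>') \<le> \<mu> \<tau> + \<mu> \<tau>'" if \<tau>: "0 \<le> \<tau>" "0 \<le> \<tau>'" for \<tau> \<tau>'
  proof (rule least)
    fix t s assume ts: "t \<in> {0..T}" "s \<in> {0..T}" "\<bar>t - s\<bar> \<le> \<tau> + \<tau>'"
    define r where "r = (if s \<le> t then max s (t - \<tau>) else min s (t + \<tau>))"
    have "r \<in> {0..T}" "\<bar>t - r\<bar> \<le> \<tau>" "\<bar>r - s\<bar> \<le> \<tau>'" using ts \<tau> by (auto simp: r_def max_def min_def)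
    then show "L2_set (R t - R s) A \<le> \<mu> \<tau> + \<mu> \<tau>'"
      using tri[of t s r] bound[of r t \<tau>] bound[of s r \<tau>'] ts by auto
  qed (use \<tau> in auto)
  show "\<exists>d>0. \<forall>\<tau>. 0 \<le> \<tau> \<and> \<tau> \<le> d \<longrightarrow> \<mu> \<tau> \<le> e" if e: "0 < e" for e
  proof -
    define e' where "e' = e / (real (card A) + 1)"
    have e': "e' > 0" using e by (simp add: e'_def)
    have "\<exists>d. \<forall>\<alpha>\<in>A. 0 < d \<alpha> \<and> (\<forall>t\<in>{0..T}. \<forall>s\<in>{0..T}. \<bar>s - t\<bar> < d \<alpha> \<longrightarrow> \<bar>R s \<alpha> - R t \<alpha>\<bar> < e')"
    proof (intro bchoice ballI)
      fix \<alpha> assume "\<alpha> \<in> A"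
      then have "uniformly_continuous_on {0..T} (\<lambda>t. R t \<alpha>)" by (intro compact_uniformly_continuous R) auto
      with e' show "\<exists>d>0. \<forall>t\<in>{0..T}. \<forall>s\<in>{0..T}. \<bar>s - t\<bar> < d \<longrightarrow> \<bar>R s \<alpha> - R t \<alpha>\<bar> < e'"
        unfolding uniformly_continuous_on_def dist_real_def by blast
    qed
    then obtain d where d: "\<And>\<alpha>. \<alpha> \<in> A \<Longrightarrow> 0 < d \<alpha>"
      "\<And>\<alpha> t s. \<alpha> \<in> A \<Longrightarrow> t \<in> {0..T} \<Longrightarrow> s \<in> {0..T} \<Longrightarrow> \<bar>s - t\<bar> < d \<alpha> \<Longrightarrow> \<bar>R s \<alpha> - R t \<alpha>\<bar> < e'" by metis
    define D where "D = Min (insert 1 (d ` A)) / 2"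
    have D0: "D > 0" using A d(1) by (auto simp: D_def)
    have D: "D < d \<alpha>" if "\<alpha> \<in> A" for \<alpha>
    proof -
      have "Min (insert 1 (d ` A)) \<le> d \<alpha>" using A that by (intro Min_le) auto
      then show ?thesis using d(1)[OF that] D0 by (simp add: D_def)
    qed
    show ?thesis
    proof (intro exI[of _ D] conjI D0 allI impI least)
      fix \<tau> t s assume \<tau>: "0 \<le> \<tau> \<and> \<tau> \<le> D" and ts: "t \<in> {0..T}" "s \<in> {0..T}" "\<bar>t - s\<bar> \<le> \<tau>"
      have "L2_set (R t - R s) A \<le> (\<Sum>\<alpha>\<in>A. \<bar>(R t - R s) \<alpha>\<bar>)" by (rule N_le)
      also have "\<dots> \<le> (\<Sum>\<alpha>\<in>A. e')"
      proof (rule sum_mono)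
        fix \<alpha> assume "\<alpha> \<in> A"
        then show "\<bar>(R t - R s) \<alpha>\<bar> \<le> e'"
          using d(2)[of \<alpha> s t] D[of \<alpha>] ts \<tau> by (force simp: fun_diff_def)
      qed
      also have "\<dots> \<le> e" using e by (simp add: e'_def field_simps)
      finally show "L2_set (R t - R s) A \<le> e" .
    qed auto
  qed
qed

text \<open>
  The differential equation for \<open>\<sigma>\<close> needs a continuous right-hand side that is positive away from 0, and
  the symbol inequality needs \<open>s \<le> \<omega> s\<close>; adding \<open>s\<close> to the modulus provides this. The integral of
  \<open>1 / \<omega>\<close> still diverges: a subadditive \<open>\<mu>\<close> with \<open>\<mu> 1 > 0\<close> satisfies \<open>s \<mu>(1) \<le> 2 \<mu>(s)\<close>, so \<open>\<omega>\<close> is at most a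
  multiple of \<open>\<mu>\<close>. If \<open>\<mu> 1 = 0\<close>, then \<open>\<omega> s = s\<close> on \<open>[0, 1]\<close>.
\<close>

lemma osgood_majorant:
  fixes \<mu> :: "real \<Rightarrow> real"
  assumes osg: "osgood \<mu>"
    and nn: "\<And>\<tau>. 0 \<le> \<tau> \<Longrightarrow> 0 \<le> \<mu> \<tau>"
    and mono: "\<And>\<tau> \<tau>'. 0 \<le> \<tau> \<Longrightarrow> \<tau> \<le> \<tau>' \<Longrightarrow> \<mu> \<tau> \<le> \<mu> \<tau>'"
    and sub: "\<And>\<tau> \<tau>'. 0 \<le> \<tau> \<Longrightarrow> 0 \<le> \<tau>' \<Longrightarrow> \<mu> (\<tau> + \<tau>') \<le> \<mu> \<tau> + \<mu> \<tau>'"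
    and small: "\<And>e. 0 < e \<Longrightarrow> \<exists>d>0. \<forall>\<tau>. 0 \<le> \<tau> \<and> \<tau> \<le> d \<longrightarrow> \<mu> \<tau> \<le> e"
  defines "\<omega> \<equiv> \<lambda>s. \<mu> (max 0 s) + max 0 s"
  shows "continuous_on UNIV \<omega>" "(\<integral>\<^sup>+s. ennreal (1 / \<omega> s) * indicator {0<..1} s \<partial>lborel) = \<infinity>" "\<omega> 0 = 0"
proof -
  show "\<omega> 0 = 0" using osg by (simp add: \<omega>_def osgood_def)
  have "\<mu> 0 = 0" using osg by (simp add: osgood_def)
  have close: "\<bar>\<mu> a - \<mu> b\<bar> \<le> \<mu> \<bar>a - b\<bar>" if "0 \<le> a" "0 \<le> b" for a b
  proof -
    have *: "\<mu> a - \<mu> b \<le> \<mu> (a - b) \<and> \<mu> b \<le> \<mu> a" if "0 \<le> b" "b \<le> a" for a b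
      using sub[of b "a - b"] mono[of b a] that by auto
    then show ?thesis using *[of b a] *[of a b] that by (cases "a \<le> b") (auto simp: abs_minus_commute)
  qed
  have "continuous_on UNIV (\<lambda>s. \<mu> (max 0 s))"
    unfolding continuous_on_iff
  proof (intro ballI allI impI)
    fix x e :: real assume "0 < e"
    then obtain d where d: "d > 0" "\<And>\<tau>. 0 \<le> \<tau> \<Longrightarrow> \<tau> \<le> d \<Longrightarrow> \<mu> \<tau> \<le> e / 2" using small[of "e / 2"] by auto
    show "\<exists>d>0. \<forall>x'\<in>UNIV. dist x' x < d \<longrightarrow> dist (\<mu> (max 0 x')) (\<mu> (max 0 x)) < e"
    proof (intro exI[of _ d] conjI d(1) ballI impI)
      fix x' assume "dist x' x < d"
      then have "\<bar>max 0 x' - max 0 x\<bar> \<le> d" by (auto simp: dist_real_def max_def)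
      then have "\<mu> \<bar>max 0 x' - max 0 x\<bar> \<le> e / 2" by (intro d(2)) auto
      then show "dist (\<mu> (max 0 x')) (\<mu> (max 0 x)) < e"
        using close[of "max 0 x'" "max 0 x"] \<open>0 < e\<close> by (simp add: dist_real_def)
    qed
  qed
  then show c: "continuous_on UNIV \<omega>" unfolding \<omega>_def by (intro continuous_intros)
  have [measurable]: "\<omega> \<in> borel_measurable borel" using c by (rule borel_measurable_continuous_onI)
  have O: "(\<integral>\<^sup>+s. inverse (ennreal (\<mu> s)) \<partial>lebesgue_on {0..1}) = \<infinity>" using osg by (simp add: osgood_def)
  obtain c where c0: "c \<ge> 0" and le: "\<And>s. 0 < s \<Longrightarrow> s \<le> 1 \<Longrightarrow> \<mu> s = 0 \<or> \<omega> s \<le> c * \<mu> s" and z: "\<mu> 1 = 0 \<or> (\<forall>s. 0 < s \<and> s \<le> 1 \<longrightarrow> 0 < \<mu> s)"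
  proof (cases "\<mu> 1 = 0")
    case True
    then have "\<mu> s = 0" if "0 < s" "s \<le> 1" for s using nn[of s] mono[of s 1] that by auto
    with True show ?thesis by (intro that[of 0]) auto
  next
    case False
    with nn[of 1] have p: "\<mu> 1 > 0" by simp
    have mult: "\<mu> (real n * s) \<le> real n * \<mu> s" if "0 \<le> s" for n s
    proof (induction n)
      case (Suc n)
      have "\<mu> (real (Suc n) * s) \<le> \<mu> (real n * s) + \<mu> s"
        using sub[of "real n * s" s] that by (simp add: algebra_simps)
      with Suc show ?case by (simp add: algebra_simps)
    qed (simp add: \<open>\<mu> 0 = 0\<close>)
    \<comment> \<open>\<open>1 \<le> n s \<le> 2\<close> for \<open>n\<close> the ceiling of \<open>1 / s\<close>\<close>
    have lin: "s * \<mu> 1 \<le> 2 * \<mu> s" if s: "0 < s" "s \<le> 1" for s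
    proof -
      define n where "n = nat \<lceil>1 / s\<rceil>"
      have n: "1 / s \<le> real n" "real n \<le> 1 / s + 1" using s by (auto simp: n_def le_nat_iff)
      have "1 \<le> real n * s" using n(1) s by (simp add: field_simps)
      then have "\<mu> 1 \<le> \<mu> (real n * s)" by (intro mono) auto
      also have "\<dots> \<le> real n * \<mu> s" using mult s by simp
      finally have "s * \<mu> 1 \<le> s * (real n * \<mu> s)" using s by (intro mult_left_mono) auto
      also have "\<dots> = (real n * s) * \<mu> s" by simp
      also have "\<dots> \<le> 2 * \<mu> s"
      proof (rule mult_right_mono)
        have "real n * s \<le> (1 / s + 1) * s" using n(2) s by (intro mult_right_mono) auto
        also have "\<dots> = 1 + s" using s by (simp add: field_simps)
        finally show "real n * s \<le> 2" using s by simp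
      qed (use nn s in auto)
      finally show ?thesis .
    qed
    show ?thesis
    proof (rule that[of "1 + 2 / \<mu> 1"])
      show "\<mu> s = 0 \<or> \<omega> s \<le> (1 + 2 / \<mu> 1) * \<mu> s" if "0 < s" "s \<le> 1" for s
        using lin[OF that] p that by (auto simp: \<omega>_def field_simps)
      show "\<mu> 1 = 0 \<or> (\<forall>s. 0 < s \<and> s \<le> 1 \<longrightarrow> 0 < \<mu> s)"
      proof (intro disjI2 allI impI)
        fix s :: real assume s: "0 < s \<and> s \<le> 1"
        then have "0 < s * \<mu> 1" using p by simp
        with lin[of s] s show "0 < \<mu> s" by linarith
      qed
    qed (use p in simp)
  qed
  show "(\<integral>\<^sup>+s. ennreal (1 / \<omega> s) * indicator {0<..1} s \<partial>lborel) = \<infinity>"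
  proof (cases "\<mu> 1 = 0")
    case False
    have "inverse (ennreal (\<mu> s)) * indicator {0..1} s \<le> ennreal c * (ennreal (1 / \<omega> s) * indicator {0<..1} s)" if "s \<noteq> 0" for s
    proof (cases "0 < s \<and> s \<le> 1")
      case True
      with z False have m: "0 < \<mu> s" by auto
      then have w: "0 < \<omega> s" "\<omega> s \<le> c * \<mu> s" using le[of s] True by (auto simp: \<omega>_def)
      have "1 / \<mu> s \<le> c * (1 / \<omega> s)" using m w by (simp add: field_simps)
      then show ?thesis
        using True m w c0 by (simp add: ennreal_mult[symmetric] inverse_ennreal inverse_eq_divide ennreal_leI)
    qed (use that in \<open>auto simp: indicator_def\<close>)
    note le' = this
    have "\<infinity> = (\<integral>\<^sup>+s. inverse (ennreal (\<mu> s)) * indicator {0..1} s \<partial>lebesgue)"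
      using O by (subst (asm) nn_integral_restrict_space) auto
    also have "\<dots> \<le> (\<integral>\<^sup>+s. ennreal c * (ennreal (1 / \<omega> s) * indicator {0<..1} s) \<partial>lebesgue)"
    proof (rule nn_integral_mono_AE)
      have "AE s in lebesgue. s \<noteq> (0::real)" by (intro AE_completion AE_lborel_singleton)
      then show "AE s in lebesgue. inverse (ennreal (\<mu> s)) * indicator {0..1} s \<le> ennreal c * (ennreal (1 / \<omega> s) * indicator {0<..1} s)"
        by eventually_elim (rule le')
    qed
    also have "\<dots> = ennreal c * (\<integral>\<^sup>+s. ennreal (1 / \<omega> s) * indicator {0<..1} s \<partial>lborel)"
      unfolding nn_integral_completion by (rule nn_integral_cmult) measurable
    finally show ?thesis by (auto simp: ennreal_mult_eq_top_iff top_unique)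
  next
    case True
    then have "\<mu> s = 0" if "0 < s" "s \<le> 1" for s using nn[of s] mono[of s 1] that by auto
    then have "\<omega> s = s" if "0 < s" "s \<le> 1" for s using that by (simp add: \<omega>_def)
    then have eq: "ennreal (1 / \<omega> s) * indicator {0<..1} s = ennreal (1 / s) * indicator {0<..1} s" for s
      by (auto simp: indicator_def)
    show ?thesis
    proof (rule ccontr)
      assume "\<not> ?thesis"
      then obtain C where C: "C \<ge> 0" "(\<integral>\<^sup>+s. ennreal (1 / s) * indicator {0<..1} s \<partial>lborel) = ennreal C"
        unfolding eq by (cases "(\<integral>\<^sup>+s. ennreal (1 / s) * indicator {0<..1} s \<partial>lborel)") auto
      define a where "a = exp (- (C + 1))"
      have a: "0 < a" "a \<le> 1" using C by (auto simp: a_def)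
      have "(\<integral>\<^sup>+s. ennreal (1 / s) * indicator {a..1} s \<partial>lborel) = ennreal (ln 1 - ln a)"
        by (rule nn_integral_FTC_Icc) (use a in \<open>auto intro!: derivative_eq_intros simp: field_simps\<close>)
      moreover have "(\<integral>\<^sup>+s. ennreal (1 / s) * indicator {a..1} s \<partial>lborel) \<le> (\<integral>\<^sup>+s. ennreal (1 / s) * indicator {0<..1} s \<partial>lborel)"
        using a by (intro nn_integral_mono) (auto simp: indicator_def)
      ultimately have "ennreal (C + 1) \<le> ennreal C" using C by (simp add: a_def)
      then show False using C by (simp add: ennreal_le_iff)
    qed
  qed
qed

text \<open>
  Here \<open>w\<close> stands for \<open>\<omega>(\<sigma>)\<close> and \<open>\<gamma>\<close> for \<open>1 / \<sigma>\<close>. If \<open>Y \<le> B \<gamma>\<close>, then \<open>|P'|\<close>, \<open>(P\<^sub>\<sigma> - P)\<^sup>2\<close> and \<open>A Y\<close> are at most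
  multiples of \<open>w \<gamma>\<^sup>2\<close> (the last one by \<open>1 \<le> \<gamma> w\<close>), and \<open>K\<close> is the sum of their constants. If \<open>Y > B \<gamma>\<close>, then
  \<open>P\<^sub>\<sigma> - \<gamma> \<ge> Y / (8 \<Lambda>)\<close>, and all errors are at most \<open>Y\<^sup>2\<close> times a quantity that is small with \<open>w\<close> or \<open>1 / \<gamma>\<close>.
\<close>

lemma carleman_symbol_inequality:
  fixes A D M \<Lambda> :: real
  assumes pos: "A > 0" "D \<ge> 0" "M > 0" "\<Lambda> > 0"
  obtains K \<omega>0 \<gamma>0 where "K > 0" "\<omega>0 > 0" "\<gamma>0 > 0"
    "\<And>Y P P\<^sub>\<sigma> P' \<gamma> w. \<lbrakk>1 \<le> Y; 0 < w; w \<le> \<omega>0; \<gamma>0 \<le> \<gamma>; 1 \<le> \<gamma> * w;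
       \<bar>P\<^sub>\<sigma> - P\<bar> \<le> M * w * Y; \<bar>P'\<bar> \<le> 2 * M * w * \<gamma> * Y; Y / (2 * \<Lambda>) - D \<le> P\<rbrakk>
     \<Longrightarrow> A * Y \<le> (P\<^sub>\<sigma> - \<gamma>)\<^sup>2 + (P' + K * w * \<gamma>\<^sup>2) - 2 * (P\<^sub>\<sigma> - P)\<^sup>2"
proof -
  \<comment> \<open>of the \<open>Y / (2 \<Lambda>)\<close> of ellipticity, the terms \<open>\<gamma>\<close> and \<open>D\<close> cost \<open>Y / (16 \<Lambda>)\<close> each and the averaging error
    \<open>Y / (4 \<Lambda>)\<close>, which leaves \<open>Y / (8 \<Lambda>)\<close>; of its square \<open>Y\<^sup>2 / (64 \<Lambda>\<^sup>2)\<close> the errors use a quarter and \<open>A Y\<close> a half\<close>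
  define B where "B = 16 * \<Lambda>"
  define K where "K = 2 * M * B + 2 * M\<^sup>2 * B\<^sup>2 + A * B"
  define \<omega>0 where "\<omega>0 = min 1 (min (1 / (4 * \<Lambda> * M)) (1 / (256 * \<Lambda>\<^sup>2 * (2 * M / B + 2 * M\<^sup>2))))"
  define \<gamma>0 where "\<gamma>0 = D + 8 * \<Lambda> * A"
  have B: "B > 0" using pos by (simp add: B_def)
  have K: "K > 0" using pos B by (simp add: K_def add_pos_pos)
  have s: "2 * M / B + 2 * M\<^sup>2 > 0" using pos B by (simp add: add_pos_pos)
  have \<omega>0: "\<omega>0 > 0" "\<omega>0 \<le> 1" "\<omega>0 \<le> 1 / (4 * \<Lambda> * M)" "\<omega>0 \<le> 1 / (256 * \<Lambda>\<^sup>2 * (2 * M / B + 2 * M\<^sup>2))"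
    using pos s by (auto simp: \<omega>0_def)
  have \<gamma>0: "\<gamma>0 > 0" using pos by (simp add: \<gamma>0_def add_nonneg_pos)
  show ?thesis
  proof (rule that[OF K \<omega>0(1) \<gamma>0])
    fix Y P Ps P' g w :: real
    assume Y: "1 \<le> Y" and w: "0 < w" "w \<le> \<omega>0" and g: "\<gamma>0 \<le> g" and gw: "1 \<le> g * w"
      and d: "\<bar>Ps - P\<bar> \<le> M * w * Y" and p': "\<bar>P'\<bar> \<le> 2 * M * w * g * Y" and ell: "Y / (2 * \<Lambda>) - D \<le> P"
    have g0: "g > 0" using g \<gamma>0 by linarith
    have w1: "w \<le> 1" using w \<omega>0 by linarith
    have "\<bar>Ps - P\<bar>\<^sup>2 \<le> (M * w * Y)\<^sup>2" using d by (intro power_mono) auto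
    then have err: "(Ps - P)\<^sup>2 \<le> M\<^sup>2 * w\<^sup>2 * Y\<^sup>2" by (simp add: power_mult_distrib)
    have w2: "w\<^sup>2 \<le> w" using w w1 by (simp add: power2_eq_square mult_left_le)
    show "A * Y \<le> (Ps - g)\<^sup>2 + (P' + K * w * g\<^sup>2) - 2 * (Ps - P)\<^sup>2"
    proof (cases "Y \<le> B * g")
      case True
      have 1: "2 * M * w * g * Y \<le> 2 * M * B * (w * g\<^sup>2)"
      proof -
        have "2 * M * w * g * Y \<le> 2 * M * w * g * (B * g)"
          using True pos w g0 by (intro mult_left_mono) auto
        then show ?thesis by (simp add: power2_eq_square mult_ac)
      qed
      have 2: "(Ps - P)\<^sup>2 \<le> M\<^sup>2 * B\<^sup>2 * (w * g\<^sup>2)"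
      proof -
        have "Y\<^sup>2 \<le> (B * g)\<^sup>2" using True Y by (intro power_mono) auto
        then have "M\<^sup>2 * w\<^sup>2 * Y\<^sup>2 \<le> M\<^sup>2 * w * (B * g)\<^sup>2"
          using w2 pos w by (intro mult_mono mult_left_mono) auto
        with err show ?thesis by (simp add: power_mult_distrib mult_ac)
      qed
      have 3: "A * Y \<le> A * B * (w * g\<^sup>2)"
      proof -
        have "g * 1 \<le> g * (g * w)" using gw g0 by (intro mult_left_mono) auto
        then have "Y \<le> B * (w * g\<^sup>2)" using True B
          by (intro order_trans[OF True] mult_left_mono) (auto simp: power2_eq_square mult_ac)
        then show ?thesis using pos by (simp add: mult.assoc mult_left_mono)
      qed
      have "K * w * g\<^sup>2 = 2 * M * B * (w * g\<^sup>2) + 2 * (M\<^sup>2 * B\<^sup>2 * (w * g\<^sup>2)) + A * B * (w * g\<^sup>2)"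
        by (simp add: K_def algebra_simps)
      with 1 2 3 p' zero_le_power2[of "Ps - g"] show ?thesis by linarith
    next
      case False
      then have YB: "B * g < Y" by simp
      have Mw: "M * w \<le> 1 / (4 * \<Lambda>)"
      proof -
        have "M * w \<le> M * (1 / (4 * \<Lambda> * M))" using w \<omega>0 pos by (intro mult_left_mono) auto
        then show ?thesis using pos by simp
      qed
      have "D \<le> g" "8 * \<Lambda> * A \<le> g" using g pos by (auto simp: \<gamma>0_def intro: order_trans[rotated])
      then have YD: "16 * \<Lambda> * D \<le> Y" and YA: "128 * \<Lambda>\<^sup>2 * A \<le> Y"
      proof -
        have "16 * \<Lambda> * D \<le> B * g" unfolding B_def using \<open>D \<le> g\<close> pos by (intro mult_left_mono) auto
        with YB show "16 * \<Lambda> * D \<le> Y" by linarith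
        have "B * (8 * \<Lambda> * A) \<le> B * g" using \<open>8 * \<Lambda> * A \<le> g\<close> B by (intro mult_left_mono) auto
        moreover have "B * (8 * \<Lambda> * A) = 128 * \<Lambda>\<^sup>2 * A" by (simp add: B_def power2_eq_square)
        ultimately show "128 * \<Lambda>\<^sup>2 * A \<le> Y" using YB by linarith
      qed
      have "M * w * Y \<le> 1 / (4 * \<Lambda>) * Y" using Mw Y by (intro mult_right_mono) auto
      moreover have "g \<le> Y / (16 * \<Lambda>)" using YB pos by (simp add: B_def field_simps)
      moreover have "D \<le> Y / (16 * \<Lambda>)" using YD pos by (simp add: field_simps)
      moreover have "Y / (2 * \<Lambda>) = 8 * (Y / (16 * \<Lambda>))" "1 / (4 * \<Lambda>) * Y = 4 * (Y / (16 * \<Lambda>))" "Y / (8 * \<Lambda>) = 2 * (Y / (16 * \<Lambda>))"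
        by simp_all
      ultimately have q: "Y / (8 * \<Lambda>) \<le> Ps - g" using d ell by linarith
      then have q2: "Y\<^sup>2 / (64 * \<Lambda>\<^sup>2) \<le> (Ps - g)\<^sup>2"
      proof -
        have "(Y / (8 * \<Lambda>))\<^sup>2 \<le> (Ps - g)\<^sup>2" using q Y pos by (intro power_mono) auto
        then show ?thesis by (simp add: power_divide power_mult_distrib)
      qed
      have bad: "2 * M * w * g * Y + 2 * (Ps - P)\<^sup>2 \<le> Y\<^sup>2 / (256 * \<Lambda>\<^sup>2)"
      proof -
        have "g \<le> Y / B" using YB B by (simp add: field_simps)
        then have "2 * M * w * g * Y \<le> 2 * M * w * (Y / B) * Y" using pos w Y by (intro mult_right_mono mult_left_mono) auto
        moreover have "M\<^sup>2 * w\<^sup>2 * Y\<^sup>2 \<le> M\<^sup>2 * w * Y\<^sup>2" using w2 by (intro mult_right_mono mult_left_mono) auto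
        ultimately have "2 * M * w * g * Y + 2 * (Ps - P)\<^sup>2 \<le> w * (2 * M / B + 2 * M\<^sup>2) * Y\<^sup>2"
          using err by (simp add: algebra_simps power2_eq_square)
        also have "\<dots> \<le> (1 / (256 * \<Lambda>\<^sup>2)) * Y\<^sup>2"
        proof (rule mult_right_mono)
          have "w * (2 * M / B + 2 * M\<^sup>2) \<le> 1 / (256 * \<Lambda>\<^sup>2 * (2 * M / B + 2 * M\<^sup>2)) * (2 * M / B + 2 * M\<^sup>2)"
            using w \<omega>0 s by (intro mult_right_mono) auto
          also have "\<dots> = 1 / (256 * \<Lambda>\<^sup>2)" using s by simp
          finally show "w * (2 * M / B + 2 * M\<^sup>2) \<le> 1 / (256 * \<Lambda>\<^sup>2)" .
        qed simp
        finally show ?thesis by simp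
      qed
      have "A * Y \<le> Y\<^sup>2 / (128 * \<Lambda>\<^sup>2)"
      proof -
        have "A * Y * (128 * \<Lambda>\<^sup>2) \<le> Y * Y" using mult_right_mono[OF YA, of Y] Y by (simp add: mult_ac)
        then show ?thesis using pos by (simp add: power2_eq_square pos_le_divide_eq)
      qed
      moreover have "Y\<^sup>2 / (64 * \<Lambda>\<^sup>2) = 4 * (Y\<^sup>2 / (256 * \<Lambda>\<^sup>2))" "Y\<^sup>2 / (128 * \<Lambda>\<^sup>2) = 2 * (Y\<^sup>2 / (256 * \<Lambda>\<^sup>2))" by simp_all
      moreover have "0 \<le> Y\<^sup>2 / (256 * \<Lambda>\<^sup>2)" by simp
      moreover have "0 \<le> K * w * g\<^sup>2" using K w by simp
      ultimately show ?thesis using q2 bad p' by linarith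
    qed
  qed
qed

section \<open>Energies cut off in frequency\<close>

text \<open>
  With the cut-off every continuous symbol becomes a bounded multiplier, and the calculus of
  symbols holds on one fixed ball of frequencies.
\<close>

definition cutm :: "nat \<Rightarrow> ('a::euclidean_space \<Rightarrow> real) \<Rightarrow> 'a L2 \<Rightarrow> 'a L2" where
  "cutm N g = mulL (\<lambda>\<xi>. g \<xi> * fcut N \<xi>)"

lemma bounded_linear_cutm: "continuous_on UNIV g \<Longrightarrow> bounded_linear (cutm N g)"
  unfolding cutm_def by (intro bounded_linear_mulL bmult_cut)

lemma cutm_1: "cutm N (\<lambda>_. 1) = mulL (fcut N)"
  by (simp add: cutm_def)

lemma inner_cutm:
  assumes "continuous_on UNIV g" "continuous_on UNIV h"
  shows "cutm N g f \<bullet> cutm N h f' = cutm N (\<lambda>\<xi>. g \<xi> * h \<xi>) f \<bullet> f'"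
proof -
  have "(\<lambda>\<xi>. g \<xi> * fcut N \<xi> * (h \<xi> * fcut N \<xi>)) = (\<lambda>\<xi>. g \<xi> * h \<xi> * fcut N \<xi>)"
    by (auto simp: fcut_def)
  then show ?thesis
    unfolding cutm_def using assms by (simp add: inner_mulL_right bmult_cut)
qed

lemma cutm_symmetric: "continuous_on UNIV g \<Longrightarrow> cutm N g f \<bullet> f' = cutm N g f' \<bullet> f"
  unfolding cutm_def by (subst inner_mulL_commute[OF bmult_cut]) (simp_all only: inner_commute)

lemma cutm_mono:
  assumes "continuous_on UNIV g" "continuous_on UNIV h" "\<And>\<xi>. g \<xi> \<le> h \<xi>"
  shows "cutm N g f \<bullet> f \<le> cutm N h f \<bullet> f"
  unfolding cutm_def by (intro mulL_mono bmult_cut assms) (auto simp: fcut_def assms(3))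

lemma cutm_add:
  assumes "continuous_on UNIV g" "continuous_on UNIV h"
  shows "cutm N (\<lambda>\<xi>. g \<xi> + h \<xi>) f = cutm N g f + cutm N h f"
  unfolding cutm_def distrib_right by (intro mulL_add_fun bmult_cut assms)

lemma cutm_scale: "continuous_on UNIV g \<Longrightarrow> cutm N (\<lambda>\<xi>. r * g \<xi>) f = r *\<^sub>R cutm N g f"
  unfolding cutm_def mult.assoc by (intro mulL_scale_fun bmult_cut)

lemma cutm_diff:
  assumes "continuous_on UNIV g" "continuous_on UNIV h"
  shows "cutm N (\<lambda>\<xi>. g \<xi> - h \<xi>) f = cutm N g f - cutm N h f"
  using cutm_add[OF assms(1) continuous_on_minus[OF assms(2)]] cutm_scale[OF assms(2), of N "-1" f] by simp

lemma cutm_sum: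
  assumes "\<And>i. i \<in> A \<Longrightarrow> continuous_on UNIV (g i)"
  shows "cutm N (\<lambda>\<xi>. \<Sum>i\<in>A. g i \<xi>) f = (\<Sum>i\<in>A. cutm N (g i) f)"
  unfolding cutm_def sum_distrib_right by (intro mulL_sum_fun bmult_cut assms)

lemma cutm_cut: "continuous_on UNIV g \<Longrightarrow> cutm N g f \<bullet> f' = cutm N g f \<bullet> mulL (fcut N) f'"
  using inner_cutm[of g "\<lambda>_. 1" N f f'] by (simp add: cutm_1)

lemma norm_cutm_sq: "continuous_on UNIV g \<Longrightarrow> (norm (cutm N g f))\<^sup>2 = cutm N (\<lambda>\<xi>. (g \<xi>)\<^sup>2) f \<bullet> f"
  unfolding power2_norm_eq_inner by (simp only: inner_cutm power2_eq_square)

lemma norm_fcut_le: "norm (mulL (fcut N) f) \<le> norm f"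
proof -
  have "(\<lambda>x::'a. complex_of_real (fcut N x)) \<in> borel_measurable lborel"
    unfolding fcut_def by measurable
  then have "(\<lambda>x::'a. complex_of_real (fcut N x)) \<in> borel_measurable lebesgue" by (rule measurable_completion)
  then have "norm (mulL (fcut N) f) \<le> 1 * norm (abs_L2 (rep_L2 f))"
    unfolding mulL_def by (intro norm_bounded_mult) (auto simp: fcut_def)
  then show ?thesis by simp
qed

definition poly_symbol :: "('n::finite \<Rightarrow> nat) set \<Rightarrow> (('n \<Rightarrow> nat) \<Rightarrow> real) \<Rightarrow> real^'n \<Rightarrow> real" where
  "poly_symbol A c \<xi> = (\<Sum>\<alpha>\<in>A. c \<alpha> * multi_power \<xi> \<alpha>)"

lemma continuous_multi_power [continuous_intros]: "continuous_on UNIV (\<lambda>\<xi>. multi_power \<xi> \<alpha>)"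
  unfolding multi_power_def by (intro continuous_intros)

lemma continuous_poly_symbol: "continuous_on UNIV (poly_symbol A c)"
  unfolding poly_symbol_def by (intro continuous_intros)

text \<open>
  A polynomial symbol with time-dependent coefficients is a finite sum of coefficients times fixed
  operators, so differentiating it in time only involves scalar functions.
\<close>

lemma cutm_poly_symbol: "cutm N (poly_symbol A c) f = (\<Sum>\<alpha>\<in>A. c \<alpha> *\<^sub>R cutm N (\<lambda>\<xi>. multi_power \<xi> \<alpha>) f)"
  unfolding poly_symbol_def by (subst cutm_sum) (auto intro!: continuous_intros sum.cong simp: cutm_scale continuous_intros)

text \<open>
  The product rule applied to each coefficient and to the two factors \<open>w\<close>; symmetry of the real
  multiplier merges the latter into the factor 2.
\<close>

lemma energy_primitive:
  fixes w w' :: "real \<Rightarrow> (real^'n::finite) L2"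
  assumes w: "primitive_on T w w'" and a: "\<And>\<alpha>. \<alpha> \<in> A \<Longrightarrow> primitive_on T (\<lambda>t. a t \<alpha>) (\<lambda>t. a' t \<alpha>)"
    and g: "primitive_on T \<gamma> \<gamma>'"
  shows "primitive_on T (\<lambda>t. cutm N (\<lambda>\<xi>. poly_symbol A (a t) \<xi> - \<gamma> t) (w t) \<bullet> w t)
    (\<lambda>t. 2 * (cutm N (\<lambda>\<xi>. poly_symbol A (a t) \<xi> - \<gamma> t) (w t) \<bullet> w' t)
       + cutm N (\<lambda>\<xi>. poly_symbol A (a' t) \<xi> - \<gamma>' t) (w t) \<bullet> w t)"
proof -
  have quad: "primitive_on T (\<lambda>t. cutm N h (w t) \<bullet> w t) (\<lambda>t. 2 * (cutm N h (w t) \<bullet> w' t))"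
    if h: "continuous_on UNIV h" for h
  proof -
    have "primitive_on T (\<lambda>t. cutm N h (w t) \<bullet> w t) (\<lambda>t. cutm N h (w' t) \<bullet> w t + cutm N h (w t) \<bullet> w' t)"
      by (rule primitive_on_bilinear[OF bounded_bilinear_inner primitive_on_linear[OF bounded_linear_cutm[OF h] w] w])
    then show ?thesis by (simp add: cutm_symmetric[OF h, of N "w' _" "w _"])
  qed
  have c1: "continuous_on UNIV (\<lambda>_::real^'n. 1::real)" by (rule continuous_on_const)
  let ?m = "\<lambda>\<alpha> \<xi>. multi_power \<xi> \<alpha> :: real"
  have exp: "cutm N (\<lambda>\<xi>. poly_symbol A c \<xi> - g) f \<bullet> f' = (\<Sum>\<alpha>\<in>A. c \<alpha> * (cutm N (?m \<alpha>) f \<bullet> f')) - g * (cutm N (\<lambda>_. 1) f \<bullet> f')" for c g and f f' :: "(real^'n) L2"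
    using cutm_scale[OF c1, of N g f]
    by (simp add: cutm_diff continuous_poly_symbol cutm_poly_symbol inner_diff_left inner_sum_left)
  have "primitive_on T (\<lambda>t. (\<Sum>\<alpha>\<in>A. a t \<alpha> * (cutm N (?m \<alpha>) (w t) \<bullet> w t)) + (- 1) * (\<gamma> t * (cutm N (\<lambda>_. 1) (w t) \<bullet> w t)))
    (\<lambda>t. (\<Sum>\<alpha>\<in>A. a' t \<alpha> * (cutm N (?m \<alpha>) (w t) \<bullet> w t) + a t \<alpha> * (2 * (cutm N (?m \<alpha>) (w t) \<bullet> w' t)))
      + (- 1) * (\<gamma>' t * (cutm N (\<lambda>_. 1) (w t) \<bullet> w t) + \<gamma> t * (2 * (cutm N (\<lambda>_. 1) (w t) \<bullet> w' t))))"
    by (intro primitive_on_add primitive_on_sum primitive_on_linear[OF bounded_linear_mult_right]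
        primitive_on_bilinear[OF bounded_bilinear_mult] a g quad continuous_multi_power c1)
  then show ?thesis
    unfolding exp by (simp add: sum.distrib sum_distrib_left algebra_simps)
qed

text \<open>
  With \<open>q = P\<^sub>s - \<gamma>\<close>, \<open>x = d - \<gamma> V\<close> and \<open>y = q V\<close> (after the cut-off), polarisation gives
  \<open>2 \<langle>y, x\<rangle> \<ge> |y|\<^sup>2 - |x - y|\<^sup>2\<close>. The difference \<open>x - y = (d - P V) - (P\<^sub>s - P) V\<close> consists of the defect in the
  equation and the averaging error; the square of the latter is absorbed by the symbol inequality.
\<close>

lemma carleman_pointwise:
  fixes V d :: "(real^'n::finite) L2"
  assumes P: "continuous_on UNIV P" and Ps: "continuous_on UNIV Ps" and q': "continuous_on UNIV q'" and Y: "continuous_on UNIV Y"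
    and ineq: "\<And>\<xi>. A * Y \<xi> \<le> (Ps \<xi> - \<gamma>)\<^sup>2 + q' \<xi> - 2 * (Ps \<xi> - P \<xi>)\<^sup>2"
  shows "e\<^sup>2 * (A * (cutm N Y V \<bullet> V)) - 2 * e\<^sup>2 * (norm (mulL (fcut N) d - cutm N P V))\<^sup>2
    \<le> 2 * (cutm N (\<lambda>\<xi>. Ps \<xi> - \<gamma>) (e *\<^sub>R V) \<bullet> (e *\<^sub>R (d - \<gamma> *\<^sub>R V))) + cutm N q' (e *\<^sub>R V) \<bullet> (e *\<^sub>R V)"
proof -
  let ?q = "\<lambda>\<xi>. Ps \<xi> - \<gamma>" and ?r = "\<lambda>\<xi>. Ps \<xi> - P \<xi>"
  have c: "continuous_on UNIV ?q" "continuous_on UNIV ?r" "continuous_on UNIV (\<lambda>\<xi>. (?q \<xi>)\<^sup>2)" "continuous_on UNIV (\<lambda>\<xi>. (?r \<xi>)\<^sup>2)"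
    "continuous_on UNIV (\<lambda>\<xi>. (?q \<xi>)\<^sup>2 + q' \<xi>)"
    by (intro continuous_intros P Ps q')+
  have c1: "continuous_on UNIV (\<lambda>_::real^'n. 1::real)" by (rule continuous_on_const)
  note lin = linear_simps[OF bounded_linear_cutm[OF c(1)]] linear_simps[OF bounded_linear_cutm[OF q']]
  define x where "x = mulL (fcut N) (d - \<gamma> *\<^sub>R V)"
  define y where "y = cutm N ?q V"
  have xy: "x - y = (mulL (fcut N) d - cutm N P V) - cutm N ?r V"
  proof -
    have "x = mulL (fcut N) d - \<gamma> *\<^sub>R mulL (fcut N) V"
      unfolding x_def by (simp add: linear_simps[OF bounded_linear_mulL[OF bmult_fcut]])
    moreover have "y = cutm N Ps V - \<gamma> *\<^sub>R mulL (fcut N) V"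
      unfolding y_def using cutm_scale[OF c1, of N \<gamma> V] by (simp add: cutm_diff Ps cutm_1)
    moreover have "cutm N ?r V = cutm N Ps V - cutm N P V" by (rule cutm_diff[OF Ps P])
    ultimately show ?thesis by simp
  qed
  have "(norm (x - y))\<^sup>2 \<le> 2 * (norm (mulL (fcut N) d - cutm N P V))\<^sup>2 + 2 * (norm (cutm N ?r V))\<^sup>2"
    unfolding xy using norm_add_sq_le[of "mulL (fcut N) d - cutm N P V" "- cutm N ?r V"] by simp
  moreover have "2 * (y \<bullet> x) = (norm x)\<^sup>2 + (norm y)\<^sup>2 - (norm (x - y))\<^sup>2"
    by (simp add: power2_norm_eq_inner inner_diff_left inner_diff_right inner_commute)
  moreover have "(norm x)\<^sup>2 \<ge> 0" by simp
  ultimately have 1: "(norm y)\<^sup>2 - 2 * (norm (mulL (fcut N) d - cutm N P V))\<^sup>2 - 2 * (norm (cutm N ?r V))\<^sup>2 \<le> 2 * (y \<bullet> x)"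
    by linarith
  have yx: "cutm N ?q V \<bullet> (d - \<gamma> *\<^sub>R V) = y \<bullet> x"
    unfolding x_def y_def by (rule cutm_cut[OF c(1)])
  have "A * (cutm N Y V \<bullet> V) = cutm N (\<lambda>\<xi>. A * Y \<xi>) V \<bullet> V"
    using cutm_scale[OF Y, of N A V] by simp
  also have "\<dots> \<le> cutm N (\<lambda>\<xi>. ((?q \<xi>)\<^sup>2 + q' \<xi>) - 2 * (?r \<xi>)\<^sup>2) V \<bullet> V"
    using ineq by (intro cutm_mono continuous_intros Y c P Ps q') simp
  also have "\<dots> = (norm y)\<^sup>2 + cutm N q' V \<bullet> V - 2 * (norm (cutm N ?r V))\<^sup>2"
    using cutm_scale[OF c(4), of N 2 V]
    by (simp add: cutm_diff[OF c(5)] continuous_intros c cutm_add[OF c(3) q'] norm_cutm_sq[OF c(1)] norm_cutm_sq[OF c(2)] y_def inner_diff_left inner_add_left)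
  finally have "A * (cutm N Y V \<bullet> V) - 2 * (norm (mulL (fcut N) d - cutm N P V))\<^sup>2 \<le> 2 * (y \<bullet> x) + cutm N q' V \<bullet> V"
    using 1 by linarith
  then have "e\<^sup>2 * (A * (cutm N Y V \<bullet> V) - 2 * (norm (mulL (fcut N) d - cutm N P V))\<^sup>2) \<le> e\<^sup>2 * (2 * (y \<bullet> x) + cutm N q' V \<bullet> V)"
    by (rule mult_left_mono) simp
  moreover have "cutm N ?q (e *\<^sub>R V) \<bullet> (e *\<^sub>R z) = e\<^sup>2 * (cutm N ?q V \<bullet> z)" for z
    by (simp add: lin power2_eq_square)
  moreover have "cutm N q' (e *\<^sub>R V) \<bullet> (e *\<^sub>R V) = e\<^sup>2 * (cutm N q' V \<bullet> V)"
    by (simp add: lin power2_eq_square)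
  ultimately show ?thesis
    by (simp only: yx) (simp add: algebra_simps)
qed

section \<open>Symbol of the operator and Sobolev norms\<close>

definition sweight :: "nat \<Rightarrow> real^'n::finite \<Rightarrow> real" where
  "sweight m \<xi> = (max 1 (norm \<xi>)) ^ (2 * m)"

lemma continuous_sweight [continuous_intros]: "continuous_on UNIV (sweight m)"
  unfolding sweight_def by (intro continuous_intros)

lemma sweight_ge_1: "1 \<le> sweight m \<xi>"
  by (simp add: sweight_def one_le_power)

lemma sweight_nonneg: "0 \<le> sweight m \<xi>"
  by (rule order_trans[OF zero_le_one sweight_ge_1])

lemma abs_multi_power_le: "\<bar>multi_power \<xi> \<alpha>\<bar> \<le> (max 1 (norm \<xi>)) ^ sum \<alpha> UNIV"
proof -
  have "\<bar>multi_power \<xi> \<alpha>\<bar> = (\<Prod>i\<in>UNIV. \<bar>\<xi> $ i\<bar> ^ \<alpha> i)"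
    by (simp add: multi_power_def abs_prod power_abs)
  also have "\<dots> \<le> (\<Prod>i\<in>UNIV. (max 1 (norm \<xi>)) ^ \<alpha> i)"
    by (intro prod_mono conjI power_mono) (auto intro: order_trans[OF component_le_norm_cart])
  finally show ?thesis by (simp add: power_sum)
qed

lemma abs_multi_power_le_sweight: "\<alpha> \<in> multiindices_le (2 * m) \<Longrightarrow> \<bar>multi_power \<xi> \<alpha>\<bar> \<le> sweight m \<xi>"
  unfolding sweight_def multiindices_le_def
  by (intro order_trans[OF abs_multi_power_le] power_increasing) auto

lemma multi_power_sq_le_sweight:
  assumes "\<alpha> \<in> multiindices_le m" shows "(multi_power \<xi> \<alpha>)\<^sup>2 \<le> sweight m \<xi>"
proof -
  have "\<bar>multi_power \<xi> \<alpha>\<bar> \<le> (max 1 (norm \<xi>)) ^ m"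
    using assms unfolding multiindices_le_def by (intro order_trans[OF abs_multi_power_le] power_increasing) auto
  then have "\<bar>multi_power \<xi> \<alpha>\<bar>\<^sup>2 \<le> ((max 1 (norm \<xi>)) ^ m)\<^sup>2" by (intro power_mono) auto
  then show ?thesis by (simp add: sweight_def power_mult[symmetric] mult.commute)
qed

text \<open>
  The weight is controlled by the monomials of order 0 and of order \<open>m\<close> in a coordinate of largest
  modulus alone.
\<close>

lemma sweight_le:
  fixes \<xi> :: "real^'n::finite"
  assumes m: "m \<ge> 1"
  shows "sweight m \<xi> \<le> real (CARD('n) ^ m) * (\<Sum>\<alpha>\<in>multiindices_le m. (multi_power \<xi> \<alpha>)\<^sup>2)"
proof -
  have "Max (range (\<lambda>i. \<bar>\<xi> $ i\<bar>)) \<in> range (\<lambda>i. \<bar>\<xi> $ i\<bar>)" by (intro Max_in) auto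
  then obtain j where "Max (range (\<lambda>i. \<bar>\<xi> $ i\<bar>)) = \<bar>\<xi> $ j\<bar>" by (rule imageE)
  then have j: "\<bar>\<xi> $ i\<bar> \<le> \<bar>\<xi> $ j\<bar>" for i by (metis Max_ge finite rangeI finite_imageI)
  have "(norm \<xi>)\<^sup>2 = (\<Sum>i\<in>UNIV. (\<xi> $ i)\<^sup>2)"
    unfolding power2_norm_eq_inner by (simp add: inner_vec_def power2_eq_square)
  also have "\<dots> \<le> (\<Sum>i\<in>(UNIV::'n set). (\<xi> $ j)\<^sup>2)"
    by (intro sum_mono) (use j in \<open>simp add: abs_le_square_iff[symmetric]\<close>)
  finally have "((norm \<xi>)\<^sup>2) ^ m \<le> (real CARD('n) * (\<xi> $ j)\<^sup>2) ^ m" by (intro power_mono) auto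
  then have n: "(norm \<xi>) ^ (2 * m) \<le> real (CARD('n) ^ m) * ((\<xi> $ j) ^ m)\<^sup>2"
    by (simp add: power_mult power_mult_distrib power2_eq_square)
  define \<alpha> where "\<alpha> = (\<lambda>i. if i = j then m else 0)"
  define z where "z = (\<lambda>i::'n. 0::nat)"
  have p: "multi_power \<xi> \<alpha> = (\<xi> $ j) ^ m"
    unfolding multi_power_def \<alpha>_def by (subst prod.remove[of UNIV j]) auto
  have "sum \<alpha> UNIV = m" by (simp add: \<alpha>_def)
  then have in1: "{z, \<alpha>} \<subseteq> multiindices_le m" by (auto simp: multiindices_le_def z_def)
  have ne: "z \<noteq> \<alpha>" using m by (auto simp: z_def \<alpha>_def fun_eq_iff)
  have "1 + ((\<xi> $ j) ^ m)\<^sup>2 = (\<Sum>\<alpha>\<in>{z, \<alpha>}. (multi_power \<xi> \<alpha>)\<^sup>2)"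
    using ne by (simp add: p) (simp add: z_def multi_power_def)
  also have "\<dots> \<le> (\<Sum>\<alpha>\<in>multiindices_le m. (multi_power \<xi> \<alpha>)\<^sup>2)"
    by (intro sum_mono2 finite_multiindices_le in1) auto
  finally have s: "1 + ((\<xi> $ j) ^ m)\<^sup>2 \<le> (\<Sum>\<alpha>\<in>multiindices_le m. (multi_power \<xi> \<alpha>)\<^sup>2)" .
  have "1 \<le> CARD('n) ^ m" by (rule one_le_power) (simp add: Suc_leI)
  then have c: "1 \<le> real (CARD('n) ^ m)" by (simp only: real_of_nat_ge_one_iff)
  have "sweight m \<xi> \<le> 1 + (norm \<xi>) ^ (2 * m)" by (simp add: sweight_def max_def)
  also have "\<dots> \<le> real (CARD('n) ^ m) * (1 + ((\<xi> $ j) ^ m)\<^sup>2)" using n c unfolding distrib_left mult_1_right by linarith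
  also have "\<dots> \<le> real (CARD('n) ^ m) * (\<Sum>\<alpha>\<in>multiindices_le m. (multi_power \<xi> \<alpha>)\<^sup>2)"
    using s by (intro mult_left_mono) auto
  finally show ?thesis .
qed

definition full_symbol :: "nat \<Rightarrow> (('n::finite \<Rightarrow> nat) \<Rightarrow> real) \<Rightarrow> real^'n \<Rightarrow> real" where
  "full_symbol k c = poly_symbol (multiindices_le k) (\<lambda>\<alpha>. (- 1) ^ sum \<alpha> UNIV * c \<alpha>)"

lemma full_symbol_eq_parts:
  assumes "\<xi> \<noteq> 0" shows "full_symbol k (R t) \<xi> = (\<Sum>j\<le>k. symbol_part R j t \<xi> * norm \<xi> ^ j)"
proof -
  let ?f = "\<lambda>\<alpha>. (- 1) ^ sum \<alpha> UNIV * R t \<alpha> * multi_power \<xi> \<alpha>"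
  have "full_symbol k (R t) \<xi> = (\<Sum>\<alpha>\<in>multiindices_le k. ?f \<alpha>)"
    by (simp add: full_symbol_def poly_symbol_def)
  also have "\<dots> = (\<Sum>j\<in>{..k}. \<Sum>\<alpha>\<in>{\<alpha> \<in> multiindices_le k. sum \<alpha> UNIV = j}. ?f \<alpha>)"
    by (rule sum.group[symmetric, OF finite_multiindices_le finite_atMost]) (auto simp: multiindices_le_def)
  also have "\<dots> = (\<Sum>j\<le>k. symbol_part R j t \<xi> * norm \<xi> ^ j)"
  proof (intro sum.cong refl)
    fix j assume "j \<in> {..k}"
    then have "{\<alpha> \<in> multiindices_le k. sum \<alpha> UNIV = j} = {\<alpha>. sum \<alpha> UNIV = j}" by (auto simp: multiindices_le_def)
    then show "(\<Sum>\<alpha>\<in>{\<alpha> \<in> multiindices_le k. sum \<alpha> UNIV = j}. ?f \<alpha>) = symbol_part R j t \<xi> * norm \<xi> ^ j"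
      using assms by (simp only: symbol_part_def) (auto simp: sum_distrib_left mult.assoc intro!: sum.cong)
  qed
  finally show ?thesis .
qed

text \<open>
  The principal part is at least \<open>(L ^ (2 m) - 1) / \<Lambda>\<close> with \<open>L = max 1 |\<xi>|\<close>, the lower-order part at
  least \<open>- 2 m \<Lambda> L ^ (2 m - 1)\<close>. Half of the former absorbs the latter once \<open>L \<ge> 4 m \<Lambda>\<^sup>2\<close>; for smaller \<open>L\<close> it is
  bounded. The parts are not defined at \<open>\<xi> = 0\<close>, where only the coefficient of order 0 remains, which is
  read off from the part of order 0 at a unit vector.
\<close>

lemma full_symbol_lower_bound:
  fixes \<xi> :: "real^'n::finite"
  assumes m: "m \<ge> 1" and \<Lambda>: "\<Lambda> > 0"
    and H: "\<And>\<xi>::real^'n. \<xi> \<noteq> 0 \<Longrightarrow> (\<forall>k<2 * m. \<bar>symbol_part R k t \<xi>\<bar> \<le> \<Lambda>) \<and> 1 / \<Lambda> \<le> symbol_part R (2 * m) t \<xi>"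
  shows "sweight m \<xi> / (2 * \<Lambda>) - (1 / \<Lambda> + \<Lambda> + 2 * m * \<Lambda> * (4 * m * \<Lambda>\<^sup>2) ^ (2 * m - 1)) \<le> full_symbol (2 * m) (R t) \<xi>"
proof (cases "\<xi> = 0")
  case True
  have mz: "multi_power (0::real^'n) \<alpha> = (if \<alpha> = (\<lambda>_. 0) then 1 else 0)" for \<alpha>
  proof (cases "\<alpha> = (\<lambda>_. 0)")
    case False
    then obtain i where "\<alpha> i \<noteq> 0" by auto
    then have "(\<Prod>i\<in>UNIV. ((0::real^'n) $ i) ^ \<alpha> i) = 0" by (intro prod_zero) auto
    with False show ?thesis by (simp add: multi_power_def)
  qed (simp add: multi_power_def)
  have "full_symbol (2 * m) (R t) \<xi> = (\<Sum>\<alpha>\<in>multiindices_le (2 * m). if \<alpha> = (\<lambda>_. 0) then R t \<alpha> else 0)"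
    unfolding full_symbol_def poly_symbol_def True by (intro sum.cong) (auto simp: mz)
  also have "\<dots> = R t (\<lambda>_. 0)"
    by (simp add: sum.delta[OF finite_multiindices_le]) (simp add: multiindices_le_def)
  finally have e: "full_symbol (2 * m) (R t) \<xi> = R t (\<lambda>_. 0)" .
  obtain i :: 'n where True by simp
  have nz: "axis i 1 \<noteq> (0::real^'n)" by (simp add: axis_eq_0_iff)
  have "{\<alpha>. sum \<alpha> UNIV = 0} = {\<lambda>_::'n. 0::nat}" by (auto simp: fun_eq_iff)
  then have "symbol_part R 0 t (axis i 1 :: real^'n) = R t (\<lambda>_. 0)"
    by (simp add: symbol_part_def multi_power_def)
  then have "\<bar>R t (\<lambda>_. 0)\<bar> \<le> \<Lambda>" using H[OF nz] m by (metis less_numeral_extra(1) mult_pos_pos order_less_le_trans pos2)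
  then have "- \<Lambda> \<le> full_symbol (2 * m) (R t) \<xi>" unfolding e by linarith
  moreover have "sweight m \<xi> = 1" by (simp add: sweight_def True)
  moreover have "1 / (2 * \<Lambda>) \<le> 1 / \<Lambda>" using \<Lambda> by (simp add: field_simps)
  moreover have "0 \<le> 2 * real m * \<Lambda> * (4 * real m * \<Lambda>\<^sup>2) ^ (2 * m - 1)" using \<Lambda> by simp
  ultimately show ?thesis by (simp only:)
next
  case False
  note H = H[OF False]
  define L where "L = max 1 (norm \<xi>)"
  have L: "1 \<le> L" "norm \<xi> \<le> L" by (auto simp: L_def)
  define Q where "Q = 4 * m * \<Lambda>\<^sup>2"
  have Q: "Q > 0" using m \<Lambda> by (simp add: Q_def)
  have 1: "symbol_part R (2 * m) t \<xi> * norm \<xi> ^ (2 * m) \<ge> (L ^ (2 * m) - 1) / \<Lambda>"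
  proof -
    have "L ^ (2 * m) - 1 \<le> norm \<xi> ^ (2 * m)" by (auto simp: L_def max_def)
    then have "(L ^ (2 * m) - 1) / \<Lambda> \<le> 1 / \<Lambda> * norm \<xi> ^ (2 * m)" using \<Lambda> by (simp add: divide_right_mono)
    also have "\<dots> \<le> symbol_part R (2 * m) t \<xi> * norm \<xi> ^ (2 * m)" using H by (intro mult_right_mono) auto
    finally show ?thesis .
  qed
  have 2: "(\<Sum>j<2 * m. symbol_part R j t \<xi> * norm \<xi> ^ j) \<ge> - (2 * m * \<Lambda> * L ^ (2 * m - 1))"
  proof -
    have "- (\<Lambda> * L ^ (2 * m - 1)) \<le> symbol_part R j t \<xi> * norm \<xi> ^ j" if "j < 2 * m" for j
    proof -
      have "norm \<xi> ^ j \<le> L ^ j" using L by (intro power_mono) auto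
      also have "\<dots> \<le> L ^ (2 * m - 1)" using L that by (intro power_increasing) auto
      finally have "\<bar>symbol_part R j t \<xi>\<bar> * norm \<xi> ^ j \<le> \<Lambda> * L ^ (2 * m - 1)"
        using H that \<Lambda> by (intro mult_mono) auto
      moreover have "- (\<bar>symbol_part R j t \<xi>\<bar> * norm \<xi> ^ j) \<le> symbol_part R j t \<xi> * norm \<xi> ^ j"
        unfolding minus_mult_left by (intro mult_right_mono) auto
      ultimately show ?thesis by linarith
    qed
    then have "(\<Sum>j<2 * m. - (\<Lambda> * L ^ (2 * m - 1))) \<le> (\<Sum>j<2 * m. symbol_part R j t \<xi> * norm \<xi> ^ j)"
      by (intro sum_mono) auto
    then show ?thesis by simp
  qed
  have 3: "2 * m * \<Lambda> * L ^ (2 * m - 1) \<le> L ^ (2 * m) / (2 * \<Lambda>) + 2 * m * \<Lambda> * Q ^ (2 * m - 1)"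
  proof (cases "Q \<le> L")
    case True
    have "2 * m * \<Lambda> * L ^ (2 * m - 1) = (Q * L ^ (2 * m - 1)) / (2 * \<Lambda>)" using \<Lambda> by (simp add: Q_def power2_eq_square)
    also have "\<dots> \<le> (L * L ^ (2 * m - 1)) / (2 * \<Lambda>)" using True L \<Lambda> by (intro divide_right_mono mult_right_mono) auto
    also have "L * L ^ (2 * m - 1) = L ^ (2 * m)" using m by (simp flip: power_Suc)
    finally show ?thesis using \<Lambda> Q by (simp add: add_increasing2)
  next
    case False
    then have "L ^ (2 * m - 1) \<le> Q ^ (2 * m - 1)" using L by (intro power_mono) auto
    then have "2 * m * \<Lambda> * L ^ (2 * m - 1) \<le> 2 * m * \<Lambda> * Q ^ (2 * m - 1)" using \<Lambda> by (intro mult_left_mono) auto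
    moreover have "0 \<le> L ^ (2 * m) / (2 * \<Lambda>)" using L \<Lambda> by simp
    ultimately show ?thesis by linarith
  qed
  have "full_symbol (2 * m) (R t) \<xi> = (\<Sum>j<2 * m. symbol_part R j t \<xi> * norm \<xi> ^ j) + symbol_part R (2 * m) t \<xi> * norm \<xi> ^ (2 * m)"
    unfolding full_symbol_eq_parts[OF False] by (simp add: lessThan_Suc_atMost[symmetric])
  moreover have "(L ^ (2 * m) - 1) / \<Lambda> = 2 * (L ^ (2 * m) / (2 * \<Lambda>)) - 1 / \<Lambda>" using \<Lambda> by (simp add: field_simps)
  moreover have "sweight m \<xi> = L ^ (2 * m)" by (simp add: sweight_def L_def)
  ultimately show ?thesis using 1 2 3 \<Lambda> unfolding Q_def by simp
qed

lemma norm_cut_weak_deriv: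
  assumes "f \<in> sobolev k" "\<alpha> \<in> multiindices_le k"
  shows "norm (mulL (fcut N) (four (weak_deriv \<alpha> f))) = norm (cutm N (\<lambda>\<xi>. multi_power \<xi> \<alpha>) (four f))"
  unfolding four_weak_deriv[OF assms] by (simp add: norm_scaleC norm_power cutm_def)

lemma sobolev_norm_sq: "(sobolev_norm k f)\<^sup>2 = (\<Sum>\<alpha>\<in>multiindices_le k. (norm (weak_deriv \<alpha> f))\<^sup>2)"
  by (simp add: sobolev_norm_def sum_nonneg)

lemma multiindices_le_mono: "k \<le> l \<Longrightarrow> multiindices_le k \<subseteq> multiindices_le l"
  by (auto simp: multiindices_le_def)

text \<open>
  On the frequency side the weak derivatives are multiplications by monomials, which control the
  weight; the bound is uniform in the cut-off.
\<close>

lemma cut_energy_le_sobolev: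
  fixes f :: "(real^'n::finite) L2"
  assumes f: "f \<in> sobolev (2 * m)" and m: "m \<ge> 1"
  shows "cutm N (sweight m) (four f) \<bullet> four f \<le> real (CARD('n) ^ m) * (sobolev_norm m f)\<^sup>2"
proof -
  let ?c = "real (CARD('n) ^ m)" and ?A = "multiindices_le m :: ('n \<Rightarrow> nat) set"
  have cm: "continuous_on UNIV (\<lambda>\<xi>. (multi_power \<xi> \<alpha>)\<^sup>2)" for \<alpha> :: "'n \<Rightarrow> nat"
    by (intro continuous_intros)
  have cs: "continuous_on UNIV (\<lambda>\<xi>. \<Sum>\<alpha>\<in>?A. (multi_power \<xi> \<alpha>)\<^sup>2)"
    by (intro continuous_intros)
  have "cutm N (sweight m) (four f) \<bullet> four f \<le> cutm N (\<lambda>\<xi>. ?c * (\<Sum>\<alpha>\<in>?A. (multi_power \<xi> \<alpha>)\<^sup>2)) (four f) \<bullet> four f"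
    by (intro cutm_mono continuous_intros sweight_le m)
  also have "\<dots> = ?c * (\<Sum>\<alpha>\<in>?A. (norm (cutm N (\<lambda>\<xi>. multi_power \<xi> \<alpha>) (four f)))\<^sup>2)"
    by (simp only: cutm_scale[OF cs] cutm_sum[OF cm] inner_scaleR_left inner_sum_left norm_cutm_sq[OF continuous_multi_power])
  also have "\<dots> \<le> ?c * (\<Sum>\<alpha>\<in>?A. (norm (weak_deriv \<alpha> f))\<^sup>2)"
  proof (intro mult_left_mono sum_mono power_mono)
    fix \<alpha> assume "\<alpha> \<in> ?A"
    then have "\<alpha> \<in> multiindices_le (2 * m)" using multiindices_le_mono[of m "2 * m"] by auto
    from norm_cut_weak_deriv[OF f this, of N, symmetric]
    show "norm (cutm N (\<lambda>\<xi>. multi_power \<xi> \<alpha>) (four f)) \<le> norm (weak_deriv \<alpha> f)"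
      using norm_fcut_le[of N "four (weak_deriv \<alpha> f)"] by (simp add: norm_four)
  qed auto
  finally show ?thesis by (simp add: sobolev_norm_sq)
qed

text \<open>
  Conversely the weight dominates the square of every monomial of order at most \<open>m\<close>.
\<close>

lemma sobolev_le_limit_energy:
  fixes f :: "(real^'n::finite) L2"
  assumes f: "f \<in> sobolev (2 * m)" and S: "(\<lambda>N. cutm N (sweight m) (four f) \<bullet> four f) \<longlonglongrightarrow> S"
  shows "(sobolev_norm m f)\<^sup>2 \<le> real (card (multiindices_le m :: ('n \<Rightarrow> nat) set)) * S"
proof -
  have "(norm (weak_deriv \<alpha> f))\<^sup>2 \<le> S" if \<alpha>: "\<alpha> \<in> multiindices_le m" for \<alpha>
  proof (rule LIMSEQ_le[OF _ S])
    have \<alpha>2: "\<alpha> \<in> multiindices_le (2 * m)" using \<alpha> multiindices_le_mono[of m "2 * m"] by auto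
    have "(\<lambda>N. (norm (mulL (fcut N) (four (weak_deriv \<alpha> f))))\<^sup>2) \<longlonglongrightarrow> (norm (four (weak_deriv \<alpha> f)))\<^sup>2"
      by (intro tendsto_intros fcut_limit)
    then show "(\<lambda>N. (norm (cutm N (\<lambda>\<xi>. multi_power \<xi> \<alpha>) (four f)))\<^sup>2) \<longlonglongrightarrow> (norm (weak_deriv \<alpha> f))\<^sup>2"
      by (simp add: norm_cut_weak_deriv[OF f \<alpha>2] norm_four)
    show "\<exists>N. \<forall>n\<ge>N. (norm (cutm n (\<lambda>\<xi>. multi_power \<xi> \<alpha>) (four f)))\<^sup>2 \<le> cutm n (sweight m) (four f) \<bullet> four f"
      unfolding norm_cutm_sq[OF continuous_multi_power]
      by (intro exI allI impI cutm_mono continuous_intros multi_power_sq_le_sweight \<alpha>)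
  qed
  then have "(\<Sum>\<alpha>\<in>multiindices_le m. (norm (weak_deriv \<alpha> f))\<^sup>2) \<le> (\<Sum>\<alpha>\<in>(multiindices_le m :: ('n \<Rightarrow> nat) set). S)"
    by (intro sum_mono)
  then show ?thesis by (simp add: sobolev_norm_sq)
qed

text \<open>
  The two factors \<open>\<i> ^ |\<alpha>|\<close>, one from the operator and one from the derivative, combine to \<open>(- 1) ^ |\<alpha>|\<close>.
\<close>

lemma cut_operator:
  fixes f v :: "(real^'n::finite) L2"
  assumes f: "f \<in> sobolev k"
  shows "mulL (fcut N) (four (v - (\<Sum>\<alpha>\<in>multiindices_le k. scaleC (\<i> ^ sum \<alpha> UNIV * complex_of_real (c \<alpha>)) (weak_deriv \<alpha> f))))
    = mulL (fcut N) (four v) - cutm N (full_symbol k c) (four f)"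
proof -
  have four_sum: "four (\<Sum>\<alpha>\<in>A. g \<alpha>) = (\<Sum>\<alpha>\<in>A. four (g \<alpha>))" for A and g :: "('n \<Rightarrow> nat) \<Rightarrow> (real^'n) L2"
    by (induction A rule: infinite_finite_induct) (auto simp: linear_simps[OF bounded_linear_four])
  have mul_sum: "mulL (fcut N) (\<Sum>\<alpha>\<in>A. g \<alpha>) = (\<Sum>\<alpha>\<in>A. mulL (fcut N) (g \<alpha>))" for A and g :: "('n \<Rightarrow> nat) \<Rightarrow> (real^'n) L2"
    by (induction A rule: infinite_finite_induct) (auto simp: linear_simps[OF bounded_linear_mulL[OF bmult_fcut]])
  have "mulL (fcut N) (four (scaleC (\<i> ^ sum \<alpha> UNIV * complex_of_real (c \<alpha>)) (weak_deriv \<alpha> f)))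
     = ((- 1) ^ sum \<alpha> UNIV * c \<alpha>) *\<^sub>R cutm N (\<lambda>\<xi>. multi_power \<xi> \<alpha>) (four f)" if "\<alpha> \<in> multiindices_le k" for \<alpha>
  proof -
    have "\<i> ^ sum \<alpha> UNIV * complex_of_real (c \<alpha>) * \<i> ^ sum \<alpha> UNIV = of_real ((- 1) ^ sum \<alpha> UNIV * c \<alpha>)"
      by (simp add: power_mult_distrib[symmetric])
    then show ?thesis
      by (simp only: four_scaleC mulL_scaleC[OF bmult_fcut] four_weak_deriv[OF f that] scaleC_scaleC scaleC_of_real cutm_def)
  qed
  then show ?thesis
    unfolding full_symbol_def cutm_poly_symbol
    by (simp add: linear_simps[OF bounded_linear_four] linear_simps[OF bounded_linear_mulL[OF bmult_fcut]] four_sum mul_sum)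
qed

lemma cut_energy_mono:
  "N \<le> N' \<Longrightarrow> cutm N (sweight m) V \<bullet> V \<le> cutm N' (sweight m) V \<bullet> V"
  unfolding cutm_def
  by (intro mulL_mono bmult_cut continuous_sweight) (auto simp: fcut_def sweight_nonneg)

lemma cut_energy_nonneg: "0 \<le> cutm N (sweight m) V \<bullet> V"
proof -
  have "0 \<le> (norm (cutm N (\<lambda>_. 1) V))\<^sup>2" by simp
  also have "\<dots> = cutm N (\<lambda>\<xi>. 1\<^sup>2) V \<bullet> V" by (rule norm_cutm_sq) (rule continuous_on_const)
  also have "\<dots> \<le> cutm N (sweight m) V \<bullet> V"
    by (intro cutm_mono continuous_intros) (simp add: sweight_ge_1)
  finally show ?thesis .
qed

lemma norm_fcut_le_energy: "(norm (mulL (fcut N) V))\<^sup>2 \<le> cutm N (sweight m) V \<bullet> V"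
proof -
  have "(norm (cutm N (\<lambda>_. 1) V))\<^sup>2 = cutm N (\<lambda>\<xi>. 1\<^sup>2) V \<bullet> V" by (rule norm_cutm_sq) (rule continuous_on_const)
  also have "\<dots> \<le> cutm N (sweight m) V \<bullet> V"
    by (intro cutm_mono continuous_intros) (simp add: sweight_ge_1)
  finally show ?thesis by (simp add: cutm_1)
qed

section \<open>Carleman estimate\<close>

lemma AE_time_exists_between:
  fixes a b T :: real
  assumes ae: "AE t in lebesgue_on {0..T}. P t" and ab: "0 \<le> a" "a < b" "b \<le> T"
  obtains t where "a < t" "t < b" "P t"
proof (rule ccontr)
  assume "\<not> thesis"
  with that have np: "\<not> P t" if "t \<in> {a<..<b}" for t using that by auto
  have "AE t in lebesgue. t \<in> {0..T} \<longrightarrow> P t"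
    using ae by (subst (asm) AE_restrict_space_iff) auto
  then have "AE t in lebesgue. t \<notin> {a<..<b}"
    by eventually_elim (use np ab in auto)
  then have "{a<..<b} \<in> null_sets lebesgue"
    by (subst AE_iff_null_sets) auto
  then have "emeasure lebesgue {a<..<b} = 0" by auto
  then show False using ab by simp
qed

text \<open>
  The weight is \<open>exp \<phi>\<close> with \<open>\<phi>' = - 1 / \<sigma>\<close>. As \<open>\<sigma> \<le> s\<^sub>1\<close>, it falls at least as fast as \<open>exp (- t / s\<^sub>1)\<close>.
\<close>

lemma carleman_weight:
  fixes \<sigma> :: "real \<Rightarrow> real"
  assumes T: "T > 0" and \<sigma>: "\<And>t. t \<in> {0..T} \<Longrightarrow> 0 < \<sigma> t \<and> \<sigma> t \<le> s1" and c: "continuous_on {0..T} \<sigma>"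
  obtains e where "\<And>t. t \<in> {0..T} \<Longrightarrow> 0 < e t" "\<And>t. t \<in> {0..T} \<Longrightarrow> (e has_real_derivative - (1 / \<sigma> t) * e t) (at t within {0..T})"
    "\<And>s t. 0 \<le> s \<Longrightarrow> s \<le> t \<Longrightarrow> t \<le> T \<Longrightarrow> e t \<le> e s"
    "\<And>s t. 0 \<le> s \<Longrightarrow> s < t \<Longrightarrow> t \<le> T \<Longrightarrow> e t \<le> exp (- ((t - s) / s1)) * e s"
proof -
  define k where "k t = max 0 (min t T)" for t
  have k: "k t \<in> {0..T}" "t \<in> {0..T} \<Longrightarrow> k t = t" for t using T by (auto simp: k_def)
  have "continuous_on UNIV (\<lambda>t. - (1 / \<sigma> (k t)))"
  proof (intro continuous_intros continuous_on_compose2[OF c] ballI)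
    show "continuous_on UNIV k" unfolding k_def by (intro continuous_intros)
    show "\<sigma> (k t) \<noteq> 0" for t using \<sigma>[OF k(1)[of t]] by simp
  qed (use k in auto)
  from continuous_antiderivative[OF this]
  obtain \<phi> where \<phi>: "\<And>t. (\<phi> has_real_derivative - (1 / \<sigma> (k t))) (at t)"
    by metis
  have dec: "\<phi> t \<le> \<phi> s - (t - s) / s1" if st: "s < t" for s t
  proof -
    obtain z where z: "\<phi> t - \<phi> s = (t - s) * (- (1 / \<sigma> (k z)))"
      using MVT2[OF st, of \<phi> "\<lambda>t. - (1 / \<sigma> (k t))"] \<phi> by blast
    have "1 / s1 \<le> 1 / \<sigma> (k z)" using \<sigma>[OF k(1)[of z]] by (intro divide_left_mono) auto
    then have "(t - s) * (1 / s1) \<le> (t - s) * (1 / \<sigma> (k z))" using st by (intro mult_left_mono) auto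
    with z show ?thesis by simp
  qed
  have s1: "s1 > 0" using \<sigma>[of 0] T by auto
  show ?thesis
  proof (rule that[of "\<lambda>t. exp (\<phi> t)"])
    fix t assume t: "t \<in> {0..T}"
    have "((\<lambda>t. exp (\<phi> t)) has_real_derivative exp (\<phi> t) * (- (1 / \<sigma> (k t)))) (at t within {0..T})"
      by (rule has_field_derivative_at_within[OF DERIV_fun_exp[OF \<phi>]])
    then show "((\<lambda>t. exp (\<phi> t)) has_real_derivative - (1 / \<sigma> t) * exp (\<phi> t)) (at t within {0..T})"
      using k(2)[OF t] by (simp add: mult.commute)
  next
    fix s t :: real assume "s < t"
    have "exp (\<phi> t) \<le> exp (\<phi> s - (t - s) / s1)" using dec[OF \<open>s < t\<close>] by simp
    also have "\<dots> = exp (- ((t - s) / s1)) * exp (\<phi> s)" by (simp flip: exp_add)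
    finally show "exp (\<phi> t) \<le> exp (- ((t - s) / s1)) * exp (\<phi> s)" .
  next
    fix s t :: real assume st: "s \<le> t"
    then have "\<phi> t \<le> \<phi> s"
    proof (cases "s = t")
      case False
      with st have "s < t" by simp
      moreover have "0 \<le> (t - s) / s1" using st s1 by simp
      ultimately show ?thesis using dec[of s t] by linarith
    qed simp
    then show "exp (\<phi> t) \<le> exp (\<phi> s)" by simp
  qed auto
qed

text \<open>
  The energy of \<open>w = e V\<close> with the averaged symbol vanishes at time 0, its derivative dominates \<open>J\<close> by
  the pointwise estimate, and at time \<open>b\<close> it is at most a multiple of the weighted energy of \<open>V\<close>,
  as \<open>- \<gamma>\<close> has the good sign. The weight \<open>e\<close> depends on the bound \<open>s\<^sub>1\<close> for \<open>\<sigma>\<close>, but the constants do not,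
  and the same \<open>e\<close> serves all cut-offs \<open>N\<close>.
\<close>

lemma carleman_integrated:
  fixes V d :: "real \<Rightarrow> (real^'n::finite) L2" and R :: "real \<Rightarrow> ('n \<Rightarrow> nat) \<Rightarrow> real" and \<omega> :: "real \<Rightarrow> real"
    and m :: nat
  defines "\<I> \<equiv> multiindices_le (2 * m) :: ('n \<Rightarrow> nat) set"
  defines "M \<equiv> real (card \<I>)"
  assumes m: "m \<ge> 1" and T: "T > 0" and \<Lambda>: "\<Lambda> > 0" and D: "D \<ge> 0" and A: "A > 0"
    and Rc: "\<And>\<alpha>. \<alpha> \<in> \<I> \<Longrightarrow> continuous_on {0..T} (\<lambda>t. R t \<alpha>)"
    and RB: "\<And>\<alpha> t. \<alpha> \<in> \<I> \<Longrightarrow> t \<in> {0..T} \<Longrightarrow> \<bar>R t \<alpha>\<bar> \<le> B"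
    and osc: "\<And>\<alpha> s t h. \<alpha> \<in> \<I> \<Longrightarrow> s \<in> {0..T} \<Longrightarrow> t \<in> {0..T} \<Longrightarrow> \<bar>t - s\<bar> \<le> h \<Longrightarrow> h \<le> 1 \<Longrightarrow> \<bar>R t \<alpha> - R s \<alpha>\<bar> \<le> \<omega> h"
    and ell: "\<And>t \<xi>. t \<in> {0..T} \<Longrightarrow> sweight m \<xi> / (2 * \<Lambda>) - D \<le> full_symbol (2 * m) (R t) \<xi>"
    and \<omega>c: "continuous_on UNIV \<omega>" and \<omega>ge: "\<And>s. 0 < s \<Longrightarrow> s \<le> \<omega> s" and \<omega>0: "\<omega> 0 = 0"
    and div: "(\<integral>\<^sup>+s. ennreal (1 / \<omega> s) * indicator {0<..1} s \<partial>lborel) = \<infinity>"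
    and V: "primitive_on T V d" and V0: "V 0 = 0" and s1: "s1 > 0"
  obtains e where "\<And>t. t \<in> {0..T} \<Longrightarrow> 0 < e t" "continuous_on {0..T} e"
    "\<And>s t. 0 \<le> s \<Longrightarrow> s \<le> t \<Longrightarrow> t \<le> T \<Longrightarrow> e t \<le> e s"
    "\<And>s t. 0 \<le> s \<Longrightarrow> s < t \<Longrightarrow> t \<le> T \<Longrightarrow> e t \<le> exp (- ((t - s) / s1)) * e s"
    "\<And>N b J. \<lbrakk>0 \<le> b; b \<le> T; integrable (lebesgue_on {0..T}) J;
       AE t in lebesgue_on {0..T}. J t \<le> (e t)\<^sup>2 * (A * (cutm N (sweight m) (V t) \<bullet> V t))
         - 2 * (e t)\<^sup>2 * (norm (mulL (fcut N) (d t) - cutm N (full_symbol (2 * m) (R t)) (V t)))\<^sup>2\<rbrakk>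
     \<Longrightarrow> (\<integral>t. indicator {0<..b} t *\<^sub>R J t \<partial>lebesgue_on {0..T}) \<le> M * (B + 1) * (e b)\<^sup>2 * (cutm N (sweight m) (V b) \<bullet> V b)"
proof -
  let ?M = "lebesgue_on {0..T}"
  have fin: "finite \<I>" by (simp add: \<I>_def finite_multiindices_le)
  have "(\<lambda>_. 0) \<in> \<I>" by (simp add: \<I>_def multiindices_le_def)
  then have M: "M > 0" using fin by (auto simp: M_def card_gt_0_iff)
  obtain K w0 \<gamma>0 where K: "K > 0" "w0 > 0" "\<gamma>0 > 0"
    and ineq: "\<And>Y P P\<^sub>\<sigma> P' \<gamma> w. \<lbrakk>1 \<le> Y; 0 < w; w \<le> w0; \<gamma>0 \<le> \<gamma>; 1 \<le> \<gamma> * w;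
       \<bar>P\<^sub>\<sigma> - P\<bar> \<le> M * w * Y; \<bar>P'\<bar> \<le> 2 * M * w * \<gamma> * Y; Y / (2 * \<Lambda>) - D \<le> P\<rbrakk>
     \<Longrightarrow> A * Y \<le> (P\<^sub>\<sigma> - \<gamma>)\<^sup>2 + (P' + K * w * \<gamma>\<^sup>2) - 2 * (P\<^sub>\<sigma> - P)\<^sup>2"
    using carleman_symbol_inequality[OF A D M \<Lambda>] by blast
  \<comment> \<open>the bound for \<open>\<omega>(\<sigma>)\<close>: \<open>w\<^sub>0\<close> for the symbol inequality, \<open>1 / K\<close> for \<open>|\<sigma>'| \<le> 1\<close>, and 1 for the energy at time \<open>b\<close>\<close>
  define w1 where "w1 = min 1 (min w0 (1 / K))"
  have w1: "w1 > 0" "w1 \<le> 1" "w1 \<le> w0" "w1 \<le> 1 / K" using K by (auto simp: w1_def)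
  have "isCont \<omega> 0" using \<omega>c by (simp add: continuous_on_eq_continuous_at)
  then have "\<exists>\<delta>>0. \<forall>s. dist s 0 < \<delta> \<longrightarrow> dist (\<omega> s) (\<omega> 0) < w1"
    using w1(1) unfolding continuous_at_eps_delta by blast
  then obtain \<delta> where \<delta>: "\<delta> > 0" "\<And>s. \<bar>s\<bar> < \<delta> \<Longrightarrow> \<bar>\<omega> s\<bar> < w1" by (auto simp: dist_real_def \<omega>0)
  \<comment> \<open>the bound for \<open>\<sigma>\<close>: at most 1, where \<open>\<omega>\<close> controls the coefficients, and \<open>s\<^sub>1\<close>, the prescribed bound;
    below \<open>\<delta>\<close> it makes \<open>\<omega>(\<sigma>)\<close> small, and below \<open>1 / \<gamma>\<^sub>0\<close> it makes \<open>\<gamma>\<close> large\<close>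
  define s2 where "s2 = min (min 1 s1) (min (\<delta> / 2) (1 / \<gamma>0))"
  have s2: "0 < s2" "s2 \<le> 1" "s2 \<le> s1" "s2 < \<delta>" "s2 \<le> 1 / \<gamma>0"
  proof -
    have "s2 \<le> \<delta> / 2" by (simp add: s2_def min_le_iff_disj)
    then show "s2 < \<delta>" using \<delta>(1) by linarith
    show "0 < s2" using s1 \<delta>(1) K by (simp add: s2_def)
  qed (simp_all add: s2_def min_le_iff_disj)
  obtain \<sigma> where \<sigma>: "\<And>t. t \<in> {0..T} \<Longrightarrow> 0 < \<sigma> t \<and> \<sigma> t \<le> s2"
    and \<sigma>': "\<And>t. t \<in> {0..T} \<Longrightarrow> (\<sigma> has_real_derivative K * \<omega> (\<sigma> t)) (at t)"
    using slow_growth_solution[OF \<omega>c \<omega>ge div s2(1,2) K(1) T] by blast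
  have \<sigma>1: "0 < \<sigma> t \<and> \<sigma> t \<le> 1" if "t \<in> {0..T}" for t
    using \<sigma>[OF that] s2(2) by linarith
  have \<omega>\<sigma>: "0 < \<omega> (\<sigma> t)" "\<omega> (\<sigma> t) \<le> w1" "\<sigma> t \<le> \<omega> (\<sigma> t)" if "t \<in> {0..T}" for t
    using \<omega>ge[of "\<sigma> t"] \<sigma>[OF that] \<delta>(2)[of "\<sigma> t"] s2(4) by auto
  have K\<omega>: "\<bar>K * \<omega> (\<sigma> t)\<bar> \<le> 1" if t: "t \<in> {0..T}" for t
  proof -
    have "K * \<omega> (\<sigma> t) \<le> K * (1 / K)" using \<omega>\<sigma>[OF t] w1(4) K by (intro mult_left_mono) auto
    then show ?thesis using K \<omega>\<sigma>[OF t] by (simp add: abs_mult)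
  qed
  have c\<sigma>: "continuous_on {0..T} \<sigma>"
    by (rule DERIV_continuous_on[OF has_field_derivative_at_within[OF \<sigma>']])
  have c\<omega>\<sigma>: "continuous_on {0..T} (\<lambda>t. K * \<omega> (\<sigma> t))"
    by (intro continuous_intros continuous_on_compose2[OF \<omega>c c\<sigma>]) auto
  define k where "k t = max 0 (min t T)" for t
  have k: "k t \<in> {0..T}" "t \<in> {0..T} \<Longrightarrow> k t = t" for t using T by (auto simp: k_def)
  have kl: "\<bar>k x - k y\<bar> \<le> \<bar>x - y\<bar>" for x y by (auto simp: k_def)
  have ck: "continuous_on UNIV k" unfolding k_def by (intro continuous_intros)
  \<comment> \<open>the averages reach beyond time \<open>T\<close>, so the coefficients are extended by constants through the
    projection \<open>k\<close> onto \<open>[0, T]\<close>, which preserves their modulus of continuity\<close>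
  let ?c = "\<lambda>t \<alpha>. (- 1) ^ sum \<alpha> UNIV * R t \<alpha>"
  have "\<exists>p. \<forall>t\<in>{0..T}. (fst p has_real_derivative snd p t) (at t within {0..T}) \<and> continuous_on {0..T} (snd p)
      \<and> \<bar>fst p t - ?c t \<alpha>\<bar> \<le> \<omega> (\<sigma> t) \<and> \<bar>snd p t\<bar> \<le> 2 * \<omega> (\<sigma> t) / \<sigma> t" if \<alpha>: "\<alpha> \<in> \<I>" for \<alpha>
  proof -
    obtain a a' where "\<And>t. t \<in> {0..T} \<Longrightarrow> (a has_real_derivative a' t) (at t within {0..T})"
      "continuous_on {0..T} a'" "\<And>t. t \<in> {0..T} \<Longrightarrow> \<bar>a t - ?c (k t) \<alpha>\<bar> \<le> \<omega> (\<sigma> t)"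
      "\<And>t. t \<in> {0..T} \<Longrightarrow> \<bar>a' t\<bar> \<le> 2 * \<omega> (\<sigma> t) / \<sigma> t"
    proof (rule averaged_coefficient[where r = "\<lambda>t. ?c (k t) \<alpha>" and \<omega> = \<omega> and \<sigma> = \<sigma> and \<sigma>' = "\<lambda>t. K * \<omega> (\<sigma> t)" and T = T])
      show "continuous_on UNIV (\<lambda>t. ?c (k t) \<alpha>)"
        by (intro continuous_intros continuous_on_compose2[OF Rc[OF \<alpha>] ck]) (use k in auto)
      show "\<bar>?c (k x) \<alpha> - ?c (k y) \<alpha>\<bar> \<le> \<omega> h" if "\<bar>x - y\<bar> \<le> h" "h \<le> 1" for x y h
      proof -
        have "\<bar>?c (k x) \<alpha> - ?c (k y) \<alpha>\<bar> = \<bar>R (k x) \<alpha> - R (k y) \<alpha>\<bar>"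
          by (simp add: right_diff_distrib[symmetric] abs_mult power_abs)
        also have "\<dots> \<le> \<omega> h" using kl[of x y] that by (intro osc \<alpha> k) auto
        finally show ?thesis .
      qed
    qed (use \<sigma>1 \<sigma>' c\<omega>\<sigma> K\<omega> in \<open>auto intro: has_field_derivative_at_within\<close>)
    with k(2) show ?thesis by (intro exI[of _ "(a, a')"]) auto
  qed
  then have "\<exists>p. \<forall>\<alpha>\<in>\<I>. \<forall>t\<in>{0..T}. (fst (p \<alpha>) has_real_derivative snd (p \<alpha>) t) (at t within {0..T}) \<and> continuous_on {0..T} (snd (p \<alpha>))
      \<and> \<bar>fst (p \<alpha>) t - ?c t \<alpha>\<bar> \<le> \<omega> (\<sigma> t) \<and> \<bar>snd (p \<alpha>) t\<bar> \<le> 2 * \<omega> (\<sigma> t) / \<sigma> t"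
    by (intro bchoice ballI) blast
  then obtain p where p: "\<And>\<alpha> t. \<alpha> \<in> \<I> \<Longrightarrow> t \<in> {0..T} \<Longrightarrow> (fst (p \<alpha>) has_real_derivative snd (p \<alpha>) t) (at t within {0..T}) \<and> continuous_on {0..T} (snd (p \<alpha>))
      \<and> \<bar>fst (p \<alpha>) t - ?c t \<alpha>\<bar> \<le> \<omega> (\<sigma> t) \<and> \<bar>snd (p \<alpha>) t\<bar> \<le> 2 * \<omega> (\<sigma> t) / \<sigma> t"
    by blast
  define a a' where "a t \<alpha> = fst (p \<alpha>) t" and "a' t \<alpha> = snd (p \<alpha>) t" for t \<alpha>
  have a: "primitive_on T (\<lambda>t. a t \<alpha>) (\<lambda>t. a' t \<alpha>)" if "\<alpha> \<in> \<I>" for \<alpha>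
    unfolding a_def a'_def using p[OF that] p[OF that, of 0] T by (intro primitive_on_C1) auto
  have ac: "\<bar>a t \<alpha> - ?c t \<alpha>\<bar> \<le> \<omega> (\<sigma> t)" and a'b: "\<bar>a' t \<alpha>\<bar> \<le> 2 * \<omega> (\<sigma> t) / \<sigma> t" if "\<alpha> \<in> \<I>" "t \<in> {0..T}" for \<alpha> t
    using p[OF that] by (auto simp: a_def a'_def)
  define \<gamma> \<gamma>' where "\<gamma> t = 1 / \<sigma> t" and "\<gamma>' t = - (K * \<omega> (\<sigma> t) * (\<gamma> t)\<^sup>2)" for t
  have \<gamma>: "primitive_on T \<gamma> \<gamma>'"
  proof (rule primitive_on_C1)
    fix t assume t: "t \<in> {0..T}"
    have "(\<gamma> has_real_derivative - (K * \<omega> (\<sigma> t) * inverse (\<sigma> t ^ 2))) (at t)"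
      unfolding \<gamma>_def[abs_def] using DERIV_inverse_fun[OF \<sigma>'[OF t]] \<sigma>[OF t] by (simp add: inverse_eq_divide power2_eq_square)
    then show "(\<gamma> has_real_derivative \<gamma>' t) (at t within {0..T})"
      by (simp add: \<gamma>'_def \<gamma>_def power_divide inverse_eq_divide has_field_derivative_at_within)
  next
    show "continuous_on {0..T} \<gamma>'" unfolding \<gamma>'_def \<gamma>_def
      by (intro continuous_intros continuous_on_compose2[OF \<omega>c c\<sigma>] c\<sigma> ballI) (use \<sigma> in fastforce)+
  qed
  have \<sigma>s1: "0 < \<sigma> t \<and> \<sigma> t \<le> s1" if "t \<in> {0..T}" for t
    using \<sigma>[OF that] s2(3) by linarith
  obtain e where e: "\<And>t. t \<in> {0..T} \<Longrightarrow> 0 < e t"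
    and e': "\<And>t. t \<in> {0..T} \<Longrightarrow> (e has_real_derivative - (1 / \<sigma> t) * e t) (at t within {0..T})"
    and e_mono: "\<And>s t. 0 \<le> s \<Longrightarrow> s \<le> t \<Longrightarrow> t \<le> T \<Longrightarrow> e t \<le> e s"
    and e_dec: "\<And>s t. 0 \<le> s \<Longrightarrow> s < t \<Longrightarrow> t \<le> T \<Longrightarrow> e t \<le> exp (- ((t - s) / s1)) * e s"
    using carleman_weight[OF T \<sigma>s1 c\<sigma>] by blast
  have ce: "continuous_on {0..T} e" by (rule DERIV_continuous_on[OF e'])
  have pe: "primitive_on T e (\<lambda>t. - (1 / \<sigma> t) * e t)"
  proof (rule primitive_on_C1[OF e'])
    have "\<sigma> t \<noteq> 0" if "t \<in> {0..T}" for t using \<sigma>[OF that] by simp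
    then show "continuous_on {0..T} (\<lambda>t. - (1 / \<sigma> t) * e t)"
      by (intro continuous_intros c\<sigma> ce) auto
  qed
  define w w' where "w t = e t *\<^sub>R V t" and "w' t = e t *\<^sub>R (d t - \<gamma> t *\<^sub>R V t)" for t
  have w: "primitive_on T w w'"
  proof -
    have "primitive_on T (\<lambda>t. e t *\<^sub>R V t) (\<lambda>t. (- (1 / \<sigma> t) * e t) *\<^sub>R V t + e t *\<^sub>R d t)"
      by (rule primitive_on_bilinear[OF bounded_bilinear_scaleR pe V])
    then show ?thesis unfolding w_def[abs_def] w'_def[abs_def] \<gamma>_def by (simp add: algebra_simps)
  qed
  let ?Y = "sweight m :: real^'n \<Rightarrow> real"
  let ?P = "\<lambda>t. full_symbol (2 * m) (R t) :: real^'n \<Rightarrow> real" and ?Ps = "\<lambda>t. poly_symbol \<I> (a t) :: real^'n \<Rightarrow> real" and ?P' = "\<lambda>t. poly_symbol \<I> (a' t) :: real^'n \<Rightarrow> real"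
  have PP: "?P t = poly_symbol \<I> (?c t)" for t by (simp add: full_symbol_def \<I>_def)
  have sumY: "\<bar>\<Sum>\<alpha>\<in>\<I>. f \<alpha> * multi_power \<xi> \<alpha>\<bar> \<le> M * C * ?Y \<xi>" if "\<And>\<alpha>. \<alpha> \<in> \<I> \<Longrightarrow> \<bar>f \<alpha>\<bar> \<le> C" for f C and \<xi> :: "real^'n"
  proof -
    have "\<bar>\<Sum>\<alpha>\<in>\<I>. f \<alpha> * multi_power \<xi> \<alpha>\<bar> \<le> (\<Sum>\<alpha>\<in>\<I>. \<bar>f \<alpha>\<bar> * \<bar>multi_power \<xi> \<alpha>\<bar>)"
      by (intro order_trans[OF sum_abs]) (simp add: abs_mult)
    also have "\<dots> \<le> (\<Sum>\<alpha>\<in>\<I>. C * ?Y \<xi>)"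
    proof (intro sum_mono)
      fix \<alpha> assume \<alpha>: "\<alpha> \<in> \<I>"
      have "0 \<le> C" by (rule order_trans[OF abs_ge_zero that[OF \<alpha>]])
      then show "\<bar>f \<alpha>\<bar> * \<bar>multi_power \<xi> \<alpha>\<bar> \<le> C * ?Y \<xi>"
        using that[OF \<alpha>] abs_multi_power_le_sweight[OF \<alpha>[unfolded \<I>_def]] by (intro mult_mono) auto
    qed
    finally show ?thesis by (simp add: M_def mult.assoc)
  qed
  have PsP: "\<bar>?Ps t \<xi> - ?P t \<xi>\<bar> \<le> M * \<omega> (\<sigma> t) * ?Y \<xi>" if "t \<in> {0..T}" for t \<xi>
    using sumY[of "\<lambda>\<alpha>. a t \<alpha> - ?c t \<alpha>" "\<omega> (\<sigma> t)" \<xi>] ac[OF _ that]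
    unfolding PP poly_symbol_def by (simp add: sum_subtractf left_diff_distrib)
  have P'b: "\<bar>?P' t \<xi>\<bar> \<le> 2 * M * \<omega> (\<sigma> t) * \<gamma> t * ?Y \<xi>" if "t \<in> {0..T}" for t \<xi>
    using sumY[of "a' t" "2 * \<omega> (\<sigma> t) / \<sigma> t" \<xi>] a'b[OF _ that]
    unfolding poly_symbol_def \<gamma>_def by (simp add: mult_ac)
  have Pb: "?P t \<xi> \<le> M * B * ?Y \<xi>" if "t \<in> {0..T}" for t \<xi>
    using sumY[of "?c t" B \<xi>] RB[OF _ that] unfolding PP poly_symbol_def by (simp add: abs_mult power_abs)
  have key: "A * ?Y \<xi> \<le> (?Ps t \<xi> - \<gamma> t)\<^sup>2 + (?P' t \<xi> - \<gamma>' t) - 2 * (?Ps t \<xi> - ?P t \<xi>)\<^sup>2" if t: "t \<in> {0..T}" for t \<xi>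
  proof -
    have "\<gamma>0 \<le> \<gamma> t"
    proof -
      have "\<sigma> t \<le> 1 / \<gamma>0" using \<sigma>[OF t] s2(5) by auto
      then show ?thesis using \<sigma>[OF t] K(3) by (simp add: \<gamma>_def field_simps)
    qed
    moreover have "1 \<le> \<gamma> t * \<omega> (\<sigma> t)" using \<omega>\<sigma>(3)[OF t] \<sigma>[OF t] by (simp add: \<gamma>_def field_simps)
    ultimately have "A * ?Y \<xi> \<le> (?Ps t \<xi> - \<gamma> t)\<^sup>2 + (?P' t \<xi> + K * \<omega> (\<sigma> t) * (\<gamma> t)\<^sup>2) - 2 * (?Ps t \<xi> - ?P t \<xi>)\<^sup>2"
      using \<omega>\<sigma>[OF t] w1 PsP[OF t] P'b[OF t] ell[OF t] by (intro ineq sweight_ge_1) auto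
    then show ?thesis by (simp add: \<gamma>'_def)
  qed
  show ?thesis
  proof (rule that[OF e ce e_mono e_dec])
    fix N b J assume b: "0 \<le> b" "b \<le> T" and Ji: "integrable ?M J"
      and J: "AE t in ?M. J t \<le> (e t)\<^sup>2 * (A * (cutm N ?Y (V t) \<bullet> V t)) - 2 * (e t)\<^sup>2 * (norm (mulL (fcut N) (d t) - cutm N (?P t) (V t)))\<^sup>2"
    define E where "E t = cutm N (\<lambda>\<xi>. ?Ps t \<xi> - \<gamma> t) (w t) \<bullet> w t" for t
    define E' where "E' t = 2 * (cutm N (\<lambda>\<xi>. ?Ps t \<xi> - \<gamma> t) (w t) \<bullet> w' t) + cutm N (\<lambda>\<xi>. ?P' t \<xi> - \<gamma>' t) (w t) \<bullet> w t" for t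
    have EE: "primitive_on T E E'"
      unfolding E_def[abs_def] E'_def[abs_def] by (rule energy_primitive[OF w a \<gamma>])
    have cP: "continuous_on UNIV (?P t)" "continuous_on UNIV (?Ps t)" "continuous_on UNIV (\<lambda>\<xi>. ?P' t \<xi> - \<gamma>' t)" for t
      unfolding PP by (intro continuous_intros continuous_poly_symbol)+
    have "AE t in ?M. indicator {0<..b} t *\<^sub>R J t \<le> indicator {0<..b} t *\<^sub>R E' t"
      using J AE_space
    proof eventually_elim
      case (elim t)
      then have t: "t \<in> {0..T}" by simp
      have "(e t)\<^sup>2 * (A * (cutm N ?Y (V t) \<bullet> V t)) - 2 * (e t)\<^sup>2 * (norm (mulL (fcut N) (d t) - cutm N (?P t) (V t)))\<^sup>2 \<le> E' t"
        unfolding E'_def w_def w'_def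
        by (rule carleman_pointwise[OF cP continuous_sweight]) (rule key[OF t])
      with elim show ?case by (intro scaleR_left_mono) auto
    qed
    then have "(\<integral>t. indicator {0<..b} t *\<^sub>R J t \<partial>?M) \<le> (\<integral>t. indicator {0<..b} t *\<^sub>R E' t \<partial>?M)"
      by (intro integral_mono_AE integrable_indicator_time Ji primitive_onD(1)[OF EE]) auto
    also have "\<dots> = E b - E 0" using primitive_onD(2)[OF EE, of 0 b] b by simp
    also have "E 0 = 0" by (simp add: E_def w_def V0)
    also have "E b - 0 \<le> cutm N (\<lambda>\<xi>. M * (B + 1) * ?Y \<xi>) (w b) \<bullet> w b"
    proof -
      have bT: "b \<in> {0..T}" using b by simp
      have "?Ps b \<xi> - \<gamma> b \<le> M * (B + 1) * ?Y \<xi>" for \<xi>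
      proof -
        have "M * \<omega> (\<sigma> b) * ?Y \<xi> \<le> M * 1 * ?Y \<xi>"
          using \<omega>\<sigma>(2)[OF bT] w1(2) M sweight_nonneg[of m \<xi>] by (intro mult_right_mono mult_left_mono) auto
        moreover have "0 \<le> \<gamma> b" using \<sigma>[OF bT] by (simp add: \<gamma>_def)
        moreover have "M * (B + 1) * ?Y \<xi> = M * B * ?Y \<xi> + M * 1 * ?Y \<xi>" by (simp add: algebra_simps)
        ultimately show ?thesis using PsP[OF bT, of \<xi>] Pb[OF bT, of \<xi>] by linarith
      qed
      then show ?thesis unfolding E_def diff_0_right
        by (intro cutm_mono continuous_intros continuous_poly_symbol)
    qed
    also have "\<dots> = M * (B + 1) * (e b)\<^sup>2 * (cutm N ?Y (V b) \<bullet> V b)"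
      by (simp only: cutm_scale[OF continuous_sweight] w_def)
         (simp add: linear_simps[OF bounded_linear_cutm[OF continuous_sweight]] power2_eq_square)
    finally show "(\<integral>t. indicator {0<..b} t *\<^sub>R J t \<partial>?M) \<le> M * (B + 1) * (e b)\<^sup>2 * (cutm N ?Y (V b) \<bullet> V b)" .
  qed
qed

section \<open>Uniqueness\<close>

text \<open>
  The integral is continuous in its upper limit, so the bound extends to the whole interval.
\<close>

lemma AE_zero_of_truncated_integrals:
  fixes S :: "real \<Rightarrow> real"
  assumes T: "T > 0" and S: "integrable (lebesgue_on {0..T}) S" and nn: "AE t in lebesgue_on {0..T}. 0 \<le> S t"
    and le: "\<And>a. 0 < a \<Longrightarrow> a < T \<Longrightarrow> (\<integral>t. indicator {0<..a} t *\<^sub>R S t \<partial>lebesgue_on {0..T}) \<le> 0"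
  shows "AE t in lebesgue_on {0..T}. S t = 0"
proof -
  let ?M = "lebesgue_on {0..T}"
  define F where "F t = 0 + (\<integral>r. indicator {0<..t} r *\<^sub>R S r \<partial>?M)" for t
  have F: "continuous_on {0..T} F"
    unfolding F_def[abs_def] by (rule primitive_on_continuous[OF primitive_on_exists[OF S]])
  define a where "a n = T - T / 2 * inverse (real (Suc n))" for n
  have a: "0 < a n" "a n < T" for n
  proof -
    have "T / 2 * inverse (real (Suc n)) \<le> T / 2 * 1"
      using T by (intro mult_left_mono) (auto simp: inverse_le_1_iff)
    then show "0 < a n" using T unfolding a_def by linarith
    show "a n < T" using T by (simp add: a_def)
  qed
  have "a \<longlonglongrightarrow> T - T / 2 * 0"
    unfolding a_def by (intro tendsto_intros LIMSEQ_inverse_real_of_nat)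
  then have "(\<lambda>n. F (a n)) \<longlonglongrightarrow> F T"
    by (intro continuous_on_tendsto_compose[OF F]) (use T a in \<open>auto simp: less_imp_le\<close>)
  then have "F T \<le> 0"
    by (rule LIMSEQ_le_const2) (use le[OF a] in \<open>auto simp: F_def\<close>)
  moreover have "F T = (\<integral>r. S r \<partial>?M)"
    unfolding F_def add_0
  proof (rule integral_cong_AE)
    show "AE r in ?M. indicator {0<..T} r *\<^sub>R S r = S r"
      using AE_time_neq[of 0 T] AE_space by eventually_elim (auto simp: indicator_def)
  qed (use S integrable_indicator_time[OF S, of "{0<..T}"] in auto)
  moreover have "0 \<le> (\<integral>r. S r \<partial>?M)" using nn by (rule integral_nonneg_AE)
  ultimately have "(\<integral>r. S r \<partial>?M) = 0" by simp
  then show ?thesis using integral_nonneg_eq_0_iff_AE[OF S nn] by simp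
qed

theorem theorem1:
  fixes m :: nat and T \<Lambda> C :: real
    and R :: "real \<Rightarrow> ('n::finite \<Rightarrow> nat) \<Rightarrow> real"
    and u :: "real \<Rightarrow> (real^'n) L2"
  assumes "m \<ge> 1" and "T > 0"
    and "\<forall>\<alpha>\<in>multiindices_le (2 * m). continuous_on {0..T} (\<lambda>t. R t \<alpha>)"
    and "\<Lambda> > 0"
    and "\<forall>t\<in>{0..T}. \<forall>\<xi>. \<xi> \<noteq> 0 \<longrightarrow>
           (\<forall>k<2 * m. \<bar>symbol_part R k t \<xi>\<bar> \<le> \<Lambda>) \<and>
           1 / \<Lambda> \<le> symbol_part R (2 * m) t \<xi> \<and> symbol_part R (2 * m) t \<xi> \<le> \<Lambda>"
    and "osgood (modulus_of_continuity (\<lambda>v. L2_set v (multiindices_le (2 * m))) {0..T} R)"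
    and "u \<in> time_H1 T \<inter> time_L2_sobolev T (2 * m)"
    and "AE t in lebesgue_on {0..T}.
           norm (time_deriv T u t -
             (\<Sum>\<alpha>\<in>multiindices_le (2 * m).
               scaleC (\<i> ^ sum \<alpha> UNIV * complex_of_real (R t \<alpha>)) (weak_deriv \<alpha> (u t))))
           \<le> C * sobolev_norm m (u t)"
    and "continuous_rep T u 0 = 0"
  shows "(AE t in lebesgue_on {0..T}. u t = 0) \<and> (\<forall>t\<in>{0..T}. continuous_rep T u t = 0)"
proof -
  note m = assms(1) and T = assms(2) and \<Lambda> = assms(4) and symb = assms(5)
  let ?M = "lebesgue_on {0..T}" and ?A = "multiindices_le (2 * m) :: ('n \<Rightarrow> nat) set"
  have fin: "finite ?A" by (rule finite_multiindices_le)
  have R_cont: "continuous_on {0..T} (\<lambda>t. R t \<alpha>)" if "\<alpha> \<in> ?A" for \<alpha> using assms(3) that by blast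

  define \<mu> where "\<mu> = modulus_of_continuity (\<lambda>v. L2_set v ?A) {0..T} R"
  have \<mu>: "\<And>s t \<tau>. s \<in> {0..T} \<Longrightarrow> t \<in> {0..T} \<Longrightarrow> \<bar>t - s\<bar> \<le> \<tau> \<Longrightarrow> L2_set (R t - R s) ?A \<le> \<mu> \<tau>"
    "\<And>\<tau>. 0 \<le> \<tau> \<Longrightarrow> 0 \<le> \<mu> \<tau>" "\<And>\<tau> \<tau>'. 0 \<le> \<tau> \<Longrightarrow> \<tau> \<le> \<tau>' \<Longrightarrow> \<mu> \<tau> \<le> \<mu> \<tau>'"
    "\<And>\<tau> \<tau>'. 0 \<le> \<tau> \<Longrightarrow> 0 \<le> \<tau>' \<Longrightarrow> \<mu> (\<tau> + \<tau>') \<le> \<mu> \<tau> + \<mu> \<tau>'"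
    "\<And>e. 0 < e \<Longrightarrow> \<exists>d>0. \<forall>\<tau>. 0 \<le> \<tau> \<and> \<tau> \<le> d \<longrightarrow> \<mu> \<tau> \<le> e"
    unfolding \<mu>_def by (rule modulus_properties[OF fin R_cont T]; assumption)+
  define \<omega> where "\<omega> s = \<mu> (max 0 s) + max 0 s" for s
  have osg: "osgood \<mu>" using assms(6) by (simp add: \<mu>_def)
  note \<omega> = osgood_majorant[OF osg \<mu>(2-5), folded \<omega>_def]
  have \<omega>_ge: "s \<le> \<omega> s" if "0 < s" for s using \<mu>(2)[of s] that by (simp add: \<omega>_def)
  have osc: "\<bar>R t \<alpha> - R s \<alpha>\<bar> \<le> \<omega> h"
    if "\<alpha> \<in> ?A" "s \<in> {0..T}" "t \<in> {0..T}" "\<bar>t - s\<bar> \<le> h" "h \<le> 1" for \<alpha> s t h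
  proof -
    have "R t \<alpha> - R s \<alpha> \<le> \<mu> h"
      using member_le_L2_set[OF fin that(1), of "R t - R s"] \<mu>(1)[OF that(2,3,4)] by (simp add: fun_diff_def)
    moreover have "R s \<alpha> - R t \<alpha> \<le> \<mu> h"
      using member_le_L2_set[OF fin that(1), of "R s - R t"] \<mu>(1)[OF that(3,2), of h] that(4) by (simp add: fun_diff_def abs_minus_commute)
    moreover have "0 \<le> h" using that(4) by linarith
    ultimately show ?thesis by (simp add: \<omega>_def abs_le_iff)
  qed
  have "\<exists>B. \<forall>\<alpha>\<in>?A. \<forall>t\<in>{0..T}. \<bar>R t \<alpha>\<bar> \<le> B \<alpha>"
  proof (intro bchoice ballI)
    fix \<alpha> assume "\<alpha> \<in> ?A"
    then show "\<exists>B. \<forall>t\<in>{0..T}. \<bar>R t \<alpha>\<bar> \<le> B"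
      using compact_imp_bounded[OF compact_continuous_image[OF R_cont]] by (auto simp: bounded_iff)
  qed
  then obtain B\<^sub>0 where B\<^sub>0: "\<And>\<alpha> t. \<alpha> \<in> ?A \<Longrightarrow> t \<in> {0..T} \<Longrightarrow> \<bar>R t \<alpha>\<bar> \<le> B\<^sub>0 \<alpha>" by blast
  define B where "B = (\<Sum>\<alpha>\<in>?A. B\<^sub>0 \<alpha>)"
  have B\<^sub>0_nn: "0 \<le> B\<^sub>0 \<alpha>" if "\<alpha> \<in> ?A" for \<alpha> using B\<^sub>0[OF that, of 0] T by (auto intro: order_trans[OF abs_ge_zero])
  have B: "\<bar>R t \<alpha>\<bar> \<le> B" if "\<alpha> \<in> ?A" "t \<in> {0..T}" for \<alpha> t
    using B\<^sub>0[OF that] member_le_sum[of \<alpha> ?A B\<^sub>0] that fin B\<^sub>0_nn by (force simp: B_def)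
  have B_nn: "0 \<le> B" unfolding B_def by (intro sum_nonneg B\<^sub>0_nn)
  define D where "D = 1 / \<Lambda> + \<Lambda> + 2 * m * \<Lambda> * (4 * m * \<Lambda>\<^sup>2) ^ (2 * m - 1)"
  have D: "0 \<le> D" using \<Lambda> by (simp add: D_def)
  have ell: "sweight m \<xi> / (2 * \<Lambda>) - D \<le> full_symbol (2 * m) (R t) \<xi>" if "t \<in> {0..T}" for t and \<xi> :: "real^'n"
  proof -
    have "(\<forall>k<2 * m. \<bar>symbol_part R k t \<xi>'\<bar> \<le> \<Lambda>) \<and> 1 / \<Lambda> \<le> symbol_part R (2 * m) t \<xi>'" if "\<xi>' \<noteq> 0" for \<xi>' :: "real^'n"
      using symb \<open>t \<in> {0..T}\<close> that by blast
    from full_symbol_lower_bound[where R = R and t = t and m = m, OF m \<Lambda> this, of \<xi>] show ?thesis by (simp add: D_def)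
  qed

  define v where "v = time_deriv T u"
  define U where "U = continuous_rep T u"
  have u: "u \<in> time_L2 T" and v: "is_time_deriv T u v"
    using assms(7) someI_ex[of "is_time_deriv T u"] by (auto simp: time_H1_def v_def time_deriv_def)
  note rep = time_representation[OF T u v, folded U_def]
  define V d where "V t = four (U t)" and "d t = four (v t)" for t
  have V: "primitive_on T V d"
    unfolding V_def[abs_def] d_def[abs_def] by (rule primitive_on_linear[OF bounded_linear_four rep(1)])
  have V0: "V 0 = 0" using assms(9) by (simp add: V_def U_def linear_simps[OF bounded_linear_four])
  have cV: "continuous_on {0..T} V" by (rule primitive_on_continuous[OF V])

  define good where "good t \<longleftrightarrow> t \<in> {0..T} \<and> U t = u t \<and> u t \<in> sobolev (2 * m) \<and>
    norm (v t - (\<Sum>\<alpha>\<in>?A. scaleC (\<i> ^ sum \<alpha> UNIV * complex_of_real (R t \<alpha>)) (weak_deriv \<alpha> (u t)))) \<le> C * sobolev_norm m (u t)" for t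
  have sob: "AE t in ?M. u t \<in> sobolev (2 * m)"
    using assms(7) unfolding time_L2_sobolev_def sobolev_measurable_def by (auto elim: eventually_mono)
  have good: "AE t in ?M. good t"
    using sob rep(2) assms(8) AE_space by eventually_elim (auto simp: good_def v_def)

  define S\<^sub>N where "S\<^sub>N N t = cutm N (sweight m) (V t) \<bullet> V t" for N t
  define S where "S t = lim (\<lambda>N. S\<^sub>N N t)" for t
  \<comment> \<open>\<open>S\<close> is equivalent to the square of the norm of \<open>H\<^sup>m\<close>, with these constants\<close>
  define c\<^sub>1 c\<^sub>2 where "c\<^sub>1 = real (CARD('n) ^ m)" and "c\<^sub>2 = real (card (multiindices_le m :: ('n \<Rightarrow> nat) set))"
  have S\<^sub>N_nn: "0 \<le> S\<^sub>N N t" for N t unfolding S\<^sub>N_def by (rule cut_energy_nonneg)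
  have S\<^sub>N_cont: "continuous_on {0..T} (S\<^sub>N N)" for N
    unfolding S\<^sub>N_def by (intro continuous_on_inner cV bounded_linear.continuous_on[OF bounded_linear_cutm[OF continuous_sweight]])
  have S\<^sub>N_le: "S\<^sub>N N t \<le> c\<^sub>1 * (sobolev_norm m (u t))\<^sup>2" if "good t" for N t
    using cut_energy_le_sobolev[of "u t" m N] that m by (simp add: good_def S\<^sub>N_def V_def c\<^sub>1_def)
  have S_lim: "(\<lambda>N. S\<^sub>N N t) \<longlonglongrightarrow> S t" and S\<^sub>N_S: "\<And>N. S\<^sub>N N t \<le> S t" if "good t" for t
  proof -
    have "incseq (\<lambda>N. S\<^sub>N N t)" unfolding incseq_def S\<^sub>N_def by (auto intro: cut_energy_mono)
    then obtain L where L: "(\<lambda>N. S\<^sub>N N t) \<longlonglongrightarrow> L" "\<forall>N. S\<^sub>N N t \<le> L"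
      using incseq_convergent[of "\<lambda>N. S\<^sub>N N t"] S\<^sub>N_le[OF \<open>good t\<close>] by blast
    moreover have "S t = L" unfolding S_def by (rule limI[OF L(1)])
    ultimately show "(\<lambda>N. S\<^sub>N N t) \<longlonglongrightarrow> S t" "\<And>N. S\<^sub>N N t \<le> S t" by auto
  qed
  have S_nn: "0 \<le> S t" if "good t" for t using S\<^sub>N_nn[of 0 t] S\<^sub>N_S[OF that, of 0] by linarith
  have S_sob: "(sobolev_norm m (u t))\<^sup>2 \<le> c\<^sub>2 * S t" if "good t" for t
    unfolding c\<^sub>2_def using that S_lim[OF that]
    by (intro sobolev_le_limit_energy[of "u t"]) (auto simp: good_def S\<^sub>N_def V_def)
  have S_int: "integrable ?M S"
  proof (rule Bochner_Integration.integrable_bound)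
    show "integrable ?M (\<lambda>t. c\<^sub>1 * (sobolev_norm (2 * m) (u t))\<^sup>2)"
      using assms(7) by (simp add: time_L2_sobolev_def)
    show "S \<in> borel_measurable ?M"
      unfolding S_def by (intro borel_measurable_lim_metric continuous_time_measurable S\<^sub>N_cont)
    show "AE t in ?M. norm (S t) \<le> norm (c\<^sub>1 * (sobolev_norm (2 * m) (u t))\<^sup>2)"
      using good
    proof eventually_elim
      case (elim t)
      have "S t \<le> c\<^sub>1 * (sobolev_norm m (u t))\<^sup>2"
        by (rule LIMSEQ_le_const2[OF S_lim[OF elim]]) (use S\<^sub>N_le[OF elim] in auto)
      also have "\<dots> \<le> c\<^sub>1 * (sobolev_norm (2 * m) (u t))\<^sup>2"
        unfolding sobolev_norm_sq c\<^sub>1_def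
        by (intro mult_left_mono sum_mono2 finite_multiindices_le multiindices_le_mono) auto
      finally show ?case using S_nn[OF elim] by simp
    qed
  qed

  have small: "(\<integral>t. indicator {0<..a} t *\<^sub>R S t \<partial>?M) \<le> 0" if a: "0 < a" "a < T" for a
  proof -
    \<comment> \<open>the right end is a time at which \<open>S\<close> is finite, and there is one beyond every \<open>a < T\<close>\<close>
    obtain b where b: "a < b" "b < T" "good b"
      using AE_time_exists_between[OF good, of a T] a by auto
    \<comment> \<open>the summand \<open>2 C\<^sup>2 c\<^sub>2\<close> absorbs the right-hand side of the equation, and 1 is what remains\<close>
    define A where "A = 2 * (C\<^sup>2 * c\<^sub>2) + 1"
    have A: "A > 0" by (simp add: A_def c\<^sub>2_def add_nonneg_pos)
    define Q where "Q = real (card ?A) * (B + 1)"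
    have Q: "Q \<ge> 0" using B_nn by (simp add: Q_def)
    have est: "(\<integral>t. indicator {0<..a} t *\<^sub>R S t \<partial>?M) \<le> Q * S b * (exp (- ((b - a) / s1)))\<^sup>2" if s1: "s1 > 0" for s1
    proof -
      obtain e where e: "\<And>t. t \<in> {0..T} \<Longrightarrow> 0 < e t" and ce: "continuous_on {0..T} e"
        and e_mono: "\<And>s t. 0 \<le> s \<Longrightarrow> s \<le> t \<Longrightarrow> t \<le> T \<Longrightarrow> e t \<le> e s"
        and e_dec: "\<And>s t. 0 \<le> s \<Longrightarrow> s < t \<Longrightarrow> t \<le> T \<Longrightarrow> e t \<le> exp (- ((t - s) / s1)) * e s"
        and carl: "\<And>N b J. \<lbrakk>0 \<le> b; b \<le> T; integrable ?M J;
           AE t in ?M. J t \<le> (e t)\<^sup>2 * (A * (cutm N (sweight m) (V t) \<bullet> V t))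
             - 2 * (e t)\<^sup>2 * (norm (mulL (fcut N) (d t) - cutm N (full_symbol (2 * m) (R t)) (V t)))\<^sup>2\<rbrakk>
         \<Longrightarrow> (\<integral>t. indicator {0<..b} t *\<^sub>R J t \<partial>?M) \<le> real (card ?A) * (B + 1) * (e b)\<^sup>2 * (cutm N (sweight m) (V b) \<bullet> V b)"
        by (rule carleman_integrated[where R = R and \<omega> = \<omega> and B = B and m = m and T = T and \<Lambda> = \<Lambda> and D = D and A = A and V = V and d = d and ?s1.0 = s1,
            OF m T \<Lambda> D A R_cont B osc ell \<omega>(1) \<omega>_ge \<omega>(3) \<omega>(2) V V0 s1])
          (assumption | (rule that; assumption))+
      \<comment> \<open>the cut-off bounds the equation only by the full \<open>S\<close>, so the absorption leaves \<open>e\<^sup>2 S\<close> only in the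
        limit \<open>N \<longrightarrow> \<infinity>\<close>\<close>
      define J where "J N t = (e t)\<^sup>2 *\<^sub>R (A * S\<^sub>N N t) - (2 * (C\<^sup>2 * c\<^sub>2) * (e t)\<^sup>2) *\<^sub>R S t" for N t
      have J_int: "integrable ?M (J N)" for N
        unfolding J_def
        by (intro Bochner_Integration.integrable_diff integrable_scaleR_continuous S_int integrable_continuous_time continuous_intros ce S\<^sub>N_cont)
      have J_le: "(\<integral>t. indicator {0<..b} t *\<^sub>R J N t \<partial>?M) \<le> Q * (e b)\<^sup>2 * S b" for N
      proof -
        have "AE t in ?M. J N t \<le> (e t)\<^sup>2 * (A * (cutm N (sweight m) (V t) \<bullet> V t))
             - 2 * (e t)\<^sup>2 * (norm (mulL (fcut N) (d t) - cutm N (full_symbol (2 * m) (R t)) (V t)))\<^sup>2"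
          using good
        proof eventually_elim
          case (elim t)
          define r where "r = v t - (\<Sum>\<alpha>\<in>?A. scaleC (\<i> ^ sum \<alpha> UNIV * complex_of_real (R t \<alpha>)) (weak_deriv \<alpha> (u t)))"
          have us: "u t \<in> sobolev (2 * m)" "U t = u t" and r: "norm r \<le> C * sobolev_norm m (u t)"
            using elim by (auto simp: good_def r_def)
          have "mulL (fcut N) (d t) - cutm N (full_symbol (2 * m) (R t)) (V t) = mulL (fcut N) (four r)"
            unfolding r_def cut_operator[OF us(1)] by (simp add: d_def V_def us(2))
          then have "norm (mulL (fcut N) (d t) - cutm N (full_symbol (2 * m) (R t)) (V t)) \<le> norm r"
            using norm_fcut_le[of N "four r"] by (simp add: norm_four)
          also note r
          finally have "(norm (mulL (fcut N) (d t) - cutm N (full_symbol (2 * m) (R t)) (V t)))\<^sup>2 \<le> (C * sobolev_norm m (u t))\<^sup>2"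
            by (intro power_mono) auto
          also have "\<dots> = C\<^sup>2 * (sobolev_norm m (u t))\<^sup>2" by (rule power_mult_distrib)
          also have "\<dots> \<le> C\<^sup>2 * (c\<^sub>2 * S t)" using S_sob[OF elim] by (intro mult_left_mono) auto
          finally have "2 * (e t)\<^sup>2 * (norm (mulL (fcut N) (d t) - cutm N (full_symbol (2 * m) (R t)) (V t)))\<^sup>2 \<le> 2 * (e t)\<^sup>2 * (C\<^sup>2 * (c\<^sub>2 * S t))"
            by (intro mult_left_mono) auto
          then show ?case by (simp add: J_def S\<^sub>N_def mult_ac)
        qed
        from carl[OF _ _ J_int this, of b] b a
        have "(\<integral>t. indicator {0<..b} t *\<^sub>R J N t \<partial>?M) \<le> Q * (e b)\<^sup>2 * S\<^sub>N N b" by (simp add: Q_def S\<^sub>N_def)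
        also have "\<dots> \<le> Q * (e b)\<^sup>2 * S b" using Q S\<^sub>N_S[OF b(3)] by (intro mult_left_mono) auto
        finally show ?thesis .
      qed
      have "(\<lambda>N. \<integral>t. indicator {0<..b} t *\<^sub>R J N t \<partial>?M) \<longlonglongrightarrow> (\<integral>t. indicator {0<..b} t *\<^sub>R ((e t)\<^sup>2 *\<^sub>R S t) \<partial>?M)"
      proof (rule integral_dominated_convergence)
        show "integrable ?M (\<lambda>t. ((A + 2 * (C\<^sup>2 * c\<^sub>2)) * (e t)\<^sup>2) *\<^sub>R S t)"
          by (intro integrable_scaleR_continuous S_int continuous_intros ce)
        have "integrable ?M (\<lambda>t. (e t)\<^sup>2 *\<^sub>R S t)"
          by (intro integrable_scaleR_continuous S_int continuous_intros ce)
        from integrable_indicator_time[OF this, of "{0<..b}"]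
        show "(\<lambda>t. indicator {0<..b} t *\<^sub>R ((e t)\<^sup>2 *\<^sub>R S t)) \<in> borel_measurable ?M" by auto
        show "(\<lambda>t. indicator {0<..b} t *\<^sub>R J N t) \<in> borel_measurable ?M" for N
          using integrable_indicator_time[OF J_int, of "{0<..b}" N] by auto
        show "AE t in ?M. (\<lambda>N. indicator {0<..b} t *\<^sub>R J N t) \<longlonglongrightarrow> indicator {0<..b} t *\<^sub>R ((e t)\<^sup>2 *\<^sub>R S t)"
          using good
        proof eventually_elim
          case (elim t)
          have "(\<lambda>N. J N t) \<longlonglongrightarrow> (e t)\<^sup>2 *\<^sub>R (A * S t) - (2 * (C\<^sup>2 * c\<^sub>2) * (e t)\<^sup>2) *\<^sub>R S t"
            unfolding J_def by (intro tendsto_intros S_lim elim)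
          also have "(e t)\<^sup>2 *\<^sub>R (A * S t) - (2 * (C\<^sup>2 * c\<^sub>2) * (e t)\<^sup>2) *\<^sub>R S t = (e t)\<^sup>2 *\<^sub>R S t"
            by (simp add: A_def algebra_simps)
          finally show ?case by (intro tendsto_intros)
        qed
        show "AE t in ?M. norm (indicator {0<..b} t *\<^sub>R J N t) \<le> ((A + 2 * (C\<^sup>2 * c\<^sub>2)) * (e t)\<^sup>2) *\<^sub>R S t" for N
          using good
        proof eventually_elim
          case (elim t)
          have "norm (indicator {0<..b} t *\<^sub>R J N t) \<le> norm (J N t)" by (auto simp: indicator_def)
          also have "\<dots> \<le> (e t)\<^sup>2 * (A * S\<^sub>N N t) + 2 * (C\<^sup>2 * c\<^sub>2) * (e t)\<^sup>2 * S t"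
            using A S\<^sub>N_nn[of N t] S_nn[OF elim] unfolding J_def real_norm_def
            by (intro order_trans[OF abs_triangle_ineq4]) (simp add: abs_mult c\<^sub>2_def)
          also have "(e t)\<^sup>2 * (A * S\<^sub>N N t) \<le> (e t)\<^sup>2 * (A * S t)"
            using A S\<^sub>N_S[OF elim, of N] by (intro mult_left_mono) auto
          finally show ?case by (simp add: algebra_simps)
        qed
      qed
      then have "(\<integral>t. indicator {0<..b} t *\<^sub>R ((e t)\<^sup>2 *\<^sub>R S t) \<partial>?M) \<le> Q * (e b)\<^sup>2 * S b"
        by (rule LIMSEQ_le_const2) (use J_le in auto)
      moreover have "(\<integral>t. (e a)\<^sup>2 *\<^sub>R (indicator {0<..a} t *\<^sub>R S t) \<partial>?M) \<le> (\<integral>t. indicator {0<..b} t *\<^sub>R ((e t)\<^sup>2 *\<^sub>R S t) \<partial>?M)"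
      proof (rule integral_mono_AE)
        show "integrable ?M (\<lambda>t. (e a)\<^sup>2 *\<^sub>R (indicator {0<..a} t *\<^sub>R S t))"
          by (intro integrable_scaleR_right integrable_indicator_time S_int) auto
        show "integrable ?M (\<lambda>t. indicator {0<..b} t *\<^sub>R ((e t)\<^sup>2 *\<^sub>R S t))"
          by (intro integrable_indicator_time integrable_scaleR_continuous S_int continuous_intros ce) auto
        show "AE t in ?M. (e a)\<^sup>2 *\<^sub>R (indicator {0<..a} t *\<^sub>R S t) \<le> indicator {0<..b} t *\<^sub>R ((e t)\<^sup>2 *\<^sub>R S t)"
          using good
        proof eventually_elim
          case (elim t)
          show ?case
          proof (cases "t \<in> {0<..a}")
            case True
            then have "e a \<le> e t" using a by (intro e_mono) auto
            then have "(e a)\<^sup>2 \<le> (e t)\<^sup>2" using e[of a] a by (intro power_mono) auto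
            then have "(e a)\<^sup>2 * S t \<le> (e t)\<^sup>2 * S t" using S_nn[OF elim] by (rule mult_right_mono)
            with True b show ?thesis by simp
          next
            case False
            then show ?thesis using S_nn[OF elim] by (auto simp: indicator_def)
          qed
        qed
      qed
      ultimately have "(e a)\<^sup>2 * (\<integral>t. indicator {0<..a} t *\<^sub>R S t \<partial>?M) \<le> Q * (e b)\<^sup>2 * S b"
        unfolding integral_scaleR_right by (simp only: real_scaleR_def)
      also have "\<dots> \<le> Q * (exp (- ((b - a) / s1)) * e a)\<^sup>2 * S b"
      proof (intro mult_right_mono mult_left_mono power_mono Q S_nn b(3))
        show "e b \<le> exp (- ((b - a) / s1)) * e a" using a b by (intro e_dec) auto
        show "0 \<le> e b" using e[of b] a b by auto
      qed
      finally have "(e a)\<^sup>2 * (\<integral>t. indicator {0<..a} t *\<^sub>R S t \<partial>?M) \<le> (e a)\<^sup>2 * (Q * S b * (exp (- ((b - a) / s1)))\<^sup>2)"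
        by (simp add: power_mult_distrib mult_ac)
      moreover have "0 < (e a)\<^sup>2" using e[of a] a by simp
      ultimately show ?thesis by (rule mult_left_le_imp_le)
    qed
    \<comment> \<open>the weights belong to the bounds \<open>s\<^sub>1 = 1 / n\<close>\<close>
    define q where "q = exp (- (b - a))"
    have q: "0 \<le> q" "q < 1" using b by (auto simp: q_def)
    have "(\<lambda>n. Q * S b * (q ^ n)\<^sup>2) \<longlonglongrightarrow> Q * S b * 0\<^sup>2"
      by (intro tendsto_mult tendsto_power tendsto_const LIMSEQ_power_zero) (use q in simp)
    moreover have "(\<integral>t. indicator {0<..a} t *\<^sub>R S t \<partial>?M) \<le> Q * S b * (q ^ n)\<^sup>2" if "n \<ge> 1" for n
    proof -
      have "exp (- ((b - a) / (1 / real n))) = q ^ n"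
        by (simp add: q_def exp_of_nat_mult[symmetric] algebra_simps)
      then show ?thesis using est[of "1 / real n"] that by simp
    qed
    ultimately show ?thesis
      by (intro LIMSEQ_le_const[of "\<lambda>n. Q * S b * (q ^ n)\<^sup>2"]) auto
  qed
  have "AE t in ?M. S t = 0"
    using good by (intro AE_zero_of_truncated_integrals[OF T S_int _ small]) (auto elim: eventually_mono intro: S_nn)
  with good have "AE t in ?M. U t = 0"
  proof eventually_elim
    case (elim t)
    have "mulL (fcut N) (V t) = 0" for N
    proof -
      have "(norm (mulL (fcut N) (V t)))\<^sup>2 \<le> S\<^sub>N N t" unfolding S\<^sub>N_def by (rule norm_fcut_le_energy)
      with S\<^sub>N_S[OF elim(1), of N] elim(2) have "(norm (mulL (fcut N) (V t)))\<^sup>2 \<le> 0" by linarith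
      then show ?thesis by simp
    qed
    with fcut_limit[of "V t"] have "V t = 0" by (simp add: LIMSEQ_const_iff)
    then show ?case using norm_four[of "U t"] by (simp add: V_def)
  qed
  moreover from continuous_AE_zero[OF primitive_on_continuous[OF rep(1)] T this]
  have "\<forall>t\<in>{0..T}. U t = 0" by blast
  moreover have "AE t in ?M. u t = 0"
    using \<open>AE t in ?M. U t = 0\<close> rep(2) by eventually_elim simp
  ultimately show ?thesis by (simp add: U_def)
qed

end
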